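(* Let $A=A(V,R)$ be a QLC algebra over a field $k$ of characteristic zero, and let $(qA)^{¡}$ be its Koszul dual curved coalgebra. Suppose that the associated quadratic algebra $qA$ is Koszul. Then the total Koszul complex $A\otimes_\kappa (qA)^{¡}\otimes_\kappa A$ is a resolution of $A$ in the category of $A$-bimodules (the augmentation to $A$ being the map $\xi$ described in the context).
   Context: Conventions. $k$ is a field of characteristic zero; gradings are homological, differentials have degree $-1$, and the Koszul sign rule is used. $sV$ is the suspension, $(sV)_i=V_{i-1}$; $s^{-1}$ is the desuspension. Sweedler notation $\Delta(c)=c'\otimes c''$ (summation implicit). $T^c(W)$ is the tensor coalgebra with deconcatenation. QLC algebras. A QLC datum is a non-negatively graded vector space $V$ with a degree-homogeneous subspace $R\subset k\oplus V\oplus V^{\otimes 2}$. The QLC algebra is $A=A(V,R):=T(V)/(R)$, with $(R)$ the two-sided ideal generated by $R$; it is graded by the grading of $V$ and has zero differential. It is assumed throughout that $R\cap(k\oplus V)=\{0\}$ and $(R)\cap(k\oplus V\oplus V^{\otimes 2})=R$. Let $q:T(V)\to V^{\otimes 2}$ be the projection and $qR:=q(R)$. There are unique degree $0$ linear maps $\phi:qR\to V$, $\theta:qR\to k$ with $R=\{x-\phi(x)+\theta(x)\mid x\in qR\}$. The associated quadratic algebra is $qA:=T(V)/(qR)$. Koszul dual curved coalgebra. View $s^2qR\subset (sV)^{\otimes 2}$ via $s^2(v\otimes w)=(-1)^{|v|}sv\otimes sw$. Then $(qA)^{¡}=C(sV,s^2qR)\subset T^c(sV)$ is the graded subcoalgebra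 $k\oplus sV\oplus s^2qR\oplus\cdots\oplus\bigcap_{i+2+j=n}(sV)^{\otimes i}\otimes s^2qR\otimes (sV)^{\otimes j}\oplus\cdots$, the $n$-th summand having weight $n$, with counit $\epsilon$ the projection to $k$. Let $\tilde\phi$ be the restriction to $(qA)^{¡}$ of the unique coderivation extending $(qA)^{¡}\twoheadrightarrow s^2qR\to sV$, $s^2x\mapsto s\phi(x)$ (degree $-1$); it maps $(qA)^{¡}$ to itself. Let $\tilde\theta:(qA)^{¡}\twoheadrightarrow s^2qR\to k$, $s^2x\mapsto\theta(x)$ (degree $-2$). Then $((qA)^{¡},\tilde\phi,\tilde\theta)$ is a curved DG coalgebra, i.e. $\tilde\phi^2=(\tilde\theta\otimes\mathrm{id}-\mathrm{id}\otimes\tilde\theta)\Delta$ and $\tilde\theta\tilde\phi=0$; it is called the Koszul dual curved coalgebra of $A$. Koszulness. For the coaugmented graded coalgebra $C=(qA)^{¡}$, with $\bar C=C/k$ and reduced comultiplication $\bar\Delta$, let $(T(s^{-1}\bar C),d_2)$ be the DG algebra with $d_2(s^{-1}c)=-(-1)^{|c'|}s^{-1}c'\otimes s^{-1}c''$, $\bar\Delta(c)=c'\otimes c''$. $qA$ is Koszul if the algebra map $(T(s^{-1}\bar C),d_2)\to qA$ induced by $(qA)^{¡}\twoheadrightarrow sV\xrightarrow{s^{-1}}V\hookrightarrow qA$ is a quasi-isomorphism. Total Koszul complex. $\kappa$ is the degree $-1$ map $(qA)^{¡}\twoheadrightarrow sV\xrightarrow{s^{-1}}V\hookrightarrow A$.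 $A\otimes_\kappa(qA)^{¡}\otimes_\kappa A$ is the free $A$-bimodule $A\otimes(qA)^{¡}\otimes A$ with the differential $$D(a\otimes c\otimes b)=(-1)^{|a|}a\otimes\tilde\phi(c)\otimes b+(-1)^{|a|+|c'|}a\otimes c'\otimes\kappa(c'')b-(-1)^{|a|}a\kappa(c')\otimes c''\otimes b .$$ Resolution. The augmentation is the $A$-bimodule map $\xi: A\otimes_\kappa(qA)^{¡}\otimes_\kappa A\xrightarrow{\mathrm{id}\otimes\epsilon\otimes\mathrm{id}}A\otimes k\otimes A\cong A\otimes A\xrightarrow{\mu}A$, where $\mu$ is the multiplication. That the complex is a resolution of $A$ means that $\xi$ is a morphism of complexes of $A$-bimodules and a quasi-isomorphism. *)

theory Defs
  imports Complex_Main "HOL-Library.Poly_Mapping"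
begin

section \<open>Linear algebra on free vector spaces\<close>

text \<open>
  A vector space over a field is given with a basis: \<open>'i \<Rightarrow>\<^sub>0 'k\<close> is the \<open>'k\<close>-vector space with basis
  \<open>'i\<close>, and a grading is a degree function on the basis (every graded vector space has a
  homogeneous basis). Tensor products of such spaces have the product basis, and the tensor
  algebra (or tensor coalgebra) has the basis of words. On words, addition is concatenation, so that
  the convolution product of the type \<open>'x list \<Rightarrow>\<^sub>0 'k\<close> is the product of the tensor algebra.
\<close>

instantiation list :: (type) monoid_add
begin

definition zero_list :: "'a list" where "0 = []"

definition plus_list :: "'a list \<Rightarrow> 'a list \<Rightarrow> 'a list" where "u + v = u @ v"

instance by standard (simp_all add: zero_list_def plus_list_def)

end

definition scale :: "'k::field \<Rightarrow> ('i \<Rightarrow>\<^sub>0 'k) \<Rightarrow> ('i \<Rightarrow>\<^sub>0 'k)" where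
  "scale c p = Poly_Mapping.map ((*) c) p"

lemma lookup_scale [simp]: "Poly_Mapping.lookup (scale c p) i = c * Poly_Mapping.lookup p i"
  by (simp add: scale_def Poly_Mapping.map.rep_eq when_def)

interpretation pm: vector_space "scale :: 'k::field \<Rightarrow> ('i \<Rightarrow>\<^sub>0 'k) \<Rightarrow> ('i \<Rightarrow>\<^sub>0 'k)"
  by standard (rule poly_mapping_eqI; simp add: lookup_add algebra_simps)+

abbreviation bas :: "'i \<Rightarrow> ('i \<Rightarrow>\<^sub>0 'k::field)" where
  "bas i \<equiv> Poly_Mapping.single i 1"

abbreviation lin :: "(('i \<Rightarrow>\<^sub>0 'k::field) \<Rightarrow> ('j \<Rightarrow>\<^sub>0 'k)) \<Rightarrow> bool" where
  "lin f \<equiv> Vector_Spaces.linear scale scale f"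

definition linext :: "('i \<Rightarrow> ('j \<Rightarrow>\<^sub>0 'k::field)) \<Rightarrow> ('i \<Rightarrow>\<^sub>0 'k) \<Rightarrow> ('j \<Rightarrow>\<^sub>0 'k)" where
  "linext f p = (\<Sum>i\<in>Poly_Mapping.keys p. scale (Poly_Mapping.lookup p i) (f i))"

definition part :: "('i \<Rightarrow> bool) \<Rightarrow> ('i \<Rightarrow>\<^sub>0 'k::field) \<Rightarrow> ('i \<Rightarrow>\<^sub>0 'k)" where
  "part P = linext (\<lambda>i. if P i then bas i else 0)"

definition tensor2 :: "('i \<Rightarrow>\<^sub>0 'k::field) \<Rightarrow> ('j \<Rightarrow>\<^sub>0 'k) \<Rightarrow> ('i \<times> 'j \<Rightarrow>\<^sub>0 'k)" where
  "tensor2 p q = linext (\<lambda>i. linext (\<lambda>j. bas (i, j)) q) p"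

definition tensor3 ::
  "('i \<Rightarrow>\<^sub>0 'k::field) \<Rightarrow> ('j \<Rightarrow>\<^sub>0 'k) \<Rightarrow> ('l \<Rightarrow>\<^sub>0 'k) \<Rightarrow> ('i \<times> 'j \<times> 'l \<Rightarrow>\<^sub>0 'k)" where
  "tensor3 p q r = tensor2 p (tensor2 q r)"

definition homog :: "('i \<Rightarrow> int) \<Rightarrow> int \<Rightarrow> ('i \<Rightarrow>\<^sub>0 'k::field) \<Rightarrow> bool" where
  "homog g n p \<longleftrightarrow> (\<forall>i\<in>Poly_Mapping.keys p. g i = n)"

definition graded_subspace :: "('i \<Rightarrow> int) \<Rightarrow> ('i \<Rightarrow>\<^sub>0 'k::field) set \<Rightarrow> bool" where
  "graded_subspace g S \<longleftrightarrow> pm.subspace S \<and> (\<forall>p\<in>S. \<forall>n. part (\<lambda>i. g i = n) p \<in> S)"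

definition ksgn :: "int \<Rightarrow> 'k::field" where
  "ksgn n = (if even n then 1 else - 1)"


section \<open>Complexes and bimodules presented as quotients\<close>

text \<open>
  A record of type \<open>presented_complex\<close> stands for the complex with underlying graded vector space
  \<open>num K / den K\<close>, where \<open>den K \<subseteq> num K\<close> are graded subspaces of a space with basis
  graded by \<open>gdeg K\<close>, and with the differential induced by \<open>diff K\<close>. Two elements of \<open>num K\<close> are equal in the
  complex iff their difference is in \<open>den K\<close>.
\<close>

record ('i, 'm) subquotient =
  gdeg :: "'i \<Rightarrow> int"
  num :: "'m set"
  den :: "'m set"
  diff :: "'m \<Rightarrow> 'm"

type_synonym ('i, 'k) presented_complex = "('i, 'i \<Rightarrow>\<^sub>0 'k) subquotient"

definition chain_complex :: "('i, 'k::field) presented_complex \<Rightarrow> bool" where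
  "chain_complex K \<longleftrightarrow>
     graded_subspace (gdeg K) (num K) \<and> graded_subspace (gdeg K) (den K) \<and> den K \<subseteq> num K \<and>
     lin (diff K) \<and> diff K ` num K \<subseteq> num K \<and> diff K ` den K \<subseteq> den K \<and>
     (\<forall>n. \<forall>x\<in>num K. homog (gdeg K) n x \<longrightarrow>
        (\<exists>y\<in>num K. homog (gdeg K) (n - 1) y \<and> diff K x - y \<in> den K)) \<and>
     (\<forall>x\<in>num K. diff K (diff K x) \<in> den K)"

definition chain_map ::
  "('i, 'k::field) presented_complex \<Rightarrow> ('j, 'k) presented_complex \<Rightarrow>
   (('i \<Rightarrow>\<^sub>0 'k) \<Rightarrow> ('j \<Rightarrow>\<^sub>0 'k)) \<Rightarrow> bool" where
  "chain_map K L f \<longleftrightarrow>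
     chain_complex K \<and> chain_complex L \<and>
     lin f \<and> f ` num K \<subseteq> num L \<and> f ` den K \<subseteq> den L \<and>
     (\<forall>n. \<forall>x\<in>num K. homog (gdeg K) n x \<longrightarrow>
        (\<exists>y\<in>num L. homog (gdeg L) n y \<and> f x - y \<in> den L)) \<and>
     (\<forall>x\<in>num K. f (diff K x) - diff L (f x) \<in> den L)"

definition cycles :: "('i, 'k::field) presented_complex \<Rightarrow> ('i \<Rightarrow>\<^sub>0 'k) set" where
  "cycles K = {x \<in> num K. diff K x \<in> den K}"

definition boundaries :: "('i, 'k::field) presented_complex \<Rightarrow> ('i \<Rightarrow>\<^sub>0 'k) set" where
  "boundaries K = {diff K x + y | x y. x \<in> num K \<and> y \<in> den K}"

definition homologous ::
  "('i, 'k::field) presented_complex \<Rightarrow> (('i \<Rightarrow>\<^sub>0 'k) \<times> ('i \<Rightarrow>\<^sub>0 'k)) set" where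
  "homologous K = {(x, y). x \<in> cycles K \<and> y \<in> cycles K \<and> x - y \<in> boundaries K}"

definition homology :: "('i, 'k::field) presented_complex \<Rightarrow> ('i \<Rightarrow>\<^sub>0 'k) set set" where
  "homology K = cycles K // homologous K"

definition homology_map ::
  "('j, 'k) presented_complex \<Rightarrow> (('i \<Rightarrow>\<^sub>0 'k::field) \<Rightarrow> ('j \<Rightarrow>\<^sub>0 'k)) \<Rightarrow>
   ('i \<Rightarrow>\<^sub>0 'k) set \<Rightarrow> ('j \<Rightarrow>\<^sub>0 'k) set" where
  "homology_map L f X = homologous L `` (f ` X)"

definition quasi_iso ::
  "('i, 'k::field) presented_complex \<Rightarrow> ('j, 'k) presented_complex \<Rightarrow>
   (('i \<Rightarrow>\<^sub>0 'k) \<Rightarrow> ('j \<Rightarrow>\<^sub>0 'k)) \<Rightarrow> bool" where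
  "quasi_iso K L f \<longleftrightarrow>
     chain_map K L f \<and> bij_betw (homology_map L f) (homology K) (homology L)"

text \<open>
  A two-sided ideal \<open>I\<close> of the tensor algebra presents the graded algebra \<open>T(V)/I\<close>, regarded as a DG
  algebra with zero differential. A DG bimodule over it is a presented complex with left and right
  actions of the tensor algebra for which \<open>I\<close> acts by zero on the quotient. The left action commutes
  with the differential up to the Koszul sign.
\<close>

definition wdeg :: "('x \<Rightarrow> nat) \<Rightarrow> 'x list \<Rightarrow> int" where
  "wdeg deg w = int (sum_list (map deg w))"

definition dg_bimodule ::
  "('x \<Rightarrow> nat) \<Rightarrow> ('x list \<Rightarrow>\<^sub>0 'k::field) set \<Rightarrow> ('i, 'k) presented_complex \<Rightarrow>
   (('x list \<Rightarrow>\<^sub>0 'k) \<Rightarrow> ('i \<Rightarrow>\<^sub>0 'k) \<Rightarrow> ('i \<Rightarrow>\<^sub>0 'k)) \<Rightarrow>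
   (('i \<Rightarrow>\<^sub>0 'k) \<Rightarrow> ('x list \<Rightarrow>\<^sub>0 'k) \<Rightarrow> ('i \<Rightarrow>\<^sub>0 'k)) \<Rightarrow> bool" where
  "dg_bimodule deg I K lact ract \<longleftrightarrow>
     chain_complex K \<and>
     (\<forall>a. lin (lact a)) \<and> (\<forall>x. lin (\<lambda>a. lact a x)) \<and>
     (\<forall>b. lin (\<lambda>x. ract x b)) \<and> (\<forall>x. lin (ract x)) \<and>
     (\<forall>x. lact 1 x = x) \<and> (\<forall>a a' x. lact (a * a') x = lact a (lact a' x)) \<and>
     (\<forall>x. ract x 1 = x) \<and> (\<forall>x b b'. ract x (b * b') = ract (ract x b) b') \<and>
     (\<forall>a x b. ract (lact a x) b = lact a (ract x b)) \<and>
     (\<forall>a. \<forall>x\<in>num K. lact a x \<in> num K \<and> ract x a \<in> num K) \<and>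
     (\<forall>a. \<forall>x\<in>den K. lact a x \<in> den K \<and> ract x a \<in> den K) \<and>
     (\<forall>a\<in>I. \<forall>x\<in>num K. lact a x \<in> den K \<and> ract x a \<in> den K) \<and>
     (\<forall>m n a x. homog (wdeg deg) m a \<and> homog (gdeg K) n x \<longrightarrow>
        homog (gdeg K) (m + n) (lact a x) \<and> homog (gdeg K) (m + n) (ract x a)) \<and>
     (\<forall>m a. homog (wdeg deg) m a \<longrightarrow>
        (\<forall>x\<in>num K. diff K (lact a x) - scale (ksgn m) (lact a (diff K x)) \<in> den K)) \<and>
     (\<forall>b. \<forall>x\<in>num K. diff K (ract x b) - ract (diff K x) b \<in> den K)"

definition dg_bimodule_map ::
  "('x \<Rightarrow> nat) \<Rightarrow> ('x list \<Rightarrow>\<^sub>0 'k::field) set \<Rightarrow>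
   ('i, 'k) presented_complex \<Rightarrow>
   (('x list \<Rightarrow>\<^sub>0 'k) \<Rightarrow> ('i \<Rightarrow>\<^sub>0 'k) \<Rightarrow> ('i \<Rightarrow>\<^sub>0 'k)) \<Rightarrow>
   (('i \<Rightarrow>\<^sub>0 'k) \<Rightarrow> ('x list \<Rightarrow>\<^sub>0 'k) \<Rightarrow> ('i \<Rightarrow>\<^sub>0 'k)) \<Rightarrow>
   ('j, 'k) presented_complex \<Rightarrow>
   (('x list \<Rightarrow>\<^sub>0 'k) \<Rightarrow> ('j \<Rightarrow>\<^sub>0 'k) \<Rightarrow> ('j \<Rightarrow>\<^sub>0 'k)) \<Rightarrow>
   (('j \<Rightarrow>\<^sub>0 'k) \<Rightarrow> ('x list \<Rightarrow>\<^sub>0 'k) \<Rightarrow> ('j \<Rightarrow>\<^sub>0 'k)) \<Rightarrow>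
   (('i \<Rightarrow>\<^sub>0 'k) \<Rightarrow> ('j \<Rightarrow>\<^sub>0 'k)) \<Rightarrow> bool" where
  "dg_bimodule_map deg I K lactK ractK L lactL ractL f \<longleftrightarrow>
     dg_bimodule deg I K lactK ractK \<and> dg_bimodule deg I L lactL ractL \<and> chain_map K L f \<and>
     (\<forall>a. \<forall>x\<in>num K. f (lactK a x) - lactL a (f x) \<in> den L \<and>
                     f (ractK x a) - ractL (f x) a \<in> den L)"


section \<open>QLC algebras\<close>

text \<open>
  \<open>V\<close> has basis \<open>'x\<close>, graded by \<open>deg :: 'x \<Rightarrow> nat\<close>. The tensor algebra \<open>T(V)\<close> is the ring
  \<open>'x list \<Rightarrow>\<^sub>0 'k\<close> and the weight of a word is its length.
\<close>

definition wtpart :: "nat \<Rightarrow> ('x list \<Rightarrow>\<^sub>0 'k::field) \<Rightarrow> ('x list \<Rightarrow>\<^sub>0 'k)" where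
  "wtpart n = part (\<lambda>w. length w = n)"

definition wt_le :: "nat \<Rightarrow> ('x list \<Rightarrow>\<^sub>0 'k::field) set" where
  "wt_le n = {p. \<forall>w\<in>Poly_Mapping.keys p. length w \<le> n}"

definition two_sided_ideal :: "('x list \<Rightarrow>\<^sub>0 'k::field) set \<Rightarrow> ('x list \<Rightarrow>\<^sub>0 'k) set" where
  "two_sided_ideal S = pm.span {a * r * b | a r b. r \<in> S}"

definition qlc_datum :: "('x \<Rightarrow> nat) \<Rightarrow> ('x list \<Rightarrow>\<^sub>0 'k::field) set \<Rightarrow> bool" where
  "qlc_datum deg R \<longleftrightarrow>
     graded_subspace (wdeg deg) R \<and> R \<subseteq> wt_le 2 \<and>
     R \<inter> wt_le 1 = {0} \<and>
     two_sided_ideal R \<inter> wt_le 2 = R"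

definition qrel :: "('x list \<Rightarrow>\<^sub>0 'k::field) set \<Rightarrow> ('x list \<Rightarrow>\<^sub>0 'k) set" where
  "qrel R = wtpart 2 ` R"

definition rel_of :: "('x list \<Rightarrow>\<^sub>0 'k::field) set \<Rightarrow> ('x list \<Rightarrow>\<^sub>0 'k) \<Rightarrow> ('x list \<Rightarrow>\<^sub>0 'k)" where
  "rel_of R x = (THE r. r \<in> R \<and> wtpart 2 r = x)"

definition phi :: "('x list \<Rightarrow>\<^sub>0 'k::field) set \<Rightarrow> ('x list \<Rightarrow>\<^sub>0 'k) \<Rightarrow> ('x list \<Rightarrow>\<^sub>0 'k)" where
  "phi R x = - wtpart 1 (rel_of R x)"

definition theta :: "('x list \<Rightarrow>\<^sub>0 'k::field) set \<Rightarrow> ('x list \<Rightarrow>\<^sub>0 'k) \<Rightarrow> 'k" where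
  "theta R x = Poly_Mapping.lookup (rel_of R x) []"

definition alg_complex ::
  "('x \<Rightarrow> nat) \<Rightarrow> ('x list \<Rightarrow>\<^sub>0 'k::field) set \<Rightarrow> ('x list, 'k) presented_complex" where
  "alg_complex deg S =
     \<lparr>gdeg = wdeg deg, num = UNIV, den = two_sided_ideal S, diff = (\<lambda>_. 0)\<rparr>"

lemma part_eq_lookup:
  "Poly_Mapping.lookup (part P p) i = (if P i then Poly_Mapping.lookup p i else 0)"
proof -
  have "Poly_Mapping.lookup (part P p) i =
      (\<Sum>j\<in>Poly_Mapping.keys p. if j = i then (if P i then Poly_Mapping.lookup p i else 0) else 0)"
    unfolding part_def linext_def lookup_sum
    by (intro sum.cong) (auto simp: lookup_single when_def)
  then show ?thesis by (simp add: in_keys_iff)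
qed

lemma relations_eq:
  assumes "qlc_datum deg R"
  shows "R = {x - phi R x + Poly_Mapping.single [] (theta R x) | x. x \<in> qrel R}"
proof -
  have uniq: "r = r'" if mem: "r \<in> R" "r' \<in> R" and eq: "wtpart 2 r = wtpart 2 r'" for r r'
  proof -
    have sub: "r - r' \<in> R"
      using assms mem unfolding qlc_datum_def graded_subspace_def
      by (blast intro: pm.subspace_diff)
    have "length w \<le> 1" if w: "w \<in> Poly_Mapping.keys (r - r')" for w
    proof (rule ccontr)
      assume "\<not> length w \<le> 1"
      moreover have "length w \<le> 2"
        using assms sub w by (auto simp: qlc_datum_def wt_le_def)
      ultimately have "length w = 2" by simp
      then have "Poly_Mapping.lookup r w = Poly_Mapping.lookup r' w"
        using arg_cong[OF eq, of "\<lambda>p. Poly_Mapping.lookup p w"]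
        by (simp add: wtpart_def part_eq_lookup)
      with w show False by (simp add: in_keys_iff lookup_minus)
    qed
    with sub assms have "r - r' \<in> {0}"
      unfolding qlc_datum_def wt_le_def by blast
    then show ?thesis by simp
  qed
  have rel: "rel_of R (wtpart 2 r) = r" if "r \<in> R" for r
    unfolding rel_of_def using that uniq by (intro the_equality) auto
  have split: "wtpart 2 r - phi R (wtpart 2 r) + Poly_Mapping.single [] (theta R (wtpart 2 r)) = r"
    if r: "r \<in> R" for r
  proof (rule poly_mapping_eqI)
    fix w
    have "Poly_Mapping.lookup r w = 0" if len: "length w > 2"
    proof (rule ccontr)
      assume "Poly_Mapping.lookup r w \<noteq> 0"
      then have "w \<in> Poly_Mapping.keys r" by (simp add: in_keys_iff)
      moreover have "r \<in> wt_le 2" using r assms by (auto simp: qlc_datum_def)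
      ultimately show False using len by (auto simp: wt_le_def)
    qed
    moreover have "length w > 2 \<or> length w = 2 \<or> length w = 1 \<or> length w = 0"
      by arith
    ultimately show "Poly_Mapping.lookup (wtpart 2 r - phi R (wtpart 2 r) +
        Poly_Mapping.single [] (theta R (wtpart 2 r))) w = Poly_Mapping.lookup r w"
      by (elim disjE) (auto simp: phi_def theta_def rel[OF r, unfolded wtpart_def] wtpart_def part_eq_lookup lookup_add
          lookup_minus lookup_uminus lookup_single when_def)
  qed
  show ?thesis
  proof (intro equalityI subsetI)
    fix r assume r: "r \<in> R"
    show "r \<in> {x - phi R x + Poly_Mapping.single [] (theta R x) | x. x \<in> qrel R}"
      unfolding qrel_def using r split[OF r, symmetric] by blast
  next
    fix r assume "r \<in> {x - phi R x + Poly_Mapping.single [] (theta R x) | x. x \<in> qrel R}"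
    then show "r \<in> R" using split by (auto simp: qrel_def)
  qed
qed


section \<open>The Koszul dual curved coalgebra\<close>

text \<open>
  \<open>T\<^sup>c(sV)\<close> has the same type as \<open>T(V)\<close>: the word \<open>[x\<^sub>1, \<dots>, x\<^sub>n]\<close> now stands for
  \<open>sx\<^sub>1 \<otimes> \<dots> \<otimes> sx\<^sub>n\<close>, which has degree \<open>|x\<^sub>1| + \<dots> + |x\<^sub>n| + n\<close>. In weight 1 the suspension is then
  the identity map on the level of terms.
\<close>

definition sdeg :: "('x \<Rightarrow> nat) \<Rightarrow> 'x list \<Rightarrow> int" where
  "sdeg deg = wdeg (\<lambda>x. deg x + 1)"

text \<open>The map \<open>v \<otimes> w \<mapsto> s\<^sup>2(v \<otimes> w) = (-1)\<^bsup>|v|\<^esup> sv \<otimes> sw\<close>.\<close>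

definition susp2 :: "('x \<Rightarrow> nat) \<Rightarrow> ('x list \<Rightarrow>\<^sub>0 'k::field) \<Rightarrow> ('x list \<Rightarrow>\<^sub>0 'k)" where
  "susp2 deg = linext (\<lambda>u. case u of
     [v, w] \<Rightarrow> scale (ksgn (int (deg v))) (bas [v, w]) | _ \<Rightarrow> 0)"

text \<open>The coalgebra \<open>C(sV, s\<^sup>2Q)\<close>. The condition is empty in weights 0 and 1.\<close>

definition koszul_coalg ::
  "('x \<Rightarrow> nat) \<Rightarrow> ('x list \<Rightarrow>\<^sub>0 'k::field) set \<Rightarrow> ('x list \<Rightarrow>\<^sub>0 'k) set" where
  "koszul_coalg deg Q =
     {c. \<forall>n i j. i + 2 + j = n \<longrightarrow>
        wtpart n c \<in> pm.span {bas u * susp2 deg x * bas v | u x v.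
                                 length u = i \<and> x \<in> Q \<and> length v = j}}"

definition deconc :: "('x list \<Rightarrow>\<^sub>0 'k::field) \<Rightarrow> ('x list \<times> 'x list \<Rightarrow>\<^sub>0 'k)" where
  "deconc = linext (\<lambda>w. \<Sum>i\<le>length w. bas (take i w, drop i w))"

text \<open>The degree \<open>-1\<close> coderivations of \<open>T\<^sup>c(sV)\<close>; \<open>id \<otimes> d\<close> carries the Koszul sign.\<close>

definition coderivation ::
  "('x \<Rightarrow> nat) \<Rightarrow> (('x list \<Rightarrow>\<^sub>0 'k::field) \<Rightarrow> ('x list \<Rightarrow>\<^sub>0 'k)) \<Rightarrow> bool" where
  "coderivation deg d \<longleftrightarrow>
     lin d \<and>
     (\<forall>n p. homog (sdeg deg) n p \<longrightarrow> homog (sdeg deg) (n - 1) (d p)) \<and>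
     (\<forall>p. deconc (d p) =
        linext (\<lambda>(u, v). tensor2 (d (bas u)) (bas v)) (deconc p) +
        linext (\<lambda>(u, v). scale (ksgn (sdeg deg u)) (tensor2 (bas u) (d (bas v)))) (deconc p))"

text \<open>
  The coderivation on the Koszul dual coalgebra that extends \<open>s\<^sup>2x \<mapsto> s\<phi>(x)\<close>. As \<open>\<phi>\<close> is only defined on
  \<open>qR\<close>, a coderivation of all of \<open>T\<^sup>c(sV)\<close> is chosen; its restriction to \<open>koszul_coalg deg (qrel R)\<close>
  does not depend on the choice, and only this restriction is relevant.
\<close>

definition phi_tilde ::
  "('x \<Rightarrow> nat) \<Rightarrow> ('x list \<Rightarrow>\<^sub>0 'k::field) set \<Rightarrow> ('x list \<Rightarrow>\<^sub>0 'k) \<Rightarrow> ('x list \<Rightarrow>\<^sub>0 'k)" where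
  "phi_tilde deg R = (SOME d. coderivation deg d \<and>
     (\<forall>c\<in>koszul_coalg deg (qrel R). \<forall>x\<in>qrel R.
        wtpart 2 c = susp2 deg x \<longrightarrow> wtpart 1 (d c) = phi R x))"

definition theta_tilde ::
  "('x \<Rightarrow> nat) \<Rightarrow> ('x list \<Rightarrow>\<^sub>0 'k::field) set \<Rightarrow> ('x list \<Rightarrow>\<^sub>0 'k) \<Rightarrow> 'k" where
  "theta_tilde deg R c = theta R (THE x. x \<in> qrel R \<and> wtpart 2 c = susp2 deg x)"


section \<open>Koszul quadratic algebras\<close>

text \<open>
  A word \<open>[w\<^sub>1, \<dots>, w\<^sub>m]\<close> of words stands for \<open>s\<^sup>-\<^sup>1w\<^sub>1 \<otimes> \<dots> \<otimes> s\<^sup>-\<^sup>1w\<^sub>m\<close> in the tensor algebra on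
  \<open>s\<^sup>-\<^sup>1T\<^sup>c(sV)\<close>. Here \<open>C/k\<close> is identified with the elements of \<open>C\<close> without a component of weight 0, and
  \<open>T(s\<^sup>-\<^sup>1(C/k))\<close> is spanned by the products of elements of \<open>s\<^sup>-\<^sup>1(C/k)\<close>.
\<close>

definition cobar_deg :: "('x \<Rightarrow> nat) \<Rightarrow> 'x list list \<Rightarrow> int" where
  "cobar_deg deg ws = (\<Sum>w\<leftarrow>ws. sdeg deg w - 1)"

definition cobar_gen :: "('x list \<Rightarrow>\<^sub>0 'k::field) \<Rightarrow> ('x list list \<Rightarrow>\<^sub>0 'k)" where
  "cobar_gen = linext (\<lambda>w. bas [w])"

definition cobar_space ::
  "('x list \<Rightarrow>\<^sub>0 'k::field) set \<Rightarrow> ('x list list \<Rightarrow>\<^sub>0 'k) set" where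
  "cobar_space C = pm.span {prod_list (map cobar_gen cs) | cs.
     set cs \<subseteq> {c \<in> C. Poly_Mapping.lookup c [] = 0}}"

text \<open>The value of \<open>d\<^sub>2\<close> on \<open>s\<^sup>-\<^sup>1w\<close>, from the reduced deconcatenation of \<open>w\<close>.\<close>

definition cobar_diff_gen :: "('x \<Rightarrow> nat) \<Rightarrow> 'x list \<Rightarrow> ('x list list \<Rightarrow>\<^sub>0 'k::field)" where
  "cobar_diff_gen deg w =
     (\<Sum>i\<in>{0<..<length w}. scale (- ksgn (sdeg deg (take i w))) (bas [take i w, drop i w]))"

text \<open>The extension of \<open>d\<^sub>2\<close> as a derivation of degree \<open>-1\<close>.\<close>

definition cobar_diff ::
  "('x \<Rightarrow> nat) \<Rightarrow> ('x list list \<Rightarrow>\<^sub>0 'k::field) \<Rightarrow> ('x list list \<Rightarrow>\<^sub>0 'k)" where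
  "cobar_diff deg = linext (\<lambda>ws. \<Sum>i<length ws.
     scale (ksgn (cobar_deg deg (take i ws)))
       (bas (take i ws) * cobar_diff_gen deg (ws ! i) * bas (drop (Suc i) ws)))"

definition cobar_complex ::
  "('x \<Rightarrow> nat) \<Rightarrow> ('x list \<Rightarrow>\<^sub>0 'k::field) set \<Rightarrow> ('x list list, 'k) presented_complex" where
  "cobar_complex deg C =
     \<lparr>gdeg = cobar_deg deg, num = cobar_space C, den = {0}, diff = cobar_diff deg\<rparr>"

definition cobar_to_alg :: "('x list list \<Rightarrow>\<^sub>0 'k::field) \<Rightarrow> ('x list \<Rightarrow>\<^sub>0 'k)" where
  "cobar_to_alg = linext (\<lambda>ws. prod_list (map (\<lambda>w. if length w = 1 then bas w else 0) ws))"

definition koszul :: "('x \<Rightarrow> nat) \<Rightarrow> ('x list \<Rightarrow>\<^sub>0 'k::field) set \<Rightarrow> bool" where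
  "koszul deg Q \<longleftrightarrow>
     quasi_iso (cobar_complex deg (koszul_coalg deg Q)) (alg_complex deg Q) cobar_to_alg"


section \<open>The total Koszul complex\<close>

text \<open>
  With \<open>A = T(V)/I\<close>, the space \<open>A \<otimes> C \<otimes> A\<close> is the quotient of \<open>T(V) \<otimes> C \<otimes> T(V)\<close> by
  \<open>I \<otimes> C \<otimes> T(V) + T(V) \<otimes> C \<otimes> I\<close>. Sums over the splittings of a word are Sweedler sums.
\<close>

definition kappa :: "('x list \<Rightarrow>\<^sub>0 'k::field) \<Rightarrow> ('x list \<Rightarrow>\<^sub>0 'k)" where
  "kappa = wtpart 1"

definition triple_deg :: "('x \<Rightarrow> nat) \<Rightarrow> 'x list \<times> 'x list \<times> 'x list \<Rightarrow> int" where
  "triple_deg deg = (\<lambda>(u, w, v). wdeg deg u + sdeg deg w + wdeg deg v)"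

definition koszul_diff ::
  "('x \<Rightarrow> nat) \<Rightarrow> ('x list \<Rightarrow>\<^sub>0 'k::field) set \<Rightarrow>
   ('x list \<times> 'x list \<times> 'x list \<Rightarrow>\<^sub>0 'k) \<Rightarrow> ('x list \<times> 'x list \<times> 'x list \<Rightarrow>\<^sub>0 'k)" where
  "koszul_diff deg R = linext (\<lambda>(u, w, v).
     scale (ksgn (wdeg deg u)) (tensor3 (bas u) (phi_tilde deg R (bas w)) (bas v)) +
     (\<Sum>i\<le>length w.
        scale (ksgn (wdeg deg u + sdeg deg (take i w)))
          (tensor3 (bas u) (bas (take i w)) (kappa (bas (drop i w)) * bas v)) -
        scale (ksgn (wdeg deg u))
          (tensor3 (bas u * kappa (bas (take i w))) (bas (drop i w)) (bas v))))"

definition total_koszul_complex ::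
  "('x \<Rightarrow> nat) \<Rightarrow> ('x list \<Rightarrow>\<^sub>0 'k::field) set \<Rightarrow>
   ('x list \<times> 'x list \<times> 'x list, 'k) presented_complex" where
  "total_koszul_complex deg R =
     (let C = koszul_coalg deg (qrel R); I = two_sided_ideal R in
      \<lparr>gdeg = triple_deg deg,
       num = pm.span {tensor3 a c b | a c b. c \<in> C},
       den = pm.span {tensor3 a c b | a c b. c \<in> C \<and> (a \<in> I \<or> b \<in> I)},
       diff = koszul_diff deg R\<rparr>)"

definition triple_lact ::
  "('x list \<Rightarrow>\<^sub>0 'k::field) \<Rightarrow> ('x list \<times> 'x list \<times> 'x list \<Rightarrow>\<^sub>0 'k) \<Rightarrow>
   ('x list \<times> 'x list \<times> 'x list \<Rightarrow>\<^sub>0 'k)" where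
  "triple_lact a = linext (\<lambda>(u, w, v). tensor3 (a * bas u) (bas w) (bas v))"

definition triple_ract ::
  "('x list \<times> 'x list \<times> 'x list \<Rightarrow>\<^sub>0 'k::field) \<Rightarrow> ('x list \<Rightarrow>\<^sub>0 'k) \<Rightarrow>
   ('x list \<times> 'x list \<times> 'x list \<Rightarrow>\<^sub>0 'k)" where
  "triple_ract x b = linext (\<lambda>(u, w, v). tensor3 (bas u) (bas w) (bas v * b)) x"

definition xi :: "('x list \<times> 'x list \<times> 'x list \<Rightarrow>\<^sub>0 'k::field) \<Rightarrow> ('x list \<Rightarrow>\<^sub>0 'k)" where
  "xi = linext (\<lambda>(u, w, v). if w = [] then bas u * bas v else 0)"

definition is_bimodule_resolution ::
  "('x \<Rightarrow> nat) \<Rightarrow> ('x list \<Rightarrow>\<^sub>0 'k::field) set \<Rightarrow>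
   ('i, 'k) presented_complex \<Rightarrow>
   (('x list \<Rightarrow>\<^sub>0 'k) \<Rightarrow> ('i \<Rightarrow>\<^sub>0 'k) \<Rightarrow> ('i \<Rightarrow>\<^sub>0 'k)) \<Rightarrow>
   (('i \<Rightarrow>\<^sub>0 'k) \<Rightarrow> ('x list \<Rightarrow>\<^sub>0 'k) \<Rightarrow> ('i \<Rightarrow>\<^sub>0 'k)) \<Rightarrow>
   (('i \<Rightarrow>\<^sub>0 'k) \<Rightarrow> ('x list \<Rightarrow>\<^sub>0 'k)) \<Rightarrow> bool" where
  "is_bimodule_resolution deg S K lact ract f \<longleftrightarrow>
     dg_bimodule_map deg (two_sided_ideal S) K lact ract (alg_complex deg S) (*) (*) f \<and>
     quasi_iso K (alg_complex deg S) f"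

end

theory Submission
  imports Defs
begin

text \<open>
  Write \<open>I\<close> for the ideal generated by \<open>R\<close> and \<open>J\<close> for the ideal generated by the leading terms \<open>qR\<close>. The total
  Koszul complex is filtered by weight, the total length of a triple in \<open>T(V) \<otimes> C \<otimes> T(V)\<close>. The coderivation \<open>\<phi>\<close>
  lowers the weight, whereas the two terms of the differential that move a letter out of the coalgebra preserve it
  and form the differential of the bimodule Koszul complex of the quadratic algebra \<open>qA\<close>. Hence the leading part
  of a cycle is a cycle over \<open>qA\<close>, and if it is a boundary there, then subtracting a boundary lowers the weight of
  the given cycle; this is the induction of \<open>total_koszul_exact\<close>. It rests on two consequences of Koszulness:
  the bimodule Koszul complex of \<open>qA\<close> is exact (\<open>bimodule_koszul_exact\<close>), and the leading part of an
  element of \<open>I\<close> lies in \<open>J\<close> (\<open>ideal_leading_part\<close>, the Poincare-Birkhoff-Witt property). The latter makes weights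
  in \<open>A\<close> and in \<open>qA\<close> comparable, through a normal form for \<open>A\<close> that does not raise the weight.

  Koszulness enters as injectivity in homology (\<open>cobar_exact\<close>): a cycle of the cobar construction \<open>\<Omega>\<close> of \<open>C\<close> whose image in
  \<open>T(V)\<close> lies in \<open>J\<close> is a boundary.

  For the exactness over \<open>qA\<close>, filter \<open>\<Omega>\<close> by the weight of the first factor. The layers are \<open>C\<^sub>p \<otimes> \<Omega>\<close>, and they are
  resolutions of \<open>C\<^sub>p \<otimes> qA\<close>; so the exactness of \<open>\<Omega>\<close> and of its layers yields that of the complex \<open>C \<otimes> qA\<close>
  (\<open>right_koszul_exact\<close>). A second filtration, by the weight of the left factor of \<open>qA \<otimes> C \<otimes> qA\<close>, yields
  \<open>bimodule_koszul_exact\<close>.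

  For the Poincare-Birkhoff-Witt property, let a combination of multiples of relations in words of length \<open>n\<close>
  have cancelling leading terms. Its leading terms form a cycle of \<open>\<Omega>\<close> in which one factor has weight two and
  all others have weight one. It is the boundary of an element whose components have either one factor of weight
  three or two factors of weight two. In the second case the combination expresses that reductions at disjoint places
  commute, in the first case it is an overlap, which is a relation since all elements of \<open>I\<close> of weight at
  most two are in \<open>R\<close>. In both cases it can be rewritten with relations in shorter words
  (\<open>lift_rel_gens\<close>, \<open>filt_descend\<close>).

  The same overlaps show that \<open>\<phi>\<close> preserves \<open>C\<close> and that its square is the commutator with the curvature (\<open>cf_d_d\<close>). So
  the square of the differential splits off a factor of weight two to the left or to the right and replaces it
  by a relation (\<open>tdiff_square\<close>), which is zero over \<open>A\<close>.

  Subspaces of tensor products are handled by coefficients: an element lies in \<open>A \<otimes> B\<close> if and only if its coefficients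
  with respect to both factors lie in \<open>A\<close> and \<open>B\<close> (\<open>tens2_iff\<close>). In particular \<open>C\<close> is described by the condition
  that all coefficients of two consecutive letters are in \<open>s\<^sup>2qR\<close> (\<open>koszul_coalg_iff\<close>).
\<close>

section \<open>Linear maps between free vector spaces\<close>

abbreviation cf :: "('i \<Rightarrow>\<^sub>0 'k::zero) \<Rightarrow> 'i \<Rightarrow> 'k" where
  "cf \<equiv> Poly_Mapping.lookup"

abbreviation supp :: "('i \<Rightarrow>\<^sub>0 'k::zero) \<Rightarrow> 'i set" where
  "supp \<equiv> Poly_Mapping.keys"

interpretation pmp: vector_space_pair
  "scale :: 'k::field \<Rightarrow> ('i \<Rightarrow>\<^sub>0 'k) \<Rightarrow> ('i \<Rightarrow>\<^sub>0 'k)"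
  "scale :: 'k \<Rightarrow> ('j \<Rightarrow>\<^sub>0 'k) \<Rightarrow> ('j \<Rightarrow>\<^sub>0 'k)"
  by standard

lemmas scale_rules [simp] = pm.scale_zero_left pm.scale_zero_right pm.scale_one

lemma linI:
  assumes "\<And>x y. f (x + y) = f x + f y" and "\<And>c x. f (scale c x) = scale c (f x)"
  shows "lin f"
  unfolding Vector_Spaces.linear_iff using assms by (simp add: pm.vector_space_axioms)

lemma lin_add: "lin f \<Longrightarrow> f (x + y) = f x + f y"
  and lin_scale: "lin f \<Longrightarrow> f (scale c x) = scale c (f x)"
  by (simp_all add: Vector_Spaces.linear_iff)

lemma lin_zero: "lin f \<Longrightarrow> f 0 = 0"
  using lin_scale[of f 0 0] by simp

lemma lin_minus: "lin f \<Longrightarrow> f (x - y) = f x - f y"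
  using lin_add[of f "x - y" y] by (simp add: algebra_simps)

lemma lin_uminus: "lin f \<Longrightarrow> f (- x) = - f x"
  using lin_minus[of f 0 x] by (simp add: lin_zero)

lemma lin_sum: "lin f \<Longrightarrow> f (\<Sum>i\<in>S. g i) = (\<Sum>i\<in>S. f (g i))"
  by (induction S rule: infinite_finite_induct) (simp_all add: lin_zero lin_add)

lemma linext_superset:
  assumes "finite S" "supp p \<subseteq> S"
  shows "linext f p = (\<Sum>i\<in>S. scale (cf p i) (f i))"
  unfolding linext_def using assms
  by (intro sum.mono_neutral_left) (auto simp: in_keys_iff)

lemma lin_linext0: "lin (linext (f :: 'a \<Rightarrow> ('c \<Rightarrow>\<^sub>0 'b::field)))"
proof (rule linI)
  fix x y :: "'a \<Rightarrow>\<^sub>0 'b"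
  let ?S = "supp x \<union> supp y"
  have "linext f (x + y) = (\<Sum>i\<in>?S. scale (cf (x + y) i) (f i))"
    by (rule linext_superset) (simp_all add: keys_add)
  also have "\<dots> = (\<Sum>i\<in>?S. scale (cf x i) (f i)) + (\<Sum>i\<in>?S. scale (cf y i) (f i))"
    by (simp add: lookup_add pm.scale_left_distrib sum.distrib)
  also have "\<dots> = linext f x + linext f y"
    by (simp add: linext_superset[of ?S])
  finally show "linext f (x + y) = linext f x + linext f y" .
next
  fix c and x :: "'a \<Rightarrow>\<^sub>0 'b"
  have "linext f (scale c x) = (\<Sum>i\<in>supp x. scale (cf (scale c x) i) (f i))"
    by (rule linext_superset) (auto simp: in_keys_iff)
  then show "linext f (scale c x) = scale c (linext f x)"
    by (simp add: linext_def pm.scale_sum_right)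
qed

lemma linext_bas [simp]: "linext f (bas i) = f i"
  by (simp add: linext_def)

lemma cf_bas: "cf (bas i) j = (if i = j then 1 else 0)"
  by (simp add: lookup_single when_def)

lemma linext_bas_id: "linext bas p = p"
  by (rule poly_mapping_eqI)
    (simp add: linext_def lookup_sum cf_bas if_distrib[of "(*) _"] in_keys_iff cong: if_cong)

lemma lin_expand: "lin f \<Longrightarrow> f p = linext (\<lambda>i. f (bas i)) p"
proof -
  assume f: "lin f"
  have "f p = f (linext bas p)" by (simp add: linext_bas_id)
  also have "\<dots> = linext (\<lambda>i. f (bas i)) p"
    unfolding linext_def by (simp add: lin_sum[OF f] lin_scale[OF f])
  finally show ?thesis .
qed

lemma lin_ext:
  assumes "lin f" "lin g" "\<And>i. f (bas i) = g (bas i)"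
  shows "f p = g p"
  using lin_expand[OF assms(1), of p] lin_expand[OF assms(2), of p] assms(3) by simp

lemma lin_ext_supp:
  assumes "lin f" "lin g" "\<And>i. i \<in> supp p \<Longrightarrow> f (bas i) = g (bas i)"
  shows "f p = g p"
  using lin_expand[OF assms(1), of p] lin_expand[OF assms(2), of p] assms(3)
  by (simp add: linext_def)

text \<open>Closure rules for \<open>lin\<close>. Every linear map of this development is given one in the form
  \<open>lin g \<Longrightarrow> lin (\<lambda>x. F (g x))\<close>, so that \<open>intro lin_intros\<close>
  proves the linearity of nested expressions and identities between such expressions can be checked on basis
  elements.\<close>

named_theorems lin_intros

lemma lin_ident [lin_intros]: "lin (\<lambda>x. x)"
  by (rule linI) auto

lemma lin_const [lin_intros]: "lin (\<lambda>x. 0)"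
  by (rule linI) auto

lemma lin_compose: "lin f \<Longrightarrow> lin g \<Longrightarrow> lin (\<lambda>x. f (g x))"
  by (rule linI) (simp_all add: lin_add lin_scale)

lemma lin_linext [lin_intros]: "lin g \<Longrightarrow> lin (\<lambda>x. linext f (g x))"
  by (rule lin_compose[OF lin_linext0])

lemma lin_plus [lin_intros]: "lin f \<Longrightarrow> lin g \<Longrightarrow> lin (\<lambda>x. f x + g x)"
  by (rule linI) (simp_all add: lin_add lin_scale pm.scale_right_distrib algebra_simps)

lemma lin_neg [lin_intros]: "lin f \<Longrightarrow> lin (\<lambda>x. - f x)"
  by (rule linI) (simp_all add: lin_add lin_scale pm.scale_minus_right)

lemma lin_diff [lin_intros]: "lin f \<Longrightarrow> lin g \<Longrightarrow> lin (\<lambda>x. f x - g x)"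
  by (rule linI) (simp_all add: lin_add lin_scale pm.scale_right_diff_distrib algebra_simps)

lemma lin_scale_const [lin_intros]: "lin f \<Longrightarrow> lin (\<lambda>x. scale c (f x))"
  by (rule linI) (simp_all add: lin_add lin_scale pm.scale_right_distrib algebra_simps)

lemma lin_sum_const [lin_intros]: "(\<And>i. i \<in> S \<Longrightarrow> lin (f i)) \<Longrightarrow> lin (\<lambda>x. \<Sum>i\<in>S. f i x)"
  by (induction S rule: infinite_finite_induct) (simp_all add: lin_const lin_plus)

lemma lin_if [lin_intros]: "lin f \<Longrightarrow> lin g \<Longrightarrow> lin (\<lambda>x. if P then f x else g x)"
  by (cases P) simp_all

lemma bilinear_ext:
  assumes "\<And>q. lin (\<lambda>p. F p q)" "\<And>p. lin (F p)" "\<And>q. lin (\<lambda>p. G p q)" "\<And>p. lin (G p)"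
    and "\<And>i j. F (bas i) (bas j) = G (bas i) (bas j)"
  shows "F p q = G p q"
proof -
  have "F (bas i) q = G (bas i) q" for i
    by (rule lin_ext[OF assms(2)[of "bas i"] assms(4)[of "bas i"]]) (rule assms(5))
  then show ?thesis by (rule lin_ext[OF assms(1)[of q] assms(3)[of q]])
qed

lemma trilinear_ext:
  assumes "\<And>q r. lin (\<lambda>p. F p q r)" "\<And>p r. lin (\<lambda>q. F p q r)" "\<And>p q. lin (\<lambda>r. F p q r)"
    "\<And>q r. lin (\<lambda>p. G p q r)" "\<And>p r. lin (\<lambda>q. G p q r)" "\<And>p q. lin (\<lambda>r. G p q r)"
    and "\<And>i j k. F (bas i) (bas j) (bas k) = G (bas i) (bas j) (bas k)"
  shows "F p q r = G p q r"
proof -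
  have "F (bas i) q r = G (bas i) q r" for i q r
    by (rule bilinear_ext[of "F (bas i)" "G (bas i)"]) (rule assms)+
  then show ?thesis by (rule lin_ext[OF assms(1)[of q r] assms(4)[of q r]])
qed

text \<open>Linear functionals are compared as maps into the one-dimensional space with basis
  \<open>unit\<close>, because \<open>lin\<close> speaks of maps between spaces with a basis.\<close>

lemma functional_eq:
  assumes "lin (\<lambda>q. scale (\<phi> q) (bas ()))" "lin (\<lambda>q. scale (\<psi> q) (bas ()))" "\<And>i. \<phi> (bas i) = \<psi> (bas i)"
  shows "\<phi> q = (\<psi> q :: 'k::field)"
proof -
  have "scale (\<phi> q) (bas ()) = scale (\<psi> q) (bas ())"
    by (rule lin_ext[OF assms(1,2)]) (simp add: assms(3))
  from arg_cong[OF this, of "\<lambda>p. cf p ()"] show ?thesis by simp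
qed

lemma scale_eq_mult: "scale c p = Poly_Mapping.single 0 c * (p :: 'x :: monoid_add \<Rightarrow>\<^sub>0 'k::field)"
  unfolding scale_def by (rule mult_map_scale_conv_mult)

lemma single_0_commute: "Poly_Mapping.single 0 c * p = p * Poly_Mapping.single 0 (c::'k::field)"
  for p :: "'x::monoid_add \<Rightarrow>\<^sub>0 'k::field"
proof -
  have p: "p = (\<Sum>i\<in>supp p. Poly_Mapping.single i (cf p i))"
    by (rule poly_mapping_eqI) (auto simp: lookup_sum lookup_single when_def in_keys_iff)
  have "Poly_Mapping.single 0 c * (\<Sum>i\<in>supp p. Poly_Mapping.single i (cf p i)) =
      (\<Sum>i\<in>supp p. Poly_Mapping.single i (cf p i)) * Poly_Mapping.single 0 c"
    by (simp add: sum_distrib_left sum_distrib_right mult_single mult.commute)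
  then show ?thesis by (simp flip: p)
qed

lemma scale_mult_left: "scale c p * q = scale c (p * (q :: 'x :: monoid_add \<Rightarrow>\<^sub>0 'k::field))"
  by (simp add: scale_eq_mult mult.assoc)

lemma scale_mult_right: "p * scale c q = scale c (p * (q :: 'x :: monoid_add \<Rightarrow>\<^sub>0 'k::field))"
  by (metis scale_eq_mult mult.assoc single_0_commute)

lemma lin_mult_left [lin_intros]: "lin f \<Longrightarrow> lin (\<lambda>x. a * (f x :: 'x :: monoid_add \<Rightarrow>\<^sub>0 'k::field))"
  by (rule linI) (simp_all add: lin_add lin_scale distrib_left scale_mult_right)

lemma lin_mult_right [lin_intros]: "lin f \<Longrightarrow> lin (\<lambda>x. (f x :: 'x :: monoid_add \<Rightarrow>\<^sub>0 'k::field) * a)"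
  by (rule linI) (simp_all add: lin_add lin_scale distrib_right scale_mult_left)

lemma bas_mult [simp]: "bas u * bas v = bas (u @ v)"
  by (simp add: mult_single plus_list_def)

lemma one_eq_bas: "1 = bas []"
  by (metis single_one zero_list_def)

lemma bas_Nil_mult [simp]: "bas [] * p = p" "p * bas [] = p"
  by (simp_all flip: one_eq_bas)

lemma cf_lin:
  assumes "lin f"
  shows "cf (f p) j = (\<Sum>i\<in>supp p. cf p i * cf (f (bas i)) j)"
  by (subst lin_expand[OF assms]) (simp add: linext_def lookup_sum)

lemma supp_lin_bas: "lin f \<Longrightarrow> j \<in> supp (f p) \<Longrightarrow> \<exists>i\<in>supp p. j \<in> supp (f (bas i))"
  using cf_lin[of f p j] by (metis (no_types, lifting) in_keys_iff mult_zero_right sum.neutral)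

lemma cf_linext: "cf (linext f p) j = (\<Sum>i\<in>supp p. cf p i * cf (f i) j)"
  by (simp add: linext_def lookup_sum)

lemma linext_in_subspace:
  assumes "pm.subspace S" "\<And>i. i \<in> supp p \<Longrightarrow> f i \<in> S"
  shows "linext f p \<in> S"
  unfolding linext_def using assms by (intro pm.subspace_sum pm.subspace_scale) auto

lemma lin_in_subspace:
  assumes "lin f" "pm.subspace S" "\<And>i. i \<in> supp p \<Longrightarrow> f (bas i) \<in> S"
  shows "f p \<in> S"
  using linext_in_subspace[OF assms(2,3)] lin_expand[OF assms(1), of p] by simp

lemma subspace_vimage: "lin f \<Longrightarrow> pm.subspace S \<Longrightarrow> pm.subspace {x. f x \<in> S}"
  by (auto simp: pm.subspace_def lin_zero lin_add lin_scale)

lemma lin_span_into: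
  assumes "x \<in> pm.span G" "lin f" "pm.subspace S" "\<And>g. g \<in> G \<Longrightarrow> f g \<in> S"
  shows "f x \<in> S"
  using pm.span_minimal[of G "{x. f x \<in> S}"] subspace_vimage[OF assms(2,3)] assms(1,4) by blast

lemma lin_image_subspace: "lin f \<Longrightarrow> pm.subspace S \<Longrightarrow> pm.subspace (f ` S)"
proof (rule pm.subspaceI)
  assume f: "lin f" and S: "pm.subspace S"
  show "0 \<in> f ` S" using lin_zero[OF f] pm.subspace_0[OF S] by (metis imageI)
  show "x + y \<in> f ` S" if "x \<in> f ` S" "y \<in> f ` S" for x y
    using that lin_add[OF f] pm.subspace_add[OF S] by (auto simp flip: lin_add[OF f])
  show "scale c x \<in> f ` S" if "x \<in> f ` S" for c x
    using that pm.subspace_scale[OF S] by (auto simp flip: lin_scale[OF f])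
qed

lemma projection_exists:
  assumes "pm.subspace (C :: ('i \<Rightarrow>\<^sub>0 'k::field) set)"
  shows "\<exists>P. lin P \<and> (\<forall>x. P x \<in> C) \<and> (\<forall>x\<in>C. P x = x)"
  using pmp.linear_exists_right_inverse_on[OF lin_ident assms] by auto

subsection \<open>Components with respect to a grading\<close>

lemma cf_part [simp]: "cf (part P p) i = (if P i then cf p i else 0)"
  by (rule part_eq_lookup)

lemma lin_part [lin_intros]: "lin f \<Longrightarrow> lin (\<lambda>x. part P (f x))"
  unfolding part_def by (rule lin_linext)

lemma part_bas [simp]: "part P (bas i) = (if P i then bas i else 0)"
  by (simp add: part_def)

lemma supp_part: "supp (part P p) = {i \<in> supp p. P i}"
  by (auto simp: in_keys_iff split: if_splits)

lemma part_id: "(\<And>i. i \<in> supp p \<Longrightarrow> P i) \<Longrightarrow> part P p = p"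
  by (rule poly_mapping_eqI) (auto simp: in_keys_iff)

lemma part_none: "(\<And>i. i \<in> supp p \<Longrightarrow> \<not> P i) \<Longrightarrow> part P p = 0"
  by (rule poly_mapping_eqI) (auto simp: in_keys_iff)

lemma part_compl: "part P p + part (\<lambda>i. \<not> P i) p = p"
  by (rule poly_mapping_eqI) (auto simp: lookup_add)

lemma part_diff_compl: "p - part P p = part (\<lambda>i. \<not> P i) p"
  by (rule poly_mapping_eqI) (auto simp: lookup_minus)

lemma part_add: "part P (p + q) = part P p + part P q"
  and part_minus: "part P (p - q) = part P p - part P q"
  and part_scale: "part P (scale c p) = scale c (part P p)"
  and part_zero [simp]: "part P 0 = 0"
  by (rule poly_mapping_eqI; simp add: lookup_add lookup_minus)+

lemma sum_of_parts: "p = (\<Sum>t\<in>g ` supp p. part (\<lambda>i. g i = t) p)"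
proof (rule poly_mapping_eqI)
  fix i
  show "cf p i = cf (\<Sum>t\<in>g ` supp p. part (\<lambda>i. g i = t) p) i"
    by (cases "i \<in> supp p") (auto simp: lookup_sum sum.delta' in_keys_iff)
qed

text \<open>A version of \<open>graded_subspace\<close> for degrees in an arbitrary type that also allows bounds
  on the degree. Closure under single components suffices (\<open>graded_byI\<close>), as an element has only
  finitely many nonzero ones.\<close>

definition graded_by :: "('i \<Rightarrow> 't) \<Rightarrow> ('i \<Rightarrow>\<^sub>0 'k::field) set \<Rightarrow> bool" where
  "graded_by g S \<longleftrightarrow> pm.subspace S \<and> (\<forall>p\<in>S. \<forall>P. part (\<lambda>i. P (g i)) p \<in> S)"

lemma graded_byI:
  assumes "pm.subspace S" "\<And>p t. p \<in> S \<Longrightarrow> part (\<lambda>i. g i = t) p \<in> S"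
  shows "graded_by g S"
  unfolding graded_by_def
proof (intro conjI ballI allI)
  fix p P assume "p \<in> S"
  have "part (\<lambda>i. P (g i)) p = (\<Sum>t\<in>g ` supp p. part (\<lambda>i. P (g i)) (part (\<lambda>i. g i = t) p))"
    by (subst (1) sum_of_parts[of p g]) (rule lin_sum[OF lin_part[OF lin_ident]])
  also have "\<dots> = (\<Sum>t\<in>g ` supp p. if P t then part (\<lambda>i. g i = t) p else 0)"
    by (intro sum.cong poly_mapping_eqI) auto
  also have "\<dots> \<in> S"
    using assms \<open>p \<in> S\<close> by (intro pm.subspace_sum) (auto simp: pm.subspace_0)
  finally show "part (\<lambda>i. P (g i)) p \<in> S" .
qed (rule assms)

lemma graded_by_subspace: "graded_by g S \<Longrightarrow> pm.subspace S"
  and graded_byD: "graded_by g S \<Longrightarrow> p \<in> S \<Longrightarrow> part (\<lambda>i. P (g i)) p \<in> S"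
  by (auto simp: graded_by_def)

lemma graded_subspace_iff: "graded_subspace g S \<longleftrightarrow> graded_by g S"
proof
  assume "graded_subspace g S"
  then show "graded_by g S" by (intro graded_byI) (auto simp: graded_subspace_def)
next
  assume S: "graded_by g S"
  show "graded_subspace g S"
    using graded_by_subspace[OF S] graded_byD[OF S, where P = "\<lambda>t. t = _"]
    by (auto simp: graded_subspace_def)
qed

text \<open>Any linear map can be made homogeneous, by keeping of each \<open>f (bas i)\<close> only the component of the
  degree of \<open>i\<close>; on homogeneous elements with homogeneous image nothing is lost.\<close>

definition homogenized :: "('i \<Rightarrow> 't) \<Rightarrow> ('j \<Rightarrow> 't) \<Rightarrow> (('i \<Rightarrow>\<^sub>0 'k::field) \<Rightarrow> ('j \<Rightarrow>\<^sub>0 'k)) \<Rightarrow>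
   ('i \<Rightarrow>\<^sub>0 'k) \<Rightarrow> ('j \<Rightarrow>\<^sub>0 'k)" where
  "homogenized g h f = linext (\<lambda>i. part (\<lambda>j. h j = g i) (f (bas i)))"

lemma cf_homogenized:
  assumes "lin f"
  shows "cf (homogenized g h f p) j = cf (f (part (\<lambda>i. g i = h j) p)) j"
proof -
  have "cf (homogenized g h f p) j =
      (\<Sum>i\<in>supp p. cf p i * (if h j = g i then cf (f (bas i)) j else 0))"
    by (simp add: homogenized_def cf_linext)
  also have "\<dots> = (\<Sum>i\<in>{i\<in>supp p. g i = h j}. cf p i * cf (f (bas i)) j)"
    by (subst sum.inter_filter) (auto intro!: sum.cong)
  also have "\<dots> = cf (f (part (\<lambda>i. g i = h j) p)) j"
    by (subst cf_lin[OF assms]) (auto simp: supp_part intro!: sum.cong)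
  finally show ?thesis .
qed

lemma graded_projection_exists:
  assumes "graded_by g (C :: ('i \<Rightarrow>\<^sub>0 'k::field) set)"
  shows "\<exists>P. lin P \<and> (\<forall>x. P x \<in> C) \<and> (\<forall>x\<in>C. P x = x) \<and> (\<forall>i. \<forall>j\<in>supp (P (bas i)). g j = g i)"
proof -
  obtain P0 where P0: "lin P0" "\<And>x. P0 x \<in> C" "\<And>x. x \<in> C \<Longrightarrow> P0 x = x"
    using projection_exists[OF graded_by_subspace[OF assms]] by blast
  let ?P = "homogenized g g P0"
  have "?P x \<in> C" for x
    unfolding homogenized_def
    by (rule linext_in_subspace[OF graded_by_subspace[OF assms]])
      (rule graded_byD[OF assms P0(2), where P = "\<lambda>t. t = _"])
  moreover have "?P x = x" if "x \<in> C" for x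
  proof (rule poly_mapping_eqI)
    fix j
    have "P0 (part (\<lambda>i. g i = g j) x) = part (\<lambda>i. g i = g j) x"
      by (rule P0(3)[OF graded_byD[OF assms that, of "\<lambda>t. t = g j"]])
    then show "cf (?P x) j = cf x j"
      by (simp add: cf_homogenized[OF P0(1)])
  qed
  moreover have "lin ?P"
    unfolding homogenized_def by (intro lin_intros)
  moreover have "\<forall>i. \<forall>j\<in>supp (?P (bas i)). g j = g i"
    by (auto simp: homogenized_def supp_part)
  ultimately show ?thesis by blast
qed

subsection \<open>Slices\<close>

lemma cf_pull: "inj f \<Longrightarrow> cf (Poly_Mapping.map_key f p) k = cf p (f k)"
  by (simp add: Poly_Mapping.map_key.rep_eq)

lemma lin_pull: "inj f \<Longrightarrow> lin (Poly_Mapping.map_key f)"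
  by (rule linI) (rule poly_mapping_eqI, simp add: cf_pull lookup_add)+

text \<open>The contractions with a word of the dual basis, that is, the coefficients of the deconcatenation
  with respect to its left and right factor. Working with coefficients avoids having to choose bases of
  subcoalgebras.\<close>

definition lslice :: "'x list \<Rightarrow> ('x list \<Rightarrow>\<^sub>0 'k::field) \<Rightarrow> ('x list \<Rightarrow>\<^sub>0 'k)" where
  "lslice u = Poly_Mapping.map_key (\<lambda>v. u @ v)"

definition rslice :: "'x list \<Rightarrow> ('x list \<Rightarrow>\<^sub>0 'k::field) \<Rightarrow> ('x list \<Rightarrow>\<^sub>0 'k)" where
  "rslice v = Poly_Mapping.map_key (\<lambda>u. u @ v)"

lemma inj_slices [simp]: "inj ((@) u)" "inj (\<lambda>u. u @ v)" "inj (\<lambda>v. u @ v)"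
  "inj ((#) x)" "inj (\<lambda>w. (w, l))" "inj (Pair m)"
  by (auto intro: injI)

lemma cf_lslice [simp]: "cf (lslice u p) v = cf p (u @ v)"
  and cf_rslice [simp]: "cf (rslice v p) u = cf p (u @ v)"
  and cf_cslice [simp]: "cf (Poly_Mapping.map_key ((#) y) q) ws = cf q (y # ws)"
  and cf_pslice1 [simp]: "cf (Poly_Mapping.map_key (\<lambda>w. (w, j)) z) w = cf z (w, j)"
  and cf_pslice2 [simp]: "cf (Poly_Mapping.map_key (Pair i) z) m = cf z (i, m)"
  by (simp_all add: cf_pull lslice_def rslice_def)

lemma lin_slices [lin_intros]:
  "lin f \<Longrightarrow> lin (\<lambda>x. lslice u (f x))" "lin f \<Longrightarrow> lin (\<lambda>x. rslice u (f x))"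
  "lin f' \<Longrightarrow> lin (\<lambda>x. Poly_Mapping.map_key ((#) y) (f' x))"
  "lin h \<Longrightarrow> lin (\<lambda>x. Poly_Mapping.map_key (\<lambda>w. (w, j)) (h x))"
  "lin h \<Longrightarrow> lin (\<lambda>x. Poly_Mapping.map_key (Pair i) (h x))"
  by (auto simp: lslice_def rslice_def intro!: lin_compose[OF lin_pull])

lemma lslice_append: "lslice v (lslice u p) = lslice (u @ v) p"
  and rslice_append: "rslice u (rslice v p) = rslice (u @ v) p"
  and lslice_rslice: "lslice u (rslice v p) = rslice v (lslice u p)"
  and lslice_Nil [simp]: "lslice [] p = p"
  and rslice_Nil [simp]: "rslice [] p = p"
  by (rule poly_mapping_eqI, simp only: cf_lslice cf_rslice, simp)+

subsection \<open>Signs and tensors\<close>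

lemma ksgn_add: "ksgn (m + n) = ksgn m * (ksgn n :: 'k::field)"
  by (auto simp: ksgn_def)

lemma ksgn_minus_one [simp]: "ksgn (n - 1) = - (ksgn n :: 'k::field)"
  "ksgn (n + 1) = - (ksgn n :: 'k::field)" "ksgn (1 + n) = - (ksgn n :: 'k::field)"
  by (auto simp: ksgn_def)

lemma ksgn_square [simp]: "ksgn n * ksgn n = (1 :: 'k::field)"
  "ksgn n * (ksgn n * c) = (c :: 'k::field)"
  by (auto simp: ksgn_def)

lemma ksgn_0 [simp]: "ksgn 0 = 1" "ksgn 1 = -1"
  by (simp_all add: ksgn_def)

lemma wdeg_append [simp]: "wdeg deg (u @ v) = wdeg deg u + wdeg deg v"
  and wdeg_Cons [simp]: "wdeg deg (x # v) = int (deg x) + wdeg deg v"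
  and wdeg_Nil [simp]: "wdeg deg [] = 0"
  by (simp_all add: wdeg_def)

lemma sdeg_append [simp]: "sdeg deg (u @ v) = sdeg deg u + sdeg deg v"
  and sdeg_Cons [simp]: "sdeg deg (x # v) = int (deg x) + 1 + sdeg deg v"
  and sdeg_Nil [simp]: "sdeg deg [] = 0"
  by (simp_all add: sdeg_def)

lemma sdeg_wdeg: "sdeg deg w = wdeg deg w + int (length w)"
  by (induction w) auto

lemma tensor2_bas [simp]: "tensor2 (bas i) (bas j) = bas (i, j)"
  by (simp add: tensor2_def)

lemma tensor3_bas [simp]: "tensor3 (bas i) (bas j) (bas l) = bas (i, j, l)"
  by (simp add: tensor3_def)

lemma cf_tensor2 [simp]: "cf (tensor2 p q) (i, j) = cf p i * cf q j"
proof -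
  have 1: "cf (linext (\<lambda>j. bas (i', j)) q) (i, j) = (if i' = i then cf q j else 0)" for i'
    by (auto simp: cf_linext cf_bas if_distrib[of "(*) _"] in_keys_iff cong: if_cong)
  show ?thesis
    by (simp add: tensor2_def cf_linext[of _ p] 1 if_distrib[of "(*) _"] in_keys_iff cong: if_cong)
qed

lemma cf_tensor3 [simp]: "cf (tensor3 p q r) (i, j, l) = cf p i * cf q j * cf r l"
  by (simp add: tensor3_def mult.assoc)

lemma lin_tensor2 [lin_intros]:
  "lin f \<Longrightarrow> lin (\<lambda>x. tensor2 (f x) q)" "lin g \<Longrightarrow> lin (\<lambda>x. tensor2 p (g x))"
  by (rule linI; rule poly_mapping_eqI;
      auto simp: lookup_add algebra_simps lin_add lin_scale)+

lemma lin_tensor3 [lin_intros]: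
  "lin f \<Longrightarrow> lin (\<lambda>x. tensor3 (f x) q r)" "lin g \<Longrightarrow> lin (\<lambda>x. tensor3 p (g x) r)"
  "lin h \<Longrightarrow> lin (\<lambda>x. tensor3 p q (h x))"
  unfolding tensor3_def by (intro lin_tensor2; assumption)+

lemma cf_wtpart [simp]: "cf (wtpart n p) w = (if length w = n then cf p w else 0)"
  by (simp add: wtpart_def)

lemma lin_wtpart [lin_intros]: "lin f \<Longrightarrow> lin (\<lambda>x. wtpart n (f x))"
  unfolding wtpart_def by (rule lin_part)

lemma wtpart_bas [simp]: "wtpart n (bas w) = (if length w = n then bas w else 0)"
  by (simp add: wtpart_def)

section \<open>Tensor products of subspaces\<close>

definition tens2 :: "('i \<Rightarrow>\<^sub>0 'k::field) set \<Rightarrow> ('j \<Rightarrow>\<^sub>0 'k) set \<Rightarrow> ('i \<times> 'j \<Rightarrow>\<^sub>0 'k) set" where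
  "tens2 A B = pm.span {tensor2 a b | a b. a \<in> A \<and> b \<in> B}"

definition tens3 :: "('i \<Rightarrow>\<^sub>0 'k::field) set \<Rightarrow> ('j \<Rightarrow>\<^sub>0 'k) set \<Rightarrow> ('l \<Rightarrow>\<^sub>0 'k) set \<Rightarrow>
    ('i \<times> 'j \<times> 'l \<Rightarrow>\<^sub>0 'k) set" where
  "tens3 A B D = pm.span {tensor3 a b d | a b d. a \<in> A \<and> b \<in> B \<and> d \<in> D}"

text \<open>The coefficients of an element of a tensor product with respect to the basis of the other factor.\<close>

abbreviation slice1 :: "'j \<Rightarrow> ('i \<times> 'j \<Rightarrow>\<^sub>0 'k::field) \<Rightarrow> ('i \<Rightarrow>\<^sub>0 'k)" where
  "slice1 j \<equiv> Poly_Mapping.map_key (\<lambda>i. (i, j))"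

abbreviation slice2 :: "'i \<Rightarrow> ('i \<times> 'j \<Rightarrow>\<^sub>0 'k::field) \<Rightarrow> ('j \<Rightarrow>\<^sub>0 'k)" where
  "slice2 i \<equiv> Poly_Mapping.map_key (Pair i)"

lemma subspace_tens2 [simp]: "pm.subspace (tens2 A B)"
  and subspace_tens3 [simp]: "pm.subspace (tens3 A B D)"
  unfolding tens2_def tens3_def by (rule pm.subspace_span)+

lemma tensor2_in [intro]: "a \<in> A \<Longrightarrow> b \<in> B \<Longrightarrow> tensor2 a b \<in> tens2 A B"
  unfolding tens2_def by (rule pm.span_base) blast

lemma tensor3_in [intro]: "a \<in> A \<Longrightarrow> b \<in> B \<Longrightarrow> d \<in> D \<Longrightarrow> tensor3 a b d \<in> tens3 A B D"
  unfolding tens3_def by (rule pm.span_base) blast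

lemma tens2_into:
  assumes "x \<in> tens2 A B" "lin f" "pm.subspace S" "\<And>a b. a \<in> A \<Longrightarrow> b \<in> B \<Longrightarrow> f (tensor2 a b) \<in> S"
  shows "f x \<in> S"
  using assms(1) unfolding tens2_def by (rule lin_span_into[OF _ assms(2,3)]) (use assms(4) in blast)

lemma tens3_into:
  assumes "x \<in> tens3 A B D" "lin f" "pm.subspace S"
    "\<And>a b d. a \<in> A \<Longrightarrow> b \<in> B \<Longrightarrow> d \<in> D \<Longrightarrow> f (tensor3 a b d) \<in> S"
  shows "f x \<in> S"
  using assms(1) unfolding tens3_def by (rule lin_span_into[OF _ assms(2,3)]) (use assms(4) in blast)

lemma slice1_tensor2: "slice1 j (tensor2 p q) = scale (cf q j) p"
  and slice2_tensor2: "slice2 i (tensor2 p q) = scale (cf p i) q"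
  by (rule poly_mapping_eqI; simp)+

text \<open>An element of a tensor product of two spaces lies in \<open>A \<otimes> B\<close> as soon as all its coefficients with
  respect to either factor do: apply projections onto \<open>A\<close> and \<open>B\<close> to the two factors.\<close>

lemma tens2_iff:
  assumes A: "pm.subspace (A :: ('i \<Rightarrow>\<^sub>0 'k::field) set)" and B: "pm.subspace (B :: ('j \<Rightarrow>\<^sub>0 'k) set)"
  shows "x \<in> tens2 A B \<longleftrightarrow> (\<forall>j. slice1 j x \<in> A) \<and> (\<forall>i. slice2 i x \<in> B)"
proof (intro iffI conjI allI)
  fix j assume "x \<in> tens2 A B"
  then show "slice1 j x \<in> A"
    by (rule tens2_into) (auto intro!: lin_intros A simp: slice1_tensor2 pm.subspace_scale[OF A])
next
  fix i assume "x \<in> tens2 A B"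
  then show "slice2 i x \<in> B"
    by (rule tens2_into) (auto intro!: lin_intros B simp: slice2_tensor2 pm.subspace_scale[OF B])
next
  assume x: "(\<forall>j. slice1 j x \<in> A) \<and> (\<forall>i. slice2 i x \<in> B)"
  obtain P where P: "lin P" "\<And>a. P a \<in> A" "\<And>a. a \<in> A \<Longrightarrow> P a = a"
    using projection_exists[OF A] by blast
  obtain P' where P': "lin P'" "\<And>a. P' a \<in> B" "\<And>a. a \<in> B \<Longrightarrow> P' a = a"
    using projection_exists[OF B] by blast
  define T1 where "T1 = linext (\<lambda>(i, j). tensor2 (P (bas i)) (bas j :: 'j \<Rightarrow>\<^sub>0 'k))"
  define T2 where "T2 = linext (\<lambda>(i, j). tensor2 (bas i :: 'i \<Rightarrow>\<^sub>0 'k) (P' (bas j)))"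
  have T1: "slice1 j (T1 y) = P (slice1 j y)" for j y
    by (rule lin_ext[of "\<lambda>y. slice1 j (T1 y)" "\<lambda>y. P (slice1 j y)"])
      (auto intro!: lin_intros lin_compose[OF P(1)] poly_mapping_eqI
        simp: T1_def cf_bas lin_zero[OF P(1)] lin_scale[OF P(1)] slice1_tensor2 simp flip: tensor2_bas)
  have T2: "slice2 i (T2 y) = P' (slice2 i y)" for i y
    by (rule lin_ext[of "\<lambda>y. slice2 i (T2 y)" "\<lambda>y. P' (slice2 i y)"])
      (auto intro!: lin_intros lin_compose[OF P'(1)] poly_mapping_eqI
        simp: T2_def cf_bas lin_zero[OF P'(1)] lin_scale[OF P'(1)] slice2_tensor2 simp flip: tensor2_bas)
  have 1: "T1 x = x"
  proof (rule poly_mapping_eqI)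
    fix ij :: "'i \<times> 'j"
    obtain i j where ij: "ij = (i, j)" by fastforce
    have "cf (slice1 j (T1 x)) i = cf (slice1 j x) i" using x by (simp add: T1 P(3) del: cf_pslice1)
    then show "cf (T1 x) ij = cf x ij" by (simp add: ij)
  qed
  have 2: "T2 x = x"
  proof (rule poly_mapping_eqI)
    fix ij :: "'i \<times> 'j"
    obtain i j where ij: "ij = (i, j)" by fastforce
    have "cf (slice2 i (T2 x)) j = cf (slice2 i x) j" using x by (simp add: T2 P'(3) del: cf_pslice2)
    then show "cf (T2 x) ij = cf x ij" by (simp add: ij)
  qed
  have lin1: "lin T1" unfolding T1_def by (intro lin_intros)
  have lin2: "lin T2" unfolding T2_def by (intro lin_intros)
  have T1t: "T1 (tensor2 a b) = tensor2 (P a) b" for a b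
    by (rule poly_mapping_eqI, clarify) (metis T1 slice1_tensor2 lin_scale[OF P(1)] cf_pslice1)
  have "T1 (T2 x) \<in> tens2 A B"
  proof (rule lin_in_subspace[where f = "\<lambda>x. T1 (T2 x)"])
    fix ij :: "'i \<times> 'j"
    obtain i j where ij: "ij = (i, j)" by fastforce
    have "T1 (T2 (bas ij)) = tensor2 (P (bas i)) (P' (bas j))"
      by (simp add: ij T2_def T1t)
    then show "T1 (T2 (bas ij)) \<in> tens2 A B" using P(2) P'(2) by auto
  qed (simp_all add: lin_compose[OF lin1] lin2)
  then show "x \<in> tens2 A B" by (simp add: 1 2)
qed

lemma tens3_eq_tens2: "tens3 A B D = tens2 A (tens2 B D)"
proof (rule antisym)
  show "tens3 A B D \<subseteq> tens2 A (tens2 B D)"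
    unfolding tens3_def
    by (rule pm.span_minimal) (auto simp: tensor3_def)
  have "tensor2 a t \<in> tens3 A B D" if "a \<in> A" "t \<in> tens2 B D" for a t
    using that(2) by (rule tens2_into) (auto intro!: lin_intros simp: that simp flip: tensor3_def)
  then show "tens2 A (tens2 B D) \<subseteq> tens3 A B D"
    unfolding tens2_def[of A] by (intro pm.span_minimal) auto
qed

lemma tens3_iff:
  assumes A: "pm.subspace (A :: ('i \<Rightarrow>\<^sub>0 'k::field) set)" and B: "pm.subspace (B :: ('j \<Rightarrow>\<^sub>0 'k) set)"
    and D: "pm.subspace (D :: ('l \<Rightarrow>\<^sub>0 'k) set)"
  shows "x \<in> tens3 A B D \<longleftrightarrow> (\<forall>jl. slice1 jl x \<in> A) \<and> (\<forall>i l. slice1 l (slice2 i x) \<in> B) \<and>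
      (\<forall>i j. slice2 j (slice2 i x) \<in> D)"
  by (auto simp: tens3_eq_tens2 tens2_iff[OF A subspace_tens2] tens2_iff[OF B D])

lemma subspace_UNIV [simp]: "pm.subspace UNIV"
  by (simp add: pm.subspace_def)

section \<open>The coalgebra of a quadratic algebra\<close>

lemma wtpart_zero [simp]: "wtpart n 0 = 0"
  by (simp add: wtpart_def)

lemma cf_bas_mult: "cf (bas u * p) w = (if take (length u) w = u then cf p (drop (length u) w) else 0)"
  for p :: "'x list \<Rightarrow>\<^sub>0 'k::field"
proof -
  have "cf (bas u * p) w = (\<Sum>i\<in>supp p. cf p i * cf (bas u * bas i) w)"
    by (rule cf_lin) (intro lin_intros)
  also have "\<dots> = (\<Sum>i\<in>supp p. if i = drop (length u) w then
      if take (length u) w = u then cf p i else 0 else 0)"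
    by (intro sum.cong) (auto simp: cf_bas, metis append_take_drop_id)
  finally show ?thesis by (auto simp: in_keys_iff)
qed

lemma cf_mult_bas: "cf (p * bas v) w =
    (if drop (length w - length v) w = v then cf p (take (length w - length v) w) else 0)"
  for p :: "'x list \<Rightarrow>\<^sub>0 'k::field"
proof -
  have "cf (p * bas v) w = (\<Sum>i\<in>supp p. cf p i * cf (bas i * bas v) w)"
    by (rule cf_lin) (intro lin_intros)
  also have "\<dots> = (\<Sum>i\<in>supp p. if i = take (length w - length v) w then
      if drop (length w - length v) w = v then cf p i else 0 else 0)"
    by (intro sum.cong) (auto simp: cf_bas, metis append_take_drop_id)
  finally show ?thesis by (auto simp: in_keys_iff)
qed

lemma lslice_bas_mult: "lslice u (bas u * p) = p"
  "length u = length u' \<Longrightarrow> u \<noteq> u' \<Longrightarrow> lslice u (bas u' * p) = 0"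
  by (rule poly_mapping_eqI; simp add: cf_bas_mult)+

lemma rslice_mult_bas: "rslice v (p * bas v) = p"
  "length v = length v' \<Longrightarrow> v \<noteq> v' \<Longrightarrow> rslice v (p * bas v') = 0"
  by (rule poly_mapping_eqI; simp add: cf_mult_bas)+

lemma lin_susp2 [lin_intros]: "lin f \<Longrightarrow> lin (\<lambda>x. susp2 deg (f x))"
  unfolding susp2_def by (rule lin_linext)

lemma susp2_bas2 [simp]: "susp2 deg (bas [a, b]) = scale (ksgn (int (deg a))) (bas [a, b])"
  by (simp add: susp2_def)

lemma susp2_bas: "susp2 deg (bas w) = (if length w = 2 then scale (ksgn (int (deg (hd w)))) (bas w) else 0)"
  by (auto simp: susp2_def split: list.splits)

lemma cf_susp2: "cf (susp2 deg p) w = (if length w = 2 then ksgn (int (deg (hd w))) * cf p w else 0)"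
proof -
  have "cf (susp2 deg p) w = (\<Sum>i\<in>supp p. cf p i * cf (susp2 deg (bas i)) w)"
    by (rule cf_lin) (intro lin_intros)
  also have "\<dots> = (\<Sum>i\<in>supp p. if i = w then if length w = 2 then ksgn (int (deg (hd w))) * cf p w else 0 else 0)"
    by (intro sum.cong) (auto simp: cf_bas susp2_bas)
  finally show ?thesis by (auto simp: in_keys_iff)
qed

lemma susp2_susp2 [simp]: "susp2 deg (susp2 deg p) = wtpart 2 p"
  by (rule poly_mapping_eqI) (auto simp: cf_susp2)

lemma wtpart_susp2 [simp]: "wtpart 2 (susp2 deg p) = susp2 deg p" "susp2 deg (wtpart 2 p) = susp2 deg p"
  by (rule poly_mapping_eqI; auto simp: cf_susp2)+

text \<open>Multiplies a homogeneous element of degree \<open>n\<close> of the tensor coalgebra by the sign of \<open>n\<close>.\<close>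

definition sg :: "('x \<Rightarrow> nat) \<Rightarrow> ('x list \<Rightarrow>\<^sub>0 'k::field) \<Rightarrow> ('x list \<Rightarrow>\<^sub>0 'k)" where
  "sg deg = linext (\<lambda>w. scale (ksgn (sdeg deg w)) (bas w))"

lemma lin_sg [lin_intros]: "lin f \<Longrightarrow> lin (\<lambda>x. sg deg (f x))"
  unfolding sg_def by (rule lin_linext)

lemma sg_bas [simp]: "sg deg (bas w) = scale (ksgn (sdeg deg w)) (bas w)"
  by (simp add: sg_def)

lemma cf_sg [simp]: "cf (sg deg p) w = ksgn (sdeg deg w) * cf p w"
proof -
  have "cf (sg deg p) w = (\<Sum>i\<in>supp p. if i = w then ksgn (sdeg deg w) * cf p w else 0)"
    unfolding sg_def cf_linext by (intro sum.cong) (auto simp: cf_bas)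
  then show ?thesis by (auto simp: in_keys_iff)
qed

lemma graded_by_sg:
  assumes "graded_by (sdeg deg) C" "c \<in> C"
  shows "sg deg c \<in> C"
proof -
  have "sg deg c = part (\<lambda>w. even (sdeg deg w)) c - part (\<lambda>w. \<not> even (sdeg deg w)) c"
    by (rule poly_mapping_eqI) (simp add: lookup_minus ksgn_def)
  then show ?thesis
    using graded_byD[OF assms, where P = even] graded_byD[OF assms, where P = "\<lambda>n. \<not> even n"]
    by (simp add: pm.subspace_diff[OF graded_by_subspace[OF assms(1)]])
qed

locale quadratic =
  fixes deg :: "'x \<Rightarrow> nat" and Q :: "('x list \<Rightarrow>\<^sub>0 'k::field) set"
  assumes graded_Q: "graded_by (wdeg deg) Q"
    and weight_Q: "x \<in> Q \<Longrightarrow> wtpart 2 x = x"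
begin

abbreviation S :: "('x list \<Rightarrow>\<^sub>0 'k) set" where "S \<equiv> susp2 deg ` Q"

abbreviation C :: "('x list \<Rightarrow>\<^sub>0 'k) set" where "C \<equiv> koszul_coalg deg Q"

lemma subspace_Q: "pm.subspace Q"
  using graded_Q by (rule graded_by_subspace)

lemma subspace_S: "pm.subspace S"
  by (rule lin_image_subspace[OF _ subspace_Q]) (intro lin_intros)

lemma susp2_S_iff: "s \<in> S \<longleftrightarrow> wtpart 2 s = s \<and> susp2 deg s \<in> Q"
proof
  assume "s \<in> S"
  then show "wtpart 2 s = s \<and> susp2 deg s \<in> Q" using weight_Q by auto
next
  assume "wtpart 2 s = s \<and> susp2 deg s \<in> Q"
  then show "s \<in> S" by (metis imageI susp2_susp2)
qed

lemma weight_S: "s \<in> S \<Longrightarrow> wtpart 2 s = s"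
  by auto

lemma graded_S: "graded_by (wdeg deg) S"
proof (rule graded_byI[OF subspace_S])
  fix s t assume "s \<in> S"
  then obtain x where x: "x \<in> Q" "s = susp2 deg x" by blast
  have "part (\<lambda>w. wdeg deg w = t) s = susp2 deg (part (\<lambda>w. wdeg deg w = t) x)"
    by (rule poly_mapping_eqI) (simp add: x cf_susp2)
  then show "part (\<lambda>w. wdeg deg w = t) s \<in> S"
    using graded_byD[OF graded_Q x(1), where P = "\<lambda>n. n = t"] by simp
qed

lemma weight_supp_S: "s \<in> S \<Longrightarrow> w \<in> supp s \<Longrightarrow> length w = 2"
  by (auto simp: in_keys_iff cf_susp2 split: if_splits)

lemma graded_S': "s \<in> S \<Longrightarrow> part (\<lambda>w. P (length w) (sdeg deg w)) s \<in> S"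
proof -
  assume s: "s \<in> S"
  have "part (\<lambda>w. P (length w) (sdeg deg w)) s = part (\<lambda>w. P 2 (wdeg deg w + 2)) s"
    using weight_supp_S[OF s] by (intro poly_mapping_eqI) (force simp: sdeg_wdeg in_keys_iff)
  then show ?thesis using graded_byD[OF graded_S s, where P = "\<lambda>n. P 2 (n + 2)"] by simp
qed

text \<open>An element of weight \<open>n\<close> is the sum of the \<open>bas u * s * bas v\<close> over the
  words \<open>u\<close>, \<open>v\<close> of lengths \<open>i\<close>, \<open>j\<close>, where \<open>s\<close>
  is its contraction with \<open>u\<close> and \<open>v\<close>.\<close>

lemma middle_span_iff:
  assumes n: "n = i + 2 + j"
  shows "wtpart n c \<in> pm.span {bas u * susp2 deg x * bas v | u x v. length u = i \<and> x \<in> Q \<and> length v = j} \<longleftrightarrow>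
    (\<forall>u v. length u = i \<longrightarrow> length v = j \<longrightarrow> wtpart 2 (lslice u (rslice v c)) \<in> S)"
    (is "_ \<in> pm.span ?G \<longleftrightarrow> _")
proof (intro iffI allI impI)
  fix u v :: "'x list" assume uv: "length u = i" "length v = j"
  assume c: "wtpart n c \<in> pm.span ?G"
  have "wtpart 2 (lslice u (rslice v (wtpart n c))) \<in> S"
  proof (rule lin_span_into[OF c _ subspace_S])
    show "lin (\<lambda>c. wtpart 2 (lslice u (rslice v c)))" by (intro lin_intros)
    fix g assume "g \<in> ?G"
    then obtain u' x v' where g: "g = bas u' * susp2 deg x * bas v'" "length u' = i" "x \<in> Q" "length v' = j"
      by blast
    have r: "rslice v g = (if v = v' then bas u' * susp2 deg x else 0)"
      using g uv rslice_mult_bas by metis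
    have "lslice u (rslice v g) = (if u = u' \<and> v = v' then susp2 deg x else 0)"
      unfolding r using g uv lslice_bas_mult[of u] lin_zero[OF lin_slices(1)[OF lin_ident]] by auto
    then show "wtpart 2 (lslice u (rslice v g)) \<in> S" using g pm.subspace_0[OF subspace_S]
      by auto
  qed
  moreover have "wtpart 2 (lslice u (rslice v (wtpart n c))) = wtpart 2 (lslice u (rslice v c))"
    by (rule poly_mapping_eqI) (simp add: n uv)
  ultimately show "wtpart 2 (lslice u (rslice v c)) \<in> S" by simp
next
  assume *: "\<forall>u v. length u = i \<longrightarrow> length v = j \<longrightarrow> wtpart 2 (lslice u (rslice v c)) \<in> S"
  let ?g = "\<lambda>w. (take i w, drop (i + 2) w)"
  have p: "part (\<lambda>w. ?g w = (u, v)) (wtpart n c) = bas u * wtpart 2 (lslice u (rslice v c)) * bas v"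
    if "length u = i" "length v = j" for u v
  proof (rule poly_mapping_eqI)
    fix w
    show "cf (part (\<lambda>w. ?g w = (u, v)) (wtpart n c)) w =
      cf (bas u * wtpart 2 (lslice u (rslice v c)) * bas v) w"
    proof (cases "length w = n")
      case True
      then have 1: "length w - length v = i + 2" "length (take i w) = i" using n that by auto
      have "take i w @ drop i (take (i + 2) w) @ drop (i + 2) w = w"
        by (metis append_assoc append_take_drop_id min.absorb1 le_add1 take_take)
      then have "take i w = u \<Longrightarrow> drop (i + 2) w = v \<Longrightarrow> u @ drop i (take (i + 2) w) @ v = w"
        by blast
      then show ?thesis using True n that 1
        by (simp add: cf_mult_bas cf_bas_mult del: drop_take)
    next
      case False
      then have "\<not> (drop (length w - length v) w = v \<and> take (length u) (take (length w - length v) w) = u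
          \<and> length (drop (length u) (take (length w - length v) w)) = 2)"
        using n that by (metis append_take_drop_id length_append add.commute add.left_commute)
      then show ?thesis using False
        by (auto simp add: cf_mult_bas cf_bas_mult)
    qed
  qed
  have "wtpart n c = (\<Sum>t\<in>?g ` supp (wtpart n c). part (\<lambda>w. ?g w = t) (wtpart n c))"
    by (rule sum_of_parts)
  also have "\<dots> \<in> pm.span ?G"
  proof (intro pm.span_sum)
    fix t assume "t \<in> ?g ` supp (wtpart n c)"
    then obtain w where w: "t = ?g w" "length w = n"
      by (auto simp: in_keys_iff split: if_splits)
    then have l: "length (take i w) = i" "length (drop (i + 2) w) = j" using n by auto
    from * l obtain x where "x \<in> Q" "wtpart 2 (lslice (take i w) (rslice (drop (i + 2) w) c)) = susp2 deg x"
      by blast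
    then have "part (\<lambda>w. ?g w = t) (wtpart n c) =
        bas (take i w) * susp2 deg x * bas (drop (i + 2) w)"
      using p[OF l] by (simp add: w(1))
    with l \<open>x \<in> Q\<close> show "part (\<lambda>w. ?g w = t) (wtpart n c) \<in> pm.span ?G"
      by (intro pm.span_base) blast
  qed
  finally show "wtpart n c \<in> pm.span ?G" .
qed

text \<open>The defining condition of the coalgebra, read off coefficientwise: every window of length two
  inside the words of \<open>c\<close> carries an element of \<open>s\<^sup>2Q\<close>.\<close>

lemma koszul_coalg_iff: "c \<in> C \<longleftrightarrow> (\<forall>u v. wtpart 2 (lslice u (rslice v c)) \<in> S)"
  unfolding koszul_coalg_def mem_Collect_eq using middle_span_iff by blast

lemma subspace_C: "pm.subspace C"
proof -
  have 1: "wtpart 2 (lslice u (rslice v (x + y))) =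
      wtpart 2 (lslice u (rslice v x)) + wtpart 2 (lslice u (rslice v y))" for u v and x y :: "'x list \<Rightarrow>\<^sub>0 'k"
    by (rule poly_mapping_eqI) (simp add: lookup_add)
  have 2: "wtpart 2 (lslice u (rslice v (scale c x))) = scale c (wtpart 2 (lslice u (rslice v x)))"
    for u v c and x :: "'x list \<Rightarrow>\<^sub>0 'k"
    by (rule poly_mapping_eqI) simp
  have 3: "wtpart 2 (lslice u (rslice v 0)) = (0 :: 'x list \<Rightarrow>\<^sub>0 'k)" for u v :: "'x list"
    by (rule poly_mapping_eqI) simp
  show ?thesis
    by (rule pm.subspaceI; simp add: koszul_coalg_iff 1 2 3)
      (use subspace_S pm.subspace_0[OF subspace_S] in
        \<open>auto intro: pm.subspace_add pm.subspace_scale\<close>)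
qed

lemma C_lslice: "c \<in> C \<Longrightarrow> lslice u c \<in> C"
  by (simp add: koszul_coalg_iff lslice_append lslice_rslice[symmetric, of _ _ c])

lemma C_rslice: "c \<in> C \<Longrightarrow> rslice v c \<in> C"
  by (simp add: koszul_coalg_iff rslice_append)

lemma C_weight2: "c \<in> C \<Longrightarrow> wtpart 2 c \<in> S"
  using koszul_coalg_iff[of c] by (metis lslice_Nil rslice_Nil)

lemma C_graded:
  assumes c: "c \<in> C" shows "part (\<lambda>w. P (length w) (sdeg deg w)) c \<in> C"
  unfolding koszul_coalg_iff
proof (intro allI)
  fix u v
  let ?P = "\<lambda>n m. P (length u + n + length v) (sdeg deg u + m + sdeg deg v)"
  have "wtpart 2 (lslice u (rslice v (part (\<lambda>w. P (length w) (sdeg deg w)) c))) =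
      part (\<lambda>w. ?P (length w) (sdeg deg w)) (wtpart 2 (lslice u (rslice v c)))"
    by (rule poly_mapping_eqI) (simp add: add.assoc)
  then show "wtpart 2 (lslice u (rslice v (part (\<lambda>w. P (length w) (sdeg deg w)) c))) \<in> S"
    using graded_S'[of _ ?P] c by (simp add: koszul_coalg_iff)
qed

lemma graded_C: "graded_by (\<lambda>w. (length w, sdeg deg w)) C"
  using C_graded[of _ "\<lambda>n m. (n, m) = _"] by (intro graded_byI subspace_C) auto

lemma graded_C_length: "graded_by length C" and graded_C_sdeg: "graded_by (sdeg deg) C"
  using C_graded[of _ "\<lambda>n m. n = _"] C_graded[of _ "\<lambda>n m. m = _"]
  by (auto intro!: graded_byI subspace_C)

lemma C_wtpart: "c \<in> C \<Longrightarrow> wtpart n c \<in> C"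
  unfolding wtpart_def using graded_byD[OF graded_C_length, where P = "\<lambda>m. m = n"] .

lemma C_short:
  assumes "\<And>w. w \<in> supp c \<Longrightarrow> length w \<le> 1" shows "c \<in> C"
proof -
  have "wtpart 2 (lslice u (rslice v c)) = 0" for u v
  proof (rule poly_mapping_eqI)
    fix w show "cf (wtpart 2 (lslice u (rslice v c))) w = cf 0 w"
      using assms[of "u @ w @ v"] by (cases "cf c (u @ w @ v) = 0") (auto simp: in_keys_iff)
  qed
  then show ?thesis by (simp add: koszul_coalg_iff pm.subspace_0[OF subspace_S])
qed

lemma C_bas_Nil: "bas [] \<in> C" and C_bas_letter: "bas [x] \<in> C"
  by (rule C_short; simp)+

lemma S_subset_C: "s \<in> S \<Longrightarrow> s \<in> C"
proof -
  assume s: "s \<in> S"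
  have "wtpart 2 (lslice u (rslice v s)) = (if u = [] \<and> v = [] then s else 0)" for u v
  proof (cases "u = [] \<and> v = []")
    case False
    have "cf s (u @ w @ v) = 0" if "length w = 2" for w
    proof (rule ccontr)
      assume "cf s (u @ w @ v) \<noteq> 0"
      then have "length (u @ w @ v) = 2" using weight_supp_S[OF s, of "u @ w @ v"] by (simp add: in_keys_iff)
      then show False using that False by simp
    qed
    then show ?thesis using False by (intro poly_mapping_eqI) auto
  qed (use weight_S[OF s] in auto)
  then show ?thesis by (auto simp: koszul_coalg_iff s pm.subspace_0[OF subspace_S])
qed

end

section \<open>Coderivations\<close>

lemma cf_weight1_mult:
  fixes q :: "'x list \<Rightarrow>\<^sub>0 'k::field"
  assumes "\<And>w. w \<in> supp q \<Longrightarrow> length w = 1"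
  shows "cf (q * p) (a # t) = cf q [a] * cf p t" and "cf (q * p) [] = 0"
proof -
  have 1: "cf (q * p) w = (\<Sum>i\<in>supp q. cf q i * cf (bas i * p) w)" for w
    by (rule cf_lin) (intro lin_intros)
  have "cf (q * p) (a # t) = (\<Sum>i\<in>supp q. if i = [a] then cf q [a] * cf p t else 0)"
    unfolding 1
  proof (rule sum.cong)
    fix i assume "i \<in> supp q"
    then obtain b where "i = [b]" using assms by (auto simp: length_Suc_conv)
    then show "cf q i * cf (bas i * p) (a # t) = (if i = [a] then cf q [a] * cf p t else 0)"
      by (simp add: cf_bas_mult)
  qed simp
  then show "cf (q * p) (a # t) = cf q [a] * cf p t" by (auto simp: in_keys_iff)
  show "cf (q * p) [] = 0"
    unfolding 1 using assms[of "[]"] by (intro sum.neutral) (auto simp: cf_bas_mult)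
qed

lemma lslice_bas: "lslice (a # u) (bas []) = (0 :: 'x list \<Rightarrow>\<^sub>0 'k::field)"
  "lslice (a # u) (bas (x # w)) = (if a = x then lslice u (bas w) else (0 :: 'x list \<Rightarrow>\<^sub>0 'k))"
  by (rule poly_mapping_eqI, auto simp: cf_bas)+

lemma rslice_bas: "rslice v (bas []) = (if v = [] then bas [] else (0 :: 'x list \<Rightarrow>\<^sub>0 'k::field))"
  "rslice v (bas (x # w)) = (if x # w = v then bas [] else 0) + bas [x] * (rslice v (bas w) :: 'x list \<Rightarrow>\<^sub>0 'k)"
proof -
  show "rslice v (bas []) = (if v = [] then bas [] else (0 :: 'x list \<Rightarrow>\<^sub>0 'k))"
    by (rule poly_mapping_eqI) (auto simp: cf_bas)
  show "rslice v (bas (x # w)) = (if x # w = v then bas [] else 0) + bas [x] * (rslice v (bas w) :: 'x list \<Rightarrow>\<^sub>0 'k)"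
  proof (rule poly_mapping_eqI)
    fix u show "cf (rslice v (bas (x # w))) u =
      cf ((if x # w = v then bas [] else 0) + bas [x] * (rslice v (bas w) :: 'x list \<Rightarrow>\<^sub>0 'k)) u"
      by (cases u) (auto simp: cf_bas lookup_add cf_bas_mult)
  qed
qed

text \<open>The coderivation of the tensor coalgebra that merges two adjacent letters \<open>x, y\<close> into
  \<open>f [x, y]\<close>. Passing the suspended letter \<open>x\<close> costs the sign of \<open>deg x +
  1\<close>, hence the minus sign.\<close>

fun cod_word :: "('x \<Rightarrow> nat) \<Rightarrow> ('x list \<Rightarrow> ('x list \<Rightarrow>\<^sub>0 'k::field)) \<Rightarrow> 'x list \<Rightarrow> ('x list \<Rightarrow>\<^sub>0 'k)" where
  "cod_word deg f [] = 0"
| "cod_word deg f [x] = 0"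
| "cod_word deg f (x # y # w) =
     f [x, y] * bas w - scale (ksgn (int (deg x))) (bas [x] * cod_word deg f (y # w))"

definition cod :: "('x \<Rightarrow> nat) \<Rightarrow> ('x list \<Rightarrow> ('x list \<Rightarrow>\<^sub>0 'k::field)) \<Rightarrow>
    ('x list \<Rightarrow>\<^sub>0 'k) \<Rightarrow> ('x list \<Rightarrow>\<^sub>0 'k)" where
  "cod deg f = linext (cod_word deg f)"

lemma lin_cod [lin_intros]: "lin g \<Longrightarrow> lin (\<lambda>x. cod deg f (g x))"
  unfolding cod_def by (rule lin_linext)

lemma lin_scale_cf [lin_intros]: "lin f \<Longrightarrow> lin (\<lambda>p. scale (cf (f p) j) t)"
  by (rule linI) (simp_all add: lin_add lin_scale lookup_add pm.scale_left_distrib)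

definition merge_first :: "('x list \<Rightarrow> ('x list \<Rightarrow>\<^sub>0 'k::field)) \<Rightarrow> 'x \<Rightarrow> ('x list \<Rightarrow>\<^sub>0 'k) \<Rightarrow> ('x list \<Rightarrow>\<^sub>0 'k)" where
  "merge_first f x = linext (\<lambda>w. case w of [] \<Rightarrow> 0 | y # b \<Rightarrow> f [x, y] * bas b)"

lemma lin_merge_first [lin_intros]: "lin g \<Longrightarrow> lin (\<lambda>p. merge_first f x (g p))"
  unfolding merge_first_def by (rule lin_linext)

lemma merge_first_letter: "merge_first f x (bas [y] * p) = f [x, y] * p"
  by (rule lin_ext[of "\<lambda>p. merge_first f x (bas [y] * p)" "\<lambda>p. f [x, y] * p"])
    (auto intro!: lin_intros simp: merge_first_def)

lemma cod_letter: "cod deg f (bas [x] * p) =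
    merge_first f x p - scale (ksgn (int (deg x))) (bas [x] * cod deg f p)"
proof (rule lin_ext[of "\<lambda>p. cod deg f (bas [x] * p)"
      "\<lambda>p. merge_first f x p - scale (ksgn (int (deg x))) (bas [x] * cod deg f p)"])
  fix w show "cod deg f (bas [x] * bas w) =
    merge_first f x (bas w) - scale (ksgn (int (deg x))) (bas [x] * cod deg f (bas w))"
    by (cases w) (auto simp: cod_def merge_first_def)
qed (intro lin_intros)+

locale merging =
  fixes deg :: "'x \<Rightarrow> nat" and f :: "'x list \<Rightarrow> ('x list \<Rightarrow>\<^sub>0 'k::field)"
  assumes merge_weight: "w \<in> supp (f [x, y]) \<Longrightarrow> length w = 1"
    and merge_degree: "w \<in> supp (f [x, y]) \<Longrightarrow> wdeg deg w = int (deg x) + int (deg y)"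
begin

lemma cod_word_supp:
  "w' \<in> supp (cod_word deg f w) \<Longrightarrow> Suc (length w') = length w \<and> sdeg deg w' = sdeg deg w - 1"
proof (induction w arbitrary: w' rule: induct_list012)
  case (3 x y w)
  from 3(3) consider "w' \<in> supp (f [x, y] * bas w)"
    | "w' \<in> supp (bas [x] * cod_word deg f (y # w))"
    by (cases "w' \<in> supp (f [x, y] * bas w)") (auto simp: in_keys_iff lookup_minus)
  then show ?case
  proof cases
    case 1
    then obtain z where z: "w' = z @ w" "z \<in> supp (f [x, y])"
      using keys_mult[of "f [x, y]" "bas w"] by (auto simp: plus_list_def)
    show ?thesis using merge_weight[OF z(2)] merge_degree[OF z(2)] by (simp add: z(1) sdeg_wdeg)
  next
    case 2
    then obtain z where z: "w' = x # z" "z \<in> supp (cod_word deg f (y # w))"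
      using keys_mult[of "bas [x]" "cod_word deg f (y # w)"] by (auto simp: plus_list_def)
    show ?thesis using 3(2)[OF z(2)] by (simp add: z(1))
  qed
qed auto

lemma cf_cod_Nil: "cf (cod deg f p) [] = 0"
proof -
  have "cf (cod_word deg f w) [] = 0" for w :: "'x list"
    using merge_weight by (induction w rule: induct_list012) (auto simp: cf_weight1_mult(2)[OF merge_weight] cf_bas_mult lookup_minus)
  then show ?thesis by (simp add: cod_def cf_linext)
qed

text \<open>The letter that results from a merge lies either in \<open>u\<close> or in \<open>v\<close>; the
  merge then took place in the part of the word before \<open>v\<close> or in the part after \<open>u\<close>.\<close>

lemma cod_word_coderivation:
  "cf (cod deg f (bas w)) (u @ v) = cf (cod deg f (rslice v (bas w))) u +
     ksgn (sdeg deg u) * cf (cod deg f (lslice u (bas w))) v"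
proof (induction w arbitrary: u)
  case Nil
  then show ?case by (cases u) (auto simp: rslice_bas lslice_bas cod_def cf_linext)
next
  case (Cons x w)
  show ?case
  proof (cases u)
    case Nil then show ?thesis by (simp add: cf_cod_Nil)
  next
    case u: (Cons a u')
    have m: "cf (merge_first f x (bas w)) (a # u' @ v) = cf (merge_first f x (rslice v (bas w))) (a # u')"
    proof (cases w)
      case Nil
      then show ?thesis by (auto simp: rslice_bas merge_first_def cf_linext)
    next
      case (Cons y b)
      have "merge_first f x (rslice v (bas w)) = f [x, y] * rslice v (bas b)"
        by (simp add: Cons rslice_bas lin_add[OF lin_merge_first[OF lin_ident]] merge_first_letter)
          (simp add: merge_first_def linext_def)
      then show ?thesis
        by (simp add: Cons cf_weight1_mult merge_weight merge_first_def)
    qed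
    have "cod deg f (bas (x # w)) = cod deg f (bas [x] * bas w)" by simp
    then have 1: "cf (cod deg f (bas (x # w))) (u @ v) = cf (merge_first f x (bas w)) (a # u' @ v) -
        ksgn (int (deg x)) * (if a = x then cf (cod deg f (bas w)) (u' @ v) else 0)"
      by (simp only: cod_letter) (simp add: u lookup_minus cf_bas_mult)
    have "cod deg f (if x # w = v then bas [] else 0) = 0" by (simp add: cod_def linext_def)
    then have "cod deg f (rslice v (bas (x # w))) = cod deg f (bas [x] * rslice v (bas w))"
      by (simp add: rslice_bas lin_add[OF lin_cod[OF lin_ident]])
    then have 2: "cf (cod deg f (rslice v (bas (x # w)))) u = cf (merge_first f x (rslice v (bas w))) (a # u') -
        ksgn (int (deg x)) * (if a = x then cf (cod deg f (rslice v (bas w))) u' else 0)"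
      by (simp only: cod_letter) (simp add: u lookup_minus cf_bas_mult)
    have 3: "cf (cod deg f (lslice u (bas (x # w)))) v =
        (if a = x then cf (cod deg f (lslice u' (bas w))) v else 0)"
      by (auto simp: u lslice_bas cod_def linext_def)
    show ?thesis
      unfolding 1 2 3 m using Cons.IH[of u'] by (simp add: u ksgn_add algebra_simps)
  qed
qed

lemma cod_coderivation_cf:
  "cf (cod deg f p) (u @ v) = cf (cod deg f (rslice v p)) u +
     ksgn (sdeg deg u) * cf (cod deg f (lslice u p)) v"
proof -
  have "scale (cf (cod deg f p) (u @ v)) (bas ()) = scale (cf (cod deg f (rslice v p)) u) (bas ()) +
     scale (ksgn (sdeg deg u)) (scale (cf (cod deg f (lslice u p)) v) (bas ()))"
    by (rule lin_ext[of "\<lambda>p. scale (cf (cod deg f p) (u @ v)) (bas ())"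
      "\<lambda>p. scale (cf (cod deg f (rslice v p)) u) (bas ()) +
        scale (ksgn (sdeg deg u)) (scale (cf (cod deg f (lslice u p)) v) (bas ()))"])
      (intro lin_intros, intro lin_intros,
        simp add: cod_word_coderivation pm.scale_left_distrib)
  from arg_cong[OF this, of "\<lambda>p. cf p ()"] show ?thesis by (simp add: lookup_add)
qed

end

lemma cf_deconc: "cf (deconc p) (u, v) = cf p (u @ v)"
  for p :: "'x list \<Rightarrow>\<^sub>0 'k::field"
proof -
  have "cf (\<Sum>i\<le>length w. bas (take i w, drop i w)) (u, v) = (cf (bas w) (u @ v) :: 'k)" for w :: "'x list"
  proof -
    have *: "(take i w, drop i w) = (u, v) \<longleftrightarrow> i = length u \<and> w = u @ v" if "i \<le> length w" for i
      using that by auto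
    have "cf (\<Sum>i\<le>length w. bas (take i w, drop i w)) (u, v) =
        (\<Sum>i\<le>length w. if i = length u then if w = u @ v then (1 :: 'k) else 0 else 0)"
      unfolding lookup_sum cf_bas by (intro sum.cong) (use * in auto)
    also have "\<dots> = (if w = u @ v then 1 else 0)" by auto
    finally show ?thesis by (simp only: cf_bas)
  qed
  then have "cf (deconc p) (u, v) = (\<Sum>w\<in>supp p. cf p w * cf (bas w) (u @ v))"
    by (simp add: deconc_def cf_linext)
  also have "\<dots> = cf p (u @ v)" by (subst (3) linext_bas_id[symmetric]) (simp add: cf_linext)
  finally show ?thesis .
qed

text \<open>The co-Leibniz rule in terms of coefficients: the coefficient of \<open>u @ v\<close> comes either from the part of
  the word before \<open>v\<close> or from the part after \<open>u\<close>.\<close>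

lemma coderivation_identity_iff:
  assumes d: "lin d"
  shows "deconc (d p) = linext (\<lambda>(u, v). tensor2 (d (bas u)) (bas v)) (deconc p) +
        linext (\<lambda>(u, v). scale (ksgn (sdeg deg u)) (tensor2 (bas u) (d (bas v)))) (deconc p)
    \<longleftrightarrow> (\<forall>u v. cf (d p) (u @ v) = cf (d (rslice v p)) u + ksgn (sdeg deg u) * cf (d (lslice u p)) v)"
    (is "_ = ?A + ?B \<longleftrightarrow> _")
proof -
  have A: "slice1 v (linext (\<lambda>(u, v). tensor2 (d (bas u)) (bas v)) q) = d (slice1 v q)" for v q
    by (rule lin_ext[of "\<lambda>q. slice1 v (linext (\<lambda>(u, v). tensor2 (d (bas u)) (bas v)) q)" "\<lambda>q. d (slice1 v q)"])
      (auto intro!: lin_intros lin_compose[OF d] simp: slice1_tensor2 cf_bas lin_scale[OF d] lin_zero[OF d]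
        simp flip: tensor2_bas)
  have B: "slice2 u (linext (\<lambda>(u, v). scale (ksgn (sdeg deg u)) (tensor2 (bas u) (d (bas v)))) q) =
      scale (ksgn (sdeg deg u)) (d (slice2 u q))" for u q
    by (rule lin_ext[of "\<lambda>q. slice2 u (linext (\<lambda>(u, v). scale (ksgn (sdeg deg u)) (tensor2 (bas u) (d (bas v)))) q)"
          "\<lambda>q. scale (ksgn (sdeg deg u)) (d (slice2 u q))"])
      (auto intro!: lin_intros lin_compose[OF d] poly_mapping_eqI
        simp: slice2_tensor2 cf_bas lin_scale[OF d] lin_zero[OF d] simp flip: tensor2_bas)
  have s: "slice1 v (deconc p) = rslice v p" "slice2 u (deconc p) = lslice u p" for u v
    by (rule poly_mapping_eqI; simp add: cf_deconc)+
  have A': "cf ?A (u, v) = cf (d (rslice v p)) u" for u v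
    using arg_cong[OF A[of v "deconc p"], of "\<lambda>q. cf q u"] by (simp add: s)
  have B': "cf ?B (u, v) = ksgn (sdeg deg u) * cf (d (lslice u p)) v" for u v
    using arg_cong[OF B[of u "deconc p"], of "\<lambda>q. cf q v"] by (simp add: s)
  have "deconc (d p) = ?A + ?B \<longleftrightarrow> (\<forall>uv. cf (deconc (d p)) uv = cf (?A + ?B) uv)"
    by (auto intro: poly_mapping_eqI)
  also have "\<dots> \<longleftrightarrow> (\<forall>u v. cf (d p) (u @ v) = cf (d (rslice v p)) u + ksgn (sdeg deg u) * cf (d (lslice u p)) v)"
    by (simp add: split_paired_All lookup_add A' B' cf_deconc)
  finally show ?thesis .
qed

lemma coderivation_cf:
  assumes "coderivation deg d"
  shows "cf (d p) (u @ v) = cf (d (rslice v p)) u + ksgn (sdeg deg u) * cf (d (lslice u p)) v"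
  using assms coderivation_identity_iff[of d p deg] by (auto simp: coderivation_def)

lemma coderivation_lin: "coderivation deg d \<Longrightarrow> lin d"
  by (simp add: coderivation_def)

lemma coderivation_counit: "coderivation deg d \<Longrightarrow> cf (d p) [] = 0"
  using coderivation_cf[of deg d p "[]" "[]"]
  by (metis add_cancel_right_right append_Nil ksgn_0(1) lslice_Nil mult_1 rslice_Nil sdeg_Nil)

lemma homog_lin:
  assumes f: "lin f" and *: "\<And>i j. j \<in> supp (f (bas i)) \<Longrightarrow> h j = g i + m" and p: "homog g n p"
  shows "homog h (n + m) (f p)"
  unfolding homog_def
proof
  fix j assume "j \<in> supp (f p)"
  then have "(\<Sum>i\<in>supp p. cf p i * cf (f (bas i)) j) \<noteq> 0"
    using cf_lin[OF f, of p j] by (simp add: in_keys_iff)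
  then obtain i where "i \<in> supp p" "j \<in> supp (f (bas i))"
    by (metis (no_types, lifting) in_keys_iff mult_zero_right sum.neutral)
  then show "h j = n + m" using * p by (auto simp: homog_def)
qed

lemma (in merging) coderivation_cod: "coderivation deg (cod deg f)"
  unfolding coderivation_def
proof (intro conjI allI impI)
  fix n and p :: "'x list \<Rightarrow>\<^sub>0 'k" assume p: "homog (sdeg deg) n p"
  have "homog (sdeg deg) (n + (- 1)) (cod deg f p)"
    by (rule homog_lin[OF lin_cod[OF lin_ident] _ p]) (use cod_word_supp in \<open>force simp: cod_def\<close>)
  then show "homog (sdeg deg) (n - 1) (cod deg f p)" by simp
next
  fix p :: "'x list \<Rightarrow>\<^sub>0 'k"
  show "deconc (cod deg f p) = linext (\<lambda>(u, v). tensor2 (cod deg f (bas u)) (bas v)) (deconc p) +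
        linext (\<lambda>(u, v). scale (ksgn (sdeg deg u)) (tensor2 (bas u) (cod deg f (bas v)))) (deconc p)"
    unfolding coderivation_identity_iff[OF lin_cod[OF lin_ident]] using cod_coderivation_cf by blast
qed (intro lin_intros)

text \<open>Cut off the first letter of \<open>w\<close> repeatedly: contractions of elements of
  \<open>C\<close> are again in \<open>C\<close>. For the empty word the rule reads \<open>\<delta> c [] =
  \<delta> c [] + \<delta> c []\<close>.\<close>

lemma (in quadratic) coleibniz_vanishing:
  assumes rule: "\<And>c u v. c \<in> C \<Longrightarrow> \<delta> c (u @ v) = \<delta> (rslice v c) u + s u * \<delta> (lslice u c) v"
    and s: "s [] = 1"
    and letter: "\<And>c x. c \<in> C \<Longrightarrow> \<delta> c [x] = (0 :: 'k)"
    and c: "c \<in> C"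
  shows "\<delta> c w = 0"
  using c
proof (induction w arbitrary: c)
  case Nil
  have "\<delta> c [] = \<delta> c [] + \<delta> c []"
    using rule[OF Nil, of "[]" "[]"] s by (simp only: append_Nil rslice_Nil lslice_Nil) simp
  then show ?case by (metis add_cancel_right_right)
next
  case (Cons x w)
  then show ?case
    using rule[OF Cons.prems, of "[x]" w] letter[OF C_rslice[OF Cons.prems]] C_lslice[OF Cons.prems]
    by simp
qed

lemma (in quadratic) coderivation_unique:
  assumes d: "coderivation deg d" and d': "coderivation deg d'"
    and eq: "\<And>c. c \<in> C \<Longrightarrow> wtpart 1 (d c) = wtpart 1 (d' c)" and c: "c \<in> C"
  shows "d c = d' c"
proof (rule poly_mapping_eqI)
  fix w
  have "(\<lambda>c. cf (d c - d' c)) c w = 0"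
  proof (rule coleibniz_vanishing[OF _ _ _ c, of _ "\<lambda>u. ksgn (sdeg deg u)"])
    fix c u v
    show "cf (d c - d' c) (u @ v) = cf (d (rslice v c) - d' (rslice v c)) u +
        ksgn (sdeg deg u) * cf (d (lslice u c) - d' (lslice u c)) v"
      using coderivation_cf[OF d, of c u v] coderivation_cf[OF d', of c u v]
      by (simp add: lookup_minus algebra_simps)
  next
    fix c x assume "c \<in> C"
    from arg_cong[OF eq[OF this], of "\<lambda>p. cf p [x]"]
    show "cf (d c - d' c) [x] = 0" by (simp add: lookup_minus)
  qed simp
  then show "cf (d c) w = cf (d' c) w" by (simp add: lookup_minus)
qed

section \<open>Two-sided ideals\<close>

lemma subspace_ideal [simp]: "pm.subspace (two_sided_ideal S)"
  unfolding two_sided_ideal_def by (rule pm.subspace_span)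

lemma ideal_base: "r \<in> S \<Longrightarrow> a * r * b \<in> two_sided_ideal S"
  unfolding two_sided_ideal_def by (rule pm.span_base) blast

lemma ideal_base': "r \<in> S \<Longrightarrow> r \<in> two_sided_ideal S"
  using ideal_base[of r S 1 1] by simp

lemma ideal_into:
  assumes "x \<in> two_sided_ideal S" "lin f" "pm.subspace T" "\<And>u r v. r \<in> S \<Longrightarrow> f (bas u * r * bas v) \<in> T"
  shows "f x \<in> T"
proof -
  have 1: "f (bas u * r * b) \<in> T" if r: "r \<in> S" for u r b
  proof (rule lin_in_subspace[of "\<lambda>b. f (bas u * r * b)"])
    show "lin (\<lambda>b. f (bas u * r * b))" by (intro lin_compose[OF assms(2)] lin_mult_left lin_ident)
  qed (use assms r in auto)
  have "f (a * r * b) \<in> T" if r: "r \<in> S" for a r b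
  proof (rule lin_in_subspace[of "\<lambda>a. f (a * r * b)"])
    show "lin (\<lambda>a. f (a * r * b))" by (intro lin_compose[OF assms(2)] lin_mult_right lin_ident)
  qed (use assms 1 r in auto)
  then show ?thesis
    using lin_span_into[OF assms(1)[unfolded two_sided_ideal_def] assms(2,3)] by blast
qed

lemma ideal_mult:
  assumes "x \<in> two_sided_ideal S" shows "a * x * b \<in> two_sided_ideal S"
proof (rule ideal_into[OF assms, of "\<lambda>x. a * x * b"])
  show "lin (\<lambda>x. a * x * b)" by (intro lin_intros)
  fix u r v assume "r \<in> S"
  from ideal_base[OF this, of "a * bas u" "bas v * b"]
  show "a * (bas u * r * bas v) * b \<in> two_sided_ideal S" by (simp add: mult.assoc)
qed simp

lemma ideal_mult_left: "x \<in> two_sided_ideal S \<Longrightarrow> a * x \<in> two_sided_ideal S"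
  and ideal_mult_right: "x \<in> two_sided_ideal S \<Longrightarrow> x * b \<in> two_sided_ideal S"
  using ideal_mult[of x S a 1] ideal_mult[of x S 1 b] by simp_all

lemma part_word_mult: "part P (bas u * r * bas v) = bas u * part (\<lambda>m. P (u @ m @ v)) r * bas v"
  by (rule lin_ext[of "\<lambda>r. part P (bas u * r * bas v)" "\<lambda>r. bas u * part (\<lambda>m. P (u @ m @ v)) r * bas v"])
    (auto intro!: lin_intros)

lemma graded_ideal:
  fixes g :: "'x list \<Rightarrow> 't :: semigroup_add"
  assumes S: "graded_by g S" and g: "\<And>u v. g (u @ v) = g u + g v"
  shows "graded_by g (two_sided_ideal S)"
proof (rule graded_byI)
  fix p t assume "p \<in> two_sided_ideal S"
  then show "part (\<lambda>i. g i = t) p \<in> two_sided_ideal S"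
  proof (rule ideal_into)
    fix u r v assume "r \<in> S"
    then show "part (\<lambda>i. g i = t) (bas u * r * bas v) \<in> two_sided_ideal S"
      using graded_byD[OF S, of r "\<lambda>m. g u + (m + g v) = t"]
      by (auto simp: part_word_mult g intro: ideal_base)
  qed (intro lin_intros, simp)
qed simp

section \<open>The curved structure\<close>

locale qlc =
  fixes deg :: "'x \<Rightarrow> nat" and R :: "('x list \<Rightarrow>\<^sub>0 'k::field) set"
  assumes datum: "qlc_datum deg R"
begin

lemma graded_R: "graded_by (wdeg deg) R"
  using datum by (simp add: qlc_datum_def graded_subspace_iff)

lemma weight_R: "r \<in> R \<Longrightarrow> w \<in> supp r \<Longrightarrow> length w \<le> 2"
  using datum unfolding qlc_datum_def wt_le_def by blast

lemma no_short_relation: "r \<in> R \<Longrightarrow> (\<And>w. w \<in> supp r \<Longrightarrow> length w \<le> 1) \<Longrightarrow> r = 0"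
  using datum unfolding qlc_datum_def wt_le_def by blast

lemma short_in_ideal: "r \<in> two_sided_ideal R \<Longrightarrow> (\<And>w. w \<in> supp r \<Longrightarrow> length w \<le> 2) \<Longrightarrow> r \<in> R"
  using datum unfolding qlc_datum_def wt_le_def by blast

lemma subspace_R: "pm.subspace R"
  using graded_R by (rule graded_by_subspace)

end

sublocale qlc \<subseteq> quadratic deg "qrel R"
proof
  show "graded_by (wdeg deg) (qrel R)"
  proof (rule graded_byI)
    show "pm.subspace (qrel R)"
      unfolding qrel_def by (rule lin_image_subspace[OF _ subspace_R]) (intro lin_intros)
    fix p t assume "p \<in> qrel R"
    then obtain r where r: "r \<in> R" "p = wtpart 2 r" by (auto simp: qrel_def)
    have "part (\<lambda>w. wdeg deg w = t) p = wtpart 2 (part (\<lambda>w. wdeg deg w = t) r)"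
      by (rule poly_mapping_eqI) (simp add: r)
    then show "part (\<lambda>w. wdeg deg w = t) p \<in> qrel R"
      using graded_byD[OF graded_R r(1), of "\<lambda>n. n = t"] by (auto simp: qrel_def)
  qed
  show "wtpart 2 x = x" if "x \<in> qrel R" for x
    using that by (auto simp: qrel_def intro: poly_mapping_eqI)
qed

context qlc
begin

abbreviation IR :: "('x list \<Rightarrow>\<^sub>0 'k) set" where "IR \<equiv> two_sided_ideal R"

lemma relation_unique:
  assumes "r \<in> R" "r' \<in> R" "wtpart 2 r = wtpart 2 r'" shows "r = r'"
proof -
  have "r - r' \<in> R" using assms pm.subspace_diff[OF subspace_R] by blast
  moreover have "length w \<le> 1" if w: "w \<in> supp (r - r')" for w
  proof (rule ccontr)
    assume "\<not> length w \<le> 1"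
    then have "length w = 2" using weight_R[OF \<open>r - r' \<in> R\<close> w] by simp
    then show False using w arg_cong[OF assms(3), of "\<lambda>p. cf p w"] by (simp add: in_keys_iff lookup_minus)
  qed
  ultimately show ?thesis using no_short_relation[of "r - r'"] by simp
qed

lemma rel_of_eq: "r \<in> R \<Longrightarrow> wtpart 2 r = x \<Longrightarrow> rel_of R x = r"
  unfolding rel_of_def using relation_unique by (intro the_equality) auto

text \<open>The lower-order terms of the relation with leading term \<open>x\<close>, as a linear map of
  \<open>s\<^sup>2x\<close> that is defined on all of the tensor coalgebra: on \<open>s\<^sup>2qR\<close> it is \<open>\<phi> - \<theta>\<close>.\<close>

definition is_low :: "(('x list \<Rightarrow>\<^sub>0 'k) \<Rightarrow> ('x list \<Rightarrow>\<^sub>0 'k)) \<Rightarrow> bool" where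
  "is_low l \<longleftrightarrow> lin l \<and> (\<forall>w. \<forall>v\<in>supp (l (bas w)). length v \<le> 1 \<and> wdeg deg v = wdeg deg w) \<and>
     (\<forall>s\<in>S. susp2 deg s - l s \<in> R)"

definition low :: "('x list \<Rightarrow>\<^sub>0 'k) \<Rightarrow> ('x list \<Rightarrow>\<^sub>0 'k)" where
  "low = (SOME l. is_low l)"

text \<open>Invert the bijection from relations to leading terms, keep the terms of weight at most one, and make
  the result homogeneous.\<close>

lemma is_low_low: "is_low low"
proof -
  obtain g where g: "lin g" "\<And>x. g x \<in> R" "\<And>r. r \<in> R \<Longrightarrow> wtpart 2 (g (wtpart 2 r)) = wtpart 2 r"
    using pmp.linear_exists_right_inverse_on[OF lin_wtpart[OF lin_ident] subspace_R, of 2] by auto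
  have g': "g (wtpart 2 r) = r" if "r \<in> R" for r
    using relation_unique g that by blast
  define l0 where "l0 s = - part (\<lambda>w. length w \<le> 1) (g (susp2 deg s))" for s
  have l0: "lin l0" unfolding l0_def by (intro lin_intros lin_compose[OF g(1)])
  let ?l = "homogenized (wdeg deg) (wdeg deg) l0"
  have "susp2 deg s - ?l s \<in> R" if "s \<in> S" for s
  proof -
    have "susp2 deg s \<in> qrel R" using that susp2_S_iff by blast
    then obtain r where r: "r \<in> R" "susp2 deg s = wtpart 2 r"
      unfolding qrel_def by blast
    have "?l s = - part (\<lambda>w. length w \<le> 1) r"
    proof (rule poly_mapping_eqI)
      fix v
      let ?t = "\<lambda>w. wdeg deg w = wdeg deg v"
      have "susp2 deg (part ?t s) = part ?t (susp2 deg s)"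
        by (rule poly_mapping_eqI) (simp add: cf_susp2)
      also have "\<dots> = wtpart 2 (part ?t r)" unfolding r by (rule poly_mapping_eqI) simp
      finally have "g (susp2 deg (part ?t s)) = part ?t r"
        using g'[OF graded_byD[OF graded_R r(1), of "\<lambda>t. t = wdeg deg v"]] by simp
      then show "cf (?l s) v = cf (- part (\<lambda>w. length w \<le> 1) r) v"
        by (simp add: cf_homogenized[OF l0] l0_def)
    qed
    moreover have "r = wtpart 2 r + part (\<lambda>w. length w \<le> 1) r"
    proof (rule poly_mapping_eqI)
      fix w
      show "cf r w = cf (wtpart 2 r + part (\<lambda>w. length w \<le> 1) r) w"
        using weight_R[OF r(1), of w] by (cases "cf r w = 0") (auto simp: lookup_add in_keys_iff)
    qed
    ultimately show ?thesis using r by simp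
  qed
  moreover have "lin ?l" unfolding homogenized_def by (intro lin_intros)
  moreover have "length v \<le> 1 \<and> wdeg deg v = wdeg deg w" if "v \<in> supp (?l (bas w))" for v w
    using that by (auto simp: homogenized_def supp_part l0_def in_keys_iff split: if_splits)
  ultimately have "is_low ?l" unfolding is_low_def by blast
  then show ?thesis unfolding low_def by (rule someI[where P = is_low])
qed

lemma lin_low0: "lin low"
  and low_weight: "v \<in> supp (low (bas w)) \<Longrightarrow> length v \<le> 1"
  and low_degree: "v \<in> supp (low (bas w)) \<Longrightarrow> wdeg deg v = wdeg deg w"
  and low_relation: "s \<in> S \<Longrightarrow> susp2 deg s - low s \<in> R"
  using is_low_low by (auto simp: is_low_def)

lemma lin_low [lin_intros]: "lin g \<Longrightarrow> lin (\<lambda>x. low (g x))"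
  by (rule lin_compose[OF lin_low0])

lemma low_weight': "v \<in> supp (low p) \<Longrightarrow> length v \<le> 1"
proof (rule ccontr)
  assume v: "v \<in> supp (low p)" "\<not> length v \<le> 1"
  then have "cf (low (bas i)) v = 0" for i using low_weight[of v i] by (auto simp: in_keys_iff)
  then show False using v cf_lin[OF lin_low0, of p v] by (simp add: in_keys_iff)
qed

lemma rel_of_low: "s \<in> S \<Longrightarrow> rel_of R (susp2 deg s) = susp2 deg s - low s"
proof (rule rel_of_eq[OF low_relation])
  have "wtpart 2 (low s) = 0"
  proof (rule poly_mapping_eqI)
    fix v show "cf (wtpart 2 (low s)) v = cf 0 v"
      using low_weight'[of v s] by (cases "cf (low s) v = 0") (auto simp: in_keys_iff)
  qed
  then show "wtpart 2 (susp2 deg s - low s) = susp2 deg s"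
    by (simp add: lin_minus[OF lin_wtpart[OF lin_ident]])
qed

lemma phi_low: "s \<in> S \<Longrightarrow> phi R (susp2 deg s) = wtpart 1 (low s)"
proof -
  assume s: "s \<in> S"
  show "phi R (susp2 deg s) = wtpart 1 (low s)"
    by (rule poly_mapping_eqI) (simp add: phi_def rel_of_low[OF s] lookup_minus cf_susp2)
qed

definition fmerge :: "'x list \<Rightarrow> ('x list \<Rightarrow>\<^sub>0 'k)" where
  "fmerge w = wtpart 1 (low (bas w))"

sublocale merging deg fmerge
  by standard (use low_degree in \<open>auto simp: fmerge_def in_keys_iff split: if_splits\<close>)

abbreviation d :: "('x list \<Rightarrow>\<^sub>0 'k) \<Rightarrow> ('x list \<Rightarrow>\<^sub>0 'k)" where
  "d \<equiv> cod deg fmerge"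

lemma d_weight: "v \<in> supp (d (bas w)) \<Longrightarrow> length w = Suc (length v)"
  using cod_word_supp[of v w] by (simp add: cod_def)

lemma wtpart_d: "wtpart n (d c) = d (wtpart (Suc n) c)"
proof (rule lin_ext[of "\<lambda>c. wtpart n (d c)" "\<lambda>c. d (wtpart (Suc n) c)"])
  fix w show "wtpart n (d (bas w)) = d (wtpart (Suc n) (bas w))"
  proof (cases "length w = Suc n")
    case True
    then show ?thesis using d_weight[of _ w] unfolding wtpart_def by (auto intro!: part_id)
  next
    case False
    then show ?thesis using d_weight[of _ w] unfolding wtpart_def
      by (auto simp: lin_zero[OF lin_cod[OF lin_ident]] intro!: part_none)
  qed
qed (intro lin_intros)+

lemma wtpart1_d: "wtpart 1 (d c) = wtpart 1 (low (wtpart 2 c))"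
proof -
  have "d (wtpart 2 c) = wtpart 1 (low (wtpart 2 c))"
  proof (rule lin_ext[of "\<lambda>c. d (wtpart 2 c)" "\<lambda>c. wtpart 1 (low (wtpart 2 c))"])
    fix w show "d (wtpart 2 (bas w)) = wtpart 1 (low (wtpart 2 (bas w)))"
      by (auto simp: cod_def linext_def[of _ 0] fmerge_def lin_zero[OF lin_low0] numeral_2_eq_2 length_Suc_conv)
  qed (intro lin_intros)+
  then show ?thesis using wtpart_d[of 1 c] by (simp add: numeral_2_eq_2)
qed

lemma phi_tilde_spec:
  "coderivation deg (phi_tilde deg R) \<and>
     (\<forall>c\<in>C. \<forall>x\<in>qrel R. wtpart 2 c = susp2 deg x \<longrightarrow> wtpart 1 (phi_tilde deg R c) = phi R x)"
  unfolding phi_tilde_def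
proof (rule someI[of _ d], intro conjI ballI impI)
  fix c x assume "x \<in> qrel R" "wtpart 2 c = susp2 deg x"
  then show "wtpart 1 (d c) = phi R x"
    using phi_low[of "susp2 deg x"] weight_Q wtpart1_d[of c] by simp
qed (rule coderivation_cod)

lemma coderivation_phi_tilde: "coderivation deg (phi_tilde deg R)"
  using phi_tilde_spec by blast

text \<open>The coderivation selected in the definition of \<open>phi_tilde\<close> is determined on the
  coalgebra only; there it can be replaced by the explicit \<open>d\<close>.\<close>

lemma phi_tilde_eq_d: "c \<in> C \<Longrightarrow> phi_tilde deg R c = d c"
proof (rule coderivation_unique[OF coderivation_phi_tilde coderivation_cod])
  fix c assume c: "c \<in> C"
  then obtain x where x: "x \<in> qrel R" "wtpart 2 c = susp2 deg x" using C_weight2 by blast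
  show "wtpart 1 (phi_tilde deg R c) = wtpart 1 (d c)"
    using phi_tilde_spec c x phi_low[of "susp2 deg x"] weight_Q[OF x(1)] wtpart1_d[of c] by simp
qed

end

text \<open>The two halves of the co-Leibniz rule as maps on \<open>T\<^sup>c \<otimes> T\<^sup>c\<close>, followed by taking one coefficient.\<close>

definition left_coeff :: "(('x list \<Rightarrow>\<^sub>0 'k::field) \<Rightarrow> ('x list \<Rightarrow>\<^sub>0 'k)) \<Rightarrow> 'x list \<Rightarrow>
    ('x list \<times> 'x list \<Rightarrow>\<^sub>0 'k) \<Rightarrow> ('x list \<Rightarrow>\<^sub>0 'k)" where
  "left_coeff d u = linext (\<lambda>(a, b). scale (cf (d (bas a)) u) (bas b))"

definition right_coeff :: "('x \<Rightarrow> nat) \<Rightarrow> (('x list \<Rightarrow>\<^sub>0 'k::field) \<Rightarrow> ('x list \<Rightarrow>\<^sub>0 'k)) \<Rightarrow> 'x list \<Rightarrow>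
    ('x list \<times> 'x list \<Rightarrow>\<^sub>0 'k) \<Rightarrow> ('x list \<Rightarrow>\<^sub>0 'k)" where
  "right_coeff deg d v = linext (\<lambda>(a, b). scale (cf (d (bas b)) v) (sg deg (bas a)))"

lemma lin_left_coeff [lin_intros]: "lin g \<Longrightarrow> lin (\<lambda>q. left_coeff d u (g q))"
  and lin_right_coeff [lin_intros]: "lin g \<Longrightarrow> lin (\<lambda>q. right_coeff deg d v (g q))"
  unfolding left_coeff_def right_coeff_def by (intro lin_linext; assumption)+

lemma left_coeff_tensor2:
  assumes "lin d" shows "left_coeff d u (tensor2 p q) = scale (cf (d p) u) q"
  by (rule bilinear_ext[of "\<lambda>p q. left_coeff d u (tensor2 p q)" "\<lambda>p q. scale (cf (d p) u) q"])
    (intro lin_intros, intro lin_intros, rule lin_scale_cf[OF assms], intro lin_intros, simp add: left_coeff_def)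

lemma right_coeff_tensor2:
  assumes "lin d" shows "right_coeff deg d v (tensor2 p q) = scale (cf (d q) v) (sg deg p)"
  by (rule bilinear_ext[of "\<lambda>p q. right_coeff deg d v (tensor2 p q)" "\<lambda>p q. scale (cf (d q) v) (sg deg p)"])
    (intro lin_intros, intro lin_intros, intro lin_intros, rule lin_scale_cf[OF assms], simp add: right_coeff_def)

lemma cf_left_coeff:
  fixes d :: "('x list \<Rightarrow>\<^sub>0 'k::field) \<Rightarrow> ('x list \<Rightarrow>\<^sub>0 'k)"
  assumes "lin d" shows "cf (left_coeff d u q) b = cf (d (slice1 b q)) u"
proof (rule functional_eq[of "\<lambda>q. cf (left_coeff d u q) b" "\<lambda>q. cf (d (slice1 b q)) u"])
  fix i :: "'x list \<times> 'x list"
  obtain a b' where i: "i = (a, b')" by fastforce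
  have "slice1 b (bas i :: _ \<Rightarrow>\<^sub>0 'k) = scale (if b' = b then 1 else 0) (bas a)"
    by (simp add: i slice1_tensor2 cf_bas flip: tensor2_bas)
  then show "cf (left_coeff d u (bas i)) b = cf (d (slice1 b (bas i))) u"
    by (auto simp: i left_coeff_def cf_bas lin_zero[OF assms])
qed (intro lin_intros lin_compose[OF assms])+

lemma cf_right_coeff:
  fixes d :: "('x list \<Rightarrow>\<^sub>0 'k::field) \<Rightarrow> ('x list \<Rightarrow>\<^sub>0 'k)"
  assumes "lin d" shows "cf (right_coeff deg d v q) a = ksgn (sdeg deg a) * cf (d (slice2 a q)) v"
proof (rule functional_eq[of "\<lambda>q. cf (right_coeff deg d v q) a" "\<lambda>q. ksgn (sdeg deg a) * cf (d (slice2 a q)) v"])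
  fix i :: "'x list \<times> 'x list"
  obtain a' b where i: "i = (a', b)" by fastforce
  have "slice2 a (bas i :: _ \<Rightarrow>\<^sub>0 'k) = scale (if a' = a then 1 else 0) (bas b)"
    by (simp add: i slice2_tensor2 cf_bas flip: tensor2_bas)
  then show "cf (right_coeff deg d v (bas i)) a = ksgn (sdeg deg a) * cf (d (slice2 a (bas i))) v"
    by (auto simp: i right_coeff_def cf_bas lin_zero[OF assms])
next
  show "lin (\<lambda>q. scale (cf (right_coeff deg d v q) a) (bas ()))" by (intro lin_intros)
  have "lin (\<lambda>q. scale (ksgn (sdeg deg a)) (scale (cf (d (slice2 a q)) v) (bas ())))"
    by (intro lin_intros lin_compose[OF assms])
  then show "lin (\<lambda>q. scale (ksgn (sdeg deg a) * cf (d (slice2 a q)) v) (bas ()))" by simp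
qed

lemma slices_deconc: "slice1 v (deconc p) = rslice v p" "slice2 u (deconc p) = lslice u p"
  by (rule poly_mapping_eqI; simp add: cf_deconc)+

lemma (in quadratic) deconc_C: "c \<in> C \<Longrightarrow> deconc c \<in> tens2 C C"
  by (simp add: tens2_iff[OF subspace_C subspace_C] slices_deconc C_lslice C_rslice)

context
  fixes deg and d :: "('x list \<Rightarrow>\<^sub>0 'k::field) \<Rightarrow> ('x list \<Rightarrow>\<^sub>0 'k)"
  assumes d: "coderivation deg d"
begin

lemma rslice_coderivation: "rslice v (d c) = d (rslice v c) + right_coeff deg d v (deconc c)"
  by (rule poly_mapping_eqI)
    (simp add: lookup_add cf_right_coeff[OF coderivation_lin[OF d]] coderivation_cf[OF d] slices_deconc)

lemma lslice_coderivation: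
  "lslice u (d c) = scale (ksgn (sdeg deg u)) (d (lslice u c)) + left_coeff d u (deconc c)"
  by (rule poly_mapping_eqI)
    (simp add: lookup_add cf_left_coeff[OF coderivation_lin[OF d]] coderivation_cf[OF d] slices_deconc)

lemma coderivation_degree: "v \<in> supp (d (bas w)) \<Longrightarrow> sdeg deg v = sdeg deg w - 1"
proof -
  have "homog (sdeg deg) (sdeg deg w) (bas w :: 'x list \<Rightarrow>\<^sub>0 'k)" by (simp add: homog_def)
  then have "homog (sdeg deg) (sdeg deg w - 1) (d (bas w))" using d unfolding coderivation_def by blast
  then show "v \<in> supp (d (bas w)) \<Longrightarrow> sdeg deg v = sdeg deg w - 1" by (simp add: homog_def)
qed

text \<open>In the square of an odd coderivation the two terms that apply \<open>d\<close> once to each factor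
  cancel, because \<open>d\<close> changes the parity of the left factor.\<close>

lemma cross_terms_cancel:
  "cf (d (right_coeff deg d v q)) u + ksgn (sdeg deg u) * cf (d (left_coeff d u q)) v = 0"
proof (rule functional_eq[of "\<lambda>q. cf (d (right_coeff deg d v q)) u + ksgn (sdeg deg u) * cf (d (left_coeff d u q)) v"
      "\<lambda>q. 0"])
  note lind = coderivation_lin[OF d]
  fix i :: "'x list \<times> 'x list"
  obtain a b where i: "i = (a, b)" by fastforce
  show "cf (d (right_coeff deg d v (bas i))) u + ksgn (sdeg deg u) * cf (d (left_coeff d u (bas i))) v = 0"
  proof (cases "u \<in> supp (d (bas a))")
    case True
    then have "ksgn (sdeg deg u) = - (ksgn (sdeg deg a) :: 'k)" using coderivation_degree by fastforce
    then show ?thesis by (simp add: i left_coeff_def right_coeff_def lin_scale[OF lind])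
  next
    case False
    then show ?thesis by (simp add: i left_coeff_def right_coeff_def lin_scale[OF lind] in_keys_iff lin_zero[OF lind])
  qed
next
  have "lin (\<lambda>q. scale (cf (d (right_coeff deg d v q)) u) (bas ()) +
      scale (ksgn (sdeg deg u)) (scale (cf (d (left_coeff d u q)) v) (bas ())))"
    by (intro lin_intros lin_compose[OF coderivation_lin[OF d]])
  then show "lin (\<lambda>q. scale (cf (d (right_coeff deg d v q)) u +
      ksgn (sdeg deg u) * cf (d (left_coeff d u q)) v) (bas ()))"
    by (simp add: pm.scale_left_distrib)
qed (simp add: lin_const)

text \<open>The square of a coderivation of odd degree is a coderivation of even degree.\<close>

lemma coderivation_square_cf:
  "cf (d (d c)) (u @ v) = cf (d (d (rslice v c))) u + cf (d (d (lslice u c))) v"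
proof -
  note lind = coderivation_lin[OF d]
  have "cf (d (d c)) (u @ v) = cf (d (rslice v (d c))) u + ksgn (sdeg deg u) * cf (d (lslice u (d c))) v"
    by (rule coderivation_cf[OF d])
  also have "\<dots> = cf (d (d (rslice v c))) u + cf (d (d (lslice u c))) v +
    (cf (d (right_coeff deg d v (deconc c))) u + ksgn (sdeg deg u) * cf (d (left_coeff d u (deconc c))) v)"
    by (simp add: rslice_coderivation lslice_coderivation lin_add[OF lind] lin_scale[OF lind] lookup_add
        algebra_simps)
  finally show ?thesis by (simp add: cross_terms_cancel)
qed

end

text \<open>A contraction of \<open>d c\<close> is \<open>d\<close> of the contraction of \<open>c\<close>, up
  to terms where \<open>d\<close> acts outside the remaining window. The latter are in \<open>C\<close> anyway,
  so only the weight two part of \<open>d\<close> matters.\<close>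

lemma (in quadratic) coderivation_preserves_C:
  assumes d: "coderivation deg d" and weight2: "\<And>c. c \<in> C \<Longrightarrow> wtpart 2 (d c) \<in> S" and c: "c \<in> C"
  shows "d c \<in> C"
  unfolding koszul_coalg_iff
proof (intro allI)
  fix u v
  note lind = coderivation_lin[OF d]
  have R: "right_coeff deg d v (deconc c) \<in> C" if "c \<in> C" for v c
    by (rule tens2_into[OF deconc_C[OF that] lin_right_coeff[OF lin_ident] subspace_C])
      (simp add: right_coeff_tensor2[OF lind] pm.subspace_scale[OF subspace_C] graded_by_sg[OF graded_C_sdeg])
  have L: "left_coeff d u (deconc c) \<in> C" if "c \<in> C" for u c
    by (rule tens2_into[OF deconc_C[OF that] lin_left_coeff[OF lin_ident] subspace_C])
      (simp add: left_coeff_tensor2[OF lind] pm.subspace_scale[OF subspace_C])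
  let ?c = "lslice u (rslice v c)"
  let ?e = "left_coeff d u (deconc (rslice v c)) + lslice u (right_coeff deg d v (deconc c))"
  have "lslice u (rslice v (d c)) = scale (ksgn (sdeg deg u)) (d ?c) + ?e"
    by (simp add: rslice_coderivation[OF d] lslice_coderivation[OF d] lin_add[OF lin_slices(1)[OF lin_ident]])
  moreover have "?e \<in> C"
    by (intro pm.subspace_add[OF subspace_C] L C_rslice[OF c] C_lslice[OF R[OF c]])
  moreover have "?c \<in> C" by (intro C_lslice C_rslice c)
  ultimately show "wtpart 2 (lslice u (rslice v (d c))) \<in> S"
    using weight2[of ?c] C_weight2[of ?e]
    by (simp add: lin_add[OF lin_wtpart[OF lin_ident]] lin_scale[OF lin_wtpart[OF lin_ident]]
        pm.subspace_add[OF subspace_S] pm.subspace_scale[OF subspace_S])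
qed

context qlc
begin

text \<open>Resolving a word of length three of the Koszul dual coalgebra in the two possible ways gives two
  elements of the ideal with the same leading term, so their difference is a relation.\<close>

definition relw :: "'x list \<Rightarrow> ('x list \<Rightarrow>\<^sub>0 'k)" where
  "relw w = susp2 deg (bas w) - low (bas w)"

definition resolve_right :: "('x list \<Rightarrow>\<^sub>0 'k) \<Rightarrow> ('x list \<Rightarrow>\<^sub>0 'k)" where
  "resolve_right = linext (\<lambda>w. bas (take 1 w) * relw (drop 1 w))"

definition resolve_left :: "('x list \<Rightarrow>\<^sub>0 'k) \<Rightarrow> ('x list \<Rightarrow>\<^sub>0 'k)" where
  "resolve_left = linext (\<lambda>w. scale (ksgn (sdeg deg (take 2 w))) (relw (take 2 w) * bas (drop 2 w)))"

lemma C_weight3_span: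
  assumes c: "c \<in> C" "wtpart 3 c = c"
  shows "c \<in> pm.span {bas u * susp2 deg x * bas v | u x v. length u = 1 \<and> x \<in> qrel R \<and> length v = 0}"
    and "c \<in> pm.span {bas u * susp2 deg x * bas v | u x v. length u = 0 \<and> x \<in> qrel R \<and> length v = 1}"
proof -
  have "\<forall>u v. wtpart 2 (lslice u (rslice v c)) \<in> S" using c(1) unfolding koszul_coalg_iff .
  then have "wtpart 3 c \<in> pm.span {bas u * susp2 deg x * bas v | u x v. length u = 1 \<and> x \<in> qrel R \<and> length v = 0}"
    "wtpart 3 c \<in> pm.span {bas u * susp2 deg x * bas v | u x v. length u = 0 \<and> x \<in> qrel R \<and> length v = 1}"
    by (subst middle_span_iff, simp, blast)+
  then show "c \<in> pm.span {bas u * susp2 deg x * bas v | u x v. length u = 1 \<and> x \<in> qrel R \<and> length v = 0}"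
    "c \<in> pm.span {bas u * susp2 deg x * bas v | u x v. length u = 0 \<and> x \<in> qrel R \<and> length v = 1}"
    using c(2) by simp_all
qed

lemma resolve_right_ideal:
  assumes c: "c \<in> C" "wtpart 3 c = c" shows "resolve_right c \<in> two_sided_ideal R"
proof (rule lin_span_into[OF C_weight3_span(1)[OF c]])
  show "lin resolve_right" unfolding resolve_right_def by (intro lin_intros)
  fix g assume "g \<in> {bas u * susp2 deg x * bas v | u x v. length u = 1 \<and> x \<in> qrel R \<and> length v = 0}"
  then obtain a x where g: "g = bas [a] * susp2 deg x" and x: "x \<in> qrel R"
    by (auto simp: length_Suc_conv)
  have "resolve_right (bas [a] * p) = bas [a] * (susp2 deg p - low p)" for p
    by (rule lin_ext[of "\<lambda>p. resolve_right (bas [a] * p)" "\<lambda>p. bas [a] * (susp2 deg p - low p)"])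
      (unfold resolve_right_def, intro lin_intros, intro lin_intros, simp add: relw_def)
  then have "resolve_right g = bas [a] * (susp2 deg (susp2 deg x) - low (susp2 deg x))" by (simp add: g)
  then show "resolve_right g \<in> two_sided_ideal R"
    using low_relation[of "susp2 deg x"] x by (auto intro: ideal_mult_left ideal_base')
qed simp

lemma resolve_left_ideal:
  assumes c: "c \<in> C" "wtpart 3 c = c" shows "resolve_left c \<in> two_sided_ideal R"
proof (rule lin_span_into[OF C_weight3_span(2)[OF c]])
  show "lin resolve_left" unfolding resolve_left_def by (intro lin_intros)
  fix g assume "g \<in> {bas u * susp2 deg x * bas v | u x v. length u = 0 \<and> x \<in> qrel R \<and> length v = 1}"
  then obtain a x where g: "g = susp2 deg x * bas [a]" and x: "x \<in> qrel R"
    by (auto simp: length_Suc_conv)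
  have 1: "resolve_left (wtpart 2 p * bas [a]) = (susp2 deg (sg deg (wtpart 2 p)) - low (sg deg (wtpart 2 p))) * bas [a]" for p
  proof (rule lin_ext[of "\<lambda>p. resolve_left (wtpart 2 p * bas [a])" "\<lambda>p. (susp2 deg (sg deg (wtpart 2 p)) - low (sg deg (wtpart 2 p))) * bas [a]"])
    fix w
    show "resolve_left (wtpart 2 (bas w) * bas [a]) =
      (susp2 deg (sg deg (wtpart 2 (bas w))) - low (sg deg (wtpart 2 (bas w)))) * bas [a]"
    proof (cases "length w = 2")
      case True
      then show ?thesis
        by (simp add: resolve_left_def relw_def lin_scale[OF lin_low0] lin_scale[OF lin_susp2[OF lin_ident]]
            scale_mult_left algebra_simps pm.scale_right_diff_distrib)
    next
      case False
      then show ?thesis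
        by (simp add: resolve_left_def linext_def[of _ 0] lin_zero[OF lin_low0] lin_zero[OF lin_susp2[OF lin_ident]]
            lin_zero[OF lin_sg[OF lin_ident]])
    qed
  qed (unfold resolve_left_def, (intro lin_intros)+)
  let ?s = "susp2 deg x"
  have "sg deg ?s = scale 1 (part (\<lambda>w. even (wdeg deg w)) ?s) - part (\<lambda>w. odd (wdeg deg w)) ?s"
    by (rule poly_mapping_eqI) (auto simp: lookup_minus ksgn_def cf_susp2 sdeg_wdeg)
  moreover have "?s \<in> S" using x by blast
  ultimately have s: "sg deg ?s \<in> S"
    using graded_byD[OF graded_S, of ?s even] graded_byD[OF graded_S, of ?s odd]
    by (simp add: pm.subspace_diff[OF subspace_S])
  have "resolve_left g = (susp2 deg (sg deg ?s) - low (sg deg ?s)) * bas [a]" using 1[of ?s] by (simp add: g)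
  then show "resolve_left g \<in> two_sided_ideal R"
    using low_relation[OF s] by (auto intro: ideal_mult_right ideal_base')
qed simp

definition overlap :: "('x list \<Rightarrow>\<^sub>0 'k) \<Rightarrow> ('x list \<Rightarrow>\<^sub>0 'k)" where
  "overlap c = resolve_right c - resolve_left c"

lemma lin_overlap [lin_intros]: "lin g \<Longrightarrow> lin (\<lambda>c. overlap (g c))"
  unfolding overlap_def resolve_right_def resolve_left_def by (intro lin_intros; assumption)

lemma overlap_word: "overlap (bas [x, y, z]) =
    scale (ksgn (int (deg x) + int (deg y))) (low (bas [x, y]) * bas [z]) - bas [x] * low (bas [y, z])"
  by (simp add: overlap_def resolve_right_def resolve_left_def relw_def algebra_simps scale_mult_left scale_mult_right
      pm.scale_right_diff_distrib ksgn_def)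

lemma overlap_weight:
  assumes "wtpart 3 c = c" "w \<in> supp (overlap c)" shows "length w \<le> 2"
proof (rule ccontr)
  assume w: "\<not> length w \<le> 2"
  have "cf (overlap (bas i)) w = 0" if "i \<in> supp c" for i
  proof -
    have "length i = 3" using that by (subst (asm) assms(1)[symmetric]) (auto simp: in_keys_iff split: if_splits)
    then obtain x y z where i: "i = [x, y, z]" by (auto simp: numeral_3_eq_3 length_Suc_conv)
    have "cf (low (bas [x, y])) (take (length w - 1) w) = 0" "cf (low (bas [y, z])) (drop 1 w) = 0"
      using low_weight[of "take (length w - 1) w" "[x, y]"] low_weight[of "drop 1 w" "[y, z]"] w
      by (cases "cf (low (bas [x, y])) (take (length w - 1) w) = 0"; simp add: in_keys_iff)
        (cases "cf (low (bas [y, z])) (drop 1 w) = 0"; use low_weight[of "drop 1 w" "[y, z]"] w in \<open>simp add: in_keys_iff\<close>)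
    then show ?thesis by (simp add: i overlap_word lookup_minus cf_mult_bas cf_bas_mult)
  qed
  then show False using assms(2) cf_lin[OF lin_overlap[OF lin_ident], of c w] by (simp add: in_keys_iff)
qed

text \<open>The leading terms of the two resolutions cancel, and an element of the ideal of weight at most two
  is a relation. This is the assumption on \<open>R\<close> that makes the curved structure exist.\<close>

lemma overlap_relation:
  assumes c: "c \<in> C" "wtpart 3 c = c" shows "overlap c \<in> R"
  by (rule short_in_ideal[OF _ overlap_weight[OF c(2)]])
    (auto simp: overlap_def pm.subspace_diff[OF subspace_ideal] resolve_right_ideal[OF c] resolve_left_ideal[OF c])

text \<open>In weight two the resolutions merge the last or the first two letters of \<open>c\<close>. So the
  overlap of \<open>c\<close> is the relation with leading term \<open>d c\<close>, up to suspension.\<close>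

lemma d_overlap: "wtpart 3 c = c \<Longrightarrow> d c = susp2 deg (overlap c)"
proof -
  assume "wtpart 3 c = c"
  have "d (wtpart 3 c) = susp2 deg (overlap (wtpart 3 c))"
  proof (rule lin_ext[of "\<lambda>c. d (wtpart 3 c)" "\<lambda>c. susp2 deg (overlap (wtpart 3 c))"])
    fix w show "d (wtpart 3 (bas w)) = susp2 deg (overlap (wtpart 3 (bas w)))"
    proof (cases "length w = 3")
      case True
      then obtain x y z where w: "w = [x, y, z]" by (auto simp: numeral_3_eq_3 length_Suc_conv)
      have "d (bas [x, y, z]) = fmerge [x, y] * bas [z] - scale (ksgn (int (deg x))) (bas [x] * fmerge [y, z])"
        by (simp add: cod_def)
      also have "\<dots> = susp2 deg (overlap (bas [x, y, z]))"
      proof (rule poly_mapping_eqI)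
        fix v
        show "cf (fmerge [x, y] * bas [z] - scale (ksgn (int (deg x))) (bas [x] * fmerge [y, z])) v =
          cf (susp2 deg (overlap (bas [x, y, z]))) v"
        proof (cases "length v = 2")
          case True
          then obtain a b where v: "v = [a, b]" by (auto simp: numeral_2_eq_2 length_Suc_conv)
          have "cf (low (bas [x, y])) [a] \<noteq> 0 \<Longrightarrow> ksgn (int (deg x) + int (deg y)) = (ksgn (int (deg a)) :: 'k)"
            using low_degree[of "[a]" "[x, y]"] by (simp add: in_keys_iff)
          then have "ksgn (int (deg a)) * (ksgn (int (deg x) + int (deg y)) * cf (low (bas [x, y])) [a]) = cf (low (bas [x, y])) [a]"
            by (cases "cf (low (bas [x, y])) [a] = 0") simp_all
          then show ?thesis
            by (auto simp: v overlap_word cf_susp2 lookup_minus fmerge_def cf_mult_bas cf_bas_mult right_diff_distrib)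
        next
          case False
          have "length v = 2" if "drop (length v - Suc 0) v = [z]" "length v - Suc 0 = 1 \<or> length v \<noteq> 2"
            "length (take (length v - Suc 0) v) = Suc 0"
            using that by (cases v) auto
          then show ?thesis using False
            by (auto simp: cf_susp2 lookup_minus fmerge_def cf_mult_bas cf_bas_mult)
        qed
      qed
      finally show ?thesis by (simp add: w)
    qed (simp add: lin_zero[OF lin_cod[OF lin_ident]] lin_zero[OF lin_susp2[OF lin_overlap[OF lin_ident]]])
  qed (intro lin_intros)+
  then show ?thesis by (simp add: \<open>wtpart 3 c = c\<close>)
qed

lemma d_weight2: "c \<in> C \<Longrightarrow> wtpart 2 (d c) \<in> S"
proof -
  assume c: "c \<in> C"
  have "wtpart 3 (wtpart 3 c) = wtpart 3 c" by (rule poly_mapping_eqI) simp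
  then have "d (wtpart 3 c) = susp2 deg (wtpart 2 (overlap (wtpart 3 c)))" "overlap (wtpart 3 c) \<in> R"
    using d_overlap overlap_relation[OF C_wtpart[OF c]] by simp_all
  then show ?thesis using wtpart_d[of 2 c] unfolding qrel_def
    by (metis imageI eval_nat_numeral(3))
qed

lemma d_C: "c \<in> C \<Longrightarrow> d c \<in> C"
  using coderivation_preserves_C[OF coderivation_cod d_weight2] .

text \<open>The curvature: the constant term of \<open>low\<close> is \<open>- \<theta>\<close>.\<close>

definition curv :: "('x list \<Rightarrow>\<^sub>0 'k) \<Rightarrow> 'k" where
  "curv c = - cf (low (wtpart 2 c)) []"

text \<open>As the overlap is the relation with leading term \<open>d c\<close>, its weight one part is \<open>-
  d (d c)\<close>. Computed from the two resolutions, this part consists of the constant terms of relations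
  times the remaining outer letter.\<close>

lemma cf_d_d_letter: "c \<in> C \<Longrightarrow> cf (d (d c)) [a] = curv (rslice [a] c) - curv (lslice [a] c)"
proof -
  assume c: "c \<in> C"
  let ?c = "wtpart 3 c"
  have c3: "wtpart 3 ?c = ?c" by (rule poly_mapping_eqI) simp
  note r = overlap_relation[OF C_wtpart[OF c] c3]
  have "susp2 deg (overlap ?c) \<in> S" using r by (metis imageI qrel_def wtpart_susp2(2))
  from rel_of_low[OF this] have 1: "overlap ?c = wtpart 2 (overlap ?c) - low (d ?c)"
    using rel_of_eq[OF r refl] by (simp add: d_overlap[OF c3])
  have "cf (d (d c)) [a] = cf (wtpart 1 (d (d c))) [a]" by simp
  also have "\<dots> = cf (low (d ?c)) [a]"
    using wtpart1_d[of "d c"] wtpart_d[of 2 c] by (simp add: numeral_3_eq_3 numeral_2_eq_2)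
  also have "\<dots> = - cf (overlap ?c) [a]"
    using arg_cong[OF 1, of "\<lambda>p. cf p [a]"] by (simp add: lookup_minus)
  also have "\<dots> = curv (rslice [a] ?c) - curv (lslice [a] ?c)"
  proof (rule functional_eq[of "\<lambda>c. - cf (overlap (wtpart 3 c)) [a]"
        "\<lambda>c. curv (rslice [a] (wtpart 3 c)) - curv (lslice [a] (wtpart 3 c))"])
    show "lin (\<lambda>c. scale (- cf (overlap (wtpart 3 c)) [a]) (bas ()))"
      unfolding pm.scale_minus_left by (intro lin_intros)
    show "lin (\<lambda>c. scale (curv (rslice [a] (wtpart 3 c)) - curv (lslice [a] (wtpart 3 c))) (bas ()))"
      unfolding pm.scale_minus_left pm.scale_left_diff_distrib curv_def by (intro lin_intros)
    fix w
    show "- cf (overlap (wtpart 3 (bas w))) [a] = curv (rslice [a] (wtpart 3 (bas w))) - curv (lslice [a] (wtpart 3 (bas w)))"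
    proof (cases "length w = 3")
      case True
      then obtain x y z where w: "w = [x, y, z]" by (auto simp: numeral_3_eq_3 length_Suc_conv)
      have l: "lslice [a] (bas w) = (if a = x then bas [y, z] else 0)"
        by (simp add: w lslice_bas)
      have r: "rslice [a] (bas w) = (if a = z then bas [x, y] else 0)"
        by (auto simp: w rslice_bas)
      have "cf (low (bas [x, y])) [] \<noteq> 0 \<Longrightarrow> ksgn (int (deg x) + int (deg y)) = (1 :: 'k)"
        using low_degree[of "[]" "[x, y]"] by (simp add: in_keys_iff)
      then show ?thesis
        using True by (auto simp add: l r curv_def lin_zero[OF lin_low0])
          (auto simp: w overlap_word lookup_minus cf_mult_bas cf_bas_mult)
    next
      case False
      have "rslice [a] 0 = (0 :: 'x list \<Rightarrow>\<^sub>0 'k)" "lslice [a] 0 = (0 :: 'x list \<Rightarrow>\<^sub>0 'k)"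
        by (rule poly_mapping_eqI; simp)+
      then show ?thesis using False by (simp add: lin_zero[OF lin_overlap[OF lin_ident]])
    qed
  qed
  also have "wtpart 2 (rslice [a] ?c) = wtpart 2 (rslice [a] c)" "wtpart 2 (lslice [a] ?c) = wtpart 2 (lslice [a] c)"
    by (rule poly_mapping_eqI; simp)+
  then have "curv (rslice [a] ?c) - curv (lslice [a] ?c) = curv (rslice [a] c) - curv (lslice [a] c)"
    by (simp add: curv_def)
  finally show ?thesis .
qed

text \<open>The curvature identity. Both sides satisfy the co-Leibniz rule of a map of even degree, so it
  suffices to compare their parts of weight one.\<close>

lemma cf_d_d:
  assumes c: "c \<in> C" shows "cf (d (d c)) w = curv (rslice w c) - curv (lslice w c)"
proof -
  have "(\<lambda>c w. cf (d (d c)) w - (curv (rslice w c) - curv (lslice w c))) c w = 0"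
  proof (rule coleibniz_vanishing[OF _ _ _ c, of _ "\<lambda>_. 1"])
    fix c u v
    show "cf (d (d c)) (u @ v) - (curv (rslice (u @ v) c) - curv (lslice (u @ v) c)) =
      cf (d (d (rslice v c))) u - (curv (rslice u (rslice v c)) - curv (lslice u (rslice v c))) +
      1 * (cf (d (d (lslice u c))) v - (curv (rslice v (lslice u c)) - curv (lslice v (lslice u c))))"
      by (simp add: coderivation_square_cf[OF coderivation_cod, of c u v] rslice_append lslice_append lslice_rslice)
  qed (simp_all add: cf_d_d_letter)
  then show ?thesis by simp
qed

end

section \<open>The cobar construction\<close>

lemma lin_cobar_gen [lin_intros]: "lin f \<Longrightarrow> lin (\<lambda>x. cobar_gen (f x))"
  and lin_cobar_diff [lin_intros]: "lin g \<Longrightarrow> lin (\<lambda>x. cobar_diff deg (g x))"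
  and lin_cobar_to_alg [lin_intros]: "lin h \<Longrightarrow> lin (\<lambda>x. cobar_to_alg (h x))"
  unfolding cobar_gen_def cobar_diff_def cobar_to_alg_def by (rule lin_linext; assumption)+

lemma cobar_gen_bas [simp]: "cobar_gen (bas w) = bas [w]"
  by (simp add: cobar_gen_def)

lemma cobar_diff_Nil [simp]: "cobar_diff deg (bas []) = 0"
  by (simp add: cobar_diff_def)

lemma cobar_diff_Cons: "(cobar_diff deg (bas (w # ws)) :: 'x list list \<Rightarrow>\<^sub>0 'k::field) =
    cobar_diff_gen deg w * bas ws - scale (ksgn (sdeg deg w)) (bas [w] * cobar_diff deg (bas ws))"
proof -
  have 1: "ksgn (cobar_deg deg (w # vs)) = - (ksgn (sdeg deg w) * ksgn (cobar_deg deg vs) :: 'k)" for vs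
    unfolding cobar_deg_def by (simp add: ksgn_add[symmetric]) (simp add: ksgn_def)
  have 2: "bas (w # us) * x * bas vs = bas [w] * (bas us * x * bas vs)" for us vs and x :: "'x list list \<Rightarrow>\<^sub>0 'k"
    by (simp add: mult.assoc[symmetric])
  have "(cobar_diff deg (bas (w # ws)) :: 'x list list \<Rightarrow>\<^sub>0 'k) = (\<Sum>i<Suc (length ws).
     scale (ksgn (cobar_deg deg (take i (w # ws))))
       (bas (take i (w # ws)) * cobar_diff_gen deg ((w # ws) ! i) * bas (drop (Suc i) (w # ws))))"
    by (simp add: cobar_diff_def)
  also have "\<dots> = cobar_diff_gen deg w * bas ws + (\<Sum>i<length ws.
     scale (- (ksgn (sdeg deg w) * ksgn (cobar_deg deg (take i ws))))
       (bas [w] * (bas (take i ws) * cobar_diff_gen deg (ws ! i) * bas (drop (Suc i) ws))))"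
    unfolding sum.lessThan_Suc_shift by (simp add: cobar_deg_def[of deg "[]"] 1 2)
  also have "\<dots> = cobar_diff_gen deg w * bas ws - scale (ksgn (sdeg deg w)) (bas [w] * cobar_diff deg (bas ws))"
    by (simp add: cobar_diff_def sum_distrib_left pm.scale_sum_right scale_mult_right sum_negf)
  finally show ?thesis .
qed

lemma cobar_to_alg_Nil [simp]: "cobar_to_alg (bas []) = 1"
  by (simp add: cobar_to_alg_def)

lemma cobar_to_alg_letter: "cobar_to_alg (bas [w] * z) = (if length w = 1 then bas w else 0) * cobar_to_alg z"
  by (rule lin_ext[of "\<lambda>z. cobar_to_alg (bas [w] * z)" "\<lambda>z. (if length w = 1 then bas w else 0) * cobar_to_alg z"])
    ((intro lin_intros)+, simp add: cobar_to_alg_def)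

lemma cobar_to_alg_Cons: "cobar_to_alg (bas (w # ws)) = (if length w = 1 then bas w else 0) * cobar_to_alg (bas ws)"
  using cobar_to_alg_letter[of w "bas ws"] by simp

lemma cobar_to_alg_eq_0: "w \<in> set ws \<Longrightarrow> length w \<noteq> 1 \<Longrightarrow> cobar_to_alg (bas ws) = 0"
  by (induction ws) (auto simp: cobar_to_alg_Cons)

lemma cobar_to_alg_ones: "cobar_to_alg (bas (map (\<lambda>x. [x]) v)) = bas v"
  by (induction v) (simp_all add: cobar_to_alg_Cons one_eq_bas)

lemma cobar_diff_gen_short: "length w \<le> 1 \<Longrightarrow> cobar_diff_gen deg w = 0"
  by (auto simp: cobar_diff_gen_def intro!: sum.neutral)

lemma cobar_diff_ones: "(\<And>w. w \<in> set ws \<Longrightarrow> length w = 1) \<Longrightarrow> cobar_diff deg (bas ws) = 0"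
  by (induction ws) (simp_all add: cobar_diff_Cons cobar_diff_gen_short)

text \<open>The coefficient of the products with first factor \<open>w\<close>.\<close>

definition cslice :: "'y \<Rightarrow> ('y list \<Rightarrow>\<^sub>0 'k::field) \<Rightarrow> ('y list \<Rightarrow>\<^sub>0 'k)" where
  "cslice w p = Poly_Mapping.map_key ((#) w) p"

lemma cf_cslice' [simp]: "cf (cslice w p) ws = cf p (w # ws)"
  by (simp add: cslice_def)

lemma cslice_zero [simp]: "cslice w 0 = 0"
  by (rule poly_mapping_eqI) simp

lemma lin_cslice [lin_intros]: "lin f \<Longrightarrow> lin (\<lambda>x. cslice w (f x))"
  unfolding cslice_def by (intro lin_intros)

lemma cslice_bas: "cslice w (bas []) = 0" "cslice w (bas (w' # ws)) = (if w = w' then bas ws else 0)"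
  by (rule poly_mapping_eqI; auto simp: cf_bas)+

lemma cslice_letter: "cslice w (bas [w'] * z) = (if w = w' then z else 0)"
  by (rule poly_mapping_eqI) (auto simp: cf_bas_mult)

lemma cslice_gen: "cslice w (cobar_gen c * z) = scale (cf c w) z"
proof (rule bilinear_ext[of "\<lambda>c z. cslice w (cobar_gen c * z)" "\<lambda>c z. scale (cf c w) z"])
  show "\<And>q. lin (\<lambda>p. scale (cf p w) q)" by (rule lin_scale_cf[OF lin_ident])
qed ((intro lin_intros)+, auto simp: cslice_bas cf_bas)

definition head_length :: "'x list list \<Rightarrow> nat" where
  "head_length ws = (case ws of [] \<Rightarrow> 0 | w # _ \<Rightarrow> length w)"

lemma head_length_simps [simp]: "head_length [] = 0" "head_length (w # ws) = length w"
  by (simp_all add: head_length_def)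

lemma cf_cobar_diff_gen_mult: "cf (cobar_diff_gen deg w * bas ws) vs =
    ((case vs of a # b # us \<Rightarrow> if a \<noteq> [] \<and> b \<noteq> [] \<and> a @ b = w \<and> us = ws then - ksgn (sdeg deg a) else 0 | _ \<Rightarrow> 0) :: 'k::field)"
proof -
  have "cf (cobar_diff_gen deg w * bas ws) vs =
    (\<Sum>i\<in>{0<..<length w}. if take i w # drop i w # ws = vs then - ksgn (sdeg deg (take i w)) else (0 :: 'k))"
    by (auto simp: cobar_diff_gen_def sum_distrib_right scale_mult_left lookup_sum cf_bas intro!: sum.cong)
  also have "\<dots> = (case vs of a # b # us \<Rightarrow> if a \<noteq> [] \<and> b \<noteq> [] \<and> a @ b = w \<and> us = ws then - ksgn (sdeg deg a) else 0 | _ \<Rightarrow> 0)"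
  proof (cases "\<exists>a b us. vs = a # b # us")
    case True
    then obtain a b us where vs: "vs = a # b # us" by blast
    have "(take i w # drop i w # ws = vs) \<longleftrightarrow> i = length a \<and> (a @ b = w \<and> us = ws)" if "i \<in> {0<..<length w}" for i
      using that by (auto simp: vs)
    then have "(\<Sum>i\<in>{0<..<length w}. if take i w # drop i w # ws = vs then - ksgn (sdeg deg (take i w)) else 0) =
      (\<Sum>i\<in>{0<..<length w}. if i = length a then if a @ b = w \<and> us = ws then - ksgn (sdeg deg a) else 0 else (0 :: 'k))"
      by (intro sum.cong) auto
    then show ?thesis by (auto simp: vs)
  next
    case False
    then show ?thesis by (auto split: list.splits intro!: sum.neutral)
  qed
  finally show ?thesis .
qed

lemma cobar_diff_head_length:
  assumes "ws' \<in> supp (cobar_diff deg (bas ws) :: 'x list list \<Rightarrow>\<^sub>0 'k::field)"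
  shows "head_length ws' \<le> head_length ws \<and> ws' \<noteq> []"
proof (cases ws)
  case Nil
  then show ?thesis using assms by simp
next
  case (Cons w vs)
  let ?a = "cobar_diff_gen deg w * bas vs :: 'x list list \<Rightarrow>\<^sub>0 'k"
  let ?b = "bas [w] * cobar_diff deg (bas vs) :: 'x list list \<Rightarrow>\<^sub>0 'k"
  have "cf ?a ws' - ksgn (sdeg deg w) * cf ?b ws' \<noteq> 0"
    using assms by (simp add: Cons cobar_diff_Cons in_keys_iff lookup_minus)
  then consider "cf ?a ws' \<noteq> 0" | "cf ?b ws' \<noteq> 0"
    by (metis diff_zero mult_zero_right)
  then show ?thesis
  proof cases
    case 1
    then show ?thesis by (auto simp: Cons cf_cobar_diff_gen_mult split: list.splits if_splits)
  next
    case 2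
    then have "take 1 ws' = [w]" by (auto simp: cf_bas_mult split: if_splits)
    then show ?thesis by (cases ws') (auto simp: Cons)
  qed
qed

text \<open>\<open>strip w\<close> removes the prefix \<open>w\<close> from the first word, provided something remains.\<close>

definition strip :: "'x list \<Rightarrow> ('x list list \<Rightarrow>\<^sub>0 'k::field) \<Rightarrow> ('x list list \<Rightarrow>\<^sub>0 'k)" where
  "strip w = linext (\<lambda>ws. case ws of [] \<Rightarrow> 0 | v # vs \<Rightarrow>
     if take (length w) v = w \<and> length w < length v then bas (drop (length w) v # vs) else 0)"

lemma lin_strip [lin_intros]: "lin f \<Longrightarrow> lin (\<lambda>x. strip w (f x))"
  unfolding strip_def by (rule lin_linext)

text \<open>The first factor becomes \<open>w\<close> only by being cut after \<open>w\<close>.\<close>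

lemma cslice_cobar_diff_long:
  fixes z :: "'x list list \<Rightarrow>\<^sub>0 'k::field"
  assumes "\<And>ws. ws \<in> supp z \<Longrightarrow> length w < head_length ws" and "w \<noteq> []"
  shows "cslice w (cobar_diff deg z) = scale (- ksgn (sdeg deg w)) (strip w z)"
proof (rule lin_ext_supp[of "\<lambda>z. cslice w (cobar_diff deg z)" "\<lambda>z. scale (- ksgn (sdeg deg w)) (strip w z)"])
  fix ws assume "ws \<in> supp z"
  then obtain v vs where ws: "ws = v # vs" "length w < length v"
    using assms(1)[of ws] by (cases ws) auto
  show "cslice w (cobar_diff deg (bas ws)) = scale (- ksgn (sdeg deg w)) (strip w (bas ws))"
  proof (rule poly_mapping_eqI)
    fix us
    have "us = drop (length w) v # vs" if "us = a # vs" "w @ a = v" for a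
      using that by auto
    moreover have "take (length w) v = w \<Longrightarrow> w @ drop (length w) v = v"
      by (metis append_take_drop_id)
    ultimately show "cf (cslice w (cobar_diff deg (bas ws))) us = cf (scale (- ksgn (sdeg deg w)) (strip w (bas ws))) us"
      using ws assms(2)
      by (auto simp: ws(1) cobar_diff_Cons lookup_minus cf_cobar_diff_gen_mult cf_bas_mult strip_def cf_bas split: list.splits)
  qed
qed (intro lin_intros)+

text \<open>The first factor is too short to be cut into \<open>w\<close> and something nonempty, so the
  differential acts on the factors after it.\<close>

lemma cslice_cobar_diff_short:
  fixes z :: "'x list list \<Rightarrow>\<^sub>0 'k::field"
  assumes "\<And>ws. ws \<in> supp z \<Longrightarrow> head_length ws \<le> length w"
  shows "cslice w (cobar_diff deg z) = scale (- ksgn (sdeg deg w)) (cobar_diff deg (cslice w z))"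
proof (rule lin_ext_supp[of "\<lambda>z. cslice w (cobar_diff deg z)" "\<lambda>z. scale (- ksgn (sdeg deg w)) (cobar_diff deg (cslice w z))"])
  fix ws assume ws: "ws \<in> supp z"
  show "cslice w (cobar_diff deg (bas ws)) = scale (- ksgn (sdeg deg w)) (cobar_diff deg (cslice w (bas ws :: _ \<Rightarrow>\<^sub>0 'k)))"
  proof (cases ws)
    case Nil
    then show ?thesis by (simp add: cslice_bas lin_zero[OF lin_cobar_diff[OF lin_ident]])
  next
    case (Cons v vs)
    then have l: "length v \<le> length w" using assms[OF ws] by simp
    have "cslice w (cobar_diff_gen deg v * bas vs) = (0 :: 'x list list \<Rightarrow>\<^sub>0 'k)"
      using l by (intro poly_mapping_eqI) (auto simp: cf_cobar_diff_gen_mult split: list.splits)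
    then show ?thesis
      by (simp add: Cons cobar_diff_Cons lin_minus[OF lin_cslice[OF lin_ident]] lin_scale[OF lin_cslice[OF lin_ident]]
          cslice_letter cslice_bas lin_zero[OF lin_cobar_diff[OF lin_ident]])
  qed
qed (intro lin_intros)+

context quadratic
begin

abbreviation \<Omega> :: "('x list list \<Rightarrow>\<^sub>0 'k) set" where "\<Omega> \<equiv> cobar_space C"

abbreviation gen_prod :: "('x list \<Rightarrow>\<^sub>0 'k) list \<Rightarrow> ('x list list \<Rightarrow>\<^sub>0 'k)" where
  "gen_prod cs \<equiv> prod_list (map cobar_gen cs)"

definition homogeneous_gens :: "('x list \<Rightarrow>\<^sub>0 'k) list \<Rightarrow> bool" where
  "homogeneous_gens cs \<longleftrightarrow> (\<forall>c\<in>set cs. c \<in> C \<and> (\<exists>n m. 0 < n \<and> (\<forall>w\<in>supp c. length w = n \<and> sdeg deg w = m)))"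

lemma subspace_cobar [simp]: "pm.subspace \<Omega>"
  unfolding cobar_space_def by (rule pm.subspace_span)

lemma gen_prod_in: "(\<And>c. c \<in> set cs \<Longrightarrow> c \<in> C \<and> cf c [] = 0) \<Longrightarrow> gen_prod cs \<in> \<Omega>"
  unfolding cobar_space_def by (rule pm.span_base) blast

lemma cobar_gen_mult_in:
  assumes c: "c \<in> C" "cf c [] = 0" and z: "z \<in> \<Omega>"
  shows "cobar_gen c * z \<in> \<Omega>"
proof -
  have "cobar_gen c * z \<in> \<Omega>"
    using z unfolding cobar_space_def[of C]
  proof (rule lin_span_into[where f = "\<lambda>z. cobar_gen c * z"])
    fix g assume "g \<in> {gen_prod cs | cs. set cs \<subseteq> {c \<in> C. cf c [] = 0}}"
    then obtain cs where "g = gen_prod cs" "set cs \<subseteq> {c \<in> C. cf c [] = 0}" by blast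
    then show "cobar_gen c * g \<in> pm.span {gen_prod cs | cs. set cs \<subseteq> {c \<in> C. cf c [] = 0}}"
      using c by (intro pm.span_base CollectI exI[of _ "c # cs"]) auto
  qed (intro lin_intros, rule pm.subspace_span)
  then show ?thesis .
qed

lemma one_in_cobar: "bas [] \<in> \<Omega>"
  using gen_prod_in[of "[]"] by (simp add: one_eq_bas)

lemma homogeneous_gensD:
  assumes "homogeneous_gens cs" "c \<in> set cs" shows "c \<in> C \<and> cf c [] = 0"
proof -
  obtain n m where "c \<in> C" "0 < n" "\<And>w. w \<in> supp c \<Longrightarrow> length w = n"
    using assms unfolding homogeneous_gens_def by blast
  then show ?thesis by (metis in_keys_iff length_0_conv less_irrefl)
qed

text \<open>Splitting the generators into components, the cobar construction is spanned by the products of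
  generators that are homogeneous both in weight and in degree.\<close>

lemma cobar_into:
  assumes z: "z \<in> \<Omega>" and f: "lin f" and T: "pm.subspace T"
    and gens: "\<And>cs. homogeneous_gens cs \<Longrightarrow> f (gen_prod cs) \<in> T"
  shows "f z \<in> T"
proof -
  let ?H = "pm.span {gen_prod cs | cs. homogeneous_gens cs}"
  have "gen_prod cs \<in> ?H" if "\<And>c. c \<in> set cs \<Longrightarrow> c \<in> C \<and> cf c [] = 0" for cs
    using that
  proof (induction cs)
    case Nil
    have "homogeneous_gens []" by (simp add: homogeneous_gens_def)
    then show ?case by (intro pm.span_base) blast
  next
    case (Cons c cs)
    let ?g = "\<lambda>w. (length w, sdeg deg w)"
    have Z: "gen_prod cs \<in> ?H" using Cons by simp
    have "cobar_gen (part (\<lambda>w. ?g w = t) c) * gen_prod cs \<in> ?H" for t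
    proof (rule lin_span_into[OF Z, of "\<lambda>Z. cobar_gen (part (\<lambda>w. ?g w = t) c) * Z"])
      fix g assume "g \<in> {gen_prod cs | cs. homogeneous_gens cs}"
      then obtain cs where cs: "g = gen_prod cs" "homogeneous_gens cs" by blast
      let ?c = "part (\<lambda>w. ?g w = t) c"
      have cC: "c \<in> C" "cf c [] = 0" using Cons.prems by auto
      show "cobar_gen ?c * g \<in> ?H"
      proof (cases "?c = 0")
        case True
        then show ?thesis by (simp add: lin_zero[OF lin_cobar_gen[OF lin_ident]] pm.span_zero)
      next
        case False
        then obtain w where w: "w \<in> supp ?c" by (metis all_not_in_conv keys_eq_empty)
        then have "0 < length w" using cC(2) by (cases w) (auto simp: in_keys_iff split: if_splits)
        then have "0 < fst t" using w by (auto simp: supp_part)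
        moreover have "?c \<in> C" using graded_byD[OF graded_C cC(1), of "\<lambda>u. u = t"] .
        ultimately have "homogeneous_gens (?c # cs)"
          using cs(2) unfolding homogeneous_gens_def
          by (auto simp: supp_part intro!: exI[of _ "fst t"] exI[of _ "snd t"])
        moreover have "cobar_gen ?c * g = gen_prod (?c # cs)" by (simp add: cs)
        ultimately show ?thesis by (intro pm.span_base) blast
      qed
    qed (intro lin_intros, rule pm.subspace_span)
    moreover have "gen_prod (c # cs) = (\<Sum>t\<in>?g ` supp c. cobar_gen (part (\<lambda>w. ?g w = t) c) * gen_prod cs)"
      by (subst (1) sum_of_parts[of c ?g]) (simp add: lin_sum[OF lin_cobar_gen[OF lin_ident]] sum_distrib_right)
    ultimately show ?case by (simp only:) (rule pm.span_sum)
  qed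
  then have "{gen_prod cs | cs. set cs \<subseteq> {c \<in> C. cf c [] = 0}} \<subseteq> ?H" by blast
  then have "\<Omega> \<subseteq> ?H" unfolding cobar_space_def by (intro pm.span_minimal pm.subspace_span)
  then have "z \<in> ?H" using z by blast
  then show ?thesis by (rule lin_span_into[OF _ f T]) (use gens in blast)
qed

lemma cobar_cslice: "z \<in> \<Omega> \<Longrightarrow> cslice w z \<in> \<Omega>"
proof (rule cobar_into[where f = "cslice w"])
  fix cs assume h: "homogeneous_gens cs"
  show "cslice w (gen_prod cs) \<in> \<Omega>"
  proof (cases cs)
    case Nil then show ?thesis by (simp add: one_eq_bas cslice_bas pm.subspace_0)
  next
    case (Cons c cs')
    then have "homogeneous_gens cs'" using h by (simp add: homogeneous_gens_def)
    then show ?thesis using homogeneous_gensD gen_prod_in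
      by (auto simp: Cons cslice_gen intro!: pm.subspace_scale[OF subspace_cobar])
  qed
qed (auto intro: lin_cslice[OF lin_ident])

lemma gen_prod_supp: "ws \<in> supp (gen_prod cs) \<Longrightarrow> list_all2 (\<lambda>w c. w \<in> supp c) ws cs"
proof (induction cs arbitrary: ws)
  case Nil
  then show ?case by (simp add: one_eq_bas)
next
  case (Cons c cs)
  have "cf (gen_prod (c # cs)) ws \<noteq> 0" using Cons.prems by (simp add: in_keys_iff)
  moreover have "cf (gen_prod (c # cs)) [] = 0"
  proof -
    have "cf (cobar_gen c * z) [] = 0" for z
      by (rule functional_eq[of "\<lambda>c. cf (cobar_gen c * z) []" "\<lambda>_. 0"])
        (intro lin_intros, simp add: lin_const, simp add: cf_bas_mult)
    then show ?thesis by simp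
  qed
  ultimately obtain w vs where ws: "ws = w # vs" by (cases ws) auto
  have "cf (gen_prod (c # cs)) ws = cf (cslice w (gen_prod (c # cs))) vs" by (simp add: ws)
  also have "\<dots> = cf c w * cf (gen_prod cs) vs" by (simp add: cslice_gen)
  finally show ?case using Cons.IH[of vs] Cons.prems by (auto simp: ws in_keys_iff)
qed

lemma cobar_supp_nonempty:
  assumes z: "z \<in> \<Omega>" and ws: "ws \<in> supp z" "w \<in> set ws" shows "w \<noteq> []"
proof -
  have "part (\<lambda>ws. [] \<in> set ws) z \<in> {0}"
  proof (rule cobar_into[OF z])
    fix cs assume h: "homogeneous_gens cs"
    have "[] \<notin> set ws" if ws: "ws \<in> supp (gen_prod cs)" for ws
    proof
      assume "[] \<in> set ws"
      then obtain i where "i < length ws" "ws ! i = []" by (auto simp: in_set_conv_nth)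
      then have "[] \<in> supp (cs ! i)" "cs ! i \<in> set cs"
        using list_all2_nthD[OF gen_prod_supp[OF ws]] list_all2_lengthD[OF gen_prod_supp[OF ws]] by fastforce+
      then show False using homogeneous_gensD[OF h] by (auto simp: in_keys_iff)
    qed
    then show "part (\<lambda>ws. [] \<in> set ws) (gen_prod cs) \<in> {0}" by (simp add: part_none)
  qed (intro lin_intros, simp)
  then have "cf (part (\<lambda>ws. [] \<in> set ws) z) ws = 0" by simp
  then show ?thesis using ws by (auto simp: in_keys_iff split: if_splits)
qed

text \<open>The cobar construction is graded by the sequence of weights of the factors.\<close>

lemma cobar_shape:
  assumes z: "z \<in> \<Omega>" shows "part (\<lambda>ws. P (map length ws)) z \<in> \<Omega>"
proof (rule cobar_into[OF z])
  fix cs assume h: "homogeneous_gens cs"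
  have "\<exists>n. \<forall>w\<in>supp c. length w = n" if "c \<in> set cs" for c
    using h that by (auto simp: homogeneous_gens_def)
  then obtain n where n: "\<And>c w. c \<in> set cs \<Longrightarrow> w \<in> supp c \<Longrightarrow> length w = n c" by metis
  have l: "map length ws = map n cs" if "ws \<in> supp (gen_prod cs)" for ws
  proof -
    from gen_prod_supp[OF that] show ?thesis using n
      by (induction rule: list_all2_induct) auto
  qed
  show "part (\<lambda>ws. P (map length ws)) (gen_prod cs) \<in> \<Omega>"
  proof (cases "P (map n cs)")
    case True
    then have "part (\<lambda>ws. P (map length ws)) (gen_prod cs) = gen_prod cs" using l by (simp add: part_id)
    then show ?thesis using gen_prod_in homogeneous_gensD[OF h] by simp
  next
    case False
    then have "part (\<lambda>ws. P (map length ws)) (gen_prod cs) = 0" using l by (simp add: part_none)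
    then show ?thesis by (simp add: pm.subspace_0)
  qed
qed (intro lin_intros, simp)

lemma cobar_head_part: "z \<in> \<Omega> \<Longrightarrow> part (\<lambda>ws. P (head_length ws)) z \<in> \<Omega>"
proof -
  assume "z \<in> \<Omega>"
  then have "part (\<lambda>ws. (\<lambda>ns. P (case ns of [] \<Rightarrow> 0 | n # _ \<Rightarrow> n)) (map length ws)) z \<in> \<Omega>"
    by (rule cobar_shape)
  moreover have "(\<lambda>ws. (\<lambda>ns. P (case ns of [] \<Rightarrow> 0 | n # _ \<Rightarrow> n)) (map length ws)) = (\<lambda>ws :: 'x list list. P (head_length ws))"
    by (auto simp: fun_eq_iff head_length_def split: list.splits)
  ultimately show ?thesis by simp
qed

end

locale koszul_quadratic = quadratic deg Q
  for deg :: "'x \<Rightarrow> nat" and Q :: "('x list \<Rightarrow>\<^sub>0 'k::field) set" +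
  assumes koszul_Q: "koszul deg Q"
begin

abbreviation D :: "('x list list \<Rightarrow>\<^sub>0 'k) \<Rightarrow> ('x list list \<Rightarrow>\<^sub>0 'k)" where "D \<equiv> cobar_diff deg"

abbreviation IQ :: "('x list \<Rightarrow>\<^sub>0 'k) set" where "IQ \<equiv> two_sided_ideal Q"

lemma cobar_diff_in: "z \<in> \<Omega> \<Longrightarrow> D z \<in> \<Omega>"
  and cobar_diff_diff: "z \<in> \<Omega> \<Longrightarrow> D (D z) = 0"
  and cobar_to_alg_diff: "z \<in> \<Omega> \<Longrightarrow> cobar_to_alg (D z) \<in> IQ"
proof -
  have *: "chain_map (cobar_complex deg C) (alg_complex deg Q) cobar_to_alg"
    using koszul_Q by (simp add: koszul_def quasi_iso_def)
  then have c: "chain_complex (cobar_complex deg C)" by (simp add: chain_map_def)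
  show "z \<in> \<Omega> \<Longrightarrow> D z \<in> \<Omega>" "z \<in> \<Omega> \<Longrightarrow> D (D z) = 0"
    using c by (auto simp: chain_complex_def cobar_complex_def)
  show "z \<in> \<Omega> \<Longrightarrow> cobar_to_alg (D z) \<in> IQ"
    using * by (auto simp: chain_map_def cobar_complex_def alg_complex_def)
qed

text \<open>The classes of \<open>z\<close> and of zero have the same image in the homology of the quadratic
  algebra, and the map in homology is injective.\<close>

lemma cobar_exact:
  assumes z: "z \<in> \<Omega>" "D z = 0" "cobar_to_alg z \<in> IQ"
  shows "\<exists>y\<in>\<Omega>. D y = z"
proof -
  let ?K = "cobar_complex deg C" and ?L = "alg_complex deg Q"
  have inj: "inj_on (homology_map ?L cobar_to_alg) (homology ?K)"
    using koszul_Q by (simp add: koszul_def quasi_iso_def bij_betw_def)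
  have cyc: "cycles ?K = {x \<in> \<Omega>. D x = 0}" by (simp add: cycles_def cobar_complex_def)
  have bd: "boundaries ?K = D ` \<Omega>" by (auto simp: boundaries_def cobar_complex_def)
  have L: "cycles ?L = UNIV" "boundaries ?L = IQ"
    by (auto simp: cycles_def boundaries_def alg_complex_def pm.subspace_0)
  have class_map: "homology_map ?L cobar_to_alg (homologous ?K `` {x}) = IQ"
    if x: "x \<in> \<Omega>" "D x = 0" "cobar_to_alg x \<in> IQ" for x
  proof -
    have hx: "cobar_to_alg x' \<in> IQ" if x': "(x, x') \<in> homologous ?K" for x'
    proof -
      obtain y where y: "y \<in> \<Omega>" "x - x' = D y" using x' by (auto simp: homologous_def bd)
      then have "cobar_to_alg x - cobar_to_alg x' \<in> IQ"
        using cobar_to_alg_diff[OF y(1)] by (simp flip: lin_minus[OF lin_cobar_to_alg[OF lin_ident]])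
      from pm.subspace_diff[OF subspace_ideal x(3) this] show ?thesis by simp
    qed
    have xx: "(x, x) \<in> homologous ?K"
      using x by (auto simp: homologous_def cyc bd image_iff lin_zero[OF lin_cobar_diff[OF lin_ident]]
          intro!: bexI[of _ 0] pm.subspace_0)
    show ?thesis
    proof (intro equalityI subsetI)
      fix y assume "y \<in> homology_map ?L cobar_to_alg (homologous ?K `` {x})"
      then obtain x' where x': "(x, x') \<in> homologous ?K" "cobar_to_alg x' - y \<in> IQ"
        by (auto simp: homology_map_def homologous_def L)
      from pm.subspace_diff[OF subspace_ideal hx[OF x'(1)] x'(2)] show "y \<in> IQ" by simp
    next
      fix y assume "y \<in> IQ"
      then have "(cobar_to_alg x, y) \<in> homologous ?L"
        by (simp add: homologous_def L pm.subspace_diff[OF subspace_ideal x(3)])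
      then show "y \<in> homology_map ?L cobar_to_alg (homologous ?K `` {x})"
        using xx by (auto simp: homology_map_def)
    qed
  qed
  have zero: "(0 :: 'x list list \<Rightarrow>\<^sub>0 'k) \<in> \<Omega>" "D 0 = 0" "cobar_to_alg 0 \<in> IQ"
    by (simp_all add: pm.subspace_0 lin_zero[OF lin_cobar_diff[OF lin_ident]] lin_zero[OF lin_cobar_to_alg[OF lin_ident]])
  have "homologous ?K `` {z} = homologous ?K `` {0}"
  proof (rule inj_onD[OF inj])
    show "homology_map ?L cobar_to_alg (homologous ?K `` {z}) = homology_map ?L cobar_to_alg (homologous ?K `` {0})"
      using class_map[OF z] class_map[OF zero] by simp
  qed (use z zero in \<open>auto simp: homology_def cyc intro!: quotientI\<close>)
  moreover have "z \<in> homologous ?K `` {z}"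
    using z zero by (auto simp: homologous_def cyc bd image_iff intro!: bexI[of _ 0])
  ultimately have "(0, z) \<in> homologous ?K" by blast
  then obtain y where "y \<in> \<Omega>" "- z = D y" by (auto simp: homologous_def bd)
  then show ?thesis
    by (intro bexI[of _ "- y"]) (auto simp: lin_uminus[OF lin_cobar_diff[OF lin_ident]] pm.subspace_neg simp flip: \<open>- z = D y\<close>)
qed

end

section \<open>Exactness of the one-sided Koszul complex\<close>

lemmas cobar_map_simps [simp] =
  lin_cobar_diff[OF lin_ident, THEN lin_zero] lin_cobar_diff[OF lin_ident, THEN lin_uminus]
  lin_cobar_diff[OF lin_ident, THEN lin_scale]
  lin_cobar_to_alg[OF lin_ident, THEN lin_zero] lin_cobar_to_alg[OF lin_ident, THEN lin_uminus]
  lin_cobar_to_alg[OF lin_ident, THEN lin_scale]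
  lin_cobar_gen[OF lin_ident, THEN lin_zero] lin_cobar_gen[OF lin_ident, THEN lin_scale]
  lin_strip[OF lin_ident, THEN lin_zero] lin_strip[OF lin_ident, THEN lin_uminus]
  lin_strip[OF lin_ident, THEN lin_scale]
  lin_cslice[OF lin_ident, THEN lin_uminus] lin_cslice[OF lin_ident, THEN lin_scale]

lemma cobar_to_alg_strip_long:
  assumes "\<And>ws. ws \<in> supp z \<Longrightarrow> Suc (length w) < head_length ws"
  shows "cobar_to_alg (strip w z) = 0"
proof -
  have "cobar_to_alg (strip w z) = (\<lambda>_. 0) z"
  proof (rule lin_ext_supp[of "\<lambda>z. cobar_to_alg (strip w z)"])
    fix ws assume "ws \<in> supp z"
    then obtain v vs where "ws = v # vs" "Suc (length w) < length v" using assms[of ws] by (cases ws) auto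
    then show "cobar_to_alg (strip w (bas ws)) = 0"
      by (auto simp: strip_def cobar_to_alg_Cons lin_zero[OF lin_cobar_to_alg[OF lin_ident]])
  qed (intro lin_intros)+
  then show ?thesis by simp
qed

context koszul_quadratic
begin

lemma diff_no_Nil: "[] \<notin> supp (D z)"
proof -
  have "cf (D (bas i)) [] = 0" for i
    using cobar_diff_head_length[where ?'k = 'k, of "[]" deg i] by (auto simp: in_keys_iff)
  then have "cf (D z) [] = 0"
    using cf_lin[OF lin_cobar_diff[OF lin_ident], of deg z "[]"] by simp
  then show ?thesis by (simp add: in_keys_iff)
qed

lemma diff_head_length:
  assumes "\<And>ws. ws \<in> supp z \<Longrightarrow> head_length ws \<le> p" "ws \<in> supp (D z)"
  shows "head_length ws \<le> p"
proof -
  obtain vs where "vs \<in> supp z" "ws \<in> supp (D (bas vs))"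
    using supp_lin_bas[OF lin_cobar_diff[OF lin_ident] assms(2)] by blast
  then show ?thesis using assms(1) cobar_diff_head_length[of ws deg vs] by fastforce
qed

text \<open>A linear choice of primitives in the cobar construction. Their components in \<open>T(V)\<close>,
  where all factors have weight one, can be dropped because the differential vanishes there, and
  \<open>cobar_to_alg\<close> vanishes on all other components.\<close>

lemma primitive_exists:
  "\<exists>h. lin h \<and> (\<forall>u. h u \<in> \<Omega>) \<and> (\<forall>u. cobar_to_alg (h u) = 0) \<and>
     (\<forall>u\<in>\<Omega>. D u = 0 \<longrightarrow> cobar_to_alg u \<in> IQ \<longrightarrow> D (h u) = u)"
proof -
  obtain h0 where h0: "lin h0" "\<And>u. h0 u \<in> \<Omega>" "\<And>y. y \<in> \<Omega> \<Longrightarrow> D (h0 (D y)) = D y"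
    using pmp.linear_exists_right_inverse_on[OF lin_cobar_diff[OF lin_ident] subspace_cobar, of deg] by auto
  let ?Q = "\<lambda>ws :: 'x list list. \<not> (\<forall>n\<in>set (map length ws). n = 1)"
  define h where "h u = part ?Q (h0 u)" for u
  have "lin h" unfolding h_def by (intro lin_intros h0)
  moreover have "h u \<in> \<Omega>" for u
    unfolding h_def using cobar_shape[OF h0(2), of "\<lambda>ns. \<not> (\<forall>n\<in>set ns. n = 1)"] by simp
  moreover have "cobar_to_alg (h u) = 0" for u
  proof -
    have "cobar_to_alg (part ?Q y) = (\<lambda>_. 0) y" for y :: "'x list list \<Rightarrow>\<^sub>0 'k"
      by (rule lin_ext[of "\<lambda>y. cobar_to_alg (part ?Q y)"])
        ((intro lin_intros)+, auto simp: cobar_to_alg_eq_0 lin_zero[OF lin_cobar_to_alg[OF lin_ident]])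
    then show ?thesis by (simp add: h_def)
  qed
  moreover have D: "D (h u) = D (h0 u)" for u
  proof -
    have "D (part ?Q y) = D y" for y :: "'x list list \<Rightarrow>\<^sub>0 'k"
      by (rule lin_ext[of "\<lambda>y. D (part ?Q y)" "\<lambda>y. D y"])
        ((intro lin_intros)+, auto simp: cobar_diff_ones lin_zero[OF lin_cobar_diff[OF lin_ident]])
    then show ?thesis by (simp add: h_def)
  qed
  moreover have "D (h u) = u" if "u \<in> \<Omega>" "D u = 0" "cobar_to_alg u \<in> IQ" for u
    using cobar_exact[OF that] h0(3) D by metis
  ultimately show ?thesis by blast
qed

text \<open>Filter the cobar construction by the weight of its first factor. The layer where this weight is \<open>p\<close> is
  \<open>C\<^sub>p \<otimes> \<Omega>\<close>, which is a resolution of \<open>C\<^sub>p \<otimes> qA\<close>; hence exactness passes from the quotient by the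
  elements of first weight at most \<open>p - 1\<close> to the quotient by those of first weight at most \<open>p\<close>. The
  condition on \<open>strip w z\<close> concerns the component of \<open>z\<close> in the last nonzero degree of that quotient.\<close>

lemma cobar_quotient_exact:
  assumes "z \<in> \<Omega>" "\<And>ws. ws \<in> supp z \<Longrightarrow> p < head_length ws" "\<And>ws. ws \<in> supp (D z) \<Longrightarrow> head_length ws \<le> p"
    and "\<And>w. length w = p \<Longrightarrow> cobar_to_alg (strip w z) \<in> IQ"
  shows "\<exists>y\<in>\<Omega>. (\<forall>ws\<in>supp y. p < head_length ws) \<and> (\<forall>ws\<in>supp (z - D y). head_length ws \<le> p)"
  using assms
proof (induction p arbitrary: z)
  case 0
  have "strip [] z = z"
  proof (rule lin_ext_supp[of "strip []" "\<lambda>z. z"])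
    fix ws assume "ws \<in> supp z"
    then show "strip [] (bas ws) = bas ws" using 0(2)[of ws] by (cases ws) (auto simp: strip_def)
  qed (intro lin_intros)+
  then have 1: "cobar_to_alg z \<in> IQ" using 0(4)[of "[]"] by simp
  have "D z = 0"
  proof (rule ccontr)
    assume "D z \<noteq> 0"
    then obtain ws where ws: "ws \<in> supp (D z)" by (metis all_not_in_conv keys_eq_empty)
    then have "ws \<noteq> []" using diff_no_Nil by blast
    then obtain w vs where "ws = w # vs" by (cases ws) auto
    then show False using 0(3)[OF ws] cobar_supp_nonempty[OF cobar_diff_in[OF 0(1)] ws] by simp
  qed
  with cobar_exact[OF 0(1) _ 1] obtain y where y: "y \<in> \<Omega>" "D y = z" by blast
  let ?y = "part (\<lambda>ws. 0 < head_length ws) y"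
  have "D (part (\<lambda>ws. \<not> 0 < head_length ws) y) = (\<lambda>_. 0) (part (\<lambda>ws. \<not> 0 < head_length ws) y)"
  proof (rule lin_ext_supp[of "\<lambda>y. D y"])
    fix ws assume "ws \<in> supp (part (\<lambda>ws. \<not> 0 < head_length ws) y)"
    then have "ws \<in> supp y" "head_length ws = 0" by (auto simp: supp_part)
    then have "ws = []" using cobar_supp_nonempty[OF y(1)] by (cases ws) auto
    then show "D (bas ws) = 0" by simp
  qed (intro lin_intros)+
  then have "D ?y = D y"
    using lin_add[OF lin_cobar_diff[OF lin_ident], of deg ?y "part (\<lambda>ws. \<not> 0 < head_length ws) y"]
    by (simp only: part_compl) simp
  then show ?case using y cobar_head_part[OF y(1), of "\<lambda>n. 0 < n"]
    by (intro bexI[of _ ?y]) (auto simp: supp_part)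
next
  case (Suc q)
  note linD = lin_cobar_diff[OF lin_ident, of deg]
  obtain h where h: "lin h" "\<And>u. h u \<in> \<Omega>" "\<And>u. cobar_to_alg (h u) = 0"
    "\<And>u. u \<in> \<Omega> \<Longrightarrow> D u = 0 \<Longrightarrow> cobar_to_alg u \<in> IQ \<Longrightarrow> D (h u) = u"
    using primitive_exists by blast
  have short: "ws \<in> supp (D z) \<Longrightarrow> head_length ws \<le> Suc q" for ws using Suc.prems(3) .
  have u: "cslice w (D z) \<in> \<Omega>" "D (cslice w (D z)) = 0" "cobar_to_alg (cslice w (D z)) \<in> IQ"
    if w: "length w = Suc q" for w
  proof -
    show "cslice w (D z) \<in> \<Omega>" by (intro cobar_cslice cobar_diff_in Suc.prems)
    have "cslice w (D (D z)) = scale (- ksgn (sdeg deg w)) (D (cslice w (D z)))"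
      by (rule cslice_cobar_diff_short) (use short w in auto)
    then have "scale (- ksgn (sdeg deg w)) (D (cslice w (D z))) = 0"
      by (simp add: cobar_diff_diff[OF Suc.prems(1)])
    moreover have "- ksgn (sdeg deg w) \<noteq> (0 :: 'k)" by (simp add: ksgn_def)
    ultimately show "D (cslice w (D z)) = 0" by (metis pm.scale_eq_0_iff)
    have "cslice w (D z) = scale (- ksgn (sdeg deg w)) (strip w z)"
      by (rule cslice_cobar_diff_long) (use Suc.prems(2) w in auto)
    then show "cobar_to_alg (cslice w (D z)) \<in> IQ"
      using Suc.prems(4)[OF w] by (simp add: lin_scale[OF lin_cobar_to_alg[OF lin_ident]] pm.subspace_scale pm.subspace_neg)
  qed
  \<comment> \<open>\<open>U\<close> replaces the coefficient of each first factor \<open>w\<close> of weight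
    \<open>q + 1\<close> by a primitive. As the differential anticommutes with taking this coefficient up to
    the sign of \<open>w\<close>, the sign makes \<open>D (U (D z))\<close> agree with \<open>D z\<close> on
    the first factors of weight \<open>q + 1\<close>.\<close>
  define U where "U = linext (\<lambda>ws. case ws of [] \<Rightarrow> 0 | w # r \<Rightarrow>
      if length w = Suc q then scale (- ksgn (sdeg deg w)) (bas [w] * h (bas r)) else 0)"
  have linU: "lin U" unfolding U_def by (intro lin_intros)
  have U_gen: "U (cobar_gen c * y) = - cobar_gen (sg deg (wtpart (Suc q) c)) * h y" for c y
    by (rule bilinear_ext[of "\<lambda>c y. U (cobar_gen c * y)" "\<lambda>c y. - cobar_gen (sg deg (wtpart (Suc q) c)) * h y"])
      ((intro lin_intros lin_compose[OF linU] lin_mult_left[OF h(1)] h(1))+,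
        auto simp: U_def lin_zero[OF lin_cobar_gen[OF lin_ident]] lin_zero[OF lin_sg[OF lin_ident]]
          lin_scale[OF lin_cobar_gen[OF lin_ident]] scale_mult_left)
  have U_in: "U y \<in> \<Omega>" if "y \<in> \<Omega>" for y
  proof (rule cobar_into[OF that linU subspace_cobar])
    fix cs assume hc: "homogeneous_gens cs"
    show "U (gen_prod cs) \<in> \<Omega>"
    proof (cases cs)
      case Nil
      then show ?thesis by (simp add: one_eq_bas U_def pm.subspace_0)
    next
      case (Cons c cs')
      then have c: "c \<in> C" using homogeneous_gensD[OF hc] by simp
      have "cobar_gen (sg deg (wtpart (Suc q) c)) * h (gen_prod cs') \<in> \<Omega>"
        by (rule cobar_gen_mult_in) (simp_all add: h(2) graded_by_sg[OF graded_C_sdeg] C_wtpart[OF c])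
      then show ?thesis by (simp add: Cons U_gen pm.subspace_neg)
    qed
  qed
  have U_slice: "cslice w (U y) = (if length w = Suc q then scale (- ksgn (sdeg deg w)) (h (cslice w y)) else 0)" for w y
  proof (rule lin_ext[of "\<lambda>y. cslice w (U y)" "\<lambda>y. if length w = Suc q then scale (- ksgn (sdeg deg w)) (h (cslice w y)) else 0"])
    show "lin (\<lambda>y. cslice w (U y))" by (intro lin_intros lin_compose[OF linU])
    show "lin (\<lambda>y. if length w = Suc q then scale (- ksgn (sdeg deg w)) (h (cslice w y)) else 0)"
      by (intro lin_intros lin_compose[OF h(1)])
    fix ws show "cslice w (U (bas ws)) = (if length w = Suc q then scale (- ksgn (sdeg deg w)) (h (cslice w (bas ws))) else 0)"
      by (cases ws) (auto simp: U_def cslice_bas lin_zero[OF h(1)] cslice_letter lin_scale[OF lin_cslice[OF lin_ident]]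
        lin_uminus[OF lin_cslice[OF lin_ident]])
  qed
  have U_supp: "head_length ws = Suc q" if U: "ws \<in> supp (U y)" for ws y
  proof -
    obtain vs where "ws \<in> supp (U (bas vs))" using supp_lin_bas[OF linU U] by blast
    then show ?thesis by (cases vs; cases ws) (auto simp: U_def in_keys_iff cf_bas_mult split: if_splits)
  qed
  let ?u = "U (D z)"
  let ?z = "z - ?u"
  have u_in: "?u \<in> \<Omega>" by (intro U_in cobar_diff_in Suc.prems)
  have z_in: "?z \<in> \<Omega>" by (intro pm.subspace_diff subspace_cobar Suc.prems u_in)
  have head: "q < head_length ws" if "ws \<in> supp ?z" for ws
  proof -
    have "ws \<in> supp z \<or> ws \<in> supp ?u" using that by (auto simp: in_keys_iff lookup_minus)
    then show ?thesis using Suc.prems(2)[of ws] U_supp[of ws] by auto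
  qed
  have Du_short: "head_length ws \<le> Suc q" if "ws \<in> supp (D ?u)" for ws
    by (rule diff_head_length[OF _ that]) (use U_supp in auto)
  have same: "cslice w (D ?u) = cslice w (D z)" if w: "length w = Suc q" for w
  proof -
    have "cslice w (D ?u) = scale (- ksgn (sdeg deg w)) (D (cslice w ?u))"
      by (rule cslice_cobar_diff_short) (use U_supp w in auto)
    also have "\<dots> = D (h (cslice w (D z)))"
      by (simp add: U_slice w lin_uminus[OF linD] lin_scale[OF linD])
    also have "\<dots> = cslice w (D z)" using h(4) u[OF w] by blast
    finally show ?thesis .
  qed
  have Dz: "head_length ws \<le> q" if "ws \<in> supp (D ?z)" for ws
  proof (rule ccontr)
    assume "\<not> head_length ws \<le> q"
    have eq: "D ?z = D z - D ?u" by (rule lin_minus[OF linD])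
    then have "ws \<in> supp (D z) \<or> ws \<in> supp (D ?u)" using that by (auto simp: in_keys_iff lookup_minus)
    then have "head_length ws = Suc q" using short Du_short \<open>\<not> head_length ws \<le> q\<close> by fastforce
    then obtain w vs where ws: "ws = w # vs" "length w = Suc q" by (cases ws) auto
    have "cf (D ?z) ws = cf (cslice w (D z) - cslice w (D ?u)) vs" by (simp add: eq ws lookup_minus)
    then show False using that same[OF ws(2)] by (simp add: in_keys_iff)
  qed
  have "cobar_to_alg (strip w ?z) \<in> IQ" if w: "length w = q" for w
  proof -
    have "cobar_to_alg (strip w z) = 0"
      by (rule cobar_to_alg_strip_long) (use Suc.prems(2) w in auto)
    moreover have "cobar_to_alg (strip w (U y)) = (\<lambda>_. 0) y" for y
    proof (rule lin_ext[of "\<lambda>y. cobar_to_alg (strip w (U y))"])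
      fix ws
      have "strip w (bas [v] * t) = (if take (length w) v = w \<and> length w < length v then bas [drop (length w) v] * t else 0)"
        for v and t :: "'x list list \<Rightarrow>\<^sub>0 'k"
      proof (rule lin_ext[of "\<lambda>t. strip w (bas [v] * t)"
          "\<lambda>t. if take (length w) v = w \<and> length w < length v then bas [drop (length w) v] * t else 0"])
        show "lin (\<lambda>t. strip w (bas [v] * t))"
          "lin (\<lambda>t. if take (length w) v = w \<and> length w < length v then bas [drop (length w) v] * t else 0)"
          by (intro lin_intros)+
      qed (simp add: strip_def)
      then show "cobar_to_alg (strip w (U (bas ws))) = 0"
        by (cases ws) (simp_all add: U_def lin_zero[OF lin_strip[OF lin_ident]] lin_scale[OF lin_strip[OF lin_ident]]
          lin_uminus[OF lin_strip[OF lin_ident]] lin_zero[OF lin_cobar_to_alg[OF lin_ident]]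
          lin_scale[OF lin_cobar_to_alg[OF lin_ident]] lin_uminus[OF lin_cobar_to_alg[OF lin_ident]]
          cobar_to_alg_letter h(3))
    qed (intro lin_intros lin_compose[OF linU])+
    ultimately show ?thesis
      by (simp add: lin_minus[OF lin_strip[OF lin_ident]] lin_minus[OF lin_cobar_to_alg[OF lin_ident]] pm.subspace_0)
  qed
  from Suc.IH[OF z_in head Dz this] obtain y where y: "y \<in> \<Omega>" "\<And>ws. ws \<in> supp y \<Longrightarrow> q < head_length ws"
    "\<And>ws. ws \<in> supp (?z - D y) \<Longrightarrow> head_length ws \<le> q" by blast
  \<comment> \<open>The components of \<open>y\<close> with first weight \<open>q + 1\<close> may be dropped,
    since the differential does not raise the first weight.\<close>
  let ?y = "part (\<lambda>ws. Suc q < head_length ws) y" and ?y' = "part (\<lambda>ws. \<not> Suc q < head_length ws) y"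
  have Dy: "D y = D ?y + D ?y'" by (metis lin_add[OF linD] part_compl)
  have "head_length ws \<le> Suc q" if ws: "ws \<in> supp (z - D ?y)" for ws
  proof -
    have E: "z - D ?y = (?z - D y) + ?u + D ?y'" by (simp add: Dy)
    have "cf (z - D ?y) ws = cf (?z - D y) ws + cf ?u ws + cf (D ?y') ws"
      unfolding E by (simp only: lookup_add)
    then have "ws \<in> supp (?z - D y) \<or> ws \<in> supp ?u \<or> ws \<in> supp (D ?y')"
      using ws by (metis add.right_neutral in_keys_iff)
    moreover have "head_length ws \<le> Suc q" if "ws \<in> supp (D ?y')"
      by (rule diff_head_length[OF _ that]) (auto simp: supp_part)
    ultimately show ?thesis using y(3)[of ws] U_supp[of ws] by auto
  qed
  then show ?case using cobar_head_part[OF y(1), of "\<lambda>n. Suc q < n"]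
    by (intro bexI[of _ ?y]) (auto simp: supp_part)
qed

end

lemma linext_zero [simp]: "linext f 0 = 0"
  by (rule lin_zero[OF lin_linext0])

lemma slice_bas: "slice2 i (bas (i', j)) = (if i = i' then bas j else 0)"
  "slice1 j (bas (i', j')) = (if j = j' then bas i' else 0)"
  by (rule poly_mapping_eqI; auto simp: cf_bas)+

lemmas slice_map_simps [simp] =
  lin_slices(4)[OF lin_ident, THEN lin_zero] lin_slices(4)[OF lin_ident, THEN lin_scale]
  lin_slices(5)[OF lin_ident, THEN lin_zero] lin_slices(5)[OF lin_ident, THEN lin_scale]
  lin_slices(4)[OF lin_ident, THEN lin_uminus] lin_slices(5)[OF lin_ident, THEN lin_uminus]
  lin_tensor2(1)[OF lin_ident, THEN lin_zero] lin_tensor2(1)[OF lin_ident, THEN lin_scale]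
  lin_tensor2(2)[OF lin_ident, THEN lin_zero] lin_tensor2(2)[OF lin_ident, THEN lin_scale]
  lin_sg[OF lin_ident, THEN lin_zero]

text \<open>The twisted part of the differential on \<open>C \<otimes> T(V)\<close>.\<close>

definition right_twist :: "('x \<Rightarrow> nat) \<Rightarrow> ('x list \<times> 'x list \<Rightarrow>\<^sub>0 'k::field) \<Rightarrow> ('x list \<times> 'x list \<Rightarrow>\<^sub>0 'k)" where
  "right_twist deg = linext (\<lambda>(w, v). if w = [] then 0 else
     scale (ksgn (sdeg deg (butlast w))) (bas (butlast w, last w # v)))"

lemma lin_right_twist [lin_intros]: "lin f \<Longrightarrow> lin (\<lambda>x. right_twist deg (f x))"
  unfolding right_twist_def by (rule lin_linext)

lemma right_twist_tensor2: "right_twist deg (tensor2 (bas w) t) = (if w = [] then 0 else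
    scale (ksgn (sdeg deg (butlast w))) (tensor2 (bas (butlast w)) (bas [last w] * t)))"
  by (rule lin_ext[of "\<lambda>t. right_twist deg (tensor2 (bas w) t)" "\<lambda>t. if w = [] then 0 else
    scale (ksgn (sdeg deg (butlast w))) (tensor2 (bas (butlast w)) (bas [last w] * t))"])
    ((intro lin_intros)+, simp add: right_twist_def)

lemma (in quadratic) tens2_weight_part:
  assumes "pm.subspace B" "x \<in> tens2 C B"
  shows "part (\<lambda>(w, v). length w = n) x \<in> tens2 C B"
proof -
  have 1: "slice1 v (part (\<lambda>(w, v). length w = n) x) = wtpart n (slice1 v x)" for v
    by (rule poly_mapping_eqI) simp
  have 2: "slice2 w (part (\<lambda>(w, v). length w = n) x) = (if length w = n then slice2 w x else 0)" for w
    by (rule poly_mapping_eqI) simp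
  show ?thesis
    using assms(2) by (auto simp: tens2_iff[OF subspace_C assms(1)] 1 2 C_wtpart pm.subspace_0[OF assms(1)])
qed

context koszul_quadratic
begin

abbreviation dR :: "('x list \<times> 'x list \<Rightarrow>\<^sub>0 'k) \<Rightarrow> ('x list \<times> 'x list \<Rightarrow>\<^sub>0 'k)" where
  "dR \<equiv> right_twist deg"

lemma ones_in_cobar: "bas (map (\<lambda>x. [x]) v) \<in> \<Omega>"
proof (induction v)
  case Nil
  then show ?case by (simp add: one_in_cobar)
next
  case (Cons a v)
  have "cobar_gen (bas [a]) * bas (map (\<lambda>x. [x]) v) \<in> \<Omega>"
    by (rule cobar_gen_mult_in[OF C_bas_letter _ Cons]) (simp add: cf_bas)
  then show ?case by simp
qed

text \<open>Regard \<open>x\<close> as an element of the cobar construction with a first factor of weight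
  \<open>p + 1\<close> and all other factors of weight one. Modulo first factors of weight at most
  \<open>p\<close> it is a cycle, and the obstruction in \<open>cobar_quotient_exact\<close> is its twisted
  differential. So it is a boundary \<open>D y\<close> there, and applying \<open>cobar_to_alg\<close> to all
  factors but the first recovers \<open>x\<close> from the components of \<open>y\<close> with first weight
  \<open>p + 1\<close> and \<open>p + 2\<close>: the former contribute a term that vanishes in the quadratic
  algebra, the latter a boundary.\<close>

lemma right_koszul_exact_weight:
  assumes x: "x \<in> tens2 C UNIV" "dR x \<in> tens2 C IQ" and weight: "\<And>w v. (w, v) \<in> supp x \<Longrightarrow> length w = Suc p"
  shows "\<exists>y\<in>tens2 C UNIV. x - dR y \<in> tens2 C IQ"
proof -
  \<comment> \<open>The embedding sends \<open>w \<otimes> v\<^sub>1 \<dots> v\<^sub>n\<close> to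
    \<open>s\<^sup>-\<^sup>1w \<otimes> s\<^sup>-\<^sup>1v\<^sub>1 \<otimes> \<dots> \<otimes>
    s\<^sup>-\<^sup>1v\<^sub>n\<close>.\<close>
  define emb where "emb = linext (\<lambda>(w, v). if length w = Suc p then bas (w # map (\<lambda>x. [x]) v) else 0 :: 'x list list \<Rightarrow>\<^sub>0 'k)"
  have lin_emb: "lin emb" unfolding emb_def by (intro lin_intros)
  have emb_tensor2: "emb (tensor2 c b) = cobar_gen (wtpart (Suc p) c) * linext (\<lambda>v. bas (map (\<lambda>x. [x]) v)) b" for c b
    by (rule bilinear_ext[of "\<lambda>c b. emb (tensor2 c b)" "\<lambda>c b. cobar_gen (wtpart (Suc p) c) * linext (\<lambda>v. bas (map (\<lambda>x. [x]) v)) b"])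
      ((intro lin_intros lin_compose[OF lin_emb])+, simp add: emb_def)
  let ?z = "emb x"
  have z: "?z \<in> \<Omega>"
    by (rule tens2_into[OF x(1) lin_emb subspace_cobar])
      (auto simp: emb_tensor2 C_wtpart intro!: cobar_gen_mult_in linext_in_subspace ones_in_cobar)
  have head: "p < head_length ws" if ws: "ws \<in> supp ?z" for ws
  proof -
    obtain wv where "ws \<in> supp (emb (bas wv))" using supp_lin_bas[OF lin_emb ws] by blast
    then show ?thesis by (cases wv) (auto simp: emb_def split: if_splits)
  qed
  have Dhead: "head_length ws \<le> p" if ws: "ws \<in> supp (D ?z)" for ws
  proof -
    have "\<exists>wv\<in>supp x. ws \<in> supp (D (emb (bas wv)))"
      by (rule supp_lin_bas[of "\<lambda>x. D (emb x)", OF _ ws]) (intro lin_intros lin_compose[OF lin_emb] lin_emb)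
    then obtain w v where "(w, v) \<in> supp x" "ws \<in> supp (D (emb (bas (w, v))))" by auto
    then have "length w = Suc p" "ws \<in> supp (D (bas (w # map (\<lambda>x. [x]) v) :: 'x list list \<Rightarrow>\<^sub>0 'k))"
      using weight by (auto simp: emb_def)
    moreover have "cobar_diff deg (bas (map (\<lambda>x. [x]) v)) = (0 :: 'x list list \<Rightarrow>\<^sub>0 'k)"
      by (rule cobar_diff_ones) auto
    ultimately show ?thesis
      by (auto simp: cobar_diff_Cons in_keys_iff cf_cobar_diff_gen_mult Suc_le_eq
          simp flip: length_greater_0_conv split: list.splits if_splits)
  qed
  have "cobar_to_alg (strip w ?z) \<in> IQ" if w: "length w = p" for w
  proof -
    have "cobar_to_alg (strip w (emb x)) = scale (ksgn (sdeg deg w)) (slice2 w (dR x))"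
    proof (rule lin_ext_supp[of "\<lambda>x. cobar_to_alg (strip w (emb x))" "\<lambda>x. scale (ksgn (sdeg deg w)) (slice2 w (dR x))"])
      fix wv assume "wv \<in> supp x"
      then obtain w' v where wv: "wv = (w', v)" "length w' = Suc p" using weight by (cases wv) auto
      then obtain u a where u: "w' = u @ [a]" "length u = p" by (metis length_Suc_conv_rev)
      have "take (length w) w' = w \<longleftrightarrow> u = w" using u w by auto
      then show "cobar_to_alg (strip w (emb (bas wv))) = scale (ksgn (sdeg deg w)) (slice2 w (dR (bas wv)))"
        using u w by (auto simp: wv emb_def strip_def cobar_to_alg_Cons cobar_to_alg_ones right_twist_def
            slice_bas)
    qed (intro lin_intros lin_compose[OF lin_emb] lin_emb)+
    then show ?thesis using x(2)
      by (simp add: tens2_iff[OF subspace_C subspace_ideal] pm.subspace_scale)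
  qed
  from cobar_quotient_exact[OF z head Dhead this] obtain y where y: "y \<in> \<Omega>"
    "\<And>ws. ws \<in> supp y \<Longrightarrow> p < head_length ws" "\<And>ws. ws \<in> supp (?z - D y) \<Longrightarrow> head_length ws \<le> p"
    by blast
  \<comment> \<open>\<open>first n\<close> keeps the elements whose first factor has weight \<open>n\<close>
    and multiplies the other factors; \<open>first (Suc p)\<close> is a left inverse of \<open>emb\<close>.\<close>
  define first where "first n = linext (\<lambda>ws. case ws of [] \<Rightarrow> 0 | w # r \<Rightarrow>
      if length w = n then tensor2 (bas w) (cobar_to_alg (bas r)) else (0 :: 'x list \<times> 'x list \<Rightarrow>\<^sub>0 'k))" for n
  have lin_first: "lin (first n)" for n unfolding first_def by (intro lin_intros)
  have first_letter: "first n (bas [w] * t) = (if length w = n then tensor2 (bas w) (cobar_to_alg t) else 0)" for n w t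
    by (rule lin_ext[of "\<lambda>t. first n (bas [w] * t)" "\<lambda>t. if length w = n then tensor2 (bas w) (cobar_to_alg t) else 0"])
      ((intro lin_intros lin_compose[OF lin_first])+, simp add: first_def)
  have first_bas: "first n (bas (w # r)) = (if length w = n then tensor2 (bas w) (cobar_to_alg (bas r)) else 0)" for n w r
    using first_letter[of n w "bas r"] by simp
  have "first (Suc p) (emb x) = x"
    by (rule lin_ext_supp[of "\<lambda>x. first (Suc p) (emb x)" "\<lambda>x. x"])
      ((intro lin_intros lin_compose[OF lin_first] lin_emb)+, use weight in \<open>auto simp: emb_def first_def cobar_to_alg_ones\<close>)
  moreover have "first (Suc p) (?z - D y) = (\<lambda>_. 0) (?z - D y)"
  proof (rule lin_ext_supp[of "first (Suc p)"])
    fix ws assume "ws \<in> supp (?z - D y)"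
    then show "first (Suc p) (bas ws) = 0" using y(3)[of ws] by (cases ws) (auto simp: first_def)
  qed (intro lin_intros lin_first)+
  ultimately have x_eq: "x = first (Suc p) (D y)" by (simp add: lin_minus[OF lin_first])
  \<comment> \<open>The part of the differential that leaves the first factor alone.\<close>
  define G where "G = linext (\<lambda>ws. case ws of [] \<Rightarrow> 0 | w # r \<Rightarrow>
      if length w = Suc p then scale (- ksgn (sdeg deg w)) (tensor2 (bas w) (cobar_to_alg (D (bas r)))) else 0)"
  have lin_G: "lin G" unfolding G_def by (intro lin_intros)
  have "first (Suc p) (D y) = G y - dR (first (Suc (Suc p)) y)"
  proof (rule lin_ext_supp[of "\<lambda>y. first (Suc p) (D y)" "\<lambda>y. G y - dR (first (Suc (Suc p)) y)"])
    fix ws assume "ws \<in> supp y"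
    then obtain w r where ws: "ws = w # r" "p < length w" using y(2)[of ws] by (cases ws) auto
    have "first (Suc p) (cobar_diff_gen deg w * bas r) = (\<Sum>i\<in>{0<..<length w}. scale (- ksgn (sdeg deg (take i w)))
        (if i = Suc p then tensor2 (bas (take i w)) (cobar_to_alg (bas (drop i w # r))) else 0))"
      by (auto simp: cobar_diff_gen_def sum_distrib_right scale_mult_left lin_sum[OF lin_first] lin_scale[OF lin_first]
          lin_uminus[OF lin_first] first_bas intro!: sum.cong)
    also have "\<dots> = (\<Sum>i\<in>{0<..<length w}. if i = Suc p then scale (- ksgn (sdeg deg (take (Suc p) w)))
        (tensor2 (bas (take (Suc p) w)) (cobar_to_alg (bas (drop (Suc p) w # r)))) else 0)"
      by (intro sum.cong) auto
    also have "\<dots> = - dR (first (Suc (Suc p)) (bas ws))"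
    proof (cases "length w = Suc (Suc p)")
      case True
      then obtain u a where u: "w = u @ [a]" "length u = Suc p" by (metis length_Suc_conv_rev)
      then show ?thesis by (simp add: ws first_def right_twist_tensor2 cobar_to_alg_Cons)
    next
      case False
      then have "Suc p < length w \<Longrightarrow> length w - Suc p \<noteq> 1" by auto
      then show ?thesis using False
        by (auto simp: ws first_def cobar_to_alg_Cons lin_zero[OF lin_right_twist[OF lin_ident]]
            lin_zero[OF lin_tensor2(2)[OF lin_ident]])
    qed
    finally have 1: "first (Suc p) (cobar_diff_gen deg w * bas r) = - dR (first (Suc (Suc p)) (bas ws))" .
    have "first (Suc p) (D (bas ws)) = first (Suc p) (cobar_diff_gen deg w * bas r) + G (bas ws)"
      by (simp add: ws cobar_diff_Cons lin_minus[OF lin_first] lin_scale[OF lin_first] first_letter G_def)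
    then show "first (Suc p) (D (bas ws)) = G (bas ws) - dR (first (Suc (Suc p)) (bas ws))" by (simp add: 1)
  qed (intro lin_intros lin_compose[OF lin_first] lin_first lin_G)+
  moreover have "G y \<in> tens2 C IQ"
  proof (rule cobar_into[OF y(1) lin_G])
    fix cs assume hc: "homogeneous_gens cs"
    have G_gen: "G (cobar_gen c * t) = - tensor2 (sg deg (wtpart (Suc p) c)) (cobar_to_alg (D t))" for c t
      by (rule bilinear_ext[of "\<lambda>c t. G (cobar_gen c * t)" "\<lambda>c t. - tensor2 (sg deg (wtpart (Suc p) c)) (cobar_to_alg (D t))"])
        ((intro lin_intros lin_compose[OF lin_G])+, auto simp: G_def lin_zero[OF lin_sg[OF lin_ident]] lin_zero[OF lin_tensor2(1)[OF lin_ident]]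
          lin_scale[OF lin_tensor2(1)[OF lin_ident]])
    show "G (gen_prod cs) \<in> tens2 C IQ"
    proof (cases cs)
      case Nil then show ?thesis by (simp add: one_eq_bas G_def pm.subspace_0)
    next
      case (Cons c cs')
      then have "c \<in> C" "gen_prod cs' \<in> \<Omega>"
        using homogeneous_gensD[OF hc] by (auto intro!: gen_prod_in)
      then show ?thesis
        by (auto simp: Cons G_gen intro!: pm.subspace_neg graded_by_sg[OF graded_C_sdeg] C_wtpart cobar_to_alg_diff)
    qed
  qed simp
  moreover have "first (Suc (Suc p)) y \<in> tens2 C UNIV"
  proof (rule cobar_into[OF y(1) lin_first])
    fix cs assume hc: "homogeneous_gens cs"
    have first_gen: "first n (cobar_gen c * t) = tensor2 (wtpart n c) (cobar_to_alg t)" for n c t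
      by (rule bilinear_ext[of "\<lambda>c t. first n (cobar_gen c * t)" "\<lambda>c t. tensor2 (wtpart n c) (cobar_to_alg t)"])
        ((intro lin_intros lin_compose[OF lin_first])+, auto simp: first_def lin_zero[OF lin_tensor2(1)[OF lin_ident]])
    show "first (Suc (Suc p)) (gen_prod cs) \<in> tens2 C UNIV"
    proof (cases cs)
      case Nil then show ?thesis by (simp add: one_eq_bas first_def pm.subspace_0)
    next
      case (Cons c cs')
      then have "c \<in> C" using homogeneous_gensD[OF hc] by auto
      then show ?thesis by (auto simp: Cons first_gen intro!: C_wtpart)
    qed
  qed simp
  ultimately show ?thesis
    using x_eq by (intro bexI[of _ "- first (Suc (Suc p)) y"])
      (simp_all add: lin_uminus[OF lin_right_twist[OF lin_ident]] pm.subspace_neg)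
qed

text \<open>Treat the weights of the coalgebra factor separately. In weight zero the first letter of the algebra
  factor can be moved back into the coalgebra; only \<open>1 \<otimes> 1\<close> has no such letter, and its
  class spans the homology.\<close>

lemma right_koszul_exact:
  assumes x: "x \<in> tens2 C UNIV" "dR x \<in> tens2 C IQ" and no_unit: "cf x ([], []) = 0"
  shows "\<exists>y\<in>tens2 C UNIV. x - dR y \<in> tens2 C IQ"
proof -
  let ?x = "\<lambda>n. part (\<lambda>(w, v). length w = n) x"
  have x_in: "?x n \<in> tens2 C UNIV" for n by (rule tens2_weight_part[OF subspace_UNIV x(1)])
  have "\<exists>y\<in>tens2 C UNIV. ?x n - dR y \<in> tens2 C IQ" for n
  proof (cases n)
    case 0
    \<comment> \<open>The value on \<open>v = []\<close> is arbitrary, since \<open>([], [])\<close> is not in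
      the support of \<open>x\<close>.\<close>
    define s where "s = linext (\<lambda>(w :: 'x list, v). bas ([hd v], tl v) :: 'x list \<times> 'x list \<Rightarrow>\<^sub>0 'k)"
    have lin_s: "lin s" unfolding s_def by (intro lin_intros)
    have "dR (s (?x n)) = ?x n"
    proof (rule lin_ext_supp[of "\<lambda>x. dR (s x)" "\<lambda>x. x"])
      fix wv assume "wv \<in> supp (?x n)"
      then obtain a v where "wv = ([], a # v)" using no_unit 0
        by (cases wv; cases "snd wv") (auto simp: supp_part in_keys_iff)
      then show "dR (s (bas wv)) = bas wv" by (simp add: s_def right_twist_def)
    qed (intro lin_intros lin_s)+
    moreover have "s (?x n) \<in> tens2 C UNIV"
    proof (rule lin_in_subspace[OF lin_s subspace_tens2])
      fix wv :: "'x list \<times> 'x list"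
      have "tensor2 (bas [hd (snd wv)]) (bas (tl (snd wv))) \<in> tens2 C (UNIV :: ('x list \<Rightarrow>\<^sub>0 'k) set)"
        by (intro tensor2_in C_bas_letter UNIV_I)
      then show "s (bas wv) \<in> tens2 C UNIV" by (cases wv) (simp add: s_def)
    qed
    ultimately show ?thesis by (intro bexI[of _ "s (?x n)"]) (simp_all add: pm.subspace_0)
  next
    case (Suc p)
    have "dR (?x (Suc p)) = part (\<lambda>(w, v). length w = p) (dR x)"
    proof (rule lin_ext[of "\<lambda>x. dR (part (\<lambda>(w, v). length w = Suc p) x)" "\<lambda>x. part (\<lambda>(w, v). length w = p) (dR x)"])
      fix wv :: "'x list \<times> 'x list"
      show "dR (part (\<lambda>(w, v). length w = Suc p) (bas wv)) = part (\<lambda>(w, v). length w = p) (dR (bas wv))"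
        by (cases wv; cases "fst wv" rule: rev_cases)
          (auto simp: right_twist_def part_scale lin_zero[OF lin_right_twist[OF lin_ident]])
    qed (intro lin_intros)+
    then have "dR (?x (Suc p)) \<in> tens2 C IQ" using tens2_weight_part[OF subspace_ideal x(2)] by simp
    then have "\<exists>y\<in>tens2 C UNIV. ?x (Suc p) - dR y \<in> tens2 C IQ"
      by (intro right_koszul_exact_weight[OF x_in, of _ p]) (auto simp: supp_part)
    then show ?thesis by (simp add: Suc)
  qed
  then obtain y where y: "\<And>n. y n \<in> tens2 C UNIV" "\<And>n. ?x n - dR (y n) \<in> tens2 C IQ" by metis
  let ?g = "\<lambda>(w, v). length w"
  have p: "part (\<lambda>i. ?g i = n) x = ?x n" for n
    by (rule poly_mapping_eqI) auto
  have "x = (\<Sum>n\<in>?g ` supp x. ?x n)"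
    using sum_of_parts[of x ?g] unfolding p .
  then have "x - dR (\<Sum>n\<in>?g ` supp x. y n) = (\<Sum>n\<in>?g ` supp x. ?x n - dR (y n))"
    by (simp add: lin_sum[OF lin_right_twist[OF lin_ident]] sum_subtractf)
  also have "\<dots> \<in> tens2 C IQ" by (intro pm.subspace_sum subspace_tens2 y)
  finally show ?thesis by (intro bexI[of _ "\<Sum>n\<in>?g ` supp x. y n"] pm.subspace_sum subspace_tens2 y)
qed

end

section \<open>The two-sided Koszul complex\<close>

lemmas linext_simps [simp] = lin_uminus[OF lin_linext0] lin_scale[OF lin_linext0]

text \<open>\<open>Rt\<close> and \<open>Lt\<close> are the two twisted terms of the differential; they split off the last letter of the
  coalgebra factor to the right and its first letter to the left.\<close>

definition Rt :: "('x \<Rightarrow> nat) \<Rightarrow> ('x list \<times> 'x list \<times> 'x list \<Rightarrow>\<^sub>0 'k::field) \<Rightarrow> ('x list \<times> 'x list \<times> 'x list \<Rightarrow>\<^sub>0 'k)" where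
  "Rt deg = linext (\<lambda>(u, w, v). if w = [] then 0 else
     scale (ksgn (wdeg deg u + sdeg deg (butlast w))) (bas (u, butlast w, last w # v)))"

definition Lt :: "('x \<Rightarrow> nat) \<Rightarrow> ('x list \<times> 'x list \<times> 'x list \<Rightarrow>\<^sub>0 'k::field) \<Rightarrow> ('x list \<times> 'x list \<times> 'x list \<Rightarrow>\<^sub>0 'k)" where
  "Lt deg = linext (\<lambda>(u, w, v). if w = [] then 0 else
     scale (ksgn (wdeg deg u)) (bas (u @ [hd w], tl w, v)))"

lemma lin_Rt [lin_intros]: "lin f \<Longrightarrow> lin (\<lambda>x. Rt deg (f x))"
  and lin_Lt [lin_intros]: "lin f \<Longrightarrow> lin (\<lambda>x. Lt deg (f x))"
  unfolding Rt_def Lt_def by (rule lin_linext; assumption)+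

lemma lin_xi [lin_intros]: "lin f \<Longrightarrow> lin (\<lambda>x. xi (f x))"
  unfolding xi_def by (rule lin_linext)

lemma xi_tensor3: "xi (tensor3 a c b) = scale (cf c []) (a * b)"
  by (rule trilinear_ext[of "\<lambda>a c b. xi (tensor3 a c b)" "\<lambda>a c b. scale (cf c []) (a * b)"])
    ((intro lin_intros)+, auto simp: xi_def cf_bas)

text \<open>The sign of the degree in \<open>T(V)\<close>.\<close>

definition wsg :: "('x \<Rightarrow> nat) \<Rightarrow> ('x list \<Rightarrow>\<^sub>0 'k::field) \<Rightarrow> ('x list \<Rightarrow>\<^sub>0 'k)" where
  "wsg deg = linext (\<lambda>w. scale (ksgn (wdeg deg w)) (bas w))"

lemma lin_wsg [lin_intros]: "lin f \<Longrightarrow> lin (\<lambda>x. wsg deg (f x))"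
  unfolding wsg_def by (rule lin_linext)

lemma wsg_bas [simp]: "wsg deg (bas w) = scale (ksgn (wdeg deg w)) (bas w)"
  by (simp add: wsg_def)

lemma graded_by_wsg:
  assumes "graded_by (wdeg deg) I" "a \<in> I"
  shows "wsg deg a \<in> I"
proof -
  have "wsg deg a = part (\<lambda>w. even (wdeg deg w)) a - part (\<lambda>w. \<not> even (wdeg deg w)) a"
    by (rule lin_ext[of "wsg deg" "\<lambda>a. part (\<lambda>w. even (wdeg deg w)) a - part (\<lambda>w. \<not> even (wdeg deg w)) a"])
      ((intro lin_intros lin_ident)+, simp add: ksgn_def)
  then show ?thesis
    using graded_byD[OF assms, where P = even] graded_byD[OF assms, where P = "\<lambda>n. \<not> even n"]
    by (simp add: pm.subspace_diff[OF graded_by_subspace[OF assms(1)]])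
qed

text \<open>Apply a linear map to the part of a word that is split off to the right or to the left.\<close>

definition split_right :: "(('x list \<Rightarrow>\<^sub>0 'k::field) \<Rightarrow> ('x list \<Rightarrow>\<^sub>0 'k)) \<Rightarrow> ('x list \<Rightarrow>\<^sub>0 'k) \<Rightarrow> ('x list \<Rightarrow>\<^sub>0 'k) \<Rightarrow>
    ('x list \<times> 'x list \<Rightarrow>\<^sub>0 'k) \<Rightarrow> ('x list \<times> 'x list \<times> 'x list \<Rightarrow>\<^sub>0 'k)" where
  "split_right \<rho> a b = linext (\<lambda>(w1, w2). tensor3 a (bas w1) (\<rho> (bas w2) * b))"

definition split_left :: "(('x list \<Rightarrow>\<^sub>0 'k::field) \<Rightarrow> ('x list \<Rightarrow>\<^sub>0 'k)) \<Rightarrow> ('x list \<Rightarrow>\<^sub>0 'k) \<Rightarrow> ('x list \<Rightarrow>\<^sub>0 'k) \<Rightarrow>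
    ('x list \<times> 'x list \<Rightarrow>\<^sub>0 'k) \<Rightarrow> ('x list \<times> 'x list \<times> 'x list \<Rightarrow>\<^sub>0 'k)" where
  "split_left \<rho> a b = linext (\<lambda>(w1, w2). tensor3 (a * \<rho> (bas w1)) (bas w2) b)"

lemma lin_split [lin_intros]: "lin g \<Longrightarrow> lin (\<lambda>x. split_right \<rho> a b (g x))"
  "lin g \<Longrightarrow> lin (\<lambda>x. split_left \<rho> a b (g x))"
  unfolding split_right_def split_left_def by (rule lin_linext; assumption)+

lemma split_right_tensor2:
  assumes "lin \<rho>" shows "split_right \<rho> a b (tensor2 p q) = tensor3 a p (\<rho> q * b)"
  by (rule bilinear_ext[of "\<lambda>p q. split_right \<rho> a b (tensor2 p q)" "\<lambda>p q. tensor3 a p (\<rho> q * b)"])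
    ((intro lin_intros assms)+, simp add: split_right_def)

lemma split_left_tensor2:
  assumes "lin \<rho>" shows "split_left \<rho> a b (tensor2 p q) = tensor3 (a * \<rho> p) q b"
  by (rule bilinear_ext[of "\<lambda>p q. split_left \<rho> a b (tensor2 p q)" "\<lambda>p q. tensor3 (a * \<rho> p) q b"])
    ((intro lin_intros assms)+, simp add: split_left_def)

lemma lin_deconc [lin_intros]: "lin f \<Longrightarrow> lin (\<lambda>x. deconc (f x))"
  unfolding deconc_def by (rule lin_linext)

lemma deconc_bas: "deconc (bas w) = (\<Sum>i\<le>length w. bas (take i w, drop i w))"
  by (simp add: deconc_def)

lemma linext_deconc_suffix:
  assumes "\<And>a b. length b \<noteq> k \<Longrightarrow> f (a, b) = 0"
  shows "linext f (deconc (bas w)) =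
    (if k \<le> length w then f (take (length w - k) w, drop (length w - k) w) else 0)"
proof -
  have "linext f (deconc (bas w)) = (\<Sum>i\<le>length w. f (take i w, drop i w))"
    by (simp add: deconc_bas lin_sum[OF lin_linext0])
  also have "\<dots> = (\<Sum>i\<le>length w. if i = length w - k then if k \<le> length w then f (take (length w - k) w, drop (length w - k) w) else 0 else 0)"
    by (intro sum.cong) (auto simp: assms)
  finally show ?thesis by simp
qed

lemma linext_deconc_prefix:
  assumes "\<And>a b. length a \<noteq> k \<Longrightarrow> f (a, b) = 0"
  shows "linext f (deconc (bas w)) = (if k \<le> length w then f (take k w, drop k w) else 0)"
proof -
  have "linext f (deconc (bas w)) = (\<Sum>i\<le>length w. f (take i w, drop i w))"
    by (simp add: deconc_bas lin_sum[OF lin_linext0])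
  also have "\<dots> = (\<Sum>i\<le>length w. if i = k then f (take k w, drop k w) else 0)"
    by (intro sum.cong) (auto simp: assms)
  finally show ?thesis by simp
qed

lemma Rt_tensor3: "Rt deg (tensor3 a c b) =
    linext (\<lambda>(w1, w2). tensor3 (wsg deg a) (sg deg (bas w1)) (wtpart 1 (bas w2) * b)) (deconc c)"
proof (rule trilinear_ext[of "\<lambda>a c b. Rt deg (tensor3 a c b)" "\<lambda>a c b.
    linext (\<lambda>(w1, w2). tensor3 (wsg deg a) (sg deg (bas w1)) (wtpart 1 (bas w2) * b)) (deconc c)"])
  let ?G = "\<lambda>a c b. linext (\<lambda>(w1, w2). tensor3 (wsg deg a) (sg deg (bas w1)) (wtpart 1 (bas w2) * b)) (deconc c)"
  show "lin (\<lambda>a. ?G a c b)" for c and b :: "'a list \<Rightarrow>\<^sub>0 'b"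
    unfolding linext_def split_def by (intro lin_intros)
  show "lin (\<lambda>b. ?G a c b)" for c and a :: "'a list \<Rightarrow>\<^sub>0 'b"
    unfolding linext_def split_def by (intro lin_intros)
  fix u w v :: "'a list"
  show "Rt deg (tensor3 (bas u) (bas w) (bas v)) = (?G (bas u) (bas w) (bas v) :: _ \<Rightarrow>\<^sub>0 'b)"
  proof (cases w rule: rev_cases)
    case Nil
    then show ?thesis by (subst linext_deconc_suffix[of 1]) (auto simp: Rt_def lin_zero[OF lin_tensor3(3)[OF lin_ident]])
  next
    case (snoc w' x)
    then show ?thesis
      by (subst linext_deconc_suffix[of 1])
        (auto simp: Rt_def lin_zero[OF lin_tensor3(3)[OF lin_ident]] lin_scale[OF lin_tensor3(1)[OF lin_ident]]
          lin_scale[OF lin_tensor3(2)[OF lin_ident]] ksgn_add mult.commute)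
  qed
qed (intro lin_intros)+

lemma Lt_tensor3: "Lt deg (tensor3 a c b) = split_left (wtpart 1) (wsg deg a) b (deconc c)"
proof (rule trilinear_ext[of "\<lambda>a c b. Lt deg (tensor3 a c b)" "\<lambda>a c b. split_left (wtpart 1) (wsg deg a) b (deconc c)"])
  show "lin (\<lambda>a. split_left (wtpart 1) (wsg deg a) b (deconc c))" for c and b :: "'a list \<Rightarrow>\<^sub>0 'b"
    unfolding linext_def split_def split_left_def by (intro lin_intros)
  show "lin (\<lambda>b. split_left (wtpart 1) (wsg deg a) b (deconc c))" for c and a :: "'a list \<Rightarrow>\<^sub>0 'b"
    unfolding linext_def split_def split_left_def by (intro lin_intros)
  fix u w v :: "'a list"
  show "Lt deg (tensor3 (bas u) (bas w) (bas v)) = (split_left (wtpart 1) (wsg deg (bas u)) (bas v) (deconc (bas w)) :: _ \<Rightarrow>\<^sub>0 'b)"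
    unfolding split_left_def
    by (subst linext_deconc_prefix[of 1]; cases w)
      (auto simp: Lt_def lin_zero[OF lin_tensor3(1)[OF lin_ident]] lin_scale[OF lin_tensor3(1)[OF lin_ident]] scale_mult_left)
qed (intro lin_intros)+

text \<open>Splitting off two letters one after the other is splitting off a word of length two, with the sign
  of \<open>susp2\<close>.\<close>

lemma Rt_Rt: "Rt deg (Rt deg (tensor3 (bas u) c (bas v))) = - split_right (susp2 deg) (bas u) (bas v) (deconc c)"
proof (rule lin_ext[of "\<lambda>c. Rt deg (Rt deg (tensor3 (bas u) c (bas v)))" "\<lambda>c. - split_right (susp2 deg) (bas u) (bas v) (deconc c)"])
  fix w
  show "Rt deg (Rt deg (tensor3 (bas u) (bas w) (bas v))) = - split_right (susp2 deg) (bas u) (bas v) (deconc (bas w :: _ \<Rightarrow>\<^sub>0 'b))"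
  proof (cases "2 \<le> length w")
    case True
    then obtain w' x y where w: "w = w' @ [x, y]"
      by (metis append_Cons append_Nil append_assoc length_0_conv length_append_singleton not_less_eq_eq numeral_2_eq_2 rev_exhaust le_zero_eq nat.distinct(1) Suc_le_mono)
    show ?thesis unfolding split_right_def
      by (subst linext_deconc_suffix[of 2])
        (auto simp: w Rt_def lin_zero[OF lin_tensor3(3)[OF lin_ident]] susp2_bas butlast_append lin_scale[OF lin_linext0]
          lin_scale[OF lin_tensor3(3)[OF lin_ident]] scale_mult_left ksgn_add algebra_simps)
  next
    case False
    then have "w = [] \<or> (\<exists>x. w = [x])" by (cases w; cases "tl w") auto
    then show ?thesis unfolding split_right_def
      by (subst linext_deconc_suffix[of 2])
        (auto simp: Rt_def lin_zero[OF lin_tensor3(3)[OF lin_ident]] susp2_bas lin_scale[OF lin_linext0])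
  qed
qed (intro lin_intros)+

lemma Lt_Lt: "Lt deg (Lt deg (tensor3 (bas u) c (bas v))) = split_left (susp2 deg) (bas u) (bas v) (deconc c)"
proof (rule lin_ext[of "\<lambda>c. Lt deg (Lt deg (tensor3 (bas u) c (bas v)))" "\<lambda>c. split_left (susp2 deg) (bas u) (bas v) (deconc c)"])
  fix w :: "'a list"
  show "Lt deg (Lt deg (tensor3 (bas u) (bas w) (bas v))) = split_left (susp2 deg) (bas u) (bas v) (deconc (bas w :: _ \<Rightarrow>\<^sub>0 'b))"
  proof (cases "\<exists>x y w'. w = x # y # w'")
    case True
    then obtain x y w' where w: "w = x # y # w'" by blast
    show ?thesis unfolding split_left_def
      by (subst linext_deconc_prefix[of 2])
        (auto simp: w Lt_def lin_zero[OF lin_tensor3(1)[OF lin_ident]] susp2_bas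
          lin_scale[OF lin_tensor3(1)[OF lin_ident]] scale_mult_right ksgn_add algebra_simps)
  next
    case False
    then have "w = [] \<or> (\<exists>x. w = [x])" by (cases w; cases "tl w") auto
    then show ?thesis unfolding split_left_def
      by (subst linext_deconc_prefix[of 2])
        (auto simp: Lt_def lin_zero[OF lin_tensor3(1)[OF lin_ident]] susp2_bas)
  qed
qed (intro lin_intros)+

lemma Rt_Lt: "Rt deg (Lt deg x) + Lt deg (Rt deg x) = 0"
proof -
  have "Rt deg (Lt deg x) + Lt deg (Rt deg x) = (\<lambda>_. 0) x"
  proof (rule lin_ext[of "\<lambda>x. Rt deg (Lt deg x) + Lt deg (Rt deg x)"])
    fix t :: "'a list \<times> 'a list \<times> 'a list"
    obtain u w v where t: "t = (u, w, v)" by (cases t)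
    show "Rt deg (Lt deg (bas t)) + Lt deg (Rt deg (bas t)) = (0 :: _ \<Rightarrow>\<^sub>0 'b)"
      by (cases w; cases "tl w = []") (auto simp: t Rt_def Lt_def lin_scale[OF lin_linext0] ksgn_add algebra_simps)
  qed (intro lin_intros)+
  then show ?thesis by simp
qed

lemma xi_Rt_Lt: "xi (Rt deg x - Lt deg x) = 0"
proof -
  have "xi (Rt deg x - Lt deg x) = (\<lambda>_. 0) x"
  proof (rule lin_ext[of "\<lambda>x. xi (Rt deg x - Lt deg x)"])
    fix t :: "'a list \<times> 'a list \<times> 'a list"
    obtain u w v where t: "t = (u, w, v)" by (cases t)
    show "xi (Rt deg (bas t) - Lt deg (bas t)) = (0 :: _ \<Rightarrow>\<^sub>0 'b)"
      by (cases w; cases "tl w = []")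
        (auto simp: t Rt_def Lt_def xi_def lin_scale[OF lin_linext0] lin_minus[OF lin_linext0] ksgn_add algebra_simps)
  qed (intro lin_intros)+
  then show ?thesis by simp
qed

context quadratic
begin

abbreviation num_space :: "('x list \<times> 'x list \<times> 'x list \<Rightarrow>\<^sub>0 'k) set" where
  "num_space \<equiv> tens3 UNIV C UNIV"

definition den_space :: "('x list \<Rightarrow>\<^sub>0 'k) set \<Rightarrow> ('x list \<times> 'x list \<times> 'x list \<Rightarrow>\<^sub>0 'k) set" where
  "den_space J = pm.span {tensor3 a c b | a c b. c \<in> C \<and> (a \<in> J \<or> b \<in> J)}"

lemma subspace_den [simp]: "pm.subspace (den_space J)"
  unfolding den_space_def by (rule pm.subspace_span)

lemma den_left: "a \<in> J \<Longrightarrow> c \<in> C \<Longrightarrow> tensor3 a c b \<in> den_space J"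
  and den_right: "b \<in> J \<Longrightarrow> c \<in> C \<Longrightarrow> tensor3 a c b \<in> den_space J"
  unfolding den_space_def by (rule pm.span_base, blast)+

lemma den_into:
  assumes "x \<in> den_space J" "lin f" "pm.subspace T"
    "\<And>a c b. c \<in> C \<Longrightarrow> a \<in> J \<Longrightarrow> f (tensor3 a c b) \<in> T" "\<And>a c b. c \<in> C \<Longrightarrow> b \<in> J \<Longrightarrow> f (tensor3 a c b) \<in> T"
  shows "f x \<in> T"
  using assms(1) unfolding den_space_def by (rule lin_span_into[OF _ assms(2,3)]) (use assms(4,5) in blast)

lemma tens3_den: "x \<in> tens3 J C UNIV \<Longrightarrow> x \<in> den_space J" "x \<in> tens3 UNIV C J \<Longrightarrow> x \<in> den_space J"
  by (erule tens3_into[OF _ lin_ident subspace_den]; rule den_left den_right; assumption)+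

lemma den_num: "x \<in> den_space J \<Longrightarrow> x \<in> num_space"
  by (erule den_into[OF _ lin_ident subspace_tens3]) (rule tensor3_in; simp)+

lemma split_right_den:
  assumes "lin \<rho>" "\<And>c. c \<in> C \<Longrightarrow> \<rho> c \<in> two_sided_ideal J" "c \<in> C"
  shows "split_right \<rho> a b (deconc c) \<in> den_space (two_sided_ideal J)"
  by (rule tens2_into[OF deconc_C[OF assms(3)] lin_split(1)[OF lin_ident] subspace_den])
    (simp add: split_right_tensor2[OF assms(1)] den_right ideal_mult_right assms(2))

lemma split_left_den:
  assumes "lin \<rho>" "\<And>c. c \<in> C \<Longrightarrow> \<rho> c \<in> two_sided_ideal J" "c \<in> C"
  shows "split_left \<rho> a b (deconc c) \<in> den_space (two_sided_ideal J)"
  by (rule tens2_into[OF deconc_C[OF assms(3)] lin_split(2)[OF lin_ident] subspace_den])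
    (simp add: split_left_tensor2[OF assms(1)] den_left ideal_mult_left assms(2))

lemma num_into:
  assumes "x \<in> num_space" "lin f" "pm.subspace T" "\<And>u c v. c \<in> C \<Longrightarrow> f (tensor3 (bas u) c (bas v)) \<in> T"
  shows "f x \<in> T"
proof (rule tens3_into[OF assms(1-3)])
  fix a c b :: "'x list \<Rightarrow>\<^sub>0 'k" assume c: "c \<in> C"
  have 1: "f (tensor3 (bas u) c b) \<in> T" for u
  proof (rule lin_in_subspace[of "\<lambda>b. f (tensor3 (bas u) c b)", OF _ assms(3)])
    show "lin (\<lambda>b. f (tensor3 (bas u) c b))" by (rule lin_compose[OF assms(2)]) (intro lin_intros)
  qed (rule assms(4)[OF c])
  show "f (tensor3 a c b) \<in> T"
  proof (rule lin_in_subspace[of "\<lambda>a. f (tensor3 a c b)", OF _ assms(3)])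
    show "lin (\<lambda>a. f (tensor3 a c b))" by (rule lin_compose[OF assms(2)]) (intro lin_intros)
  qed (rule 1)
qed

lemma Rt_num: "x \<in> num_space \<Longrightarrow> Rt deg x \<in> num_space"
  and Lt_num: "x \<in> num_space \<Longrightarrow> Lt deg x \<in> num_space"
proof -
  have L: "Lt deg (tensor3 a c b) \<in> num_space" if c: "c \<in> C" for a c b
    unfolding Lt_tensor3
    by (rule tens2_into[OF deconc_C[OF c] lin_split(2)[OF lin_ident] subspace_tens3])
      (simp add: split_left_tensor2[OF lin_wtpart[OF lin_ident]] tensor3_in)
  show "x \<in> num_space \<Longrightarrow> Lt deg x \<in> num_space"
    by (erule tens3_into[OF _ lin_Lt[OF lin_ident] subspace_tens3]) (rule L)
  have R: "Rt deg (tensor3 a c b) \<in> num_space" if c: "c \<in> C" for a c b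
    unfolding Rt_tensor3
  proof (rule tens2_into[OF deconc_C[OF c] _ subspace_tens3])
    let ?f = "linext (\<lambda>(w1, w2). tensor3 (wsg deg a) (sg deg (bas w1)) (wtpart 1 (bas w2) * b))"
    show lf: "lin ?f" by (intro lin_intros)
    have "?f (tensor2 p q) = tensor3 (wsg deg a) (sg deg p) (wtpart 1 q * b)" for p q
      by (rule bilinear_ext[of "\<lambda>p q. ?f (tensor2 p q)" "\<lambda>p q. tensor3 (wsg deg a) (sg deg p) (wtpart 1 q * b)"])
        ((intro lin_intros lin_compose[OF lf])+, simp)
    then show "?f (tensor2 p q) \<in> num_space" if "p \<in> C" for p q
      using that by (simp add: tensor3_in graded_by_sg[OF graded_C_sdeg])
  qed
  show "x \<in> num_space \<Longrightarrow> Rt deg x \<in> num_space"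
    by (erule tens3_into[OF _ lin_Rt[OF lin_ident] subspace_tens3]) (rule R)
qed

lemma Rt_den:
  assumes "graded_by (wdeg deg) (two_sided_ideal J)" "x \<in> den_space (two_sided_ideal J)"
  shows "Rt deg x \<in> den_space (two_sided_ideal J)"
proof (rule den_into[OF assms(2) lin_Rt[OF lin_ident] subspace_den])
  fix a c b :: "'x list \<Rightarrow>\<^sub>0 'k" assume c: "c \<in> C"
  let ?f = "\<lambda>b. linext (\<lambda>(w1, w2). tensor3 (wsg deg a) (sg deg (bas w1)) (wtpart 1 (bas w2) * b))"
  have lf: "lin (?f b)" for b by (intro lin_intros)
  have f: "?f b (tensor2 p q) = tensor3 (wsg deg a) (sg deg p) (wtpart 1 q * b)" for p q b
    by (rule bilinear_ext[of "\<lambda>p q. ?f b (tensor2 p q)" "\<lambda>p q. tensor3 (wsg deg a) (sg deg p) (wtpart 1 q * b)"])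
      ((intro lin_intros lin_compose[OF lf])+, simp)
  have "?f b (deconc c) \<in> den_space (two_sided_ideal J)" if "a \<in> two_sided_ideal J \<or> b \<in> two_sided_ideal J" for b
  proof (rule tens2_into[OF deconc_C[OF c] lf subspace_den])
    fix p q :: "'x list \<Rightarrow>\<^sub>0 'k" assume "p \<in> C"
    then have p: "sg deg p \<in> C" by (rule graded_by_sg[OF graded_C_sdeg])
    from that show "?f b (tensor2 p q) \<in> den_space (two_sided_ideal J)"
    proof
      assume "a \<in> two_sided_ideal J"
      then show ?thesis unfolding f by (intro den_left p graded_by_wsg[OF assms(1)])
    next
      assume "b \<in> two_sided_ideal J"
      then show ?thesis unfolding f by (intro den_right p ideal_mult_left)
    qed
  qed
  then show "a \<in> two_sided_ideal J \<Longrightarrow> Rt deg (tensor3 a c b) \<in> den_space (two_sided_ideal J)"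
    "b \<in> two_sided_ideal J \<Longrightarrow> Rt deg (tensor3 a c b) \<in> den_space (two_sided_ideal J)"
    unfolding Rt_tensor3 by simp_all
qed

lemma Lt_den:
  assumes "graded_by (wdeg deg) (two_sided_ideal J)" "x \<in> den_space (two_sided_ideal J)"
  shows "Lt deg x \<in> den_space (two_sided_ideal J)"
proof (rule den_into[OF assms(2) lin_Lt[OF lin_ident] subspace_den])
  fix a c b :: "'x list \<Rightarrow>\<^sub>0 'k" assume c: "c \<in> C"
  have "split_left (wtpart 1) (wsg deg a) b (deconc c) \<in> den_space (two_sided_ideal J)"
    if "a \<in> two_sided_ideal J \<or> b \<in> two_sided_ideal J" for b
  proof (rule tens2_into[OF deconc_C[OF c] lin_split(2)[OF lin_ident] subspace_den])
    fix p q :: "'x list \<Rightarrow>\<^sub>0 'k" assume q: "q \<in> C"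
    from that show "split_left (wtpart 1) (wsg deg a) b (tensor2 p q) \<in> den_space (two_sided_ideal J)"
    proof
      assume "a \<in> two_sided_ideal J"
      then show ?thesis unfolding split_left_tensor2[OF lin_wtpart[OF lin_ident]]
        by (intro den_left q ideal_mult_right graded_by_wsg[OF assms(1)])
    next
      assume "b \<in> two_sided_ideal J"
      then show ?thesis unfolding split_left_tensor2[OF lin_wtpart[OF lin_ident]]
        by (intro den_right q)
    qed
  qed
  then show "a \<in> two_sided_ideal J \<Longrightarrow> Lt deg (tensor3 a c b) \<in> den_space (two_sided_ideal J)"
    "b \<in> two_sided_ideal J \<Longrightarrow> Lt deg (tensor3 a c b) \<in> den_space (two_sided_ideal J)"
    unfolding Lt_tensor3 by simp_all
qed

end

lemma tens3_graded_part:
  assumes A: "graded_by f A" and B: "graded_by g B" and E: "graded_by h E" and x: "x \<in> tens3 A B E"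
  shows "part (\<lambda>(u, w, v). P (f u) (g w) (h v)) x \<in> tens3 A B E"
proof -
  let ?x = "part (\<lambda>(u, w, v). P (f u) (g w) (h v)) x"
  note s = graded_by_subspace[OF A] graded_by_subspace[OF B] graded_by_subspace[OF E]
  have 1: "slice1 wv ?x = part (\<lambda>u. P (f u) (g (fst wv)) (h (snd wv))) (slice1 wv x)" for wv
    by (rule poly_mapping_eqI) (simp add: case_prod_beta)
  have 2: "slice1 v (slice2 u ?x) = part (\<lambda>w. P (f u) (g w) (h v)) (slice1 v (slice2 u x))" for u v
    by (rule poly_mapping_eqI) simp
  have 3: "slice2 w (slice2 u ?x) = part (\<lambda>v. P (f u) (g w) (h v)) (slice2 w (slice2 u x))" for u w
    by (rule poly_mapping_eqI) simp
  have "slice1 wv x \<in> A" "slice1 v (slice2 u x) \<in> B" "slice2 w (slice2 u x) \<in> E" for u w v wv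
    using x unfolding tens3_iff[OF s] by blast+
  then show ?thesis
    unfolding tens3_iff[OF s] 1 2 3
    using graded_byD[OF A, of _ "\<lambda>n. P n _ _"] graded_byD[OF E, of _ "\<lambda>n. P _ _ n"]
      graded_byD[OF B, of _ "\<lambda>n. P _ n _"] by blast
qed

lemma graded_UNIV [simp]: "graded_by g UNIV"
  by (simp add: graded_by_def)

context quadratic
begin

lemma num_part: "x \<in> num_space \<Longrightarrow> part (\<lambda>(u, w, v). P (length u) (length w) (length v)) x \<in> num_space"
  by (rule tens3_graded_part) (simp_all add: graded_C_length)

lemma den_graded_part:
  assumes J: "graded_by f J" and C: "graded_by g C" and x: "x \<in> den_space J"
  shows "part (\<lambda>(u, w, v). P (f u) (g w) (f v)) x \<in> den_space J"
proof (rule den_into[OF x lin_part[OF lin_ident] subspace_den])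
  fix a c b :: "'x list \<Rightarrow>\<^sub>0 'k" assume c: "c \<in> C"
  show "part (\<lambda>(u, w, v). P (f u) (g w) (f v)) (tensor3 a c b) \<in> den_space J" if "a \<in> J"
    by (rule tens3_den(1)[OF tens3_graded_part[OF J C graded_UNIV]]) (use that c in \<open>auto intro: tensor3_in\<close>)
  show "part (\<lambda>(u, w, v). P (f u) (g w) (f v)) (tensor3 a c b) \<in> den_space J" if "b \<in> J"
    by (rule tens3_den(2)[OF tens3_graded_part[OF graded_UNIV C J]]) (use that c in \<open>auto intro: tensor3_in\<close>)
qed

lemmas den_part = den_graded_part[OF _ graded_C_length]

end

lemma part_Rt: "part (\<lambda>(u, w, v). length u = i \<and> length u + length w + length v = n) (Rt deg x) =
    Rt deg (part (\<lambda>(u, w, v). length u = i \<and> length u + length w + length v = n) x)"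
proof (rule lin_ext[of "\<lambda>x. part (\<lambda>(u, w, v). length u = i \<and> length u + length w + length v = n) (Rt deg x)"
      "\<lambda>x. Rt deg (part (\<lambda>(u, w, v). length u = i \<and> length u + length w + length v = n) x)"])
  fix t :: "'a list \<times> 'a list \<times> 'a list"
  obtain u w v where t: "t = (u, w, v)" by (cases t)
  show "part (\<lambda>(u, w, v). length u = i \<and> length u + length w + length v = n) (Rt deg (bas t)) =
    Rt deg (part (\<lambda>(u, w, v). length u = i \<and> length u + length w + length v = n) (bas t :: _ \<Rightarrow>\<^sub>0 'b))"
    by (cases w rule: rev_cases) (auto simp: t Rt_def part_scale)
qed (intro lin_intros)+

lemma slice2_Rt: "slice2 u (Rt deg x) = scale (ksgn (wdeg deg u)) (right_twist deg (slice2 u x))"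
proof (rule lin_ext[of "\<lambda>x. slice2 u (Rt deg x)" "\<lambda>x. scale (ksgn (wdeg deg u)) (right_twist deg (slice2 u x))"])
  fix t :: "'a list \<times> 'a list \<times> 'a list"
  obtain u' w v where t: "t = (u', w, v)" by (cases t)
  show "slice2 u (Rt deg (bas t)) = scale (ksgn (wdeg deg u)) (right_twist deg (slice2 u (bas t :: _ \<Rightarrow>\<^sub>0 'b)))"
    by (auto simp: t Rt_def slice_bas right_twist_def ksgn_add)
qed (intro lin_intros)+

context koszul_quadratic
begin

abbreviation num_weight :: "nat \<Rightarrow> ('x list \<times> 'x list \<times> 'x list \<Rightarrow>\<^sub>0 'k) set" where
  "num_weight n \<equiv> {x \<in> num_space. \<forall>(u, w, v)\<in>supp x. length u + length w + length v = n}"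

lemma graded_IQ_length: "graded_by length IQ"
proof (rule graded_ideal)
  show "graded_by length Q"
  proof (rule graded_byI[OF subspace_Q])
    fix p t assume "p \<in> Q"
    have "part (\<lambda>w. length w = t) (wtpart 2 p) = (if t = 2 then wtpart 2 p else 0)"
      by (rule poly_mapping_eqI) simp
    then show "part (\<lambda>w. length w = t) p \<in> Q"
      using \<open>p \<in> Q\<close> weight_Q[OF \<open>p \<in> Q\<close>] by (simp add: pm.subspace_0[OF subspace_Q] split: if_splits)
  qed
qed simp

lemma graded_IQ: "graded_by (wdeg deg) IQ"
  by (rule graded_ideal[OF graded_Q]) simp

text \<open>Taking the tensor product with \<open>T(V)\<close> modulo the ideal on the left preserves exactness: a linear
  projection with kernel the ideal reduces the left factor to normal forms, whose coefficients are treated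
  one at a time.\<close>

lemma left_layer_exact:
  assumes x: "x \<in> num_space" and supp: "\<And>u w v. (u, w, v) \<in> supp x \<Longrightarrow>
      length u = i \<and> length u + length w + length v = n \<and> (w, v) \<noteq> ([], [])"
    and Rx: "Rt deg x \<in> den_space IQ"
  shows "\<exists>y\<in>num_space. (\<forall>(u, w, v)\<in>supp y. length u = i \<and> length u + length w + length v = n) \<and>
    x - Rt deg y \<in> den_space IQ"
proof -
  obtain P where P: "lin P" "\<And>t. P t \<in> IQ" "\<And>t. t \<in> IQ \<Longrightarrow> P t = t"
    "\<And>u u'. u' \<in> supp (P (bas u)) \<Longrightarrow> wdeg deg u' = wdeg deg u"
    using graded_projection_exists[OF graded_IQ] by blast
  define N where "N t = t - P t" for t
  have linN: "lin N" unfolding N_def by (intro lin_intros P(1))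
  have N0: "N t = 0" if "t \<in> IQ" for t using P(3)[OF that] by (simp add: N_def)
  define N3 where "N3 = linext (\<lambda>(u, w :: 'x list, v :: 'x list). tensor3 (N (bas u)) (bas w) (bas v))"
  have linN3: "lin N3" unfolding N3_def by (intro lin_intros)
  have N3: "N3 (tensor3 a c b) = tensor3 (N a) c b" for a c b
    by (rule trilinear_ext[of "\<lambda>a c b. N3 (tensor3 a c b)" "\<lambda>a c b. tensor3 (N a) c b"])
      ((intro lin_intros lin_compose[OF linN3] linN)+, simp add: N3_def)
  have comm: "Rt deg (N3 y) = N3 (Rt deg y)" for y
  proof (rule lin_ext[of "\<lambda>y. Rt deg (N3 y)" "\<lambda>y. N3 (Rt deg y)"])
    fix t :: "'x list \<times> 'x list \<times> 'x list"
    obtain u w v where t: "t = (u, w, v)" by (cases t)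
    have "Rt deg (tensor3 (N (bas u)) (bas w) (bas v)) =
        (if w = [] then 0 else scale (ksgn (wdeg deg u + sdeg deg (butlast w))) (tensor3 (N (bas u)) (bas (butlast w)) (bas (last w # v))))"
    proof (rule lin_ext_supp[of "\<lambda>a. Rt deg (tensor3 a (bas w) (bas v))" "\<lambda>a. if w = [] then 0 else
        scale (ksgn (wdeg deg u + sdeg deg (butlast w))) (tensor3 a (bas (butlast w)) (bas (last w # v)))"])
      fix u' assume u': "u' \<in> supp (N (bas u))"
      have "wdeg deg u' = wdeg deg u"
      proof (cases "u' \<in> supp (P (bas u))")
        case True then show ?thesis by (rule P(4))
      next
        case False
        then show ?thesis using u' by (simp add: N_def in_keys_iff lookup_minus cf_bas split: if_splits)
      qed
      then show "Rt deg (tensor3 (bas u') (bas w) (bas v)) = (if w = [] then 0 else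
          scale (ksgn (wdeg deg u + sdeg deg (butlast w))) (tensor3 (bas u') (bas (butlast w)) (bas (last w # v))))"
        by (simp add: Rt_def)
    qed (intro lin_intros)+
    then show "Rt deg (N3 (bas t)) = N3 (Rt deg (bas t))"
      by (simp add: t N3_def Rt_def)
  qed (intro lin_intros lin_compose[OF linN3] linN3)+
  let ?x = "N3 x"
  have x'_in: "?x \<in> num_space"
    by (rule tens3_into[OF x linN3 subspace_tens3]) (simp add: N3 tensor3_in)
  have diff: "x - ?x \<in> den_space IQ"
  proof (rule tens3_into[OF x, of "\<lambda>x. x - N3 x"])
    fix a c b :: "'x list \<Rightarrow>\<^sub>0 'k" assume c: "c \<in> C"
    have "tensor3 a c b - N3 (tensor3 a c b) = tensor3 (P a) c b"
      by (simp add: N3 N_def lin_minus[OF lin_tensor3(1)[OF lin_ident]])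
    then show "tensor3 a c b - N3 (tensor3 a c b) \<in> den_space IQ"
      by (simp add: den_left P(2) c)
  qed (intro lin_intros linN3, simp)
  have "N3 (Rt deg x) \<in> tens3 UNIV C IQ"
    by (rule den_into[OF Rx linN3 subspace_tens3]) (simp_all add: N3 N0 tensor3_in pm.subspace_0 lin_zero[OF lin_tensor3(1)[OF lin_ident]])
  then have Rx': "slice2 u (Rt deg ?x) \<in> tens2 C IQ" for u
    by (simp add: comm tens3_eq_tens2 tens2_iff)
  have "\<exists>y\<in>tens2 C UNIV. slice2 u ?x - dR y \<in> tens2 C IQ" for u
  proof (rule right_koszul_exact)
    show "slice2 u ?x \<in> tens2 C UNIV" using x'_in by (simp add: tens3_eq_tens2 tens2_iff)
    have "scale (ksgn (wdeg deg u)) (slice2 u (Rt deg ?x)) = dR (slice2 u ?x)"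
      by (simp add: slice2_Rt)
    then show "dR (slice2 u ?x) \<in> tens2 C IQ" using pm.subspace_scale[OF subspace_tens2 Rx'[of u], of "ksgn (wdeg deg u)"] by simp
    have "slice1 ([], []) (N3 x) = N (slice1 ([], []) x)"
    proof (rule lin_ext[of "\<lambda>x. slice1 ([], []) (N3 x)" "\<lambda>x. N (slice1 ([], []) x)"])
      fix t :: "'x list \<times> 'x list \<times> 'x list"
      obtain u w v where t: "t = (u, w, v)" by (cases t)
      show "slice1 ([], []) (N3 (bas t)) = N (slice1 ([], []) (bas t))"
        by (auto simp: t N3_def tensor3_def slice_bas slice1_tensor2 cf_bas lin_zero[OF linN])
    qed (intro lin_intros lin_compose[OF linN] linN3)+
    also have "slice1 ([], []) x = 0"
      using supp by (intro poly_mapping_eqI) (auto simp: in_keys_iff)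
    finally have "cf (slice1 ([], []) ?x) u = 0" by (simp add: lin_zero[OF linN] del: cf_pslice1)
    then show "cf (slice2 u ?x) ([], []) = 0" by simp
  qed
  then obtain Y where Y: "\<And>u. Y u \<in> tens2 C UNIV" "\<And>u. slice2 u ?x - dR (Y u) \<in> tens2 C IQ" by metis
  let ?U = "fst ` supp ?x"
  define y where "y = (\<Sum>u\<in>?U. tensor2 (bas u) (scale (ksgn (wdeg deg u)) (Y u)))"
  have y_in: "y \<in> num_space"
    unfolding y_def tens3_eq_tens2 by (intro pm.subspace_sum subspace_tens2 tensor2_in UNIV_I pm.subspace_scale Y)
  have slice_y: "slice2 u y = (if u \<in> ?U then scale (ksgn (wdeg deg u)) (Y u) else 0)" for u
  proof -
    have A: "slice2 u (tensor2 (bas u') t) = (if u = u' then t else 0)" for u' and t :: "'x list \<times> 'x list \<Rightarrow>\<^sub>0 'k"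
      by (simp add: slice2_tensor2 cf_bas)
    have "slice2 u y = (\<Sum>u'\<in>?U. slice2 u (tensor2 (bas u') (scale (ksgn (wdeg deg u')) (Y u'))))"
      unfolding y_def by (rule lin_sum[OF lin_slices(5)[OF lin_ident]])
    also have "\<dots> = (\<Sum>u'\<in>?U. if u' = u then scale (ksgn (wdeg deg u)) (Y u) else 0)"
      unfolding A by (intro sum.cong) auto
    also have "\<dots> = (if u \<in> ?U then scale (ksgn (wdeg deg u)) (Y u) else 0)"
      by (rule sum.delta) simp
    finally show ?thesis .
  qed
  have "slice2 u (?x - Rt deg y) \<in> tens2 C IQ" for u
  proof (cases "u \<in> ?U")
    case True
    then have "slice2 u (?x - Rt deg y) = slice2 u ?x - dR (Y u)"
      by (simp add: lin_minus[OF lin_slices(5)[OF lin_ident]] slice2_Rt slice_y lin_scale[OF lin_right_twist[OF lin_ident]])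
    then show ?thesis using Y(2) by simp
  next
    case False
    have "slice2 u ?x = 0"
    proof (rule poly_mapping_eqI)
      fix j show "cf (slice2 u ?x) j = cf 0 j" using False by (force simp: in_keys_iff image_iff)
    qed
    then show ?thesis using False
      by (simp add: lin_minus[OF lin_slices(5)[OF lin_ident]] slice2_Rt slice_y lin_zero[OF lin_right_twist[OF lin_ident]] pm.subspace_0)
  qed
  then have "?x - Rt deg y \<in> tens3 UNIV C IQ"
    by (simp add: tens3_eq_tens2 tens2_iff)
  from pm.subspace_add[OF subspace_den diff tens3_den(2)[OF this]]
  have xy: "x - Rt deg y \<in> den_space IQ" by simp
  let ?P = "\<lambda>(u, w, v). length u = i \<and> length u + length w + length v = n"
  have "part ?P (x - Rt deg y) \<in> den_space IQ"
    using den_part[OF graded_IQ_length xy, of "\<lambda>a b c. a = i \<and> a + b + c = n"] by simp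
  moreover have "part ?P x = x" by (rule part_id) (use supp in auto)
  ultimately have "x - Rt deg (part ?P y) \<in> den_space IQ" unfolding part_minus part_Rt by simp
  moreover have "part ?P y \<in> num_space" using num_part[OF y_in, of "\<lambda>a b c. a = i \<and> a + b + c = n"] by simp
  ultimately show ?thesis by (intro bexI[of _ "part ?P y"]) (auto simp: supp_part)
qed

lemma square_den: "x \<in> num_space \<Longrightarrow> (Rt deg (Rt deg x - Lt deg x) - Lt deg (Rt deg x - Lt deg x)) \<in> den_space IQ"
proof (erule num_into)
  show "lin (\<lambda>x. Rt deg (Rt deg x - Lt deg x) - Lt deg (Rt deg x - Lt deg x))" by (intro lin_intros)
  fix u c v assume c: "c \<in> C"
  have "susp2 deg c \<in> IQ" if "c \<in> C" for c
    using C_weight2[OF that] susp2_S_iff[of "wtpart 2 c"] by (auto intro: ideal_base')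
  then have 1: "split_right (susp2 deg) (bas u) (bas v) (deconc c) \<in> den_space IQ"
    "split_left (susp2 deg) (bas u) (bas v) (deconc c) \<in> den_space IQ"
    by (intro split_right_den split_left_den lin_susp2 lin_ident c; assumption)+
  let ?x = "tensor3 (bas u) c (bas v)"
  have "Rt deg (Rt deg ?x - Lt deg ?x) - Lt deg (Rt deg ?x - Lt deg ?x) =
      Rt deg (Rt deg ?x) + Lt deg (Lt deg ?x) - (Rt deg (Lt deg ?x) + Lt deg (Rt deg ?x))"
    by (simp add: lin_minus[OF lin_Rt[OF lin_ident]] lin_minus[OF lin_Lt[OF lin_ident]])
  also have "\<dots> = split_left (susp2 deg) (bas u) (bas v) (deconc c) - split_right (susp2 deg) (bas u) (bas v) (deconc c)"
    by (simp add: Rt_Rt Lt_Lt Rt_Lt)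
  finally show "Rt deg (Rt deg ?x - Lt deg ?x) - Lt deg (Rt deg ?x - Lt deg ?x) \<in> den_space IQ"
    using 1 by (simp add: pm.subspace_diff)
qed simp

text \<open>Filter by the weight of the left factor. \<open>Lt\<close> raises it, so on the lowest layer the
  differential is \<open>Rt\<close> and \<open>left_layer_exact\<close> applies; subtracting the boundary raises
  the lowest layer. When the left factor carries all of the weight, the element is \<open>xi x \<otimes> 1
  \<otimes> 1\<close>.\<close>

lemma bimodule_koszul_exact:
  assumes "x \<in> num_weight n" "Rt deg x - Lt deg x \<in> den_space IQ" "xi x \<in> IQ"
  shows "\<exists>y\<in>num_weight n. x - (Rt deg y - Lt deg y) \<in> den_space IQ"
proof -
  have "\<exists>y\<in>num_weight n. x - (Rt deg y - Lt deg y) \<in> den_space IQ"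
    if "x \<in> num_weight n" "Rt deg x - Lt deg x \<in> den_space IQ" "xi x \<in> IQ"
      "\<And>u w v. (u, w, v) \<in> supp x \<Longrightarrow> i \<le> length u" "k + i = Suc n" for x i k
    using that
  proof (induction k arbitrary: x i)
    case 0
    have "x = 0"
    proof (rule ccontr)
      assume "x \<noteq> 0"
      then obtain u w v where "(u, w, v) \<in> supp x" by (metis all_not_in_conv keys_eq_empty prod_cases3)
      then show False using 0 by force
    qed
    then show ?case by (intro bexI[of _ 0]) (auto simp: pm.subspace_0 lin_zero[OF lin_Rt[OF lin_ident]] lin_zero[OF lin_Lt[OF lin_ident]])
  next
    case (Suc k)
    have x_in: "x \<in> num_space" and x_weight: "\<And>u w v. (u, w, v) \<in> supp x \<Longrightarrow> length u + length w + length v = n"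
      using Suc.prems(1) by auto
    show ?case
    proof (cases "i = n")
      case True
      have eq: "x = tensor3 (xi x) (bas []) (bas [])"
      proof (rule lin_ext_supp[of "\<lambda>x. x" "\<lambda>x. tensor3 (xi x) (bas []) (bas [])"])
        fix t assume "t \<in> supp x"
        moreover obtain u w v where "t = (u, w, v)" by (cases t)
        ultimately have "t = (u, [], [])" using x_weight[of u w v] Suc.prems(4)[of u w v] True by auto
        then show "bas t = tensor3 (xi (bas t)) (bas []) (bas [])" by (simp add: xi_def)
      qed (intro lin_intros)+
      have "x \<in> den_space IQ" by (subst eq) (intro den_left Suc.prems C_bas_Nil)
      then show ?thesis
        by (intro bexI[of _ 0]) (auto simp: pm.subspace_0 lin_zero[OF lin_Rt[OF lin_ident]] lin_zero[OF lin_Lt[OF lin_ident]])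
    next
      case False
      then have i: "i < n" using Suc.prems(5) by simp
      let ?P = "\<lambda>(u, w, v). length u = i \<and> length u + length w + length v = n"
      let ?x = "part ?P x"
      have x'_in: "?x \<in> num_space" using num_part[OF x_in, of "\<lambda>a b c. a = i \<and> a + b + c = n"] by simp
      have supp': "length u = i \<and> length u + length w + length v = n \<and> (w, v) \<noteq> ([], [])"
        if "(u, w, v) \<in> supp ?x" for u w v
        using that i by (auto simp: supp_part)
      have "part ?P (Lt deg x) = (\<lambda>_. 0) x"
      proof (rule lin_ext_supp[of "\<lambda>x. part ?P (Lt deg x)"])
        fix t assume t: "t \<in> supp x"
        obtain u w v where "t = (u, w, v)" by (cases t)
        then show "part ?P (Lt deg (bas t)) = 0" using Suc.prems(4)[of u w v] t by (simp add: Lt_def part_scale)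
      qed (intro lin_intros)+
      then have "Rt deg ?x = part ?P (Rt deg x - Lt deg x)" unfolding part_minus part_Rt by simp
      then have "Rt deg ?x \<in> den_space IQ"
        using den_part[OF graded_IQ_length Suc.prems(2), of "\<lambda>a b c. a = i \<and> a + b + c = n"] by simp
      from left_layer_exact[OF x'_in supp' this] obtain y where y: "y \<in> num_space"
        "\<And>u w v. (u, w, v) \<in> supp y \<Longrightarrow> length u = i \<and> length u + length w + length v = n"
        "?x - Rt deg y \<in> den_space IQ" by fast
      let ?e = "?x - Rt deg y"
      let ?x1 = "x - (Rt deg y - Lt deg y) - ?e"
      have x1_eq: "?x1 = (x - ?x) + Lt deg y" by simp
      have supp1: "Suc i \<le> length u \<and> length u + length w + length v = n" if t: "(u, w, v) \<in> supp ?x1" for u w v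
      proof -
        have "(u, w, v) \<in> supp (x - ?x) \<or> (u, w, v) \<in> supp (Lt deg y)"
          using t unfolding x1_eq by (auto simp: in_keys_iff lookup_add)
        then show ?thesis
        proof
          assume "(u, w, v) \<in> supp (x - ?x)"
          then have "(u, w, v) \<in> supp x" "\<not> ?P (u, w, v)" by (auto simp: in_keys_iff lookup_minus split: if_splits)
          then show ?thesis using Suc.prems(4)[of u w v] x_weight[of u w v] by auto
        next
          assume h: "(u, w, v) \<in> supp (Lt deg y)"
          obtain t where "t \<in> supp y" "(u, w, v) \<in> supp (Lt deg (bas t) :: _ \<Rightarrow>\<^sub>0 'k)"
            using supp_lin_bas[OF lin_Lt[OF lin_ident] h] by blast
          moreover obtain u' w' v' where "t = (u', w', v')" by (cases t)
          ultimately show ?thesis using y(2)[of u' w' v']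
            by (auto simp: Lt_def in_keys_iff cf_bas split: if_splits)
        qed
      qed
      have "?x1 \<in> num_space"
        by (intro pm.subspace_diff subspace_tens3 x_in Rt_num Lt_num y(1) x'_in)
      then have x1_in: "?x1 \<in> num_weight n" using supp1 by blast
      have De: "Rt deg ?e - Lt deg ?e \<in> den_space IQ"
        by (intro pm.subspace_diff subspace_den Rt_den Lt_den graded_IQ y(3))
      have "Rt deg ?x1 - Lt deg ?x1 = (Rt deg x - Lt deg x) -
          (Rt deg (Rt deg y - Lt deg y) - Lt deg (Rt deg y - Lt deg y)) - (Rt deg ?e - Lt deg ?e)"
        by (simp only: lin_minus[OF lin_Rt[OF lin_ident]] lin_minus[OF lin_Lt[OF lin_ident]]) (simp add: algebra_simps)
      then have D1: "Rt deg ?x1 - Lt deg ?x1 \<in> den_space IQ"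
        by (simp only:) (intro pm.subspace_diff subspace_den Suc.prems(2) square_den y(1) De)
      have xi_e: "xi ?e \<in> IQ"
      proof (rule den_into[OF y(3) lin_xi[OF lin_ident] subspace_ideal])
        show "a \<in> IQ \<Longrightarrow> xi (tensor3 a c b) \<in> IQ" "b \<in> IQ \<Longrightarrow> xi (tensor3 a c b) \<in> IQ" for a c b
          by (auto simp: xi_tensor3 intro: pm.subspace_scale ideal_mult_left ideal_mult_right)
      qed
      have "xi ?x1 = xi x - xi (Rt deg y - Lt deg y) - xi ?e"
        by (simp only: lin_minus[OF lin_xi[OF lin_ident]])
      then have "xi ?x1 = xi x - xi ?e" unfolding xi_Rt_Lt by simp
      then have xi1: "xi ?x1 \<in> IQ" using Suc.prems(3) xi_e by (simp only:) (intro pm.subspace_diff subspace_ideal)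
      have "k + Suc i = Suc n" using Suc.prems(5) by simp
      from Suc.IH[OF x1_in D1 xi1 _ this] supp1
      obtain y1 where y1: "y1 \<in> num_weight n" "?x1 - (Rt deg y1 - Lt deg y1) \<in> den_space IQ" by blast
      have "x - (Rt deg (y + y1) - Lt deg (y + y1)) = (?x1 - (Rt deg y1 - Lt deg y1)) + ?e"
        by (simp only: lin_add[OF lin_Rt[OF lin_ident]] lin_add[OF lin_Lt[OF lin_ident]]) (simp add: algebra_simps)
      also have "\<dots> \<in> den_space IQ" by (intro pm.subspace_add subspace_den y1 y)
      finally have fin: "x - (Rt deg (y + y1) - Lt deg (y + y1)) \<in> den_space IQ" .
      have "length u + length w + length v = n" if t: "(u, w, v) \<in> supp (y + y1)" for u w v
      proof -
        have "(u, w, v) \<in> supp y \<or> (u, w, v) \<in> supp y1" using t by (auto simp: in_keys_iff lookup_add)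
        then show ?thesis using y(2)[of u w v] y1(1) by auto
      qed
      moreover have "y + y1 \<in> num_space" using y(1) y1(1) by (simp add: pm.subspace_add)
      ultimately have "y + y1 \<in> num_weight n" by auto
      then show ?thesis using fin by blast
    qed
  qed
  from this[of x 0 "Suc n"] assms show ?thesis by simp
qed

end

section \<open>The Poincare-Birkhoff-Witt property\<close>

lemma supp_mult: "w \<in> supp (p * q) \<Longrightarrow> \<exists>a\<in>supp p. \<exists>b\<in>supp q. w = a @ b"
  using keys_mult[of p q] unfolding plus_list_def by blast

definition total_length :: "'x list list \<Rightarrow> nat" where
  "total_length ws = sum_list (map length ws)"

lemma total_length_simps [simp]: "total_length [] = 0" "total_length (w # ws) = length w + total_length ws"
  by (simp_all add: total_length_def)

lemma cobar_diff_total_length: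
  "ws' \<in> supp (cobar_diff deg (bas ws) :: 'x list list \<Rightarrow>\<^sub>0 'k::field) \<Longrightarrow>
    total_length ws' = total_length ws \<and> length ws' = Suc (length ws)"
proof (induction ws arbitrary: ws')
  case Nil
  then show ?case by simp
next
  case (Cons w vs)
  let ?a = "cobar_diff_gen deg w * bas vs :: 'x list list \<Rightarrow>\<^sub>0 'k"
  let ?b = "bas [w] * cobar_diff deg (bas vs) :: 'x list list \<Rightarrow>\<^sub>0 'k"
  have "cf ?a ws' - ksgn (sdeg deg w) * cf ?b ws' \<noteq> 0"
    using Cons.prems by (simp add: cobar_diff_Cons in_keys_iff lookup_minus)
  then consider "cf ?a ws' \<noteq> 0" | "cf ?b ws' \<noteq> 0"
    by (metis diff_zero mult_zero_right)
  then show ?case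
  proof cases
    case 1
    then show ?thesis by (auto simp: cf_cobar_diff_gen_mult split: list.splits if_splits)
  next
    case 2
    then obtain us where us: "ws' = w # us" "us \<in> supp (cobar_diff deg (bas vs) :: 'x list list \<Rightarrow>\<^sub>0 'k)"
      by (cases ws') (auto simp: cf_bas_mult in_keys_iff split: if_splits)
    then show ?thesis using Cons.IH[OF us(2)] by simp
  qed
qed

lemma cobar_to_alg_length: "w \<in> supp (cobar_to_alg (bas ws) :: 'x list \<Rightarrow>\<^sub>0 'k::field) \<Longrightarrow> length w = total_length ws"
proof (induction ws arbitrary: w)
  case Nil
  then show ?case by (simp add: one_eq_bas)
next
  case (Cons v vs)
  then show ?case using supp_mult[of w "bas v" "cobar_to_alg (bas vs) :: 'x list \<Rightarrow>\<^sub>0 'k"]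
    by (auto simp: cobar_to_alg_Cons split: if_splits)
qed

text \<open>The bound is strict, so that \<open>short 0\<close> is the zero space, where inductions on the bound
  start.\<close>

definition short :: "nat \<Rightarrow> ('x list \<Rightarrow>\<^sub>0 'k::field) set" where
  "short n = {p. \<forall>w\<in>supp p. length w < n}"

lemma subspace_short [simp]: "pm.subspace (short n :: ('x list \<Rightarrow>\<^sub>0 'k::field) set)"
  unfolding short_def
proof (rule pm.subspaceI)
  fix x y :: "'x list \<Rightarrow>\<^sub>0 'k" and c :: 'k
  assume x: "x \<in> {p. \<forall>w\<in>supp p. length w < n}"
  show "scale c x \<in> {p. \<forall>w\<in>supp p. length w < n}" using x by (auto simp: in_keys_iff)
  assume y: "y \<in> {p. \<forall>w\<in>supp p. length w < n}"
  have "w \<in> supp x \<or> w \<in> supp y" if "w \<in> supp (x + y)" for w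
    using that by (auto simp: in_keys_iff lookup_add)
  then show "x + y \<in> {p. \<forall>w\<in>supp p. length w < n}" using x y by blast
qed simp

lemma short_mono: "m \<le> n \<Longrightarrow> p \<in> short m \<Longrightarrow> p \<in> short n"
  unfolding short_def using less_le_trans by blast

lemma short_mult:
  assumes "p \<in> short (Suc m)" "q \<in> short n" shows "p * q \<in> short (m + n)"
  unfolding short_def
proof (intro CollectI ballI)
  fix w assume "w \<in> supp (p * q)"
  from supp_mult[OF this] obtain a b where "a \<in> supp p" "b \<in> supp q" "w = a @ b" by blast
  moreover have "length a < Suc m" "length b < n" using assms calculation by (auto simp: short_def)
  ultimately show "length w < m + n" by simp
qed

lemma short_bas: "length w < n \<Longrightarrow> bas w \<in> short n"
  by (simp add: short_def)

locale koszul_qlc = qlc deg R for deg :: "'x \<Rightarrow> nat" and R :: "('x list \<Rightarrow>\<^sub>0 'k::field) set" +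
  assumes koszul_qR: "koszul deg (qrel R)"

sublocale koszul_qlc \<subseteq> koszul_quadratic deg "qrel R"
  by standard (rule koszul_qR)

context koszul_qlc
begin

text \<open>The elements of the ideal that can be written with relations in words of length less than
  \<open>n\<close>. If the leading terms of an element of \<open>filt (Suc n)\<close> cancel, it is not obvious
  that it lies in \<open>filt n\<close>; this is the content of \<open>filt_descend\<close>.\<close>

definition filt :: "nat \<Rightarrow> ('x list \<Rightarrow>\<^sub>0 'k) set" where
  "filt n = pm.span {bas u * r * bas v | u r v. r \<in> R \<and> length u + 2 + length v < n}"

lemma subspace_filt [simp]: "pm.subspace (filt n)"
  unfolding filt_def by (rule pm.subspace_span)

lemma filt_mono: "m \<le> n \<Longrightarrow> p \<in> filt m \<Longrightarrow> p \<in> filt n"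
proof -
  assume "m \<le> n"
  then have "filt m \<subseteq> filt n" unfolding filt_def by (intro pm.span_mono) force
  then show "p \<in> filt m \<Longrightarrow> p \<in> filt n" by blast
qed

lemma filt_base: "r \<in> R \<Longrightarrow> length u + 2 + length v < n \<Longrightarrow> bas u * r * bas v \<in> filt n"
  unfolding filt_def by (rule pm.span_base) blast

lemma filt_relation_mult: "r \<in> R \<Longrightarrow> q \<in> short n \<Longrightarrow> r * q \<in> filt (2 + n)"
proof (rule lin_in_subspace[of "\<lambda>q. r * q"])
  fix v assume "r \<in> R" "q \<in> short n" "v \<in> supp q"
  then show "r * bas v \<in> filt (2 + n)" using filt_base[of r "[]" v] by (simp add: short_def)
qed ((intro lin_intros)+, simp)

lemma filt_mult:
  assumes "g \<in> filt n" "p \<in> short (Suc m)" shows "p * g \<in> filt (m + n)"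
proof (rule lin_in_subspace[of "\<lambda>p. p * g"])
  fix w assume "w \<in> supp p"
  then have w: "length w \<le> m" using assms(2) by (auto simp: short_def)
  show "bas w * g \<in> filt (m + n)"
    using assms(1) unfolding filt_def[of n]
  proof (rule lin_span_into[where f = "\<lambda>g. bas w * g"])
    fix g assume "g \<in> {bas u * r * bas v | u r v. r \<in> R \<and> length u + 2 + length v < n}"
    then obtain u r v where g: "g = bas u * r * bas v" "r \<in> R" "length u + 2 + length v < n" by blast
    have "bas w * g = bas (w @ u) * r * bas v" by (simp add: g mult.assoc[symmetric])
    then show "bas w * g \<in> filt (m + n)" using filt_base[OF g(2), of "w @ u" v] g(3) w by simp
  qed ((intro lin_intros)+, simp)
qed ((intro lin_intros)+, simp)

lemma low_short: "low p \<in> short 2"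
  using low_weight'[of _ p] by (auto simp: short_def less_Suc_eq_le numeral_2_eq_2)

lemma filt_short: "g \<in> filt n \<Longrightarrow> g \<in> short n"
  unfolding filt_def
proof (erule lin_span_into[OF _ lin_ident subspace_short])
  fix g assume "g \<in> {bas u * r * bas v | u r v. r \<in> R \<and> length u + 2 + length v < n}"
  then obtain u r v where g: "g = bas u * r * bas v" "r \<in> R" "length u + 2 + length v < n" by blast
  have "length w < n" if w: "w \<in> supp g" for w
  proof -
    obtain a where a: "a \<in> supp (bas u * r)" "w = a @ v" using supp_mult[of w "bas u * r" "bas v"] w by (auto simp: g)
    obtain b where b: "b \<in> supp r" "a = u @ b" using supp_mult[OF a(1)] by auto
    show ?thesis using weight_R[OF g(2) b(1)] g(3) a b by simp
  qed
  then show "g \<in> short n" by (simp add: short_def)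
qed

text \<open>A combination of words \<open>u \<otimes> s\<^sup>2x \<otimes> v\<close> in the cobar construction is sent to the combination of the
  \<open>u (x - \<phi>(x) + \<theta>(x)) v\<close>; the leading term of the result is the image of the cobar differential.\<close>

fun lift_word :: "'x list list \<Rightarrow> ('x list \<Rightarrow>\<^sub>0 'k)" where
  "lift_word [] = 0"
| "lift_word (w # ws) = (if length w = 2 then relw w * cobar_to_alg (bas ws) else 0) -
     (if length w = 1 then scale (ksgn (sdeg deg w)) (bas w * lift_word ws) else 0)"

definition lift_rel :: "('x list list \<Rightarrow>\<^sub>0 'k) \<Rightarrow> ('x list \<Rightarrow>\<^sub>0 'k)" where
  "lift_rel = linext lift_word"

lemma lin_lift_rel [lin_intros]: "lin f \<Longrightarrow> lin (\<lambda>x. lift_rel (f x))"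
  unfolding lift_rel_def by (rule lin_linext)

lemma lift_rel_bas [simp]: "lift_rel (bas ws) = lift_word ws"
  by (simp add: lift_rel_def)

lemma lift_rel_gen: "lift_rel (cobar_gen c * z) =
    (susp2 deg c - low (wtpart 2 c)) * cobar_to_alg z - wtpart 1 (sg deg c) * lift_rel z"
  by (rule bilinear_ext[of "\<lambda>c z. lift_rel (cobar_gen c * z)"
      "\<lambda>c z. (susp2 deg c - low (wtpart 2 c)) * cobar_to_alg z - wtpart 1 (sg deg c) * lift_rel z"])
    ((intro lin_intros)+, auto simp: relw_def lin_zero[OF lin_low0] susp2_bas lin_scale[OF lin_wtpart[OF lin_ident]] scale_mult_left)

lemma cobar_to_alg_gen: "cobar_to_alg (cobar_gen c * z) = wtpart 1 c * cobar_to_alg z"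
  by (rule bilinear_ext[of "\<lambda>c z. cobar_to_alg (cobar_gen c * z)" "\<lambda>c z. wtpart 1 c * cobar_to_alg z"])
    ((intro lin_intros)+, auto simp: cobar_to_alg_Cons)

lemma cobar_diff_gen_mult: "D (cobar_gen c * z) =
    linext (cobar_diff_gen deg) c * z - cobar_gen (sg deg c) * D z"
  by (rule bilinear_ext[of "\<lambda>c z. D (cobar_gen c * z)"
      "\<lambda>c z. linext (cobar_diff_gen deg) c * z - cobar_gen (sg deg c) * D z"])
    ((intro lin_intros)+, simp add: cobar_diff_Cons scale_mult_left)

lemma cobar_diff_gen_2: "cobar_diff_gen deg [x, y] = scale (ksgn (int (deg x))) (bas [[x], [y]])"
proof -
  have "{0<..<Suc (Suc 0)} = {1}" by auto
  then show ?thesis by (simp add: cobar_diff_gen_def)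
qed

lemma cobar_diff_gen_3: "cobar_diff_gen deg [x, y, z] = scale (ksgn (int (deg x))) (bas [[x], [y, z]])
    - scale (ksgn (int (deg x) + int (deg y))) (bas [[x, y], [z]])"
proof -
  have "{0<..<Suc (Suc (Suc 0))} = {1, 2}" by auto
  then show ?thesis by (simp add: cobar_diff_gen_def ksgn_def numeral_2_eq_2)
qed

lemma word_cases:
  obtains (empty_or_letter) "length (w :: 'x list) \<le> 1" | (two) x y where "w = [x, y]"
    | (three) x y z where "w = [x, y, z]" | (long) "4 \<le> length w"
proof -
  consider "length w \<le> 1" | "length w = 2" | "length w = 3" | "4 \<le> length w" by arith
  then show ?thesis
  proof cases
    case 2
    then obtain x y where "w = [x, y]" by (auto simp: numeral_2_eq_2 length_Suc_conv)
    then show ?thesis by (rule two)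
  next
    case 3
    then obtain x y z where "w = [x, y, z]" by (auto simp: numeral_3_eq_3 length_Suc_conv)
    then show ?thesis by (rule three)
  qed (rule empty_or_letter long; assumption)+
qed

lemma cobar_to_alg_diff_gen: "cobar_to_alg (linext (cobar_diff_gen deg) c * z) = susp2 deg c * cobar_to_alg z"
  for z :: "'x list list \<Rightarrow>\<^sub>0 'k"
proof (rule bilinear_ext[of "\<lambda>c z. cobar_to_alg (linext (cobar_diff_gen deg) c * z)" "\<lambda>c z. susp2 deg c * cobar_to_alg z"])
  fix w :: "'x list" and ws :: "'x list list"
  show "cobar_to_alg (linext (cobar_diff_gen deg) (bas w) * bas ws :: _ \<Rightarrow>\<^sub>0 'k) = susp2 deg (bas w) * cobar_to_alg (bas ws)"
  proof (cases "length w = 2")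
    case True
    then obtain x y where w: "w = [x, y]" by (auto simp: numeral_2_eq_2 length_Suc_conv)
    show ?thesis by (simp add: w cobar_diff_gen_2 scale_mult_left cobar_to_alg_Cons mult.assoc[symmetric])
  next
    case False
    have "cobar_to_alg (bas (take i w # drop i w # ws)) = (0 :: 'x list \<Rightarrow>\<^sub>0 'k)" if "i \<in> {0<..<length w}" for i
      using False that by (auto simp: cobar_to_alg_Cons)
    then show ?thesis using False
      by (auto simp: cobar_diff_gen_def sum_distrib_right scale_mult_left lin_sum[OF lin_cobar_to_alg[OF lin_ident]] susp2_bas
          intro!: sum.neutral)
  qed
qed (intro lin_intros)+

text \<open>Under the cobar differential a word of weight two becomes a product of letters, and a word of weight
  three is cut in the two ways that form its overlap. Longer words contribute nothing, because some factor has
  weight more than two or two factors have weight two.\<close>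

lemma lift_rel_diff_gen: "lift_rel (linext (cobar_diff_gen deg) c * z) =
    overlap (wtpart 3 c) * cobar_to_alg z + susp2 deg (sg deg c) * lift_rel z"
proof (rule bilinear_ext[of "\<lambda>c z. lift_rel (linext (cobar_diff_gen deg) c * z)"
      "\<lambda>c z. overlap (wtpart 3 c) * cobar_to_alg z + susp2 deg (sg deg c) * lift_rel z"])
  fix w :: "'x list" and ws :: "'x list list"
  show "lift_rel (linext (cobar_diff_gen deg) (bas w) * bas ws) =
    overlap (wtpart 3 (bas w)) * cobar_to_alg (bas ws) + susp2 deg (sg deg (bas w)) * lift_rel (bas ws)"
  proof (cases w rule: word_cases)
    case empty_or_letter
    then show ?thesis
      by (auto simp: cobar_diff_gen_short lin_zero[OF lin_lift_rel[OF lin_ident]] lin_zero[OF lin_overlap[OF lin_ident]]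
          lin_scale[OF lin_susp2[OF lin_ident]] susp2_bas)
  next
    case (two x y)
    have "bas [x] * (bas [y] * lift_word ws) = bas [x, y] * lift_word ws"
      by (simp flip: mult.assoc)
    then have A: "lift_word ([x] # [y] # ws) = scale (ksgn (int (deg x)) * ksgn (int (deg y))) (bas [x, y] * lift_word ws)"
      by (simp add: scale_mult_right)
    have B: "sg deg (bas [x, y]) = scale (ksgn (int (deg x)) * ksgn (int (deg y))) (bas [x, y] :: _ \<Rightarrow>\<^sub>0 'k)"
      by (simp add: ksgn_def)
    show ?thesis
      by (simp add: two cobar_diff_gen_2 scale_mult_left lin_scale[OF lin_lift_rel[OF lin_ident]] A B
          lin_zero[OF lin_overlap[OF lin_ident]] lin_scale[OF lin_susp2[OF lin_ident]] del: lift_word.simps sg_bas)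
  next
    case (three x y z)
    have o: "overlap (bas [x, y, z]) = bas [x] * relw [y, z] - scale (ksgn (int (deg x) + int (deg y))) (relw [x, y] * bas [z])"
      by (simp add: overlap_def resolve_right_def resolve_left_def ksgn_def)
    have A: "lift_word ([x] # [y, z] # ws) = scale (ksgn (int (deg x))) (bas [x] * (relw [y, z] * cobar_to_alg (bas ws)))"
      "lift_word ([x, y] # [z] # ws) = relw [x, y] * (bas [z] * cobar_to_alg (bas ws))"
      by (simp_all add: cobar_to_alg_Cons)
    have "lift_rel (linext (cobar_diff_gen deg) (bas w) * bas ws) =
        scale (ksgn (int (deg x))) (lift_word ([x] # [y, z] # ws)) -
        scale (ksgn (int (deg x) + int (deg y))) (lift_word ([x, y] # [z] # ws))"
      by (simp add: three cobar_diff_gen_3 left_diff_distrib scale_mult_left lin_minus[OF lin_lift_rel[OF lin_ident]]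
          lin_scale[OF lin_lift_rel[OF lin_ident]] del: lift_word.simps)
    also have "\<dots> = overlap (bas [x, y, z]) * cobar_to_alg (bas ws)"
      by (simp add: A o left_diff_distrib scale_mult_left mult.assoc del: lift_word.simps)
    also have "\<dots> = overlap (wtpart 3 (bas w)) * cobar_to_alg (bas ws) + susp2 deg (sg deg (bas w)) * lift_rel (bas ws)"
      by (simp add: three susp2_bas lin_scale[OF lin_susp2[OF lin_ident]])
    finally show ?thesis .
  next
    case long
    have "lift_word (take i w # drop i w # ws) = 0" if "i \<in> {0<..<length w}" for i
      using long that by (auto simp: cobar_to_alg_Cons)
    then show ?thesis using long
      by (auto simp: cobar_diff_gen_def sum_distrib_right scale_mult_left lin_sum[OF lin_lift_rel[OF lin_ident]] susp2_bas
          lin_scale[OF lin_lift_rel[OF lin_ident]] lin_uminus[OF lin_lift_rel[OF lin_ident]]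
          lin_zero[OF lin_overlap[OF lin_ident]] lin_scale[OF lin_susp2[OF lin_ident]]
          intro!: sum.neutral)
  qed
qed (intro lin_intros)+

lemma cobar_to_alg_short: "(\<And>ws. ws \<in> supp z \<Longrightarrow> total_length ws \<le> n) \<Longrightarrow> cobar_to_alg z \<in> short (Suc n)"
  for z :: "'x list list \<Rightarrow>\<^sub>0 'k"
proof (rule lin_in_subspace[OF lin_cobar_to_alg[OF lin_ident] subspace_short])
  fix ws assume "\<And>ws. ws \<in> supp z \<Longrightarrow> total_length ws \<le> n" "ws \<in> supp z"
  then have "total_length ws \<le> n" by blast
  then show "cobar_to_alg (bas ws :: _ \<Rightarrow>\<^sub>0 'k) \<in> short (Suc n)" using cobar_to_alg_length[where ?'k = 'k, of _ ws] by (auto simp: short_def)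
qed

text \<open>Replacing every relation by its leading term turns \<open>lift_rel\<close> into
  \<open>cobar_to_alg\<close> after the cobar differential.\<close>

lemma lift_word_leading: "lift_word ws - cobar_to_alg (D (bas ws)) \<in> short (total_length ws)"
proof (induction ws)
  case Nil
  then show ?case by (simp add: pm.subspace_0)
next
  case (Cons w ws)
  have "D (bas (w # ws)) = D (cobar_gen (bas w) * bas ws)" "lift_word (w # ws) = lift_rel (cobar_gen (bas w) * bas ws)" by simp_all
  then have eq: "lift_word (w # ws) - cobar_to_alg (D (bas (w # ws))) =
      - low (wtpart 2 (bas w)) * cobar_to_alg (bas ws) - wtpart 1 (sg deg (bas w)) * (lift_word ws - cobar_to_alg (D (bas ws)))"
    by (simp only: lift_rel_gen cobar_diff_gen_mult lin_minus[OF lin_cobar_to_alg[OF lin_ident]] cobar_to_alg_diff_gen cobar_to_alg_gen lift_rel_bas)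
      (simp add: algebra_simps)
  have 1: "low (wtpart 2 (bas w)) * cobar_to_alg (bas ws) \<in> short (length w + total_length ws)"
  proof (cases "length w = 2")
    case True
    have "low (bas w) * cobar_to_alg (bas ws) \<in> short (1 + Suc (total_length ws))"
      by (rule short_mult) (use low_short cobar_to_alg_short[of "bas ws"] in \<open>auto simp: numeral_2_eq_2\<close>)
    then show ?thesis using True by simp
  qed (simp add: lin_zero[OF lin_low0] pm.subspace_0)
  have 2: "wtpart 1 (sg deg (bas w)) * (lift_word ws - cobar_to_alg (D (bas ws))) \<in> short (length w + total_length ws)"
  proof (cases "length w = 1")
    case True
    have "bas w * (lift_word ws - cobar_to_alg (D (bas ws))) \<in> short (1 + total_length ws)"
      by (rule short_mult[OF short_bas Cons]) (simp add: True)
    then show ?thesis using True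
      by (simp add: lin_scale[OF lin_wtpart[OF lin_ident]] scale_mult_left pm.subspace_scale)
  qed (simp add: lin_scale[OF lin_wtpart[OF lin_ident]] pm.subspace_0)
  show ?case unfolding eq using 1 2 by (simp add: pm.subspace_diff pm.subspace_neg)
qed

lemma lift_rel_leading:
  assumes "\<And>ws. ws \<in> supp z \<Longrightarrow> total_length ws \<le> n"
  shows "lift_rel z - cobar_to_alg (D z) \<in> short n"
proof (rule lin_in_subspace[of "\<lambda>z. lift_rel z - cobar_to_alg (D z)"])
  fix ws assume "ws \<in> supp z"
  from short_mono[OF assms[OF this] lift_word_leading]
  show "lift_rel (bas ws) - cobar_to_alg (D (bas ws)) \<in> short n" by simp
qed ((intro lin_intros)+, simp)

text \<open>The key step: on a boundary of the cobar construction the leading terms cancel, and what remains can be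
  written with relations in shorter words. For two separate factors of weight two this is the commutation
  of two reductions at disjoint places; for a factor of weight three it is the overlap relation.\<close>

lemma lift_rel_gens:
  assumes "homogeneous_gens cs"
  shows "\<exists>n. (\<forall>ws\<in>supp (gen_prod cs). total_length ws = n) \<and> lift_rel (gen_prod cs) \<in> filt (Suc n) \<and>
     lift_rel (D (gen_prod cs)) \<in> filt n"
  using assms
proof (induction cs)
  case Nil
  then show ?case by (intro exI[of _ 0]) (simp add: one_eq_bas lin_zero[OF lin_lift_rel[OF lin_ident]] pm.subspace_0)
next
  case (Cons c cs)
  let ?Z = "gen_prod cs"
  have "homogeneous_gens cs" using Cons.prems by (simp add: homogeneous_gens_def)
  from Cons.IH[OF this] obtain n where n: "\<And>ws. ws \<in> supp ?Z \<Longrightarrow> total_length ws = n"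
    "lift_rel ?Z \<in> filt (Suc n)" "lift_rel (D ?Z) \<in> filt n" by blast
  obtain k where k: "c \<in> C" "0 < k" "\<And>w. w \<in> supp c \<Longrightarrow> length w = k"
    using Cons.prems by (auto simp: homogeneous_gens_def)
  have c_k: "wtpart k c = c" unfolding wtpart_def by (rule part_id) (rule k(3))
  have c_not: "wtpart j c = 0" if "j \<noteq> k" for j
    unfolding wtpart_def by (rule part_none) (use k(3) that in blast)
  have sg_c: "sg deg c \<in> C" by (rule graded_by_sg[OF graded_C_sdeg k(1)])
  have wt_sg: "wtpart j (sg deg c) = sg deg (wtpart j c)" for j
    by (rule poly_mapping_eqI) simp
  have sg_sg: "sg deg (sg deg c) = c" by (rule poly_mapping_eqI) simp
  have susp2_not: "susp2 deg c = 0" "susp2 deg (sg deg c) = 0" if "k \<noteq> 2"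
    using c_not[of 2] that wtpart_susp2(2)[of deg c] wtpart_susp2(2)[of deg "sg deg c"]
    by (simp_all add: wt_sg lin_zero[OF lin_susp2[OF lin_ident]])
  have Z_short: "cobar_to_alg ?Z \<in> short (Suc n)" by (rule cobar_to_alg_short) (use n in auto)
  have total: "total_length ws = k + n" if "ws \<in> supp (gen_prod (c # cs))" for ws
  proof -
    from gen_prod_supp[OF that] obtain w vs where ws: "ws = w # vs" "w \<in> supp c" by (auto simp: list_all2_Cons2)
    have "cf (gen_prod (c # cs)) ws = cf (cslice w (gen_prod (c # cs))) vs" by (simp add: ws)
    also have "\<dots> = cf c w * cf ?Z vs" by (simp add: cslice_gen)
    finally have "vs \<in> supp ?Z" using that by (auto simp: in_keys_iff)
    then show ?thesis using n(1) k(3) ws by simp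
  qed
  have letter_short: "wtpart 1 p \<in> short (Suc 1)" for p :: "'x list \<Rightarrow>\<^sub>0 'k"
    by (auto simp: short_def in_keys_iff split: if_splits)
  have "lift_rel (gen_prod (c # cs)) = (susp2 deg c - low (wtpart 2 c)) * cobar_to_alg ?Z - wtpart 1 (sg deg c) * lift_rel ?Z"
    by (simp add: lift_rel_gen)
  moreover have "(susp2 deg c - low (wtpart 2 c)) * cobar_to_alg ?Z \<in> filt (Suc (k + n))"
  proof (cases "k = 2")
    case True
    then have "c \<in> S" using C_weight2[OF k(1)] c_k by simp
    from filt_relation_mult[OF low_relation[OF this] Z_short] show ?thesis using c_k True by simp
  next
    case False
    then show ?thesis using c_not[of 2] susp2_not by (simp add: lin_zero[OF lin_low0] pm.subspace_0)
  qed
  moreover have "wtpart 1 (sg deg c) * lift_rel ?Z \<in> filt (Suc (k + n))"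
    by (rule filt_mono[OF _ filt_mult[OF n(2) letter_short]]) (use k(2) in simp)
  ultimately have a: "lift_rel (gen_prod (c # cs)) \<in> filt (Suc (k + n))"
    by (simp only:) (rule pm.subspace_diff[OF subspace_filt])
  have "lift_rel (D (gen_prod (c # cs))) = overlap (wtpart 3 c) * cobar_to_alg ?Z + susp2 deg (sg deg c) * lift_rel ?Z
      - ((susp2 deg (sg deg c) - low (wtpart 2 (sg deg c))) * cobar_to_alg (D ?Z) - wtpart 1 c * lift_rel (D ?Z))"
    by (simp add: cobar_diff_gen_mult lin_minus[OF lin_lift_rel[OF lin_ident]] lift_rel_diff_gen lift_rel_gen sg_sg)
  \<comment> \<open>Exchange the leading terms of the two relations in the products of \<open>c\<close> with a
    factor of \<open>?Z\<close> of weight two, so that each summand is a combination of relations in words of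
    length less than \<open>k + n\<close>.\<close>
  also have "\<dots> = overlap (wtpart 3 c) * cobar_to_alg ?Z + low (wtpart 2 (sg deg c)) * lift_rel ?Z
      + (susp2 deg (sg deg c) - low (wtpart 2 (sg deg c))) * (lift_rel ?Z - cobar_to_alg (D ?Z)) + wtpart 1 c * lift_rel (D ?Z)"
    by (simp add: algebra_simps)
  also have "\<dots> \<in> filt (k + n)"
  proof (intro pm.subspace_add subspace_filt)
    show "overlap (wtpart 3 c) * cobar_to_alg ?Z \<in> filt (k + n)"
    proof (cases "k = 3")
      case True
      then have "overlap (wtpart 3 c) \<in> R" using overlap_relation[OF k(1)] c_k by simp
      from filt_relation_mult[OF this Z_short] show ?thesis
        by (rule filt_mono[rotated]) (simp add: True)
    qed (use c_not[of 3] in \<open>simp add: lin_zero[OF lin_overlap[OF lin_ident]] pm.subspace_0\<close>)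
    show "low (wtpart 2 (sg deg c)) * lift_rel ?Z \<in> filt (k + n)"
    proof (cases "k = 2")
      case True
      have "low (wtpart 2 (sg deg c)) * lift_rel ?Z \<in> filt (1 + Suc n)"
        by (rule filt_mult[OF n(2)]) (use low_short in \<open>simp add: numeral_2_eq_2\<close>)
      then show ?thesis using True by simp
    qed (use c_not[of 2] in \<open>simp add: wt_sg lin_zero[OF lin_low0] lin_zero[OF lin_sg[OF lin_ident]] pm.subspace_0\<close>)
    show "(susp2 deg (sg deg c) - low (wtpart 2 (sg deg c))) * (lift_rel ?Z - cobar_to_alg (D ?Z)) \<in> filt (k + n)"
    proof (cases "k = 2")
      case True
      then have "wtpart 2 (sg deg c) = sg deg c" using c_k by (simp add: wt_sg)
      moreover have "wtpart 2 (sg deg c) \<in> S" by (rule C_weight2[OF sg_c])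
      ultimately have "susp2 deg (sg deg c) - low (wtpart 2 (sg deg c)) \<in> R" using low_relation by simp
      moreover have "lift_rel ?Z - cobar_to_alg (D ?Z) \<in> short n" by (rule lift_rel_leading) (simp add: n(1))
      ultimately have "(susp2 deg (sg deg c) - low (wtpart 2 (sg deg c))) * (lift_rel ?Z - cobar_to_alg (D ?Z)) \<in> filt (2 + n)"
        by (rule filt_relation_mult)
      then show ?thesis using True by simp
    qed (use c_not[of 2] susp2_not in \<open>simp add: wt_sg lin_zero[OF lin_low0] lin_zero[OF lin_sg[OF lin_ident]] pm.subspace_0\<close>)
    show "wtpart 1 c * lift_rel (D ?Z) \<in> filt (k + n)"
      by (rule filt_mono[OF _ filt_mult[OF n(3) letter_short]]) (use k(2) in simp)
  qed
  finally show ?case using a total by blast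
qed

lemma lift_rel_boundary:
  assumes "t \<in> \<Omega>"
  shows "lift_rel (D (part (\<lambda>ws. total_length ws = n) t)) \<in> filt n"
proof (rule cobar_into[OF assms, of "\<lambda>t. lift_rel (D (part (\<lambda>ws. total_length ws = n) t))"])
  fix cs assume "homogeneous_gens cs"
  from lift_rel_gens[OF this] obtain m where m: "\<And>ws. ws \<in> supp (gen_prod cs) \<Longrightarrow> total_length ws = m"
    "lift_rel (D (gen_prod cs)) \<in> filt m" by blast
  have "part (\<lambda>ws. total_length ws = n) (gen_prod cs) = (if m = n then gen_prod cs else 0)"
    using m(1) by (auto intro: part_id part_none)
  then show "lift_rel (D (part (\<lambda>ws. total_length ws = n) (gen_prod cs))) \<in> filt n"
    using m(2) by (cases "m = n") (simp_all add: lin_zero[OF lin_lift_rel[OF lin_ident]] pm.subspace_0)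
qed ((intro lin_intros)+, simp)

text \<open>The combinations of relations in words of length exactly \<open>n\<close>, inside the cobar
  construction: by the equation on lengths, one factor has weight two and the others have weight one.\<close>

definition relation_cochains :: "nat \<Rightarrow> ('x list list \<Rightarrow>\<^sub>0 'k) set" where
  "relation_cochains n = {z \<in> \<Omega>. \<forall>ws\<in>supp z. total_length ws = n \<and> n = Suc (length ws)}"

lemma subspace_relation_cochains: "pm.subspace (relation_cochains n)"
proof (rule pm.subspaceI)
  show "0 \<in> relation_cochains n" by (simp add: relation_cochains_def pm.subspace_0)
  show "x + y \<in> relation_cochains n" if xy: "x \<in> relation_cochains n" "y \<in> relation_cochains n" for x y
  proof -
    have "ws \<in> supp x \<or> ws \<in> supp y" if "ws \<in> supp (x + y)" for ws
      using that by (auto simp: in_keys_iff lookup_add)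
    then show ?thesis using xy unfolding relation_cochains_def by (auto simp: pm.subspace_add)
  qed
  show "scale c x \<in> relation_cochains n" if "x \<in> relation_cochains n" for c x
    using that unfolding relation_cochains_def by (auto simp: pm.subspace_scale in_keys_iff)
qed

text \<open>A multiple \<open>u r v\<close> of a relation whose leading weight is exactly \<open>n\<close> is
  the image of the corresponding element \<open>u \<otimes> s\<^sup>2x \<otimes> v\<close>, up to sign.\<close>

lemma filt_Suc_lift:
  assumes "a \<in> filt (Suc n)"
  shows "\<exists>z\<in>relation_cochains n. a - lift_rel z \<in> filt n"
proof -
  let ?T = "{a. \<exists>z\<in>relation_cochains n. a - lift_rel z \<in> filt n}"
  have T: "pm.subspace ?T"
  proof (rule pm.subspaceI)
    show "0 \<in> ?T"
      using pm.subspace_0[OF subspace_relation_cochains]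
      by (auto intro!: bexI[of _ 0] simp: lin_zero[OF lin_lift_rel[OF lin_ident]] pm.subspace_0)
    show "x + y \<in> ?T" if xy: "x \<in> ?T" "y \<in> ?T" for x y
    proof -
      obtain z z' where z: "z \<in> relation_cochains n" "x - lift_rel z \<in> filt n" "z' \<in> relation_cochains n" "y - lift_rel z' \<in> filt n"
        using xy by blast
      have e: "x + y - lift_rel (z + z') = (x - lift_rel z) + (y - lift_rel z')"
        by (simp add: lin_add[OF lin_lift_rel[OF lin_ident]])
      have "x + y - lift_rel (z + z') \<in> filt n"
        unfolding e by (rule pm.subspace_add[OF subspace_filt z(2,4)])
      then show ?thesis
        using pm.subspace_add[OF subspace_relation_cochains z(1,3)] by blast
    qed
    show "scale c x \<in> ?T" if x: "x \<in> ?T" for c x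
    proof -
      obtain z where z: "z \<in> relation_cochains n" "x - lift_rel z \<in> filt n" using x by blast
      have e: "scale c x - lift_rel (scale c z) = scale c (x - lift_rel z)"
        by (simp add: lin_scale[OF lin_lift_rel[OF lin_ident]] pm.scale_right_diff_distrib)
      have "scale c x - lift_rel (scale c z) \<in> filt n"
        unfolding e by (rule pm.subspace_scale[OF subspace_filt z(2)])
      then show ?thesis
        using pm.subspace_scale[OF subspace_relation_cochains z(1)] by blast
    qed
  qed
  have "a \<in> ?T"
    using assms unfolding filt_def[of "Suc n"]
  proof (rule lin_span_into[OF _ lin_ident T])
    fix g assume "g \<in> {bas u * r * bas v | u r v. r \<in> R \<and> length u + 2 + length v < Suc n}"
    then obtain u r v where g: "g = bas u * r * bas v" "r \<in> R" "length u + 2 + length v < Suc n" by blast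
    show "g \<in> ?T"
    proof (cases "length u + 2 + length v = n")
      case False
      then have "g \<in> filt n" using filt_base[OF g(2), of u v n] g by simp
      then show ?thesis
        using pm.subspace_0[OF subspace_relation_cochains]
        by (auto intro!: bexI[of _ 0] simp: lin_zero[OF lin_lift_rel[OF lin_ident]])
    next
      case True
      define s where "s = susp2 deg (wtpart 2 r)"
      have s: "s \<in> S" unfolding s_def qrel_def using g(2) by blast
      have low0: "wtpart 2 (low s) = 0"
      proof (rule poly_mapping_eqI)
        fix v show "cf (wtpart 2 (low s)) v = cf 0 v"
          using low_weight'[of v s] by (cases "cf (low s) v = 0") (auto simp: in_keys_iff)
      qed
      have "wtpart 2 r = wtpart 2 (susp2 deg s - low s)"
        unfolding lin_minus[OF lin_wtpart[OF lin_ident]] low0 by (rule poly_mapping_eqI) (simp add: s_def)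
      then have r: "r = susp2 deg s - low s"
        by (rule relation_unique[OF g(2) low_relation[OF s]])
      let ?ones = "\<lambda>v. map (\<lambda>x. [x]) v"
      let ?y = "cobar_gen s * bas (?ones v) :: 'x list list \<Rightarrow>\<^sub>0 'k"
      have zero: "lift_word (?ones v) = 0" by (induction v) simp_all
      have y: "lift_rel ?y = r * bas v"
        by (simp add: lift_rel_gen zero cobar_to_alg_ones r weight_S[OF s])
      have lift_ones: "lift_rel (bas (?ones u) * t) = scale (ksgn (wdeg deg u)) (bas u * lift_rel t)" for u and t :: "'x list list \<Rightarrow>\<^sub>0 'k"
      proof (induction u)
        case (Cons x u)
        have "lift_rel (bas (?ones (x # u)) * t) = lift_rel (cobar_gen (bas [x]) * (bas (?ones u) * t))"
          by (simp add: mult.assoc[symmetric])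
        also have "\<dots> = - wtpart 1 (sg deg (bas [x])) * lift_rel (bas (?ones u) * t)"
          by (subst lift_rel_gen) (simp add: lin_zero[OF lin_low0] susp2_bas)
        also have "\<dots> = scale (ksgn (int (deg x))) (bas [x] * lift_rel (bas (?ones u) * t))"
        proof -
          have "wtpart 1 (sg deg (bas [x])) = scale (- ksgn (int (deg x))) (bas [x] :: _ \<Rightarrow>\<^sub>0 'k)"
            by (rule poly_mapping_eqI) (auto simp: cf_bas)
          then show ?thesis by (simp only: scale_mult_left pm.scale_minus_left minus_mult_left[symmetric] minus_minus)
        qed
        also have "\<dots> = scale (ksgn (wdeg deg (x # u))) ((bas [x] * bas u) * lift_rel t)"
          by (simp only: Cons.IH mult.assoc) (simp add: scale_mult_right ksgn_add)
        finally show ?case by simp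
      qed simp
      define z where "z = scale (ksgn (wdeg deg u)) (bas (?ones u) * ?y)"
      have "lift_rel z = g"
        unfolding z_def lin_scale[OF lin_lift_rel[OF lin_ident]] lift_ones y by (simp add: g mult.assoc)
      moreover have "z \<in> relation_cochains n"
      proof -
        have yO: "?y \<in> \<Omega>"
          by (rule cobar_gen_mult_in[OF S_subset_C[OF s] _ ones_in_cobar]) (auto simp: s_def cf_susp2)
        have "bas (?ones u) * ?y \<in> \<Omega>"
        proof (induction u)
          case (Cons x u)
          have "cobar_gen (bas [x]) * (bas (?ones u) * ?y) \<in> \<Omega>"
            by (rule cobar_gen_mult_in[OF C_bas_letter _ Cons]) (simp add: cf_bas)
          then show ?case by (simp add: mult.assoc[symmetric])
        qed (simp add: yO)
        then have "z \<in> \<Omega>" unfolding z_def by (rule pm.subspace_scale[OF subspace_cobar])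
        moreover have "total_length ws = n \<and> n = Suc (length ws)" if ws: "ws \<in> supp z" for ws
        proof -
          have "ws \<in> supp (bas (?ones u) * ?y)" using ws by (auto simp: z_def in_keys_iff)
          then obtain vs where vs: "ws = ?ones u @ vs" "vs \<in> supp ?y"
            using keys_mult[of "bas (?ones u)" ?y] by (auto simp: plus_list_def)
          have gen: "supp (cobar_gen s) \<subseteq> (\<lambda>w. [w]) ` supp s"
          proof
            fix ws assume "ws \<in> supp (cobar_gen s)"
            from supp_lin_bas[OF lin_cobar_gen[OF lin_ident] this] show "ws \<in> (\<lambda>w. [w]) ` supp s" by auto
          qed
          obtain a where a: "a \<in> supp (cobar_gen s)" "vs = a @ ?ones v"
            using supp_mult[OF vs(2)] by auto
          then obtain w where w: "vs = w # ?ones v" "w \<in> supp s" using gen by auto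
          have ones: "total_length (?ones u) = length u" for u :: "'x list" by (induction u) simp_all
          have app: "total_length (us @ vs) = total_length us + total_length vs" for us vs :: "'x list list"
            by (simp add: total_length_def)
          show ?thesis using weight_supp_S[OF s w(2)] True by (simp add: vs w ones app)
        qed
        ultimately show ?thesis by (simp add: relation_cochains_def)
      qed
      ultimately show ?thesis by (intro CollectI bexI[of _ z]) (simp_all add: pm.subspace_0)
    qed
  qed
  then show ?thesis by blast
qed

text \<open>The leading terms of \<open>a\<close> cancel, so \<open>cobar_to_alg (D z) = 0\<close> for the
  element \<open>z\<close> that describes these leading terms. In \<open>D z\<close> all factors have weight
  one, where \<open>cobar_to_alg\<close> is injective, hence \<open>D z = 0\<close>. Koszulness makes
  \<open>z\<close> a boundary, and \<open>lift_rel_boundary\<close> rewrites its image with relations in shorter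
  words.\<close>

lemma filt_descend:
  assumes a: "a \<in> filt (Suc n)" and short: "a \<in> short n"
  shows "a \<in> filt n"
proof -
  obtain z where z: "z \<in> relation_cochains n" "a - lift_rel z \<in> filt n" using filt_Suc_lift[OF a] by blast
  have zO: "z \<in> \<Omega>" and z_supp: "\<And>ws. ws \<in> supp z \<Longrightarrow> total_length ws = n \<and> n = Suc (length ws)"
    using z(1) by (auto simp: relation_cochains_def)
  have Dz_supp: "total_length ws = n \<and> length ws = n" if ws: "ws \<in> supp (D z)" for ws
  proof -
    obtain vs where "vs \<in> supp z" "ws \<in> supp (D (bas vs))"
      using supp_lin_bas[OF lin_cobar_diff[OF lin_ident] ws] by blast
    then show ?thesis using cobar_diff_total_length[of ws deg vs] z_supp[of vs] by simp
  qed
  have ones: "ws = map (\<lambda>x. [x]) (concat ws)" if ws: "ws \<in> supp (D z)" for ws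
  proof -
    have *: "length vs \<le> total_length vs \<and> (total_length vs = length vs \<longrightarrow> vs = map (\<lambda>x. [x]) (concat vs))"
      if "\<And>w. w \<in> set vs \<Longrightarrow> w \<noteq> []" for vs :: "'x list list"
      using that
    proof (induction vs)
      case (Cons w vs)
      then have IH: "length vs \<le> total_length vs" "total_length vs = length vs \<Longrightarrow> vs = map (\<lambda>x. [x]) (concat vs)"
        and "w \<noteq> []" by auto
      then obtain x w' where w: "w = x # w'" by (cases w) auto
      show ?case
      proof (cases "total_length vs = length vs")
        case True
        then show ?thesis using IH(2) by (auto simp: w)
      next
        case False
        then show ?thesis using IH(1) by (auto simp: w)
      qed
    qed simp
    have "\<And>w. w \<in> set ws \<Longrightarrow> w \<noteq> []" using cobar_supp_nonempty[OF cobar_diff_in[OF zO] ws] .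
    from *[OF this] show ?thesis using Dz_supp[OF ws] by simp
  qed
  have "cobar_to_alg (D z) = 0"
  proof -
    have "a - (a - lift_rel z) - (lift_rel z - cobar_to_alg (D z)) \<in> short n"
      by (intro pm.subspace_diff subspace_short short filt_short[OF z(2)] lift_rel_leading) (use z_supp in auto)
    then have low: "cobar_to_alg (D z) \<in> short n" by simp
    show ?thesis
    proof (rule poly_mapping_eqI, rule ccontr)
      fix w assume "cf (cobar_to_alg (D z)) w \<noteq> cf 0 w"
      then have w: "w \<in> supp (cobar_to_alg (D z))" by (simp add: in_keys_iff)
      obtain ws where "ws \<in> supp (D z)" "w \<in> supp (cobar_to_alg (bas ws) :: 'x list \<Rightarrow>\<^sub>0 'k)"
        using supp_lin_bas[OF lin_cobar_to_alg[OF lin_ident] w] by blast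
      then have "length w = n" using Dz_supp[of ws] cobar_to_alg_length[where ?'k = 'k, of w ws] by simp
      then show False using low w by (auto simp: short_def)
    qed
  qed
  moreover have "linext (\<lambda>v. bas (map (\<lambda>x. [x]) v)) (cobar_to_alg (D z)) = D z"
  proof (rule lin_ext_supp[of "\<lambda>y. linext (\<lambda>v. bas (map (\<lambda>x. [x]) v)) (cobar_to_alg y)" "\<lambda>y. y"])
    fix ws assume "ws \<in> supp (D z)"
    from ones[OF this] obtain v where "ws = map (\<lambda>x. [x]) v" by blast
    then show "linext (\<lambda>v. bas (map (\<lambda>x. [x]) v)) (cobar_to_alg (bas ws)) = (bas ws :: _ \<Rightarrow>\<^sub>0 'k)"
      by (simp add: cobar_to_alg_ones)
  qed (intro lin_intros)+
  ultimately have Dz: "D z = 0" by simp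
  have "cobar_to_alg z = (\<lambda>_. 0) z"
  proof (rule lin_ext_supp[of "\<lambda>z. cobar_to_alg z"])
    fix ws assume "ws \<in> supp z"
    then have "total_length ws \<noteq> length ws" using z_supp by fastforce
    moreover have "(\<forall>w\<in>set vs. length w = 1) \<Longrightarrow> total_length vs = length vs" for vs :: "'x list list"
      by (induction vs) auto
    ultimately show "cobar_to_alg (bas ws) = (0 :: 'x list \<Rightarrow>\<^sub>0 'k)" using cobar_to_alg_eq_0 by blast
  qed (intro lin_intros)+
  then have "cobar_to_alg z \<in> IQ" by (simp add: pm.subspace_0)
  from cobar_exact[OF zO Dz this] obtain t where t: "t \<in> \<Omega>" "D t = z" by blast
  have "D (part (\<lambda>ws. total_length ws = n) t) = part (\<lambda>ws. total_length ws = n) (D t)"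
  proof (rule lin_ext[of "\<lambda>t. D (part (\<lambda>ws. total_length ws = n) t)" "\<lambda>t. part (\<lambda>ws. total_length ws = n) (D t)"])
    fix ws :: "'x list list"
    show "D (part (\<lambda>ws. total_length ws = n) (bas ws)) = part (\<lambda>ws. total_length ws = n) (D (bas ws))"
    proof (cases "total_length ws = n")
      case True
      have "part (\<lambda>ws. total_length ws = n) (D (bas ws)) = D (bas ws)"
        by (rule part_id) (use cobar_diff_total_length[where ?'k = 'k, of _ deg ws] True in auto)
      then show ?thesis using True by simp
    next
      case False
      have "part (\<lambda>ws. total_length ws = n) (D (bas ws)) = 0"
        by (rule part_none) (use cobar_diff_total_length[where ?'k = 'k, of _ deg ws] False in auto)
      then show ?thesis using False by simp
    qed
  qed (intro lin_intros)+
  also have "\<dots> = z" unfolding t(2) by (rule part_id) (use z_supp in blast)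
  finally have "lift_rel z \<in> filt n" using lift_rel_boundary[OF t(1), of n] by simp
  from pm.subspace_add[OF subspace_filt z(2) this] show ?thesis by simp
qed

lemma ideal_filt: "a \<in> IR \<Longrightarrow> \<exists>m. a \<in> filt m"
proof -
  have T: "pm.subspace {a. \<exists>m. a \<in> filt m}"
  proof (rule pm.subspaceI)
    show "0 \<in> {a. \<exists>m. a \<in> filt m}" by (auto simp: pm.subspace_0)
    show "x + y \<in> {a. \<exists>m. a \<in> filt m}" if xy: "x \<in> {a. \<exists>m. a \<in> filt m}" "y \<in> {a. \<exists>m. a \<in> filt m}" for x y
    proof -
      obtain m m' where "x \<in> filt m" "y \<in> filt m'" using xy by blast
      then have "x + y \<in> filt (max m m')"
        using filt_mono[of m "max m m'" x] filt_mono[of m' "max m m'" y] by (simp add: pm.subspace_add)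
      then show ?thesis by blast
    qed
    show "scale c x \<in> {a. \<exists>m. a \<in> filt m}" if "x \<in> {a. \<exists>m. a \<in> filt m}" for c x
      using that pm.subspace_scale[OF subspace_filt] by blast
  qed
  assume "a \<in> IR"
  then have "a \<in> {a. \<exists>m. a \<in> filt m}"
    by (rule ideal_into[OF _ lin_ident T]) (use filt_base[OF _ lessI] in blast)
  then show ?thesis by blast
qed

text \<open>Descend from any expression of \<open>a\<close> in terms of relations: the ideal contains nothing
  but what its relations give without cancellation of leading terms.\<close>

lemma ideal_short_filt: "a \<in> IR \<Longrightarrow> a \<in> short n \<Longrightarrow> a \<in> filt n"
proof -
  assume a: "a \<in> IR" "a \<in> short n"
  have "a \<in> filt (n + k) \<Longrightarrow> a \<in> filt n" for k
  proof (induction k)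
    case (Suc k)
    then have "a \<in> filt (Suc (n + k))" by simp
    from filt_descend[OF this short_mono[OF _ a(2)]] show ?case using Suc.IH by simp
  qed simp
  moreover obtain m where "a \<in> filt m" using ideal_filt[OF a(1)] by blast
  then have "a \<in> filt (n + m)" by (rule filt_mono[rotated]) simp
  ultimately show ?thesis by blast
qed

text \<open>The Poincare-Birkhoff-Witt property. In an expression of \<open>a\<close> without cancellation, the
  leading terms are multiples of leading terms of relations.\<close>

theorem ideal_leading_part:
  assumes "a \<in> IR" "a \<in> short (Suc n)"
  shows "wtpart n a \<in> IQ"
  using ideal_short_filt[OF assms] unfolding filt_def
proof (rule lin_span_into[OF _ lin_wtpart[OF lin_ident] subspace_ideal])
  fix g assume "g \<in> {bas u * r * bas v | u r v. r \<in> R \<and> length u + 2 + length v < Suc n}"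
  then obtain u r v where g: "g = bas u * r * bas v" "r \<in> R" "length u + 2 + length v < Suc n" by blast
  have "wtpart n g = bas u * part (\<lambda>m. length (u @ m @ v) = n) r * bas v"
    by (simp add: g wtpart_def part_word_mult)
  also have "part (\<lambda>m. length (u @ m @ v) = n) r = (if length u + 2 + length v = n then wtpart 2 r else 0)"
  proof (rule poly_mapping_eqI)
    fix m
    show "cf (part (\<lambda>m. length (u @ m @ v) = n) r) m = cf (if length u + 2 + length v = n then wtpart 2 r else 0) m"
      using weight_R[OF g(2), of m] g(3) by (cases "cf r m = 0") (auto simp: in_keys_iff)
  qed
  finally show "wtpart n g \<in> IQ"
    using g(2) by (auto simp: pm.subspace_0 qrel_def intro: ideal_base)
qed

end

section \<open>Normal forms\<close>

lemma short_0: "a \<in> short 0 \<Longrightarrow> a = 0"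
  by (auto simp: short_def)

lemma short_SucI: "a \<in> short (Suc n) \<Longrightarrow> wtpart n a = 0 \<Longrightarrow> a \<in> short n"
proof -
  assume a: "a \<in> short (Suc n)" "wtpart n a = 0"
  have "length w < n" if w: "w \<in> supp a" for w
  proof -
    have "cf (wtpart n a) w = 0" by (simp add: a(2))
    then have "length w \<noteq> n" using w by (auto simp: in_keys_iff)
    then show ?thesis using a(1) w by (auto simp: short_def less_Suc_eq)
  qed
  then show ?thesis by (simp add: short_def)
qed

lemma ex_short: "\<exists>n. a \<in> short n"
proof -
  have "finite (length ` supp a)" by simp
  then obtain n where "\<forall>m\<in>length ` supp a. m < n" using finite_nat_set_iff_bounded by auto
  then show ?thesis by (auto simp: short_def)
qed

lemma wtpart_wtpart: "wtpart m (wtpart n p) = (if m = n then wtpart n p else 0)"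
  by (rule poly_mapping_eqI) simp

lemma wtpart_short: "wtpart n a \<in> short (Suc n)"
  by (auto simp: short_def in_keys_iff split: if_splits)

context koszul_qlc
begin

text \<open>Replace the leading term in each multiple of it by the whole relation.\<close>

lemma ideal_lift:
  assumes "x \<in> IQ"
  shows "\<exists>r. r \<in> IR \<and> r \<in> short (Suc n) \<and> wtpart n r = wtpart n x"
proof -
  let ?T = "{x. \<exists>r. r \<in> IR \<and> r \<in> short (Suc n) \<and> wtpart n r = wtpart n x}"
  have T: "pm.subspace ?T"
  proof (rule pm.subspaceI)
    show "0 \<in> ?T" by (auto intro!: exI[of _ 0] simp: pm.subspace_0)
    show "x + y \<in> ?T" if xy: "x \<in> ?T" "y \<in> ?T" for x y
    proof -
      obtain r r' where "r \<in> IR" "r \<in> short (Suc n)" "wtpart n r = wtpart n x"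
        "r' \<in> IR" "r' \<in> short (Suc n)" "wtpart n r' = wtpart n y" using xy by blast
      then show ?thesis
        by (intro CollectI exI[of _ "r + r'"]) (simp add: pm.subspace_add lin_add[OF lin_wtpart[OF lin_ident]])
    qed
    show "scale c x \<in> ?T" if x: "x \<in> ?T" for c x
    proof -
      obtain r where "r \<in> IR" "r \<in> short (Suc n)" "wtpart n r = wtpart n x" using x by blast
      then show ?thesis
        by (intro CollectI exI[of _ "scale c r"]) (simp add: pm.subspace_scale lin_scale[OF lin_wtpart[OF lin_ident]])
    qed
  qed
  have "x \<in> ?T"
  proof (rule ideal_into[OF assms lin_ident T])
    fix u q v assume "q \<in> qrel R"
    then obtain r where r: "r \<in> R" "q = wtpart 2 r" by (auto simp: qrel_def)
    show "bas u * q * bas v \<in> ?T"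
    proof (cases "length u + 2 + length v = n")
      case True
      have "bas u * r * bas v \<in> filt (Suc n)" by (rule filt_base[OF r(1)]) (use True in simp)
      then have "bas u * r * bas v \<in> short (Suc n)" by (rule filt_short)
      moreover have "wtpart n (bas u * r * bas v) = wtpart n (bas u * q * bas v)"
      proof -
        have "part (\<lambda>m. length (u @ m @ v) = n) r = part (\<lambda>m. length (u @ m @ v) = n) q"
          by (rule poly_mapping_eqI) (use True in \<open>auto simp: r\<close>)
        then show ?thesis by (simp only: wtpart_def part_word_mult)
      qed
      ultimately show ?thesis using ideal_base[OF r(1)] by blast
    next
      case False
      have "part (\<lambda>m. length (u @ m @ v) = n) q = 0"
        by (rule poly_mapping_eqI) (use False in \<open>auto simp: r\<close>)
      then have "wtpart n (bas u * q * bas v) = 0" by (simp only: wtpart_def part_word_mult) simp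
      then show ?thesis by (auto intro!: exI[of _ 0] simp: pm.subspace_0)
    qed
  qed
  then show ?thesis by blast
qed

text \<open>A linear projection with kernel the ideal that does not raise the weight. By the
  Poincare-Birkhoff-Witt property a homogeneous complement of the quadratic ideal is
  also a complement of the ideal itself, and the projection is the one along the latter.\<close>

lemma normal_form_exists:
  "\<exists>N. lin N \<and> (\<forall>a. a - N a \<in> IR) \<and> (\<forall>a\<in>IR. N a = 0) \<and> (\<forall>n. \<forall>a\<in>short n. N a \<in> short n)"
proof -
  obtain P where P: "lin P" "\<And>t. P t \<in> IQ" "\<And>t. t \<in> IQ \<Longrightarrow> P t = t"
    "\<And>u u'. u' \<in> supp (P (bas u)) \<Longrightarrow> length u' = length u"
    using graded_projection_exists[OF graded_IQ_length] by blast
  have P_wt: "P (wtpart n a) = wtpart n (P a)" for n a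
  proof (rule lin_ext[of "\<lambda>a. P (wtpart n a)" "\<lambda>a. wtpart n (P a)"])
    fix u show "P (wtpart n (bas u)) = wtpart n (P (bas u))"
    proof (cases "length u = n")
      case True
      then have "wtpart n (P (bas u)) = P (bas u)" unfolding wtpart_def using P(4) by (intro part_id) auto
      then show ?thesis using True by simp
    next
      case False
      then have "wtpart n (P (bas u)) = 0" unfolding wtpart_def using P(4) by (intro part_none) auto
      then show ?thesis using False by (simp add: lin_zero[OF P(1)])
    qed
  qed (intro lin_intros lin_compose[OF P(1)] P(1))+
  \<comment> \<open>The kernel of \<open>P\<close> meets the ideal in zero only: the leading part of
    \<open>a\<close> is in the quadratic ideal, hence fixed by \<open>P\<close>.\<close>
  have zero: "a = 0" if "a \<in> IR" "P a = 0" "a \<in> short n" for a n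
    using that
  proof (induction n)
    case 0
    then show ?case by (simp add: short_0)
  next
    case (Suc n)
    have "wtpart n a = P (wtpart n a)" by (rule P(3)[symmetric]) (rule ideal_leading_part[OF Suc.prems(1,3)])
    then have "wtpart n a = 0" using P_wt Suc.prems(2) by simp
    then show ?case using Suc short_SucI by blast
  qed
  \<comment> \<open>The kernel of \<open>P\<close> and the ideal span everything: replace the component of the
    leading part in the quadratic ideal by terms of lower weight.\<close>
  have reduce: "\<exists>b. P b = 0 \<and> b \<in> short n \<and> a - b \<in> IR" if "a \<in> short n" for a n
    using that
  proof (induction n arbitrary: a)
    case 0
    then have "a = 0" by (rule short_0)
    then show ?case using 0 by (auto intro!: exI[of _ 0] simp: lin_zero[OF P(1)] pm.subspace_0)
  next
    case (Suc n)
    let ?t = "wtpart n a"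
    obtain r where r: "r \<in> IR" "r \<in> short (Suc n)" "wtpart n r = wtpart n (P ?t)" using ideal_lift[OF P(2)] by blast
    have Pt: "wtpart n (P ?t) = P ?t" by (simp add: P_wt[symmetric] wtpart_wtpart)
    have Pt_short: "P ?t \<in> short (Suc n)" using wtpart_short[of n "P ?t"] Pt by simp
    let ?a = "a - r - (?t - P ?t)"
    have "?a \<in> short n"
    proof (rule short_SucI)
      show "?a \<in> short (Suc n)" by (intro pm.subspace_diff subspace_short Suc.prems r wtpart_short Pt_short)
      show "wtpart n ?a = 0"
        by (simp add: lin_minus[OF lin_wtpart[OF lin_ident]] r(3) Pt wtpart_wtpart)
    qed
    from Suc.IH[OF this] obtain b where b: "P b = 0" "b \<in> short n" "?a - b \<in> IR" by blast
    let ?b = "b + (?t - P ?t)"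
    have "P ?b = 0" using b(1) P(3)[OF P(2)] by (simp add: lin_add[OF P(1)] lin_minus[OF P(1)])
    moreover have "?b \<in> short (Suc n)"
      by (intro pm.subspace_add pm.subspace_diff subspace_short short_mono[OF _ b(2)] wtpart_short Pt_short) simp
    moreover have "a - ?b = (?a - b) + r" by simp
    then have "a - ?b \<in> IR" by (simp only:) (intro pm.subspace_add subspace_ideal b r)
    ultimately show ?case by blast
  qed
  have unique: "b = b'" if "P b = 0" "P b' = 0" "a - b \<in> IR" "a - b' \<in> IR" for a b b'
  proof -
    have "(a - b') - (a - b) \<in> IR" by (intro pm.subspace_diff subspace_ideal that)
    then have "b - b' \<in> IR" by simp
    moreover have "P (b - b') = 0" using that by (simp add: lin_minus[OF P(1)])
    ultimately show ?thesis using zero ex_short[of "b - b'"] by fastforce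
  qed
  obtain N where N: "\<And>a. P (N a) = 0" "\<And>a. a - N a \<in> IR"
  proof -
    have "\<exists>b. P b = 0 \<and> a - b \<in> IR" for a using reduce ex_short[of a] by blast
    then show ?thesis using that by metis
  qed
  have "lin N"
  proof (rule linI)
    fix x y :: "'x list \<Rightarrow>\<^sub>0 'k" and c :: 'k
    show "N (x + y) = N x + N y"
    proof (rule unique[of _ _ "x + y"])
      have "x + y - (N x + N y) = (x - N x) + (y - N y)" by simp
      then show "x + y - (N x + N y) \<in> IR" by (simp only:) (intro pm.subspace_add subspace_ideal N)
    qed (simp_all add: N lin_add[OF P(1)])
    show "N (scale c x) = scale c (N x)"
    proof (rule unique[of _ _ "scale c x"])
      have "scale c x - scale c (N x) = scale c (x - N x)" by (simp add: pm.scale_right_diff_distrib)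
      then show "scale c x - scale c (N x) \<in> IR" by (simp only:) (intro pm.subspace_scale subspace_ideal N)
    qed (simp_all add: N lin_scale[OF P(1)])
  qed
  moreover have "N a = 0" if "a \<in> IR" for a
    by (rule unique[of _ _ a]) (simp_all add: N lin_zero[OF P(1)] that)
  moreover have "N a \<in> short n" if a: "a \<in> short n" for a n
  proof -
    obtain b where "P b = 0" "b \<in> short n" "a - b \<in> IR" using reduce[OF a] by blast
    then show ?thesis using unique[of "N a" b a] N by simp
  qed
  ultimately show ?thesis using N(2) by blast
qed

definition nf :: "('x list \<Rightarrow>\<^sub>0 'k) \<Rightarrow> ('x list \<Rightarrow>\<^sub>0 'k)" where
  "nf = (SOME N. lin N \<and> (\<forall>a. a - N a \<in> IR) \<and> (\<forall>a\<in>IR. N a = 0) \<and> (\<forall>n. \<forall>a\<in>short n. N a \<in> short n))"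

lemma lin_nf0: "lin nf"
  and nf_ideal: "a - nf a \<in> IR"
  and nf_zero: "a \<in> IR \<Longrightarrow> nf a = 0"
  and nf_short: "a \<in> short n \<Longrightarrow> nf a \<in> short n"
  using someI_ex[OF normal_form_exists, folded nf_def] by blast+

lemma lin_nf [lin_intros]: "lin f \<Longrightarrow> lin (\<lambda>x. nf (f x))"
  by (rule lin_compose[OF lin_nf0])

text \<open>The element lifts to the ideal with corrections of lower weight, and the normal form of the lift is
  zero.\<close>

lemma nf_quadratic: "x \<in> IQ \<Longrightarrow> nf (wtpart n x) \<in> short n"
proof -
  assume "x \<in> IQ"
  from ideal_lift[OF this] obtain r where r: "r \<in> IR" "r \<in> short (Suc n)" "wtpart n r = wtpart n x" by blast
  have "wtpart n x - r \<in> short n"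
  proof (rule short_SucI)
    show "wtpart n x - r \<in> short (Suc n)" by (intro pm.subspace_diff subspace_short wtpart_short r)
    show "wtpart n (wtpart n x - r) = 0" by (simp add: lin_minus[OF lin_wtpart[OF lin_ident]] r(3) wtpart_wtpart)
  qed
  from nf_short[OF this] show ?thesis by (simp add: lin_minus[OF lin_nf0] nf_zero[OF r(1)])
qed

definition weight3 :: "'x list \<times> 'x list \<times> 'x list \<Rightarrow> nat" where
  "weight3 = (\<lambda>(u, w, v). length u + length w + length v)"

definition short3 :: "nat \<Rightarrow> ('x list \<times> 'x list \<times> 'x list \<Rightarrow>\<^sub>0 'k) set" where
  "short3 n = {x. \<forall>t\<in>supp x. weight3 t < n}"

lemma subspace_short3 [simp]: "pm.subspace (short3 n)"
  unfolding short3_def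
proof (rule pm.subspaceI)
  fix x y :: "'x list \<times> 'x list \<times> 'x list \<Rightarrow>\<^sub>0 'k" and c :: 'k
  assume x: "x \<in> {x. \<forall>t\<in>supp x. weight3 t < n}"
  show "scale c x \<in> {x. \<forall>t\<in>supp x. weight3 t < n}" using x by (auto simp: in_keys_iff)
  assume y: "y \<in> {x. \<forall>t\<in>supp x. weight3 t < n}"
  have "t \<in> supp x \<or> t \<in> supp y" if "t \<in> supp (x + y)" for t
    using that by (auto simp: in_keys_iff lookup_add)
  then show "x + y \<in> {x. \<forall>t\<in>supp x. weight3 t < n}" using x y by blast
qed simp

lemma short3_tensor3:
  assumes "a \<in> short i" "c \<in> short (Suc j)" "b \<in> short (Suc k)"
  shows "tensor3 a c b \<in> short3 (i + j + k)"
  unfolding short3_def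
proof (intro CollectI ballI)
  fix t assume t: "t \<in> supp (tensor3 a c b)"
  obtain u w v where uwv: "t = (u, w, v)" by (cases t)
  have "u \<in> supp a" "w \<in> supp c" "v \<in> supp b" using t by (auto simp: uwv in_keys_iff)
  then have "length u < i" "length w < Suc j" "length v < Suc k" using assms by (auto simp: short_def)
  then show "weight3 t < i + j + k" by (simp add: uwv weight3_def)
qed

lemma short3_part_top: "x \<in> short3 (Suc n) \<Longrightarrow> x - part (\<lambda>t. weight3 t = n) x \<in> short3 n"
  unfolding part_diff_compl by (auto simp: short3_def supp_part less_Suc_eq)

lemma part_top_tensor3:
  assumes "a \<in> short (Suc i)" "c \<in> short (Suc j)" "wtpart j c = c" "b \<in> short (Suc k)" "i + j + k \<le> n"
  shows "part (\<lambda>t. weight3 t = n) (tensor3 a c b) = (if i + j + k = n then tensor3 (wtpart i a) c (wtpart k b) else 0)"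
proof (rule poly_mapping_eqI)
  fix t :: "'x list \<times> 'x list \<times> 'x list"
  obtain u w v where t: "t = (u, w, v)" by (cases t)
  show "cf (part (\<lambda>t. weight3 t = n) (tensor3 a c b)) t = cf (if i + j + k = n then tensor3 (wtpart i a) c (wtpart k b) else 0) t"
  proof (cases "cf a u = 0 \<or> cf c w = 0 \<or> cf b v = 0")
    case True
    then show ?thesis by (auto simp: t)
  next
    case False
    then have "u \<in> supp a" "v \<in> supp b" "cf (wtpart j c) w \<noteq> 0" unfolding assms(3) by (auto simp: in_keys_iff)
    then have "length u < Suc i" "length w = j" "length v < Suc k"
      using assms(1,4) by (auto simp: short_def split: if_splits)
    then show ?thesis using assms(5) by (auto simp: t weight3_def)
  qed
qed

definition nf3 :: "('x list \<times> 'x list \<times> 'x list \<Rightarrow>\<^sub>0 'k) \<Rightarrow> ('x list \<times> 'x list \<times> 'x list \<Rightarrow>\<^sub>0 'k)" where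
  "nf3 = linext (\<lambda>(u, w, v). tensor3 (nf (bas u)) (bas w) (nf (bas v)))"

lemma lin_nf3 [lin_intros]: "lin f \<Longrightarrow> lin (\<lambda>x. nf3 (f x))"
  unfolding nf3_def by (rule lin_linext)

lemma nf3_tensor3: "nf3 (tensor3 a c b) = tensor3 (nf a) c (nf b)"
  by (rule trilinear_ext[of "\<lambda>a c b. nf3 (tensor3 a c b)" "\<lambda>a c b. tensor3 (nf a) c (nf b)"])
    ((intro lin_intros)+, simp add: nf3_def)

lemma minus_nf3_tensor3: "tensor3 a c b - nf3 (tensor3 a c b) = tensor3 (a - nf a) c b + tensor3 (nf a) c (b - nf b)"
  by (simp add: nf3_tensor3 lin_minus[OF lin_tensor3(1)[OF lin_ident]] lin_minus[OF lin_tensor3(3)[OF lin_ident]])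

lemma minus_nf3_den: "x \<in> num_space \<Longrightarrow> x - nf3 x \<in> den_space IR"
  by (erule tens3_into[of _ _ _ _ "\<lambda>x. x - nf3 x"])
    ((intro lin_intros)+, simp, unfold minus_nf3_tensor3, intro pm.subspace_add subspace_den den_left den_right nf_ideal)

lemma nf3_den: "x \<in> den_space IR \<Longrightarrow> nf3 x = 0"
proof -
  assume "x \<in> den_space IR"
  then have "nf3 x \<in> {0}"
    by (rule den_into) ((intro lin_intros)+, auto simp: nf3_tensor3 nf_zero lin_zero[OF lin_tensor3(1)[OF lin_ident]] lin_zero[OF lin_tensor3(3)[OF lin_ident]])
  then show ?thesis by simp
qed

text \<open>As \<open>nf3\<close> vanishes on \<open>e\<close>, one has \<open>e = e - nf3 e\<close>. The
  right-hand side can be examined on basis triples one at a time, after projecting their middle factor to the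
  coalgebra, and there \<open>ideal_leading_part\<close> applies to the outer factors.\<close>

lemma den_leading_part:
  assumes e: "e \<in> den_space IR" "e \<in> short3 (Suc n)"
  shows "part (\<lambda>t. weight3 t = n) e \<in> den_space IQ"
proof -
  obtain P where P: "lin P" "\<And>t. P t \<in> C" "\<And>t. t \<in> C \<Longrightarrow> P t = t"
    "\<And>u u'. u' \<in> supp (P (bas u)) \<Longrightarrow> length u' = length u"
    using graded_projection_exists[OF graded_C_length] by blast
  define P3 where "P3 = linext (\<lambda>(u :: 'x list, w, v :: 'x list). tensor3 (bas u) (P (bas w)) (bas v))"
  have linP3: "lin P3" unfolding P3_def by (intro lin_intros)
  have P3: "P3 (tensor3 a c b) = tensor3 a (P c) b" for a c b
    by (rule trilinear_ext[of "\<lambda>a c b. P3 (tensor3 a c b)" "\<lambda>a c b. tensor3 a (P c) b"])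
      ((intro lin_intros lin_compose[OF linP3] P(1))+, simp add: P3_def)
  have "e - P3 e \<in> {0}"
    by (rule den_into[OF e(1)]) ((intro lin_intros linP3)+, auto simp: P3 P(3))
  then have "e = P3 e - nf3 (P3 e)" using nf3_den[OF e(1)] by simp
  moreover have "part (\<lambda>t. weight3 t = n) (P3 e - nf3 (P3 e)) \<in> den_space IQ"
  proof (rule lin_in_subspace[of "\<lambda>e. part (\<lambda>t. weight3 t = n) (P3 e - nf3 (P3 e))"])
    fix t assume "t \<in> supp e"
    obtain u w v where t: "t = (u, w, v)" by (cases t)
    then have n: "length u + length w + length v \<le> n"
      using e(2) \<open>t \<in> supp e\<close> by (auto simp: short3_def weight3_def)
    have c: "P (bas w) \<in> short (Suc (length w))" "wtpart (length w) (P (bas w)) = P (bas w)"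
      unfolding wtpart_def using P(4) by (auto simp: short_def intro: part_id)
    have short: "bas u - nf (bas u) \<in> short (Suc (length u))" "nf (bas u) \<in> short (Suc (length u))" for u
      by (intro pm.subspace_diff subspace_short nf_short short_bas; simp)+
    have IQ: "wtpart (length u) (bas u - nf (bas u)) \<in> IQ" for u
      by (rule ideal_leading_part[OF nf_ideal short(1)])
    have eq: "P3 (bas t) - nf3 (P3 (bas t)) = tensor3 (bas u - nf (bas u)) (P (bas w)) (bas v) +
        tensor3 (nf (bas u)) (P (bas w)) (bas v - nf (bas v))"
      using minus_nf3_tensor3[of "bas u" "P (bas w)" "bas v"] by (simp add: t P3_def)
    have "part (\<lambda>t. weight3 t = n) (tensor3 (bas u - nf (bas u)) (P (bas w)) (bas v)) \<in> den_space IQ"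
      by (subst part_top_tensor3[OF short(1) c short_bas n])
        (auto intro: den_left IQ P(2) simp: pm.subspace_0)
    moreover have "part (\<lambda>t. weight3 t = n) (tensor3 (nf (bas u)) (P (bas w)) (bas v - nf (bas v))) \<in> den_space IQ"
      by (subst part_top_tensor3[OF short(2) c short(1) n])
        (auto intro: den_right IQ P(2) simp: pm.subspace_0)
    ultimately show "part (\<lambda>t. weight3 t = n) (P3 (bas t) - nf3 (P3 (bas t))) \<in> den_space IQ"
      unfolding eq part_add by (rule pm.subspace_add[OF subspace_den])
  qed (intro lin_intros linP3 lin_compose[OF linP3] | simp)+
  ultimately show ?thesis by simp
qed

text \<open>By \<open>nf_quadratic\<close> the normal form lowers the weight of the factor that lies in the
  quadratic ideal, and it does not raise that of the other one.\<close>

lemma nf3_quadratic_den: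
  assumes "x \<in> den_space IQ"
  shows "nf3 (part (\<lambda>t. weight3 t = n) x) \<in> short3 n"
proof (rule den_into[OF assms, of "\<lambda>x. nf3 (part (\<lambda>t. weight3 t = n) x)"])
  have nf_top: "nf (bas v) \<in> short (Suc (length v))" for v by (intro nf_short short_bas) simp
  have words: "nf3 (part (\<lambda>t. weight3 t = n) (tensor3 a (bas w) (bas v))) \<in> short3 n" if a: "a \<in> IQ" for a w v
  proof -
    have "part (\<lambda>t. weight3 t = n) (tensor3 a (bas w) (bas v)) =
        (if length w + length v \<le> n then tensor3 (wtpart (n - length w - length v) a) (bas w) (bas v) else 0)"
      by (rule poly_mapping_eqI) (auto simp: weight3_def cf_bas split: prod.splits)
    moreover have "nf3 (tensor3 (wtpart (n - length w - length v) a) (bas w) (bas v)) \<in> short3 n" if "length w + length v \<le> n"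
      using short3_tensor3[OF nf_quadratic[OF a, of "n - length w - length v"] short_bas[OF lessI, of w] nf_top[of v]] that
      by (simp add: nf3_tensor3)
    ultimately show ?thesis by (simp add: nf3_def pm.subspace_0)
  qed
  have words': "nf3 (part (\<lambda>t. weight3 t = n) (tensor3 (bas u) (bas w) b)) \<in> short3 n" if b: "b \<in> IQ" for b u w
  proof -
    have "part (\<lambda>t. weight3 t = n) (tensor3 (bas u) (bas w) b) =
        (if length u + length w \<le> n then tensor3 (bas u) (bas w) (wtpart (n - length u - length w) b) else 0)"
      by (rule poly_mapping_eqI) (auto simp: weight3_def cf_bas split: prod.splits)
    moreover have "nf3 (tensor3 (bas u) (bas w) (wtpart (n - length u - length w) b)) \<in> short3 n" if le: "length u + length w \<le> n"
      unfolding short3_def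
    proof (intro CollectI ballI)
      fix t assume t: "t \<in> supp (nf3 (tensor3 (bas u) (bas w) (wtpart (n - length u - length w) b)))"
      obtain u' w' v' where uwv: "t = (u', w', v')" by (cases t)
      have "u' \<in> supp (nf (bas u))" "w' = w" "v' \<in> supp (nf (wtpart (n - length u - length w) b))"
        using t by (auto simp: uwv nf3_tensor3 in_keys_iff cf_bas split: if_splits)
      then show "weight3 t < n" using nf_top[of u] nf_quadratic[OF b, of "n - length u - length w"] le
        by (fastforce simp: uwv weight3_def short_def)
    qed
    ultimately show ?thesis by (simp add: nf3_def pm.subspace_0)
  qed
  have lin3: "lin (\<lambda>x. nf3 (part (\<lambda>t. weight3 t = n) x))" by (intro lin_intros)
  fix a c b :: "'x list \<Rightarrow>\<^sub>0 'k"
  show "nf3 (part (\<lambda>t. weight3 t = n) (tensor3 a c b)) \<in> short3 n" if a: "a \<in> IQ"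
  proof (rule lin_in_subspace[of "\<lambda>c. nf3 (part (\<lambda>t. weight3 t = n) (tensor3 a c b))"])
    show "nf3 (part (\<lambda>t. weight3 t = n) (tensor3 a (bas w) b)) \<in> short3 n" for w
      by (rule lin_in_subspace[of "\<lambda>b. nf3 (part (\<lambda>t. weight3 t = n) (tensor3 a (bas w) b))"])
        ((intro lin_intros)+, simp, rule words[OF a])
  qed ((intro lin_intros)+, simp)
  show "nf3 (part (\<lambda>t. weight3 t = n) (tensor3 a c b)) \<in> short3 n" if b: "b \<in> IQ"
  proof (rule lin_in_subspace[of "\<lambda>c. nf3 (part (\<lambda>t. weight3 t = n) (tensor3 a c b))"])
    show "nf3 (part (\<lambda>t. weight3 t = n) (tensor3 a (bas w) b)) \<in> short3 n" for w
      by (rule lin_in_subspace[of "\<lambda>a. nf3 (part (\<lambda>t. weight3 t = n) (tensor3 a (bas w) b))"])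
        ((intro lin_intros)+, simp, rule words'[OF b])
  qed ((intro lin_intros)+, simp)
qed ((intro lin_intros)+, simp)

end

section \<open>The differential of the total Koszul complex\<close>

text \<open>The term \<open>a \<otimes> \<phi>(c) \<otimes> b\<close> of the differential.\<close>

definition Pt :: "('x \<Rightarrow> nat) \<Rightarrow> (('x list \<Rightarrow>\<^sub>0 'k::field) \<Rightarrow> ('x list \<Rightarrow>\<^sub>0 'k)) \<Rightarrow>
    ('x list \<times> 'x list \<times> 'x list \<Rightarrow>\<^sub>0 'k) \<Rightarrow> ('x list \<times> 'x list \<times> 'x list \<Rightarrow>\<^sub>0 'k)" where
  "Pt deg d = linext (\<lambda>(u, w, v). scale (ksgn (wdeg deg u)) (tensor3 (bas u) (d (bas w)) (bas v)))"

lemma lin_Pt [lin_intros]: "lin f \<Longrightarrow> lin (\<lambda>x. Pt deg d (f x))"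
  unfolding Pt_def by (rule lin_linext)

lemma Pt_tensor3: "lin d \<Longrightarrow> Pt deg d (tensor3 a c b) = tensor3 (wsg deg a) (d c) b"
  by (rule trilinear_ext[of "\<lambda>a c b. Pt deg d (tensor3 a c b)" "\<lambda>a c b. tensor3 (wsg deg a) (d c) b"])
    ((intro lin_intros; assumption?)+, simp add: Pt_def lin_scale[OF lin_tensor3(1)[OF lin_ident]])

text \<open>Splitting off one letter, as a map into \<open>T\<^sup>c \<otimes> T(V)\<close> or \<open>T(V) \<otimes> T\<^sup>c\<close>.\<close>

definition last_letter :: "('x \<Rightarrow> nat) \<Rightarrow> ('x list \<Rightarrow>\<^sub>0 'k::field) \<Rightarrow> ('x list \<times> 'x list \<Rightarrow>\<^sub>0 'k)" where
  "last_letter deg c = linext (\<lambda>(w1, w2). tensor2 (sg deg (bas w1)) (wtpart 1 (bas w2))) (deconc c)"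

definition first_letter :: "('x list \<Rightarrow>\<^sub>0 'k::field) \<Rightarrow> ('x list \<times> 'x list \<Rightarrow>\<^sub>0 'k)" where
  "first_letter c = linext (\<lambda>(w1, w2). tensor2 (wtpart 1 (bas w1)) (bas w2)) (deconc c)"

lemma lin_letters [lin_intros]: "lin f \<Longrightarrow> lin (\<lambda>x. last_letter deg (f x))" "lin f \<Longrightarrow> lin (\<lambda>x. first_letter (f x))"
  unfolding last_letter_def first_letter_def by (intro lin_intros; assumption)+

definition tmap :: "(('i \<Rightarrow>\<^sub>0 'k::field) \<Rightarrow> ('i' \<Rightarrow>\<^sub>0 'k)) \<Rightarrow> (('j \<Rightarrow>\<^sub>0 'k) \<Rightarrow> ('j' \<Rightarrow>\<^sub>0 'k)) \<Rightarrow>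
    ('i \<times> 'j \<Rightarrow>\<^sub>0 'k) \<Rightarrow> ('i' \<times> 'j' \<Rightarrow>\<^sub>0 'k)" where
  "tmap f g = linext (\<lambda>(i, j). tensor2 (f (bas i)) (g (bas j)))"

lemma lin_tmap [lin_intros]: "lin h \<Longrightarrow> lin (\<lambda>x. tmap f g (h x))"
  unfolding tmap_def by (rule lin_linext)

lemma slice1_tmap:
  fixes f :: "('i \<Rightarrow>\<^sub>0 'k::field) \<Rightarrow> ('m \<Rightarrow>\<^sub>0 'k)" and q :: "'i \<times> 'j \<Rightarrow>\<^sub>0 'k"
  assumes "lin f"
  shows "slice1 j (tmap f (\<lambda>x. x) q) = f (slice1 j q)"
proof (rule lin_ext[of "\<lambda>q. slice1 j (tmap f (\<lambda>x. x) q)" "\<lambda>q. f (slice1 j q)"])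
  fix ij :: "'i \<times> 'j"
  obtain i' j' where "ij = (i', j')" by fastforce
  then show "slice1 j (tmap f (\<lambda>x. x) (bas ij)) = f (slice1 j (bas ij))"
    by (auto simp: tmap_def slice1_tensor2 slice_bas cf_bas lin_zero[OF assms])
qed (intro lin_intros lin_compose[OF assms])+

lemma slice2_tmap:
  fixes g :: "('j \<Rightarrow>\<^sub>0 'k::field) \<Rightarrow> ('m \<Rightarrow>\<^sub>0 'k)" and q :: "'i \<times> 'j \<Rightarrow>\<^sub>0 'k"
  assumes "lin g"
  shows "slice2 i (tmap (\<lambda>x. x) g q) = g (slice2 i q)"
proof (rule lin_ext[of "\<lambda>q. slice2 i (tmap (\<lambda>x. x) g q)" "\<lambda>q. g (slice2 i q)"])
  fix ij :: "'i \<times> 'j"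
  obtain i' j' where "ij = (i', j')" by fastforce
  then show "slice2 i (tmap (\<lambda>x. x) g (bas ij)) = g (slice2 i (bas ij))"
    by (auto simp: tmap_def slice2_tensor2 slice_bas cf_bas lin_zero[OF assms])
qed (intro lin_intros lin_compose[OF assms])+

lemma cf_split_pair: "cf (tmap f g q) (i, j) = cf (slice1 j (tmap f g q)) i" "cf (tmap f g q) (i, j) = cf (slice2 i (tmap f g q)) j"
  by simp_all

lemma letters_tmap: "last_letter deg c = tmap (sg deg) (wtpart 1) (deconc c)"
  "first_letter c = tmap (wtpart 1) (\<lambda>x. x) (deconc c)"
  by (simp_all add: last_letter_def first_letter_def tmap_def)

lemma cf_last_letter:
  fixes c :: "'x list \<Rightarrow>\<^sub>0 'k::field"
  shows "cf (last_letter deg c) (w, y) = (if length y = 1 then ksgn (sdeg deg w) * cf c (w @ y) else 0)"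
proof -
  have "slice2 w (tmap (sg deg) (wtpart 1) q) = scale (ksgn (sdeg deg w)) (wtpart 1 (slice2 w q))" for q :: "'x list \<times> 'x list \<Rightarrow>\<^sub>0 'k"
  proof (rule lin_ext[of "\<lambda>q. slice2 w (tmap (sg deg) (wtpart 1) q)" "\<lambda>q. scale (ksgn (sdeg deg w)) (wtpart 1 (slice2 w q))"])
    fix ij :: "'x list \<times> 'x list"
    obtain i j where "ij = (i, j)" by fastforce
    then show "slice2 w (tmap (sg deg) (wtpart 1) (bas ij)) = scale (ksgn (sdeg deg w)) (wtpart 1 (slice2 w (bas ij :: _ \<Rightarrow>\<^sub>0 'k)))"
      by (auto simp: tmap_def slice2_tensor2 slice_bas cf_bas)
  qed (intro lin_intros)+
  then show ?thesis
    unfolding letters_tmap cf_split_pair(2) by (simp add: slices_deconc)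
qed

lemma cf_first_letter:
  fixes c :: "'x list \<Rightarrow>\<^sub>0 'k::field"
  shows "cf (first_letter c) (y, w) = (if length y = 1 then cf c (y @ w) else 0)"
proof -
  have "cf (first_letter c) (y, w) = cf (slice1 w (tmap (wtpart 1) (\<lambda>x. x) (deconc c))) y" by (simp add: letters_tmap)
  also have "\<dots> = (if length y = 1 then cf c (y @ w) else 0)"
    by (subst slice1_tmap[OF lin_wtpart[OF lin_ident]]) (simp add: slices_deconc)
  finally show ?thesis .
qed

lemma Rt_letter:
  fixes a b c :: "'x list \<Rightarrow>\<^sub>0 'k::field"
  shows "Rt deg (tensor3 a c b) = linext (\<lambda>(w, y). tensor3 (wsg deg a) (bas w) (bas y * b)) (last_letter deg c)"
proof -
  let ?J = "linext (\<lambda>(w, y). tensor3 (wsg deg a) (bas w) (bas y * b))"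
  have J: "?J (tensor2 p q) = tensor3 (wsg deg a) p (q * b)" for p q
    by (rule bilinear_ext[of "\<lambda>p q. ?J (tensor2 p q)" "\<lambda>p q. tensor3 (wsg deg a) p (q * b)"]) ((intro lin_intros)+, simp)
  have "?J (tmap (sg deg) (wtpart 1) q) = linext (\<lambda>(w1, w2). tensor3 (wsg deg a) (sg deg (bas w1)) (wtpart 1 (bas w2) * b)) q" for q :: "'x list \<times> 'x list \<Rightarrow>\<^sub>0 'k"
    by (rule lin_ext[of "\<lambda>q. ?J (tmap (sg deg) (wtpart 1) q)"]) ((intro lin_intros)+, auto simp: tmap_def J split: prod.splits simp del: sg_bas wtpart_bas)
  then show ?thesis by (simp only: Rt_tensor3 letters_tmap)
qed

lemma Lt_letter:
  fixes a b c :: "'x list \<Rightarrow>\<^sub>0 'k::field"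
  shows "Lt deg (tensor3 a c b) = linext (\<lambda>(y, w). tensor3 (wsg deg a * bas y) (bas w) b) (first_letter c)"
proof -
  let ?J = "linext (\<lambda>(y, w). tensor3 (wsg deg a * bas y) (bas w) b)"
  have J: "?J (tensor2 p q) = tensor3 (wsg deg a * p) q b" for p q
    by (rule bilinear_ext[of "\<lambda>p q. ?J (tensor2 p q)" "\<lambda>p q. tensor3 (wsg deg a * p) q b"]) ((intro lin_intros)+, simp)
  have "?J (tmap (wtpart 1) (\<lambda>x. x) q) = linext (\<lambda>(w1, w2). tensor3 (wsg deg a * wtpart 1 (bas w1)) (bas w2) b) q" for q :: "'x list \<times> 'x list \<Rightarrow>\<^sub>0 'k"
    by (rule lin_ext[of "\<lambda>q. ?J (tmap (wtpart 1) (\<lambda>x. x) q)"]) ((intro lin_intros)+, auto simp: tmap_def J split: prod.splits simp del: wtpart_bas)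
  then show ?thesis by (simp only: Lt_tensor3 letters_tmap split_left_def)
qed

lemma coderivation_sg:
  fixes d :: "('x list \<Rightarrow>\<^sub>0 'k::field) \<Rightarrow> ('x list \<Rightarrow>\<^sub>0 'k)"
  assumes d: "coderivation deg d" shows "d (sg deg c) = - sg deg (d c)"
proof (rule lin_ext[of "\<lambda>c. d (sg deg c)" "\<lambda>c. - sg deg (d c)"])
  note lind = coderivation_lin[OF d]
  fix w show "d (sg deg (bas w)) = - sg deg (d (bas w))"
  proof (rule poly_mapping_eqI)
    fix v show "cf (d (sg deg (bas w))) v = cf (- sg deg (d (bas w))) v"
      using coderivation_degree[OF d, of v w] by (cases "cf (d (bas w)) v = 0") (auto simp: lin_scale[OF lind] in_keys_iff)
  qed
qed (intro lin_intros lin_compose[OF coderivation_lin[OF d]] coderivation_lin[OF d])+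

text \<open>The co-Leibniz rule where the second factor has weight one: either \<open>d\<close> acts on the
  remaining word, or the letter that is split off is produced by \<open>d\<close>.\<close>

lemma last_letter_coderivation:
  fixes d :: "('x list \<Rightarrow>\<^sub>0 'k::field) \<Rightarrow> ('x list \<Rightarrow>\<^sub>0 'k)"
  assumes d: "coderivation deg d"
  shows "last_letter deg (d c) + tmap d (\<lambda>x. x) (last_letter deg c) = tmap (\<lambda>x. x) (\<lambda>p. wtpart 1 (d p)) (deconc c)"
proof (rule poly_mapping_eqI)
  note lind = coderivation_lin[OF d]
  fix t :: "'x list \<times> 'x list"
  obtain w y where t: "t = (w, y)" by fastforce
  have "cf (tmap d (\<lambda>x. x) (last_letter deg c)) (w, y) = cf (d (slice1 y (last_letter deg c))) w"
    unfolding cf_split_pair(1) by (simp only: slice1_tmap[OF lind])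
  also have "slice1 y (last_letter deg c) = (if length y = 1 then sg deg (rslice y c) else 0)"
    by (rule poly_mapping_eqI) (simp add: cf_last_letter)
  finally have 1: "cf (tmap d (\<lambda>x. x) (last_letter deg c)) (w, y) =
      (if length y = 1 then - (ksgn (sdeg deg w) * cf (d (rslice y c)) w) else 0)"
    by (simp add: coderivation_sg[OF d] lin_zero[OF lind])
  have "cf (tmap (\<lambda>x. x) (\<lambda>p. wtpart 1 (d p)) (deconc c)) (w, y) = cf (wtpart 1 (d (slice2 w (deconc c)))) y"
    unfolding cf_split_pair(2) by (subst slice2_tmap) (intro lin_intros lind, rule refl)
  then have 2: "cf (tmap (\<lambda>x. x) (\<lambda>p. wtpart 1 (d p)) (deconc c)) (w, y) = (if length y = 1 then cf (d (lslice w c)) y else 0)"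
    by (simp add: slices_deconc)
  show "cf (last_letter deg (d c) + tmap d (\<lambda>x. x) (last_letter deg c)) t = cf (tmap (\<lambda>x. x) (\<lambda>p. wtpart 1 (d p)) (deconc c)) t"
    unfolding t lookup_add 1 2 cf_last_letter by (simp add: coderivation_cf[OF d, of c w y] algebra_simps)
qed

lemma first_letter_coderivation:
  fixes d :: "('x list \<Rightarrow>\<^sub>0 'k::field) \<Rightarrow> ('x list \<Rightarrow>\<^sub>0 'k)"
  assumes d: "coderivation deg d"
  shows "first_letter (d c) + tmap (wsg deg) d (first_letter c) = tmap (\<lambda>p. wtpart 1 (d p)) (\<lambda>x. x) (deconc c)"
proof (rule poly_mapping_eqI)
  note lind = coderivation_lin[OF d]
  fix t :: "'x list \<times> 'x list"
  obtain y w where t: "t = (y, w)" by fastforce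
  have m: "slice2 y (tmap (wsg deg) d q) = scale (ksgn (wdeg deg y)) (d (slice2 y q))" for q
  proof (rule lin_ext[of "\<lambda>q. slice2 y (tmap (wsg deg) d q)" "\<lambda>q. scale (ksgn (wdeg deg y)) (d (slice2 y q))"])
    fix ij :: "'x list \<times> 'x list"
    obtain i j where "ij = (i, j)" by fastforce
    then show "slice2 y (tmap (wsg deg) d (bas ij)) = scale (ksgn (wdeg deg y)) (d (slice2 y (bas ij)))"
      by (auto simp: tmap_def slice2_tensor2 slice_bas cf_bas lin_zero[OF lind])
  qed (intro lin_intros lin_compose[OF lind])+
  have "slice2 y (first_letter c) = (if length y = 1 then lslice y c else 0)"
    by (rule poly_mapping_eqI) (simp add: cf_first_letter)
  then have 1: "cf (tmap (wsg deg) d (first_letter c)) (y, w) =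
      (if length y = 1 then ksgn (wdeg deg y) * cf (d (lslice y c)) w else 0)"
    unfolding cf_split_pair(2) m by (simp add: lin_zero[OF lind])
  have "cf (tmap (\<lambda>p. wtpart 1 (d p)) (\<lambda>x. x) (deconc c)) (y, w) = cf (wtpart 1 (d (slice1 w (deconc c)))) y"
    unfolding cf_split_pair(1) by (subst slice1_tmap) (intro lin_intros lind, rule refl)
  then have 2: "cf (tmap (\<lambda>p. wtpart 1 (d p)) (\<lambda>x. x) (deconc c)) (y, w) = (if length y = 1 then cf (d (rslice w c)) y else 0)"
    by (simp add: slices_deconc)
  have s: "length y = 1 \<Longrightarrow> ksgn (sdeg deg y) = - (ksgn (wdeg deg y) :: 'k)" by (simp add: sdeg_wdeg)
  show "cf (first_letter (d c) + tmap (wsg deg) d (first_letter c)) t = cf (tmap (\<lambda>p. wtpart 1 (d p)) (\<lambda>x. x) (deconc c)) t"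
    unfolding t lookup_add 1 2 cf_first_letter by (simp add: coderivation_cf[OF d, of c y w] s)
qed

lemma Rt_Pt:
  fixes d :: "('x list \<Rightarrow>\<^sub>0 'k::field) \<Rightarrow> ('x list \<Rightarrow>\<^sub>0 'k)"
  assumes d: "coderivation deg d"
  shows "Rt deg (Pt deg d (tensor3 (bas u) c (bas v))) + Pt deg d (Rt deg (tensor3 (bas u) c (bas v))) =
    split_right (\<lambda>p. wtpart 1 (d p)) (bas u) (bas v) (deconc c)"
proof -
  note lind = coderivation_lin[OF d]
  define J where "J = linext (\<lambda>(w :: 'x list, y). tensor3 (bas u) (bas w) (bas y * bas v) :: _ \<Rightarrow>\<^sub>0 'k)"
  have linJ: "lin (\<lambda>x. J (f x))" if "lin f" for f :: "('i \<Rightarrow>\<^sub>0 'k) \<Rightarrow> _" unfolding J_def by (intro lin_intros that)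
  have J: "J (tensor2 p q) = tensor3 (bas u) p (q * bas v)" for p q
    by (rule bilinear_ext[of "\<lambda>p q. J (tensor2 p q)" "\<lambda>p q. tensor3 (bas u) p (q * bas v)"]) ((intro lin_intros linJ)+, simp add: J_def)
  have s: "linext (\<lambda>(w, y). tensor3 (wsg deg (bas u)) (bas w) (bas y * bas v)) q = scale (ksgn (wdeg deg u)) (J q)" for q
    by (rule lin_ext[of _ "\<lambda>q. scale (ksgn (wdeg deg u)) (J q)"]) ((intro lin_intros linJ)+, auto simp: J_def lin_scale[OF lin_tensor3(1)[OF lin_ident]])
  have PJ: "Pt deg d (J q) = scale (ksgn (wdeg deg u)) (J (tmap d (\<lambda>x. x) q))" for q
    by (rule lin_ext[of "\<lambda>q. Pt deg d (J q)" "\<lambda>q. scale (ksgn (wdeg deg u)) (J (tmap d (\<lambda>x. x) q))"])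
      ((intro lin_intros linJ)+, auto simp: tmap_def J lin_scale[OF linJ[OF lin_ident]], auto simp: J_def Pt_def)
  have Rt: "Rt deg (tensor3 (bas u) c (bas v)) = scale (ksgn (wdeg deg u)) (J (last_letter deg c))" for c
    by (simp only: Rt_letter s)
  have "Rt deg (Pt deg d (tensor3 (bas u) c (bas v))) = J (last_letter deg (d c))"
    by (simp add: Pt_tensor3[OF lind] lin_scale[OF lin_tensor3(1)[OF lin_ident]] lin_scale[OF lin_Rt[OF lin_ident]] Rt)
  moreover have "Pt deg d (Rt deg (tensor3 (bas u) c (bas v))) = J (tmap d (\<lambda>x. x) (last_letter deg c))"
    by (simp add: Rt lin_scale[OF lin_Pt[OF lin_ident]] PJ)
  ultimately have "Rt deg (Pt deg d (tensor3 (bas u) c (bas v))) + Pt deg d (Rt deg (tensor3 (bas u) c (bas v))) =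
      J (last_letter deg (d c) + tmap d (\<lambda>x. x) (last_letter deg c))"
    by (simp add: lin_add[OF linJ[OF lin_ident]])
  also have "\<dots> = J (tmap (\<lambda>x. x) (\<lambda>p. wtpart 1 (d p)) (deconc c))"
    by (simp only: last_letter_coderivation[OF d])
  also have "J (tmap (\<lambda>x. x) (\<lambda>p. wtpart 1 (d p)) q) = split_right (\<lambda>p. wtpart 1 (d p)) (bas u) (bas v) q" for q
    by (rule lin_ext[of "\<lambda>q. J (tmap (\<lambda>x. x) (\<lambda>p. wtpart 1 (d p)) q)"]) ((intro lin_intros linJ)+, auto simp: tmap_def J split_right_def)
  finally show ?thesis .
qed

lemma Lt_Pt:
  fixes d :: "('x list \<Rightarrow>\<^sub>0 'k::field) \<Rightarrow> ('x list \<Rightarrow>\<^sub>0 'k)"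
  assumes d: "coderivation deg d"
  shows "Lt deg (Pt deg d (tensor3 (bas u) c (bas v))) + Pt deg d (Lt deg (tensor3 (bas u) c (bas v))) =
    split_left (\<lambda>p. wtpart 1 (d p)) (bas u) (bas v) (deconc c)"
proof -
  note lind = coderivation_lin[OF d]
  define J where "J = linext (\<lambda>(y, w :: 'x list). tensor3 (bas u * bas y) (bas w) (bas v) :: _ \<Rightarrow>\<^sub>0 'k)"
  have linJ: "lin (\<lambda>x. J (f x))" if "lin f" for f :: "('i \<Rightarrow>\<^sub>0 'k) \<Rightarrow> _" unfolding J_def by (intro lin_intros that)
  have J: "J (tensor2 p q) = tensor3 (bas u * p) q (bas v)" for p q
    by (rule bilinear_ext[of "\<lambda>p q. J (tensor2 p q)" "\<lambda>p q. tensor3 (bas u * p) q (bas v)"]) ((intro lin_intros linJ)+, simp add: J_def)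
  have s: "linext (\<lambda>(y, w). tensor3 (wsg deg (bas u) * bas y) (bas w) (bas v)) q = scale (ksgn (wdeg deg u)) (J q)" for q
    by (rule lin_ext[of _ "\<lambda>q. scale (ksgn (wdeg deg u)) (J q)"]) ((intro lin_intros linJ)+, auto simp: J_def lin_scale[OF lin_tensor3(1)[OF lin_ident]] scale_mult_left)
  have PJ: "Pt deg d (J q) = scale (ksgn (wdeg deg u)) (J (tmap (wsg deg) d q))" for q
    by (rule lin_ext[of "\<lambda>q. Pt deg d (J q)" "\<lambda>q. scale (ksgn (wdeg deg u)) (J (tmap (wsg deg) d q))"])
      ((intro lin_intros linJ)+, auto simp: tmap_def J lin_scale[OF linJ[OF lin_ident]], auto simp: J_def Pt_def ksgn_add scale_mult_right lin_scale[OF lin_tensor3(1)[OF lin_ident]])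
  have Lt: "Lt deg (tensor3 (bas u) c (bas v)) = scale (ksgn (wdeg deg u)) (J (first_letter c))" for c
    by (simp only: Lt_letter s)
  have "Lt deg (Pt deg d (tensor3 (bas u) c (bas v))) = J (first_letter (d c))"
    by (simp add: Pt_tensor3[OF lind] lin_scale[OF lin_tensor3(1)[OF lin_ident]] lin_scale[OF lin_Lt[OF lin_ident]] Lt)
  moreover have "Pt deg d (Lt deg (tensor3 (bas u) c (bas v))) = J (tmap (wsg deg) d (first_letter c))"
    by (simp add: Lt lin_scale[OF lin_Pt[OF lin_ident]] PJ)
  ultimately have "Lt deg (Pt deg d (tensor3 (bas u) c (bas v))) + Pt deg d (Lt deg (tensor3 (bas u) c (bas v))) =
      J (first_letter (d c) + tmap (wsg deg) d (first_letter c))"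
    by (simp add: lin_add[OF linJ[OF lin_ident]])
  also have "\<dots> = J (tmap (\<lambda>p. wtpart 1 (d p)) (\<lambda>x. x) (deconc c))"
    by (simp only: first_letter_coderivation[OF d])
  also have "J (tmap (\<lambda>p. wtpart 1 (d p)) (\<lambda>x. x) q) = split_left (\<lambda>p. wtpart 1 (d p)) (bas u) (bas v) q" for q
    by (rule lin_ext[of "\<lambda>q. J (tmap (\<lambda>p. wtpart 1 (d p)) (\<lambda>x. x) q)"]) ((intro lin_intros linJ)+, auto simp: tmap_def J split_left_def)
  finally show ?thesis .
qed

lemma split_add: "split_right (\<lambda>p. f p + g p) a b q = split_right f a b q + split_right g a b q"
  "split_left (\<lambda>p. f p + g p) a b q = split_left f a b q + split_left g a b q"
  by (rule lin_ext; (intro lin_intros)?; auto simp: split_right_def split_left_def distrib_left distrib_right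
      lin_add[OF lin_tensor3(1)[OF lin_ident]] lin_add[OF lin_tensor3(3)[OF lin_ident]])+

lemma split_minus: "split_right (\<lambda>p. f p - g p) a b q = split_right f a b q - split_right g a b q"
  "split_left (\<lambda>p. f p - g p) a b q = split_left f a b q - split_left g a b q"
  by (rule lin_ext; (intro lin_intros)?; auto simp: split_right_def split_left_def left_diff_distrib right_diff_distrib
      lin_minus[OF lin_tensor3(1)[OF lin_ident]] lin_minus[OF lin_tensor3(3)[OF lin_ident]])+

context qlc
begin

definition tdiff :: "('x list \<times> 'x list \<times> 'x list \<Rightarrow>\<^sub>0 'k) \<Rightarrow> ('x list \<times> 'x list \<times> 'x list \<Rightarrow>\<^sub>0 'k)" where
  "tdiff x = Pt deg d x + (Rt deg x - Lt deg x)"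

lemma lin_tdiff [lin_intros]: "lin f \<Longrightarrow> lin (\<lambda>x. tdiff (f x))"
  unfolding tdiff_def by (intro lin_intros; assumption)

lemma graded_IR: "graded_by (wdeg deg) IR"
  by (rule graded_ideal[OF graded_R]) simp

definition curv1 :: "('x list \<Rightarrow>\<^sub>0 'k) \<Rightarrow> ('x list \<Rightarrow>\<^sub>0 'k)" where
  "curv1 c = scale (curv c) (bas [])"

lemma lin_curv1 [lin_intros]: "lin f \<Longrightarrow> lin (\<lambda>x. curv1 (f x))"
  unfolding curv1_def curv_def pm.scale_minus_left by (intro lin_intros; assumption)

lemma d_d_split:
  assumes c: "c \<in> C"
  shows "tensor3 a (d (d c)) b = split_left curv1 a b (deconc c) - split_right curv1 a b (deconc c)"
proof -
  define L where "L = linext (\<lambda>(w1, w2). scale (curv (bas w1)) (bas w2 :: 'x list \<Rightarrow>\<^sub>0 'k))"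
  define R' where "R' = linext (\<lambda>(w1, w2). scale (curv (bas w2)) (bas w1 :: 'x list \<Rightarrow>\<^sub>0 'k))"
  have lin_curv: "lin (\<lambda>x. scale (curv (f x)) t)" if "lin f" for f :: "('i \<Rightarrow>\<^sub>0 'k) \<Rightarrow> ('x list \<Rightarrow>\<^sub>0 'k)" and t :: "'j \<Rightarrow>\<^sub>0 'k"
    unfolding curv_def pm.scale_minus_left by (intro lin_intros that)
  have curv_if: "curv (if P then bas i else 0) = (if P then curv (bas i) else 0)" for P i
    by (simp add: curv_def lin_zero[OF lin_low0])
  have L: "cf (L q) w = curv (slice1 w q)" for q w
    by (rule functional_eq[of "\<lambda>q. cf (L q) w" "\<lambda>q. curv (slice1 w q)"])
      (unfold L_def, intro lin_intros, intro lin_curv lin_intros, auto simp: slice_bas curv_if cf_bas)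
  have R': "cf (R' q) w = curv (slice2 w q)" for q w
    by (rule functional_eq[of "\<lambda>q. cf (R' q) w" "\<lambda>q. curv (slice2 w q)"])
      (unfold R'_def, intro lin_intros, intro lin_curv lin_intros, auto simp: slice_bas curv_if cf_bas)
  have "d (d c) = L (deconc c) - R' (deconc c)"
    by (rule poly_mapping_eqI) (simp add: lookup_minus L R' slices_deconc cf_d_d[OF c])
  moreover have "tensor3 a (L q) b = split_left curv1 a b q" for q
    by (rule lin_ext[of "\<lambda>q. tensor3 a (L q) b" "split_left curv1 a b"])
      (unfold L_def split_left_def, (intro lin_intros lin_ident)+, auto simp: curv1_def scale_mult_right lin_scale[OF lin_tensor3(1)[OF lin_ident]]
        lin_scale[OF lin_tensor3(2)[OF lin_ident]])
  moreover have "tensor3 a (R' q) b = split_right curv1 a b q" for q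
    by (rule lin_ext[of "\<lambda>q. tensor3 a (R' q) b" "split_right curv1 a b"])
      (unfold R'_def split_right_def, (intro lin_intros lin_ident)+, auto simp: curv1_def scale_mult_left lin_scale[OF lin_tensor3(3)[OF lin_ident]]
        lin_scale[OF lin_tensor3(2)[OF lin_ident]])
  ultimately show ?thesis by (simp add: lin_minus[OF lin_tensor3(2)[OF lin_ident]])
qed

text \<open>The square of the differential replaces a factor of weight two, split off to either side, by the relation
  with that leading term; hence it vanishes over \<open>A\<close>.\<close>

lemma tdiff_square: "x \<in> num_space \<Longrightarrow> tdiff (tdiff x) \<in> den_space IR"
proof (erule num_into)
  show "lin (\<lambda>x. tdiff (tdiff x))" by (intro lin_intros)
  fix u v :: "'x list" and c :: "'x list \<Rightarrow>\<^sub>0 'k" assume c: "c \<in> C"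
  note lind = coderivation_lin[OF coderivation_cod]
  let ?x = "tensor3 (bas u) c (bas v)"
  let ?\<rho> = "\<lambda>p. susp2 deg p - wtpart 1 (d p) + curv1 p"
  have PP: "Pt deg d (Pt deg d ?x) = tensor3 (bas u) (d (d c)) (bas v)"
    by (simp add: Pt_tensor3[OF lind] lin_scale[OF lin_tensor3(1)[OF lin_ident]] lin_scale[OF lin_Pt[OF lin_ident]])
  have "tdiff (tdiff ?x) = Pt deg d (Pt deg d ?x) + (Rt deg (Pt deg d ?x) + Pt deg d (Rt deg ?x))
      - (Lt deg (Pt deg d ?x) + Pt deg d (Lt deg ?x)) + Rt deg (Rt deg ?x) + Lt deg (Lt deg ?x)
      - (Rt deg (Lt deg ?x) + Lt deg (Rt deg ?x))"
    unfolding tdiff_def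
    by (simp add: lin_add[OF lin_Pt[OF lin_ident]] lin_minus[OF lin_Pt[OF lin_ident]] lin_add[OF lin_Rt[OF lin_ident]]
        lin_minus[OF lin_Rt[OF lin_ident]] lin_add[OF lin_Lt[OF lin_ident]] lin_minus[OF lin_Lt[OF lin_ident]])
  also have "\<dots> = split_left ?\<rho> (bas u) (bas v) (deconc c) - split_right ?\<rho> (bas u) (bas v) (deconc c)"
    unfolding PP Rt_Pt[OF coderivation_cod] Lt_Pt[OF coderivation_cod] Rt_Rt Lt_Lt Rt_Lt d_d_split[OF c] split_add split_minus
    by simp
  also have "\<dots> \<in> den_space IR"
  proof -
    have lin_rho: "lin ?\<rho>" by (intro lin_intros lin_ident)
    have rho: "?\<rho> p \<in> IR" if p: "p \<in> C" for p
    proof -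
      let ?s = "wtpart 2 p"
      have eq: "?\<rho> p = susp2 deg ?s - low ?s"
      proof (rule poly_mapping_eqI)
        fix w
        show "cf (?\<rho> p) w = cf (susp2 deg ?s - low ?s) w"
          using low_weight'[of w ?s]
          by (cases w; cases "cf (low ?s) w = 0")
            (auto simp: wtpart1_d[simplified] lookup_add lookup_minus curv1_def curv_def cf_bas in_keys_iff)
      qed
      show ?thesis unfolding eq by (rule ideal_base'[OF low_relation[OF C_weight2[OF p]]])
    qed
    show ?thesis
      by (intro pm.subspace_diff subspace_den split_left_den[OF lin_rho rho c] split_right_den[OF lin_rho rho c])
  qed
  finally show "tdiff (tdiff ?x) \<in> den_space IR" .
qed simp

lemma Pt_num: "x \<in> num_space \<Longrightarrow> Pt deg d x \<in> num_space"
  by (erule tens3_into[OF _ lin_Pt[OF lin_ident] subspace_tens3])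
    (simp add: Pt_tensor3[OF coderivation_lin[OF coderivation_cod]] tensor3_in d_C)

lemma Pt_den: "x \<in> den_space IR \<Longrightarrow> Pt deg d x \<in> den_space IR"
  by (erule den_into[OF _ lin_Pt[OF lin_ident] subspace_den])
    (simp_all add: Pt_tensor3[OF coderivation_lin[OF coderivation_cod]] den_left den_right d_C graded_by_wsg[OF graded_IR])

lemma tdiff_num: "x \<in> num_space \<Longrightarrow> tdiff x \<in> num_space"
  unfolding tdiff_def by (intro pm.subspace_add pm.subspace_diff subspace_tens3 Pt_num Rt_num Lt_num)

lemma tdiff_den: "x \<in> den_space IR \<Longrightarrow> tdiff x \<in> den_space IR"
  unfolding tdiff_def by (intro pm.subspace_add pm.subspace_diff subspace_den Pt_den Rt_den Lt_den graded_IR)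

lemma koszul_diff_eq: "koszul_diff deg R x = Pt deg (phi_tilde deg R) x + (Rt deg x - Lt deg x)"
proof (rule lin_ext[of "koszul_diff deg R" "\<lambda>x. Pt deg (phi_tilde deg R) x + (Rt deg x - Lt deg x)"])
  fix t :: "'x list \<times> 'x list \<times> 'x list"
  obtain u w v where t: "t = (u, w, v)" by (cases t)
  have r: "(\<Sum>i\<le>length w. scale (ksgn (wdeg deg u + sdeg deg (take i w)))
        (tensor3 (bas u) (bas (take i w)) (kappa (bas (drop i w)) * bas v))) = Rt deg (bas (u, w, v) :: _ \<Rightarrow>\<^sub>0 'k)"
    using Rt_tensor3[of deg "bas u" "bas w" "bas v :: _ \<Rightarrow>\<^sub>0 'k"]
    by (simp add: deconc_bas lin_sum[OF lin_linext0] kappa_def ksgn_add lin_scale[OF lin_tensor3(1)[OF lin_ident]]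
      lin_scale[OF lin_tensor3(2)[OF lin_ident]] mult.commute)
  have l: "(\<Sum>i\<le>length w. scale (ksgn (wdeg deg u))
          (tensor3 (bas u * kappa (bas (take i w))) (bas (drop i w)) (bas v))) = Lt deg (bas (u, w, v) :: _ \<Rightarrow>\<^sub>0 'k)"
    using Lt_tensor3[of deg "bas u" "bas w" "bas v :: _ \<Rightarrow>\<^sub>0 'k"]
    by (simp add: split_left_def deconc_bas lin_sum[OF lin_linext0] kappa_def lin_scale[OF lin_tensor3(1)[OF lin_ident]] scale_mult_left)
  show "koszul_diff deg R (bas t) = Pt deg (phi_tilde deg R) (bas t) + (Rt deg (bas t) - Lt deg (bas t))"
    unfolding koszul_diff_def t linext_bas prod.case sum_subtractf r l by (simp add: Pt_def)
qed (unfold koszul_diff_def, (intro lin_intros lin_ident)+)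

lemma koszul_diff_num: "x \<in> num_space \<Longrightarrow> koszul_diff deg R x = tdiff x"
proof -
  assume x: "x \<in> num_space"
  have "Pt deg (phi_tilde deg R) x - Pt deg d x \<in> {0}"
    by (rule tens3_into[OF x, of "\<lambda>x. Pt deg (phi_tilde deg R) x - Pt deg d x"])
      ((intro lin_intros)+, auto simp: Pt_tensor3[OF coderivation_lin[OF coderivation_cod]]
        Pt_tensor3[OF coderivation_lin[OF coderivation_phi_tilde]] phi_tilde_eq_d)
  then show ?thesis by (simp add: koszul_diff_eq tdiff_def)
qed

end

section \<open>Quasi-isomorphisms\<close>

lemma subspace_cycles: "chain_complex M \<Longrightarrow> pm.subspace (cycles M)"
proof -
  assume "chain_complex M"
  then have M: "pm.subspace (num M)" "pm.subspace (den M)" "lin (diff M)"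
    by (auto simp: chain_complex_def graded_subspace_def)
  show ?thesis
    unfolding cycles_def
    by (rule pm.subspaceI) (use M in \<open>auto simp: pm.subspace_0 pm.subspace_add pm.subspace_scale lin_zero lin_add lin_scale\<close>)
qed

lemma subspace_boundaries: "chain_complex M \<Longrightarrow> pm.subspace (boundaries M)"
proof -
  assume "chain_complex M"
  then have M: "pm.subspace (num M)" "pm.subspace (den M)" "lin (diff M)"
    by (auto simp: chain_complex_def graded_subspace_def)
  show ?thesis
  proof (rule pm.subspaceI)
    show "0 \<in> boundaries M" unfolding boundaries_def
      by (intro CollectI exI[of _ 0]) (use M in \<open>simp add: pm.subspace_0 lin_zero\<close>)
    show "x + y \<in> boundaries M" if xy: "x \<in> boundaries M" "y \<in> boundaries M" for x y
    proof -
      obtain a b a' b' where "x = diff M a + b" "a \<in> num M" "b \<in> den M" "y = diff M a' + b'" "a' \<in> num M" "b' \<in> den M"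
        using xy by (auto simp: boundaries_def)
      then show ?thesis unfolding boundaries_def
        by (intro CollectI exI[of _ "a + a'"] exI[of _ "b + b'"])
          (use M in \<open>auto simp: lin_add pm.subspace_add\<close>)
    qed
    show "scale c x \<in> boundaries M" if x: "x \<in> boundaries M" for c x
    proof -
      obtain a b where "x = diff M a + b" "a \<in> num M" "b \<in> den M" using x by (auto simp: boundaries_def)
      then show ?thesis unfolding boundaries_def
        by (intro CollectI exI[of _ "scale c a"] exI[of _ "scale c b"])
          (use M in \<open>auto simp: lin_scale pm.subspace_scale pm.scale_right_distrib\<close>)
    qed
  qed
qed

lemma homologous_class_eq:
  assumes "chain_complex M" "x \<in> cycles M" "y \<in> cycles M"
  shows "homologous M `` {x} = homologous M `` {y} \<longleftrightarrow> x - y \<in> boundaries M"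
proof
  note B = subspace_boundaries[OF assms(1)]
  assume "homologous M `` {x} = homologous M `` {y}"
  moreover have "y \<in> homologous M `` {y}" using assms(3) pm.subspace_0[OF B] by (simp add: homologous_def)
  ultimately have "(x, y) \<in> homologous M" by blast
  then show "x - y \<in> boundaries M" by (simp add: homologous_def)
next
  note B = subspace_boundaries[OF assms(1)]
  assume xy: "x - y \<in> boundaries M"
  have "x - z \<in> boundaries M \<longleftrightarrow> y - z \<in> boundaries M" for z
    using pm.subspace_diff[OF B _ xy, of "x - z"] pm.subspace_add[OF B xy, of "y - z"] by auto
  then show "homologous M `` {x} = homologous M `` {y}" using assms by (auto simp: homologous_def)
qed

lemma quasi_isoI:
  assumes f: "chain_map K L f"
    and inj: "\<And>x. x \<in> cycles K \<Longrightarrow> f x \<in> boundaries L \<Longrightarrow> x \<in> boundaries K"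
    and surj: "\<And>y. y \<in> cycles L \<Longrightarrow> \<exists>x\<in>cycles K. f x - y \<in> boundaries L"
  shows "quasi_iso K L f"
proof -
  have K: "chain_complex K" and L: "chain_complex L" and linf: "lin f" using f by (auto simp: chain_map_def)
  note cK = subspace_cycles[OF K] and bL = subspace_boundaries[OF L] and bK = subspace_boundaries[OF K]
  have denL: "pm.subspace (den L)" "diff L ` den L \<subseteq> den L" "lin (diff L)"
    using L by (auto simp: chain_complex_def graded_subspace_def)
  have comm: "x \<in> num K \<Longrightarrow> f (diff K x) - diff L (f x) \<in> den L" for x using f by (auto simp: chain_map_def)
  have f_num: "x \<in> num K \<Longrightarrow> f x \<in> num L" and f_den: "x \<in> den K \<Longrightarrow> f x \<in> den L" for x
    using f by (auto simp: chain_map_def)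
  have f_cyc: "f x \<in> cycles L" if "x \<in> cycles K" for x
  proof -
    have x: "x \<in> num K" "diff K x \<in> den K" using that by (auto simp: cycles_def)
    have "f (diff K x) - (f (diff K x) - diff L (f x)) \<in> den L"
      by (intro pm.subspace_diff denL(1) f_den x comm)
    then show ?thesis using f_num[OF x(1)] by (simp add: cycles_def)
  qed
  have f_bd: "f x \<in> boundaries L" if xb: "x \<in> boundaries K" for x
  proof -
    obtain a b where x: "x = diff K a + b" "a \<in> num K" "b \<in> den K" using xb by (auto simp: boundaries_def)
    have "f x = diff L (f a) + ((f (diff K a) - diff L (f a)) + f b)" by (simp add: x lin_add[OF linf])
    moreover have "(f (diff K a) - diff L (f a)) + f b \<in> den L" by (intro pm.subspace_add denL(1) comm f_den x)
    ultimately show ?thesis using f_num[OF x(2)] unfolding boundaries_def by blast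
  qed
  have class_map: "homology_map L f (homologous K `` {x}) = homologous L `` {f x}" if x: "x \<in> cycles K" for x
  proof -
    have "homologous L `` {f x'} = homologous L `` {f x}" if x': "(x, x') \<in> homologous K" for x'
    proof -
      have c: "x' \<in> cycles K" "x - x' \<in> boundaries K" using x' by (auto simp: homologous_def)
      have "f x - f x' \<in> boundaries L" using f_bd[OF c(2)] by (simp add: lin_minus[OF linf])
      from pm.subspace_neg[OF bL this] have "f x' - f x \<in> boundaries L" by simp
      then show ?thesis using homologous_class_eq[OF L f_cyc[OF c(1)] f_cyc[OF x]] by simp
    qed
    moreover have "(x, x) \<in> homologous K" using x pm.subspace_0[OF bK] by (simp add: homologous_def)
    ultimately show ?thesis unfolding homology_map_def by blast
  qed
  have "bij_betw (homology_map L f) (homology K) (homology L)"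
  proof (rule bij_betw_imageI)
    show "inj_on (homology_map L f) (homology K)"
    proof (rule inj_onI)
      fix X Y assume "X \<in> homology K" "Y \<in> homology K" and eq: "homology_map L f X = homology_map L f Y"
      then obtain x y where x: "x \<in> cycles K" "X = homologous K `` {x}" and y: "y \<in> cycles K" "Y = homologous K `` {y}"
        by (auto simp: homology_def quotient_def)
      have "f x - f y \<in> boundaries L"
        using eq homologous_class_eq[OF L f_cyc[OF x(1)] f_cyc[OF y(1)]] by (simp add: x y class_map)
      then have "f (x - y) \<in> boundaries L" by (simp add: lin_minus[OF linf])
      from inj[OF pm.subspace_diff[OF cK x(1) y(1)] this] show "X = Y"
        using homologous_class_eq[OF K x(1) y(1)] by (simp add: x y)
    qed
    show "homology_map L f ` homology K = homology L"
    proof (intro equalityI subsetI)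
      fix Y assume "Y \<in> homology_map L f ` homology K"
      then obtain x where "x \<in> cycles K" "Y = homology_map L f (homologous K `` {x})"
        by (auto simp: homology_def quotient_def)
      then show "Y \<in> homology L" using class_map f_cyc by (auto simp: homology_def intro: quotientI)
    next
      fix Y assume "Y \<in> homology L"
      then obtain y where y: "y \<in> cycles L" "Y = homologous L `` {y}" by (auto simp: homology_def quotient_def)
      obtain x where x: "x \<in> cycles K" "f x - y \<in> boundaries L" using surj[OF y(1)] by blast
      have "homology_map L f (homologous K `` {x}) = Y"
        using homologous_class_eq[OF L f_cyc[OF x(1)] y(1)] x by (simp add: class_map y)
      moreover have "homologous K `` {x} \<in> homology K" using x(1) by (auto simp: homology_def intro: quotientI)
      ultimately show "Y \<in> homology_map L f ` homology K" by blast
    qed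
  qed
  then show ?thesis using f by (simp add: quasi_iso_def)
qed

section \<open>The bimodule structure\<close>

lemma lin_triple_lact [lin_intros]: "lin f \<Longrightarrow> lin (\<lambda>x. triple_lact a (f x))"
  and lin_triple_ract [lin_intros]: "lin f \<Longrightarrow> lin (\<lambda>x. triple_ract (f x) b)"
  unfolding triple_lact_def triple_ract_def by (rule lin_linext; assumption)+

lemma lin_triple_lact_left [lin_intros]: "lin f \<Longrightarrow> lin (\<lambda>a. triple_lact (f a) x)"
  and lin_triple_ract_right [lin_intros]: "lin f \<Longrightarrow> lin (\<lambda>b. triple_ract x (f b))"
  unfolding triple_lact_def triple_ract_def linext_def split_def by (intro lin_intros; assumption)+

lemma triple_lact_tensor3: "triple_lact a (tensor3 p q r) = tensor3 (a * p) q r"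
  by (rule trilinear_ext[of "\<lambda>p q r. triple_lact a (tensor3 p q r)" "\<lambda>p q r. tensor3 (a * p) q r"])
    ((intro lin_intros)+, simp add: triple_lact_def)

lemma triple_ract_tensor3: "triple_ract (tensor3 p q r) b = tensor3 p q (r * b)"
  by (rule trilinear_ext[of "\<lambda>p q r. triple_ract (tensor3 p q r) b" "\<lambda>p q r. tensor3 p q (r * b)"])
    ((intro lin_intros)+, simp add: triple_ract_def)

lemma triple_ext:
  fixes f g :: "('a \<times> 'b \<times> 'c \<Rightarrow>\<^sub>0 'k::field) \<Rightarrow> ('d \<Rightarrow>\<^sub>0 'k)"
  assumes "lin f" "lin g" "\<And>u w v. f (tensor3 (bas u) (bas w) (bas v)) = g (tensor3 (bas u) (bas w) (bas v))"
  shows "f x = g x"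
proof (rule lin_ext[OF assms(1,2)])
  fix t :: "'a \<times> 'b \<times> 'c"
  obtain u w v where "t = (u, w, v)" by (cases t)
  then show "f (bas t) = g (bas t)" using assms(3)[of u w v] by simp
qed

lemma homog_diff: "homog g n p \<Longrightarrow> homog g n q \<Longrightarrow> homog g n (p - q)"
  and homog_add: "homog g n p \<Longrightarrow> homog g n q \<Longrightarrow> homog g n (p + q)"
  by (auto simp: homog_def in_keys_iff lookup_minus lookup_add; metis add.right_neutral diff_zero)+

lemma Rt_triple_lact: "Rt deg (triple_lact (bas a) x) = scale (ksgn (wdeg deg a)) (triple_lact (bas a) (Rt deg x))"
  by (rule triple_ext[of "\<lambda>x. Rt deg (triple_lact (bas a) x)" "\<lambda>x. scale (ksgn (wdeg deg a)) (triple_lact (bas a) (Rt deg x))"])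
    ((intro lin_intros)+, auto simp: Rt_def triple_lact_def ksgn_add mult.assoc)

lemma Lt_triple_lact: "Lt deg (triple_lact (bas a) x) = scale (ksgn (wdeg deg a)) (triple_lact (bas a) (Lt deg x))"
  by (rule triple_ext[of "\<lambda>x. Lt deg (triple_lact (bas a) x)" "\<lambda>x. scale (ksgn (wdeg deg a)) (triple_lact (bas a) (Lt deg x))"])
    ((intro lin_intros)+, auto simp: Lt_def triple_lact_def ksgn_add mult.assoc)

lemma Pt_triple_lact: "lin d \<Longrightarrow> Pt deg d (triple_lact (bas a) x) = scale (ksgn (wdeg deg a)) (triple_lact (bas a) (Pt deg d x))"
  by (rule triple_ext[of "\<lambda>x. Pt deg d (triple_lact (bas a) x)" "\<lambda>x. scale (ksgn (wdeg deg a)) (triple_lact (bas a) (Pt deg d x))"])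
    ((intro lin_intros)+, simp add: triple_lact_tensor3 Pt_tensor3 ksgn_add scale_mult_right lin_scale[OF lin_triple_lact[OF lin_ident]]
      lin_scale[OF lin_tensor3(1)[OF lin_ident]] del: tensor3_bas)

lemma Rt_triple_ract: "Rt deg (triple_ract x (bas b)) = triple_ract (Rt deg x) (bas b)"
  by (rule triple_ext[of "\<lambda>x. Rt deg (triple_ract x (bas b))" "\<lambda>x. triple_ract (Rt deg x) (bas b)"])
    ((intro lin_intros)+, auto simp: Rt_def triple_ract_def)

lemma Lt_triple_ract: "Lt deg (triple_ract x (bas b)) = triple_ract (Lt deg x) (bas b)"
  by (rule triple_ext[of "\<lambda>x. Lt deg (triple_ract x (bas b))" "\<lambda>x. triple_ract (Lt deg x) (bas b)"])
    ((intro lin_intros)+, auto simp: Lt_def triple_ract_def)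

lemma Pt_triple_ract: "lin d \<Longrightarrow> Pt deg d (triple_ract x (bas b)) = triple_ract (Pt deg d x) (bas b)"
  by (rule triple_ext[of "\<lambda>x. Pt deg d (triple_ract x (bas b))" "\<lambda>x. triple_ract (Pt deg d x) (bas b)"])
    ((intro lin_intros)+, simp add: triple_ract_tensor3 Pt_tensor3 del: tensor3_bas)

context qlc
begin

abbreviation K :: "('x list \<times> 'x list \<times> 'x list, 'k) presented_complex" where
  "K \<equiv> total_koszul_complex deg R"

abbreviation L :: "('x list, 'k) presented_complex" where
  "L \<equiv> alg_complex deg R"

lemma K_simps: "gdeg K = triple_deg deg" "num K = num_space" "den K = den_space IR" "diff K = koszul_diff deg R"
  by (simp_all add: total_koszul_complex_def Let_def den_space_def tens3_def)

lemma L_simps: "gdeg L = wdeg deg" "num L = UNIV" "den L = IR" "diff L = (\<lambda>_. 0)"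
  by (simp_all add: alg_complex_def)

lemma lin_koszul_diff: "lin (koszul_diff deg R)"
  unfolding koszul_diff_def by (rule lin_linext0)

lemma koszul_diff_degree: "homog (triple_deg deg) n x \<Longrightarrow> homog (triple_deg deg) (n - 1) (koszul_diff deg R x)"
proof -
  assume x: "homog (triple_deg deg) n x"
  have R1: "triple_deg deg j = triple_deg deg i + (- 1)" if "j \<in> supp (Rt deg (bas i) :: _ \<Rightarrow>\<^sub>0 'k)" for i j
  proof -
    obtain u w v where i: "i = (u, w, v)" by (cases i)
    show ?thesis using that
      by (cases w rule: rev_cases) (auto simp: i Rt_def in_keys_iff cf_bas triple_deg_def split: if_splits)
  qed
  have L1: "triple_deg deg j = triple_deg deg i + (- 1)" if "j \<in> supp (Lt deg (bas i) :: _ \<Rightarrow>\<^sub>0 'k)" for i j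
  proof -
    obtain u w v where i: "i = (u, w, v)" by (cases i)
    show ?thesis using that
      by (cases w) (auto simp: i Lt_def in_keys_iff cf_bas triple_deg_def split: if_splits)
  qed
  have P1: "triple_deg deg j = triple_deg deg i + (- 1)" if j: "j \<in> supp (Pt deg (phi_tilde deg R) (bas i))" for i j
  proof -
    obtain u w v where i: "i = (u, w, v)" by (cases i)
    obtain u' w' v' where j': "j = (u', w', v')" by (cases j)
    have "u' = u" "v' = v" "w' \<in> supp (phi_tilde deg R (bas w))"
      using j by (auto simp: i j' Pt_def in_keys_iff cf_bas split: if_splits)
    then show ?thesis using coderivation_degree[OF coderivation_phi_tilde, of w' w] by (simp add: i j' triple_deg_def)
  qed
  have "homog (triple_deg deg) (n + (- 1)) (Pt deg (phi_tilde deg R) x + (Rt deg x - Lt deg x))"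
    by (intro homog_add homog_diff homog_lin[OF lin_Rt[OF lin_ident] R1 x] homog_lin[OF lin_Lt[OF lin_ident] L1 x]
        homog_lin[OF lin_Pt[OF lin_ident] P1 x])
  then show ?thesis by (simp add: koszul_diff_eq)
qed

lemma triple_deg_part: "part (\<lambda>i. triple_deg deg i = n) = part (\<lambda>(u, w, v). wdeg deg u + sdeg deg w + wdeg deg v = n)"
  by (rule arg_cong[of _ _ part]) (auto simp: triple_deg_def fun_eq_iff)

lemma chain_complex_K: "chain_complex K"
  unfolding chain_complex_def K_simps
proof (intro conjI allI ballI impI)
  show "graded_subspace (triple_deg deg) num_space"
    unfolding graded_subspace_def triple_deg_part
  proof (intro conjI ballI allI)
    fix x n assume x: "x \<in> num_space"
    show "part (\<lambda>(u, w, v). wdeg deg u + sdeg deg w + wdeg deg v = n) x \<in> num_space"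
      by (rule tens3_graded_part[OF graded_UNIV graded_C_sdeg graded_UNIV x, of "\<lambda>a b c. a + b + c = n"])
  qed (rule subspace_tens3)
  show "graded_subspace (triple_deg deg) (den_space IR)"
    unfolding graded_subspace_def triple_deg_part
  proof (intro conjI ballI allI)
    fix x n assume x: "x \<in> den_space IR"
    show "part (\<lambda>(u, w, v). wdeg deg u + sdeg deg w + wdeg deg v = n) x \<in> den_space IR"
      by (rule den_graded_part[OF graded_IR graded_C_sdeg x, of "\<lambda>a b c. a + b + c = n"])
  qed (rule subspace_den)
  show "den_space IR \<subseteq> num_space" using den_num by blast
  show "koszul_diff deg R ` num_space \<subseteq> num_space" using tdiff_num koszul_diff_num by force
  show "koszul_diff deg R ` den_space IR \<subseteq> den_space IR" using tdiff_den koszul_diff_num den_num by force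
  show "koszul_diff deg R (koszul_diff deg R x) \<in> den_space IR" if "x \<in> num_space" for x
    using tdiff_square[OF that] by (simp add: koszul_diff_num that tdiff_num)
  fix n x assume x: "x \<in> num_space" "homog (triple_deg deg) n x"
  show "\<exists>y\<in>num_space. homog (triple_deg deg) (n - 1) y \<and> koszul_diff deg R x - y \<in> den_space IR"
    using koszul_diff_degree[OF x(2)] tdiff_num[OF x(1)] koszul_diff_num[OF x(1)]
    by (intro bexI[of _ "koszul_diff deg R x"]) (simp_all add: pm.subspace_0)
qed (rule lin_koszul_diff)

lemma chain_complex_L: "chain_complex L"
  unfolding chain_complex_def L_simps
  using graded_IR by (auto simp: graded_subspace_iff lin_const pm.subspace_0 homog_def intro: exI[of _ 0])

lemma xi_num: "xi (koszul_diff deg R x) = 0"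
proof -
  have "xi (Pt deg (phi_tilde deg R) x) = (\<lambda>_. 0) x"
    by (rule triple_ext[of "\<lambda>x. xi (Pt deg (phi_tilde deg R) x)"])
      ((intro lin_intros)+, simp add: Pt_tensor3[OF coderivation_lin[OF coderivation_phi_tilde]] xi_tensor3
        coderivation_counit[OF coderivation_phi_tilde] del: tensor3_bas)
  then show ?thesis by (simp add: koszul_diff_eq lin_add[OF lin_xi[OF lin_ident]] xi_Rt_Lt)
qed

lemma xi_den: "x \<in> den_space IR \<Longrightarrow> xi x \<in> IR"
  by (erule den_into[OF _ lin_xi[OF lin_ident] subspace_ideal])
    (simp_all add: xi_tensor3 pm.subspace_scale ideal_mult_left ideal_mult_right)

lemma chain_map_xi: "chain_map K L xi"
  unfolding chain_map_def K_simps L_simps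
proof (intro conjI allI ballI impI chain_complex_K chain_complex_L)
  show "lin xi" by (rule lin_xi[OF lin_ident])
  show "xi ` den_space IR \<subseteq> IR" using xi_den by blast
  show "xi (koszul_diff deg R x) - 0 \<in> IR" for x :: "_ \<Rightarrow>\<^sub>0 'k" by (simp add: xi_num pm.subspace_0)
  fix n and x :: "_ \<Rightarrow>\<^sub>0 'k" assume x: "homog (triple_deg deg) n x"
  have "homog (wdeg deg) (n + 0) (xi x)"
    by (rule homog_lin[OF lin_xi[OF lin_ident] _ x]) (auto simp: xi_def triple_deg_def split: prod.splits if_splits)
  then show "\<exists>y\<in>UNIV. homog (wdeg deg) n y \<and> xi x - y \<in> IR"
    by (intro bexI[of _ "xi x"]) (simp_all add: pm.subspace_0)
qed simp

lemma dg_bimodule_L: "dg_bimodule deg IR L (*) (*)"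
  unfolding dg_bimodule_def L_simps
proof (intro conjI allI ballI impI chain_complex_L)
  show "lin ((*) a)" "lin (\<lambda>a. a * x)" for a x :: "'x list \<Rightarrow>\<^sub>0 'k" by (intro lin_intros)+
  then show "lin (\<lambda>x. x * b)" "lin ((*) x)" for b x :: "'x list \<Rightarrow>\<^sub>0 'k" by auto
  fix m n and a x :: "'x list \<Rightarrow>\<^sub>0 'k" assume h: "homog (wdeg deg) m a \<and> homog (wdeg deg) n x"
  show "homog (wdeg deg) (m + n) (a * x)" "homog (wdeg deg) (m + n) (x * a)"
    using h supp_mult[of _ a x] supp_mult[of _ x a] by (fastforce simp: homog_def)+
qed (auto simp: mult.assoc pm.subspace_0 ideal_mult_left ideal_mult_right)

lemma num_actions: "x \<in> num_space \<Longrightarrow> triple_lact a x \<in> num_space" "x \<in> num_space \<Longrightarrow> triple_ract x a \<in> num_space"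
  by (erule tens3_into[OF _ _ subspace_tens3], intro lin_intros, simp add: triple_lact_tensor3 triple_ract_tensor3 tensor3_in)+

lemma den_actions: "x \<in> den_space IR \<Longrightarrow> triple_lact a x \<in> den_space IR" "x \<in> den_space IR \<Longrightarrow> triple_ract x a \<in> den_space IR"
  by (erule den_into[OF _ _ subspace_den], intro lin_intros,
      simp_all add: triple_lact_tensor3 triple_ract_tensor3 den_left den_right ideal_mult_left ideal_mult_right)+

lemma ideal_actions:
  assumes a: "a \<in> IR" and x: "x \<in> num_space"
  shows "triple_lact a x \<in> den_space IR" "triple_ract x a \<in> den_space IR"
proof -
  show "triple_lact a x \<in> den_space IR"
    by (rule tens3_into[OF x lin_triple_lact[OF lin_ident] subspace_den])
      (simp add: triple_lact_tensor3 den_left ideal_mult_right a)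
  show "triple_ract x a \<in> den_space IR"
    by (rule tens3_into[OF x lin_triple_ract[OF lin_ident] subspace_den])
      (simp add: triple_ract_tensor3 den_right ideal_mult_left a)
qed

lemma koszul_diff_lact:
  assumes "homog (wdeg deg) m a"
  shows "koszul_diff deg R (triple_lact a x) = scale (ksgn m) (triple_lact a (koszul_diff deg R x))"
proof (rule lin_ext_supp[of "\<lambda>a. koszul_diff deg R (triple_lact a x)" "\<lambda>a. scale (ksgn m) (triple_lact a (koszul_diff deg R x))"])
  fix w assume "w \<in> supp a"
  then have "wdeg deg w = m" using assms by (simp add: homog_def)
  then show "koszul_diff deg R (triple_lact (bas w) x) = scale (ksgn m) (triple_lact (bas w) (koszul_diff deg R x))"
    by (simp add: koszul_diff_eq Rt_triple_lact Lt_triple_lact Pt_triple_lact[OF coderivation_lin[OF coderivation_phi_tilde]]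
        lin_add[OF lin_triple_lact[OF lin_ident]] lin_minus[OF lin_triple_lact[OF lin_ident]]
        pm.scale_right_distrib pm.scale_right_diff_distrib)
qed (intro lin_intros lin_compose[OF lin_koszul_diff])+

lemma koszul_diff_ract: "koszul_diff deg R (triple_ract x b) = triple_ract (koszul_diff deg R x) b"
proof (rule lin_ext[of "\<lambda>b. koszul_diff deg R (triple_ract x b)" "\<lambda>b. triple_ract (koszul_diff deg R x) b"])
  fix w show "koszul_diff deg R (triple_ract x (bas w)) = triple_ract (koszul_diff deg R x) (bas w)"
    by (simp add: koszul_diff_eq Rt_triple_ract Lt_triple_ract Pt_triple_ract[OF coderivation_lin[OF coderivation_phi_tilde]]
        lin_add[OF lin_triple_ract[OF lin_ident]] lin_minus[OF lin_triple_ract[OF lin_ident]])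
qed (intro lin_intros lin_compose[OF lin_koszul_diff] lin_ident)+

lemma dg_bimodule_K: "dg_bimodule deg IR K triple_lact triple_ract"
  unfolding dg_bimodule_def K_simps
proof (intro conjI allI ballI impI chain_complex_K)
  show "lin (triple_lact a)" "lin (\<lambda>x. triple_ract x b)" "lin (\<lambda>a. triple_lact a x)" "lin (triple_ract x)"
    for a b :: "'x list \<Rightarrow>\<^sub>0 'k" and x :: "_ \<Rightarrow>\<^sub>0 'k" by (intro lin_triple_lact lin_triple_ract lin_triple_lact_left lin_triple_ract_right lin_ident)+
  show "triple_lact 1 x = x" "triple_ract x 1 = x" for x :: "_ \<Rightarrow>\<^sub>0 'k"
    by (rule triple_ext; (intro lin_intros)?; simp add: triple_lact_tensor3 triple_ract_tensor3 del: tensor3_bas)+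
  show "triple_lact (a * a') x = triple_lact a (triple_lact a' x)" for a a' and x :: "_ \<Rightarrow>\<^sub>0 'k"
    by (rule triple_ext[of "\<lambda>x. triple_lact (a * a') x" "\<lambda>x. triple_lact a (triple_lact a' x)"])
      ((intro lin_intros)+, simp add: triple_lact_tensor3 mult.assoc del: tensor3_bas)
  show "triple_ract x (b * b') = triple_ract (triple_ract x b) b'" for b b' and x :: "_ \<Rightarrow>\<^sub>0 'k"
    by (rule triple_ext[of "\<lambda>x. triple_ract x (b * b')" "\<lambda>x. triple_ract (triple_ract x b) b'"])
      ((intro lin_intros)+, simp add: triple_ract_tensor3 mult.assoc del: tensor3_bas)
  show "triple_ract (triple_lact a x) b = triple_lact a (triple_ract x b)" for a b and x :: "_ \<Rightarrow>\<^sub>0 'k"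
    by (rule triple_ext[of "\<lambda>x. triple_ract (triple_lact a x) b" "\<lambda>x. triple_lact a (triple_ract x b)"])
      ((intro lin_intros)+, simp add: triple_lact_tensor3 triple_ract_tensor3 del: tensor3_bas)
  fix m n and a :: "'x list \<Rightarrow>\<^sub>0 'k" and x :: "_ \<Rightarrow>\<^sub>0 'k" assume h: "homog (wdeg deg) m a \<and> homog (triple_deg deg) n x"
  have wl: "triple_deg deg j = triple_deg deg i + m" if j: "j \<in> supp (triple_lact a (bas i))" for i j
  proof -
    obtain u w v where i: "i = (u, w, v)" by (cases i)
    obtain u' w' v' where j': "j = (u', w', v')" by (cases j)
    have "u' \<in> supp (a * bas u)" "w' = w" "v' = v"
      using j by (auto simp: i j' triple_lact_def in_keys_iff cf_bas split: if_splits)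
    then show ?thesis using supp_mult[of u' a "bas u"] h by (auto simp: i j' triple_deg_def homog_def)
  qed
  have wr: "triple_deg deg j = triple_deg deg i + m" if j: "j \<in> supp (triple_ract (bas i) a)" for i j
  proof -
    obtain u w v where i: "i = (u, w, v)" by (cases i)
    obtain u' w' v' where j': "j = (u', w', v')" by (cases j)
    have "v' \<in> supp (bas v * a)" "w' = w" "u' = u"
      using j by (auto simp: i j' triple_ract_def in_keys_iff cf_bas split: if_splits)
    then show ?thesis using supp_mult[of v' "bas v" a] h by (auto simp: i j' triple_deg_def homog_def)
  qed
  have "homog (triple_deg deg) (n + m) (triple_lact a x)" "homog (triple_deg deg) (n + m) (triple_ract x a)"
    by (rule homog_lin[OF lin_triple_lact[OF lin_ident] wl], assumption, use h in blast)
      (rule homog_lin[OF lin_triple_ract[OF lin_ident] wr], assumption, use h in blast)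
  then show "homog (triple_deg deg) (m + n) (triple_lact a x)" "homog (triple_deg deg) (m + n) (triple_ract x a)"
    by (simp_all add: add.commute)
qed (simp_all add: num_actions den_actions ideal_actions koszul_diff_lact koszul_diff_ract pm.subspace_0)

lemma dg_bimodule_map_xi: "dg_bimodule_map deg IR K triple_lact triple_ract L (*) (*) xi"
proof -
  have "xi (triple_lact a x) = a * xi x" for a :: "'x list \<Rightarrow>\<^sub>0 'k" and x
    by (rule triple_ext[of "\<lambda>x. xi (triple_lact a x)" "\<lambda>x. a * xi x"])
      ((intro lin_intros)+, simp add: triple_lact_tensor3 xi_tensor3 scale_mult_right mult.assoc del: tensor3_bas bas_mult)
  moreover have "xi (triple_ract x a) = xi x * a" for a :: "'x list \<Rightarrow>\<^sub>0 'k" and x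
    by (rule triple_ext[of "\<lambda>x. xi (triple_ract x a)" "\<lambda>x. xi x * a"])
      ((intro lin_intros)+, simp add: triple_ract_tensor3 xi_tensor3 scale_mult_left mult.assoc del: tensor3_bas bas_mult)
  ultimately show ?thesis
    unfolding dg_bimodule_map_def
    by (auto simp: dg_bimodule_K dg_bimodule_L chain_map_xi L_simps pm.subspace_0)
qed

end

section \<open>Exactness\<close>

context koszul_qlc
begin

text \<open>The coderivation lowers the weight by one, and the twisted terms preserve it.\<close>

lemma tdiff_leading:
  assumes "x \<in> short3 (Suc n)"
  shows "part (\<lambda>t. weight3 t = n) (tdiff x) = Rt deg (part (\<lambda>t. weight3 t = n) x) - Lt deg (part (\<lambda>t. weight3 t = n) x)"
    and "tdiff x \<in> short3 (Suc n)"
proof -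
  note lind = coderivation_lin[OF coderivation_cod]
  have Pt_low: "Pt deg d (bas t) \<in> short3 (weight3 t)" for t
  proof -
    obtain u w v where t: "t = (u, w, v)" by (cases t)
    have "weight3 s < weight3 t" if s: "s \<in> supp (Pt deg d (bas t))" for s
    proof -
      obtain u' w' v' where s': "s = (u', w', v')" by (cases s)
      have "u' = u" "v' = v" "w' \<in> supp (d (bas w))"
        using s by (auto simp: t s' Pt_def in_keys_iff cf_bas split: if_splits)
      then show ?thesis using d_weight[of w' w] by (simp add: t s' weight3_def)
    qed
    then show ?thesis by (simp add: short3_def)
  qed
  have RL: "weight3 s = weight3 t" if "s \<in> supp (Rt deg (bas t) - Lt deg (bas t) :: _ \<Rightarrow>\<^sub>0 'k)" for s t
  proof -
    obtain u w v where t: "t = (u, w, v)" by (cases t)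
    have "s \<in> supp (Rt deg (bas t) :: _ \<Rightarrow>\<^sub>0 'k) \<or> s \<in> supp (Lt deg (bas t) :: _ \<Rightarrow>\<^sub>0 'k)"
      using that by (auto simp: in_keys_iff lookup_minus)
    then show ?thesis
      by (auto simp: t Rt_def Lt_def weight3_def in_keys_iff cf_bas split: if_splits)
  qed
  show "part (\<lambda>t. weight3 t = n) (tdiff x) = Rt deg (part (\<lambda>t. weight3 t = n) x) - Lt deg (part (\<lambda>t. weight3 t = n) x)"
  proof (rule lin_ext_supp[of "\<lambda>x. part (\<lambda>t. weight3 t = n) (tdiff x)"
        "\<lambda>x. Rt deg (part (\<lambda>t. weight3 t = n) x) - Lt deg (part (\<lambda>t. weight3 t = n) x)"])
    fix t assume "t \<in> supp x"
    then have le: "weight3 t \<le> n" using assms by (auto simp: short3_def)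
    have P0: "part (\<lambda>t. weight3 t = n) (Pt deg d (bas t)) = 0"
      by (rule part_none) (use Pt_low[of t] le in \<open>auto simp: short3_def\<close>)
    have "part (\<lambda>t. weight3 t = n) (Rt deg (bas t) - Lt deg (bas t)) =
        (if weight3 t = n then Rt deg (bas t) - Lt deg (bas t) else (0 :: _ \<Rightarrow>\<^sub>0 'k))"
      using RL[of _ t] by (auto intro: part_id part_none)
    then show "part (\<lambda>t. weight3 t = n) (tdiff (bas t)) =
        Rt deg (part (\<lambda>t. weight3 t = n) (bas t)) - Lt deg (part (\<lambda>t. weight3 t = n) (bas t))"
      by (simp add: tdiff_def part_add P0 lin_zero[OF lin_Rt[OF lin_ident]] lin_zero[OF lin_Lt[OF lin_ident]])
  qed (intro lin_intros)+
  show "tdiff x \<in> short3 (Suc n)"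
  proof (rule lin_in_subspace[of tdiff])
    fix t assume "t \<in> supp x"
    then have le: "weight3 t \<le> n" using assms by (auto simp: short3_def)
    have "Pt deg d (bas t) \<in> short3 (Suc n)" using Pt_low[of t] le by (fastforce simp: short3_def)
    moreover have "Rt deg (bas t) - Lt deg (bas t) \<in> short3 (Suc n)" using RL[of _ t] le by (auto simp: short3_def)
    ultimately show "tdiff (bas t) \<in> short3 (Suc n)" unfolding tdiff_def by (rule pm.subspace_add[OF subspace_short3])
  qed (intro lin_intros lin_ident, simp)
qed

text \<open>Descend along the weight: the leading part of a cycle is a cycle of the quadratic complex, hence a boundary
  there, and subtracting the corresponding boundary lowers the weight.\<close>

lemma total_koszul_exact:
  assumes "x \<in> num_space" "tdiff x \<in> den_space IR" "xi x \<in> IR" "x \<in> short3 n"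
  shows "\<exists>y\<in>num_space. x - tdiff y \<in> den_space IR"
  using assms
proof (induction n arbitrary: x)
  case 0
  have "supp x = {}" using 0(4) unfolding short3_def by blast
  then have "x = 0" by simp
  then show ?case
    by (intro bexI[of _ 0]) (simp_all add: pm.subspace_0 lin_zero[OF lin_tdiff[OF lin_ident]])
next
  case (Suc n)
  let ?top = "part (\<lambda>t. weight3 t = n)"
  have top: "?top z \<in> num_space" if "z \<in> num_space" for z
  proof -
    have "(\<lambda>t. weight3 t = n) = (\<lambda>(u :: 'x list, w :: 'x list, v :: 'x list). length u + length w + length v = n)"
      by (auto simp: weight3_def fun_eq_iff)
    then show ?thesis using num_part[OF that, of "\<lambda>a b c. a + b + c = n"] by simp
  qed
  have xn: "?top x \<in> num_weight n" using top[OF Suc.prems(1)] by (auto simp: supp_part weight3_def)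
  have Dxn: "Rt deg (?top x) - Lt deg (?top x) \<in> den_space IQ"
    using den_leading_part[OF Suc.prems(2) tdiff_leading(2)[OF Suc.prems(4)]] tdiff_leading(1)[OF Suc.prems(4)] by simp
  have xi_top: "xi (?top x) = wtpart n (xi x)"
    by (rule triple_ext[of "\<lambda>x. xi (?top x)" "\<lambda>x. wtpart n (xi x)"])
      ((intro lin_intros)+, auto simp: xi_def weight3_def)
  have "xi x \<in> short (Suc n)"
  proof (rule lin_in_subspace[OF lin_xi[OF lin_ident] subspace_short])
    fix t assume "t \<in> supp x"
    then show "xi (bas t) \<in> short (Suc n)"
      using Suc.prems(4) by (cases t) (auto simp: xi_def short3_def weight3_def pm.subspace_0 intro!: short_bas)
  qed
  then have xi_n: "xi (?top x) \<in> IQ" unfolding xi_top by (rule ideal_leading_part[OF Suc.prems(3)])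
  obtain y where y: "y \<in> num_weight n" "?top x - (Rt deg y - Lt deg y) \<in> den_space IQ"
    using bimodule_koszul_exact[OF xn Dxn xi_n] by blast
  \<comment> \<open>\<open>?e\<close> vanishes over the quadratic algebra only. Subtracting its normal form
    gives an element \<open>?e'\<close> that vanishes over \<open>A\<close>, at the cost of the normal form,
    which has lower weight.\<close>
  let ?e = "?top x - (Rt deg y - Lt deg y)"
  let ?e' = "?e - nf3 ?e"
  let ?x = "x - tdiff y - ?e'"
  have y_num: "y \<in> num_space" using y(1) by blast
  have y_short: "y \<in> short3 (Suc n)" using y(1) by (auto simp: short3_def weight3_def)
  have y_top: "?top y = y" by (rule part_id) (use y(1) in \<open>auto simp: weight3_def\<close>)
  have Dy_top: "?top (tdiff y) = Rt deg y - Lt deg y" using tdiff_leading(1)[OF y_short] y_top by simp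
  have "?top (Rt deg y - Lt deg y) = ?top (?top (tdiff y))" by (simp only: Dy_top)
  also have "\<dots> = ?top (tdiff y)" by (rule part_id) (auto simp: supp_part)
  finally have "?top (Rt deg y - Lt deg y) = Rt deg y - Lt deg y" by (simp only: Dy_top)
  moreover have "?top (?top x) = ?top x" by (rule part_id) (auto simp: supp_part)
  ultimately have e_top: "?top ?e = ?e" by (simp only: part_minus)
  have nf_e: "nf3 ?e \<in> short3 n" using nf3_quadratic_den[OF y(2), of n] e_top by simp
  have e'_den: "?e' \<in> den_space IR" by (rule minus_nf3_den[OF den_num[OF y(2)]])
  have x1: "?x \<in> num_space"
    by (intro pm.subspace_diff subspace_tens3 Suc.prems tdiff_num y_num den_num[OF e'_den])
  have "?x = (x - ?top x) - (tdiff y - ?top (tdiff y)) + nf3 ?e" by (simp add: Dy_top)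
  also have "\<dots> \<in> short3 n"
    by (intro pm.subspace_add pm.subspace_diff subspace_short3 short3_part_top Suc.prems tdiff_leading(2)[OF y_short] nf_e)
  finally have x4: "?x \<in> short3 n" .
  have "tdiff ?x = tdiff x - tdiff (tdiff y) - tdiff ?e'" by (simp only: lin_minus[OF lin_tdiff[OF lin_ident]])
  also have "\<dots> \<in> den_space IR"
    by (intro pm.subspace_diff subspace_den Suc.prems tdiff_square tdiff_den y_num e'_den)
  finally have x2: "tdiff ?x \<in> den_space IR" .
  have "xi (tdiff y) = 0" using xi_num[of y] koszul_diff_num[OF y_num] by simp
  then have "xi ?x = xi x - xi ?e'" by (simp only: lin_minus[OF lin_xi[OF lin_ident]]) simp
  also have "\<dots> \<in> IR" by (intro pm.subspace_diff subspace_ideal Suc.prems xi_den e'_den)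
  finally have x3: "xi ?x \<in> IR" .
  from Suc.IH[OF x1 x2 x3 x4] obtain y1 where y1: "y1 \<in> num_space" "?x - tdiff y1 \<in> den_space IR" by blast
  have "x - tdiff (y + y1) = (?x - tdiff y1) + ?e'" by (simp only: lin_add[OF lin_tdiff[OF lin_ident]]) simp
  also have "\<dots> \<in> den_space IR" by (intro pm.subspace_add subspace_den y1 e'_den)
  finally show ?case using y_num y1(1) by (intro bexI[of _ "y + y1"]) (auto intro: pm.subspace_add[OF subspace_tens3])
qed

lemma ex_short3: "\<exists>n. x \<in> short3 n"
proof -
  have "finite (weight3 ` supp x)" by simp
  then obtain n where "\<forall>m\<in>weight3 ` supp x. m < n" using finite_nat_set_iff_bounded by auto
  then show ?thesis by (auto simp: short3_def)
qed

lemma quasi_iso_xi: "quasi_iso K L xi"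
proof (rule quasi_isoI[OF chain_map_xi])
  have bdL: "boundaries L = IR" by (auto simp: boundaries_def L_simps)
  fix x assume "x \<in> cycles K" "xi x \<in> boundaries L"
  then have x: "x \<in> num_space" "tdiff x \<in> den_space IR" "xi x \<in> IR"
    by (auto simp: cycles_def K_simps bdL koszul_diff_num)
  obtain n where "x \<in> short3 n" using ex_short3 by blast
  from total_koszul_exact[OF x this] obtain y where y: "y \<in> num_space" "x - tdiff y \<in> den_space IR" by blast
  have "x = koszul_diff deg R y + (x - tdiff y)" by (simp add: koszul_diff_num y)
  then show "x \<in> boundaries K" unfolding boundaries_def K_simps using y by blast
next
  fix y :: "'x list \<Rightarrow>\<^sub>0 'k"
  let ?x = "tensor3 (bas []) (bas []) y"
  have "?x \<in> num_space" by (intro tensor3_in UNIV_I C_bas_Nil)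
  moreover have "tdiff ?x = (\<lambda>_. 0) y"
    by (rule lin_ext[of "\<lambda>y. tdiff (tensor3 (bas []) (bas []) y)"])
      ((intro lin_intros)+, simp add: tdiff_def Rt_def Lt_def Pt_def cod_def lin_zero[OF lin_tensor3(2)[OF lin_ident]])
  ultimately have "?x \<in> cycles K" by (simp add: cycles_def K_simps koszul_diff_num pm.subspace_0)
  moreover have "xi ?x - y = 0" by (simp add: xi_tensor3 cf_bas)
  then have "xi ?x - y \<in> boundaries L" by (simp add: boundaries_def L_simps pm.subspace_0)
  ultimately show "\<exists>x\<in>cycles K. xi x - y \<in> boundaries L" by blast
qed

end

theorem theorem1p1:
  fixes deg :: "'x \<Rightarrow> nat"
    and R :: "('x list \<Rightarrow>\<^sub>0 'k::field_char_0) set"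
  assumes "qlc_datum deg R"
    and "koszul deg (qrel R)"
  shows "is_bimodule_resolution deg R
           (total_koszul_complex deg R) triple_lact triple_ract xi"
proof -
  interpret koszul_qlc deg R
    by unfold_locales (rule assms)+
  show ?thesis
    unfolding is_bimodule_resolution_def using dg_bimodule_map_xi quasi_iso_xi by blast
qed

end
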